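(* Let $X$ be a proper $\mathrm{CAT}(-1)$ geodesic metric space. Let $\Gamma$ be a non elementary discrete group of isometries of $X$, with finite critical exponent $\delta$, of divergent type. Let $\widetilde{\mu}_{\mathrm{BM}}$ be its Bowen-Margulis measure on the space $\mathcal{G}X$ of geodesic lines of $X$. Assume that $\mathrm{Card}(\Gamma x \cap B(x,n))\asymp e^{\delta n}$ for some $x\in X$. Let $(\Gamma_i)_{i\in I}$ be a finite family of almost malnormal convex-cocompact subgroups of infinite index in $\Gamma$ with critical exponents $(\delta_i)_{i\in I}$. Let $\delta_0^+=\sup_{i\in I}\delta_i$ and $\delta_0^-=\inf_{i\in I}\delta_i$. Let $g:[0,+\infty[\,\to[0,+\infty[$ be a map such that $t\mapsto f(t)=e^{-g(t)}$ is slowly varying, and let $\epsilon>0$. If $\int_{1}^{+\infty} f(t)^{\delta-\delta^-_0}\,dt$ diverges (resp. $\int_{1}^{+\infty} f(t)^{\delta-\delta^+_0}\,dt$ converges), then $\widetilde{\mu}_{\mathrm{BM}}$-almost every (resp. no) element of $\mathcal{G}X$ is $(\epsilon,g)$-Liouville with respect to $(\Gamma,\Gamma_i)$ for every (resp. some) $i\in I$.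
   Context: Geodesic lines are isometric maps $\ell:\mathbb{R}\to X$; $\mathcal{G}X$ carries the compact-open topology. For a discrete group $\Gamma$ of isometries of $X$, $\Lambda\Gamma\subset\partial_\infty X$ is its limit set; $\Gamma$ is non elementary if $\Lambda\Gamma$ has at least three points. The critical exponent is the unique $\delta_\Gamma\in[0,+\infty]$ such that $\sum_{\gamma\in\Gamma}e^{-s\,d(x_0,\gamma x_0)}$ converges for $s>\delta_\Gamma$ and diverges for $s<\delta_\Gamma$ (any $x_0\in X$); $\Gamma$ is of divergent type if this series diverges at $s=\delta_\Gamma$. $\Gamma$ is convex-cocompact if $\Lambda\Gamma$ has at least two points and $\Gamma$ acts with compact quotient on the convex hull $\mathcal{C}\Gamma$ of $\Lambda\Gamma$ in $X$. A subgroup $H$ of a group $G$ is almost malnormal if $gHg^{-1}\cap H$ is finite for every $g\in G-H$. For $u,v:\mathbb{N}\to[0,+\infty[$, $u\asymp v$ means that $\frac1c u\le v\le cu$ for some constant $c\geq1$. Bowen-Margulis measure: $\beta_\xi(x,y)=\lim_{t\to+\infty}d(x,\xi_t)-d(y,\xi_t)$ for any geodesic ray $t\mapsto\xi_t$ ending at $\xi$. A conformal density of dimension $\delta$ for $\Gamma$ is a family $(\mu_x)_{x\in X}$ of (nonzero) finite Borel measures on $\partial_\infty X$ with $\gamma_*\mu_x=\mu_{\gamma x}$ for $\gamma\in\Gamma$ and $\frac{d\mu_x}{d\mu_y}(\xi)=e^{-\delta\beta_\xi(x,y)}$; for $\Gamma$ of divergent type with critical exponent $\delta\in\,]0,+\infty[$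 it exists and is unique up to a positive scalar. For $x_0\in X$, $\mathcal{G}X$ is identified with $\{(\xi,\eta)\in(\partial_\infty X)^2:\xi\neq\eta\}\times\mathbb{R}$ by $\ell\mapsto(\ell(-\infty),\ell(+\infty),t)$, $t$ being the algebraic distance on $\ell$ between $\ell(0)$ and the closest point of $\ell$ to $x_0$, and $d\widetilde{\mu}_{\mathrm{BM}}=\frac{d\mu_{x_0}(\xi)\,d\mu_{x_0}(\eta)\,dt}{d_{x_0}(\xi,\eta)^{2\delta}}$, where $d_{x_0}(\xi,\eta)=\lim_{t\to+\infty}e^{\frac12(d(\xi_t,\eta_t)-d(x_0,\xi_t)-d(x_0,\eta_t))}$ is the visual distance ($\xi_t,\eta_t$ geodesic rays from $x_0$ to $\xi,\eta$). This does not depend on $x_0$ and is unique up to a positive scalar. A map $\psi:[0,+\infty[\,\to\,]0,+\infty[$ is slowly varying if it is measurable and there exist $B>0$, $A\ge1$ such that $|x-y|\le B$ implies $\psi(y)\le A\psi(x)$ for all $x,y\geq 0$. For a convex-cocompact subgroup $\Gamma_i$ with $C_i=\mathcal{C}\Gamma_i$, a geodesic line $\ell$ is $(\epsilon,g)$-Liouville with respect to $(\Gamma,\Gamma_i)$ if there exist positive times $(t_n)_{n\in\mathbb{N}}$ converging to $+\infty$ and elements $(\gamma_n)_{n\in\mathbb{N}}$ of $\Gamma$ such that $\ell(t)\in\mathcal{N}_\epsilon(\gamma_nC_i)$ for every $n$ and every $t\in[t_n,t_n+g(t_n)]$, where $\mathcal{N}_\epsilon A$ is the closed $\epsilon$-neighborhood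 of $A$ in $X$. "Almost no element is Liouville for some $i\in I$" means that the set of $\ell$ for which there exists $i\in I$ such that $\ell$ is $(\epsilon,g)$-Liouville with respect to $(\Gamma,\Gamma_i)$ has measure $0$. *)

theory Defs
  imports "HOL-Analysis.Analysis" "HOL-Algebra.Coset"
begin

section \<open>Geodesics and the CAT(-1) condition\<close>

definition geodesic_segment ::
    "'a set \<Rightarrow> ('a \<Rightarrow> 'a \<Rightarrow> real) \<Rightarrow> 'a \<Rightarrow> 'a \<Rightarrow> (real \<Rightarrow> 'a) \<Rightarrow> bool" where
  "geodesic_segment M d x y c \<longleftrightarrow>
     c \<in> {0..d x y} \<rightarrow> M \<and> c 0 = x \<and> c (d x y) = y \<and>
     (\<forall>s\<in>{0..d x y}. \<forall>t\<in>{0..d x y}. d (c s) (c t) = \<bar>s - t\<bar>)"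

definition geodesic_space :: "'a set \<Rightarrow> ('a \<Rightarrow> 'a \<Rightarrow> real) \<Rightarrow> bool" where
  "geodesic_space M d \<longleftrightarrow> (\<forall>x\<in>M. \<forall>y\<in>M. \<exists>c. geodesic_segment M d x y c)"

text \<open>The upper half-plane model of the real hyperbolic plane of constant curvature -1.\<close>

definition hyp_plane :: "complex set" where
  "hyp_plane = {z. Im z > 0}"

definition hyp_dist :: "complex \<Rightarrow> complex \<Rightarrow> real" where
  "hyp_dist z w = arcosh (1 + (cmod (z - w))\<^sup>2 / (2 * Im z * Im w))"

text \<open>
  Every geodesic triangle is at least as thin as its comparison triangle in the hyperbolic plane.
  The comparison is stated for points on the two sides issued from \<open>p\<close>; as the vertices are
  arbitrary, this covers every pair of sides of every triangle.
\<close>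

definition CAT_minus_one :: "'a set \<Rightarrow> ('a \<Rightarrow> 'a \<Rightarrow> real) \<Rightarrow> bool" where
  "CAT_minus_one M d \<longleftrightarrow>
     (\<forall>p\<in>M. \<forall>q\<in>M. \<forall>r\<in>M. \<forall>c\<^sub>q c\<^sub>r.
        geodesic_segment M d p q c\<^sub>q \<longrightarrow> geodesic_segment M d p r c\<^sub>r \<longrightarrow>
        (\<forall>p'\<in>hyp_plane. \<forall>q'\<in>hyp_plane. \<forall>r'\<in>hyp_plane. \<forall>c\<^sub>q' c\<^sub>r'.
           hyp_dist p' q' = d p q \<longrightarrow> hyp_dist p' r' = d p r \<longrightarrow> hyp_dist q' r' = d q r \<longrightarrow>
           geodesic_segment hyp_plane hyp_dist p' q' c\<^sub>q' \<longrightarrow>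
           geodesic_segment hyp_plane hyp_dist p' r' c\<^sub>r' \<longrightarrow>
           (\<forall>s\<in>{0..d p q}. \<forall>t\<in>{0..d p r}. d (c\<^sub>q s) (c\<^sub>r t) \<le> hyp_dist (c\<^sub>q' s) (c\<^sub>r' t))))"

definition geodesic_lines :: "(real \<Rightarrow> 'a::metric_space) set" where
  "geodesic_lines = {l. \<forall>s t. dist (l s) (l t) = \<bar>s - t\<bar>}"

text \<open>A ray is a total function of which only the restriction to \<open>[0, \<infinity>[\<close> matters.\<close>

definition geodesic_rays :: "(real \<Rightarrow> 'a::metric_space) set" where
  "geodesic_rays = {r. \<forall>s\<ge>0. \<forall>t\<ge>0. dist (r s) (r t) = \<bar>s - t\<bar>}"


section \<open>The boundary at infinity\<close>

definition asymptotic :: "((real \<Rightarrow> 'a::metric_space) \<times> (real \<Rightarrow> 'a)) set" where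
  "asymptotic = {(r, r'). r \<in> geodesic_rays \<and> r' \<in> geodesic_rays \<and>
                          (\<exists>C. \<forall>t\<ge>0. dist (r t) (r' t) \<le> C)}"

lemma equiv_asymptotic: "equiv geodesic_rays asymptotic"
proof (rule equivI)
  show "asymptotic \<subseteq> geodesic_rays \<times> (geodesic_rays :: (real \<Rightarrow> 'a) set)"
    by (auto simp: asymptotic_def)
  show "refl_on geodesic_rays (asymptotic :: ((real \<Rightarrow> 'a) \<times> _) set)"
    by (auto simp: refl_on_def asymptotic_def)
  show "sym (asymptotic :: ((real \<Rightarrow> 'a) \<times> _) set)"
    by (auto simp: sym_def asymptotic_def dist_commute)
  show "trans (asymptotic :: ((real \<Rightarrow> 'a) \<times> _) set)"
  proof (rule transI)
    fix r s u :: "real \<Rightarrow> 'a"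
    assume "(r, s) \<in> asymptotic" "(s, u) \<in> asymptotic"
    then obtain C D where "r \<in> geodesic_rays" "u \<in> geodesic_rays"
      and "\<forall>t\<ge>0. dist (r t) (s t) \<le> C" "\<forall>t\<ge>0. dist (s t) (u t) \<le> D"
      by (auto simp: asymptotic_def)
    then have "\<forall>t\<ge>0. dist (r t) (u t) \<le> C + D"
      by (meson add_mono dist_triangle order_trans)
    with \<open>r \<in> geodesic_rays\<close> \<open>u \<in> geodesic_rays\<close> show "(r, u) \<in> asymptotic"
      by (auto simp: asymptotic_def)
  qed
qed

definition boundary :: "(real \<Rightarrow> 'a::metric_space) set set" where
  "boundary = geodesic_rays // asymptotic"

text \<open>The endpoints \<open>l(+\<infinity>)\<close> and \<open>l(-\<infinity>)\<close> of a geodesic line.\<close>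

definition end_plus :: "(real \<Rightarrow> 'a::metric_space) \<Rightarrow> (real \<Rightarrow> 'a) set" where
  "end_plus l = asymptotic `` {l}"

definition end_minus :: "(real \<Rightarrow> 'a::metric_space) \<Rightarrow> (real \<Rightarrow> 'a) set" where
  "end_minus l = asymptotic `` {\<lambda>t. l (- t)}"

definition compact_open_topology :: "('b::topological_space \<Rightarrow> 'a::topological_space) topology" where
  "compact_open_topology = topology_generated_by {{f. f ` K \<subseteq> U} | K U. compact K \<and> open U}"

text \<open>
  The generalized ray from \<open>x\<close> to a point of \<open>X \<union> \<partial>\<^sub>\<infinity>X\<close>: the geodesic segment to a point of \<open>X\<close>,
  then stationary, or the geodesic ray to a point at infinity. Being stationary on \<open>]-\<infinity>, 0]\<close>
  makes it unique as a total function.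
\<close>

definition gen_ray :: "'a::metric_space \<Rightarrow> 'a + (real \<Rightarrow> 'a) set \<Rightarrow> real \<Rightarrow> 'a" where
  "gen_ray x z = (THE c. (\<forall>t\<le>0. c t = x) \<and>
     (case z of
        Inl y \<Rightarrow> geodesic_segment UNIV dist x y c \<and> (\<forall>t\<ge>dist x y. c t = y)
      | Inr \<xi> \<Rightarrow> c \<in> \<xi>))"

definition bordification :: "('a::metric_space + (real \<Rightarrow> 'a) set) set" where
  "bordification = range Inl \<union> Inr ` boundary"

text \<open>
  The cone topology on \<open>X \<union> \<partial>\<^sub>\<infinity>X\<close>: uniform convergence on compact sets of the generalized rays
  issued from a base point. In a proper CAT(-1) space it does not depend on the base point; to avoid
  choosing one, all base points are used.
\<close>

definition cone_topology :: "('a::metric_space + (real \<Rightarrow> 'a) set) topology" where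
  "cone_topology = topology_generated_by
     {{z \<in> bordification. gen_ray x z \<in> U} | x U. openin compact_open_topology U}"

definition boundary_topology :: "(real \<Rightarrow> 'a::metric_space) set topology" where
  "boundary_topology = pullback_topology boundary Inr cone_topology"

definition boundary_action :: "('a::metric_space \<Rightarrow> 'a) \<Rightarrow> (real \<Rightarrow> 'a) set \<Rightarrow> (real \<Rightarrow> 'a) set" where
  "boundary_action \<gamma> \<xi> = (\<lambda>r. \<gamma> \<circ> r) ` \<xi>"


section \<open>Discrete groups of isometries\<close>

definition isom_group :: "('a::metric_space \<Rightarrow> 'a) monoid" where
  "isom_group = \<lparr>carrier = {f. surj f \<and> (\<forall>x y. dist (f x) (f y) = dist x y)},
                 mult = (\<circ>), one = id\<rparr>"

lemma group_isom_group: "group (isom_group :: ('a::metric_space \<Rightarrow> 'a) monoid)"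
proof (rule groupI)
  fix f :: "'a \<Rightarrow> 'a" assume "f \<in> carrier isom_group"
  then have surj: "surj f" and iso: "\<And>x y. dist (f x) (f y) = dist x y"
    by (auto simp: isom_group_def)
  have inj: "inj f"
    by (metis iso dist_eq_0_iff injI)
  have "inv_into UNIV f \<in> carrier isom_group"
    using surj inj iso by (auto simp: isom_group_def inj_imp_surj_inv) (metis surj_f_inv_f)
  moreover have "inv_into UNIV f \<circ> f = id"
    using inj by simp
  ultimately show "\<exists>g\<in>carrier isom_group. g \<otimes>\<^bsub>isom_group\<^esub> f = \<one>\<^bsub>isom_group\<^esub>"
    by (auto simp: isom_group_def)
next
  fix f g :: "'a \<Rightarrow> 'a" assume "f \<in> carrier isom_group" "g \<in> carrier isom_group"
  then show "f \<otimes>\<^bsub>isom_group\<^esub> g \<in> carrier isom_group"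
    using comp_surj[of g f] by (simp add: isom_group_def)
qed (auto simp: isom_group_def comp_assoc)

text \<open>Discreteness refers to the compact-open topology on the isometry group.\<close>

definition discrete_isometry_group :: "('a::metric_space \<Rightarrow> 'a) set \<Rightarrow> bool" where
  "discrete_isometry_group \<Gamma> \<longleftrightarrow>
     subgroup \<Gamma> isom_group \<and> subtopology compact_open_topology \<Gamma> = discrete_topology \<Gamma>"

definition isom_orbit :: "('a \<Rightarrow> 'a) set \<Rightarrow> 'a \<Rightarrow> 'a set" where
  "isom_orbit \<Gamma> x = (\<lambda>\<gamma>. \<gamma> x) ` \<Gamma>"

text \<open>The accumulation points at infinity of an orbit; they are the same for all orbits.\<close>

definition limit_set :: "('a::metric_space \<Rightarrow> 'a) set \<Rightarrow> (real \<Rightarrow> 'a) set set" where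
  "limit_set \<Gamma> = {\<xi> \<in> boundary. \<exists>x. Inr \<xi> \<in> cone_topology closure_of (Inl ` isom_orbit \<Gamma> x)}"

definition non_elementary :: "('a::metric_space \<Rightarrow> 'a) set \<Rightarrow> bool" where
  "non_elementary \<Gamma> \<longleftrightarrow>
     (\<exists>\<xi>\<in>limit_set \<Gamma>. \<exists>\<eta>\<in>limit_set \<Gamma>. \<exists>\<zeta>\<in>limit_set \<Gamma>. \<xi> \<noteq> \<eta> \<and> \<eta> \<noteq> \<zeta> \<and> \<xi> \<noteq> \<zeta>)"

definition poincare_converges :: "('a::metric_space \<Rightarrow> 'a) set \<Rightarrow> 'a \<Rightarrow> real \<Rightarrow> bool" where
  "poincare_converges \<Gamma> x s \<longleftrightarrow> (\<lambda>\<gamma>. exp (- s * dist x (\<gamma> x))) summable_on \<Gamma>"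

text \<open>Only exponents \<open>s \<ge> 0\<close> are tested, so that finite groups have critical exponent 0.\<close>

definition critical_exponent :: "('a::metric_space \<Rightarrow> 'a) set \<Rightarrow> ereal" where
  "critical_exponent \<Gamma> = (THE \<delta>. 0 \<le> \<delta> \<and>
     (\<forall>x. \<forall>s\<ge>0. (ereal s > \<delta> \<longrightarrow> poincare_converges \<Gamma> x s) \<and>
                 (ereal s < \<delta> \<longrightarrow> \<not> poincare_converges \<Gamma> x s)))"

definition divergent_type :: "('a::metric_space \<Rightarrow> 'a) set \<Rightarrow> bool" where
  "divergent_type \<Gamma> \<longleftrightarrow>
     (\<exists>\<delta>::real. critical_exponent \<Gamma> = ereal \<delta> \<and> (\<forall>x. \<not> poincare_converges \<Gamma> x \<delta>))"

definition geodesically_convex :: "'a::metric_space set \<Rightarrow> bool" where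
  "geodesically_convex C \<longleftrightarrow>
     (\<forall>x\<in>C. \<forall>y\<in>C. \<forall>c. geodesic_segment UNIV dist x y c \<longrightarrow> c ` {0..dist x y} \<subseteq> C)"

text \<open>
  The (closed) convex hull in \<open>X\<close> of a set \<open>A\<close> of points at infinity: the smallest closed convex
  subset of \<open>X\<close> containing the geodesic lines with both endpoints in \<open>A\<close>.
\<close>

definition hull_at_infinity :: "(real \<Rightarrow> 'a::metric_space) set set \<Rightarrow> 'a set" where
  "hull_at_infinity A = \<Inter>{C. closed C \<and> geodesically_convex C \<and>
     (\<forall>l\<in>geodesic_lines. end_minus l \<in> A \<longrightarrow> end_plus l \<in> A \<longrightarrow> range l \<subseteq> C)}"

text \<open>The quantified topology \<open>T\<close> is the quotient topology on the orbit space of the hull.\<close>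

definition convex_cocompact :: "('a::metric_space \<Rightarrow> 'a) set \<Rightarrow> bool" where
  "convex_cocompact \<Gamma> \<longleftrightarrow>
     (\<exists>\<xi>\<in>limit_set \<Gamma>. \<exists>\<eta>\<in>limit_set \<Gamma>. \<xi> \<noteq> \<eta>) \<and>
     (\<exists>T. quotient_map (top_of_set (hull_at_infinity (limit_set \<Gamma>))) T (isom_orbit \<Gamma>) \<and>
          compact_space T)"

definition almost_malnormal :: "('g, 'b) monoid_scheme \<Rightarrow> 'g set \<Rightarrow> bool" where
  "almost_malnormal G H \<longleftrightarrow>
     (\<forall>g \<in> carrier G - H. finite ((\<lambda>h. g \<otimes>\<^bsub>G\<^esub> h \<otimes>\<^bsub>G\<^esub> inv\<^bsub>G\<^esub> g) ` H \<inter> H))"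


section \<open>The Bowen-Margulis measure\<close>

definition borel_of :: "'a topology \<Rightarrow> 'a measure" where
  "borel_of T = sigma (topspace T) {U. openin T U}"

definition busemann :: "(real \<Rightarrow> 'a::metric_space) set \<Rightarrow> 'a \<Rightarrow> 'a \<Rightarrow> real" where
  "busemann \<xi> x y = (THE b. \<forall>r\<in>\<xi>. ((\<lambda>t. dist x (r t) - dist y (r t)) \<longlongrightarrow> b) at_top)"

definition conformal_density ::
    "('a::metric_space \<Rightarrow> 'a) set \<Rightarrow> real \<Rightarrow> ('a \<Rightarrow> (real \<Rightarrow> 'a) set measure) \<Rightarrow> bool" where
  "conformal_density \<Gamma> \<delta> \<mu> \<longleftrightarrow>
     (\<forall>x. sets (\<mu> x) = sets (borel_of boundary_topology) \<and>
          finite_measure (\<mu> x) \<and> emeasure (\<mu> x) (space (\<mu> x)) \<noteq> 0) \<and>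
     (\<forall>\<gamma>\<in>\<Gamma>. \<forall>x. distr (\<mu> x) (borel_of boundary_topology) (boundary_action \<gamma>) = \<mu> (\<gamma> x)) \<and>
     (\<forall>x y. \<mu> x = density (\<mu> y) (\<lambda>\<xi>. ennreal (exp (- \<delta> * busemann \<xi> x y))))"

definition visual_dist ::
    "'a::metric_space \<Rightarrow> (real \<Rightarrow> 'a) set \<Rightarrow> (real \<Rightarrow> 'a) set \<Rightarrow> real" where
  "visual_dist x \<xi> \<eta> = Lim at_top (\<lambda>t. exp (1/2 *
     (dist (gen_ray x (Inr \<xi>) t) (gen_ray x (Inr \<eta>) t)
      - dist x (gen_ray x (Inr \<xi>) t) - dist x (gen_ray x (Inr \<eta>) t))))"

definition geodesic_lines_topology :: "(real \<Rightarrow> 'a::metric_space) topology" where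
  "geodesic_lines_topology = subtopology compact_open_topology geodesic_lines"

text \<open>
  The third coordinate is the signed distance along \<open>l\<close> from \<open>l 0\<close> to the point of \<open>l\<close> closest to
  \<open>x\<close>. The opposite orientation would give the same Bowen-Margulis measure.
\<close>

definition hopf_coords ::
    "'a::metric_space \<Rightarrow> (real \<Rightarrow> 'a) \<Rightarrow> (real \<Rightarrow> 'a) set \<times> (real \<Rightarrow> 'a) set \<times> real" where
  "hopf_coords x l = (end_minus l, end_plus l, THE t. \<forall>s. dist x (l t) \<le> dist x (l s))"

text \<open>
  The measure with density \<open>visual_dist x \<xi> \<eta> powr (-2\<delta>)\<close> on the space of triples \<open>(\<xi>, \<eta>, t)\<close> with
  \<open>\<xi> \<noteq> \<eta>\<close>, carried to the space of geodesic lines by the inverse of the Hopf coordinates.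
\<close>

definition bowen_margulis ::
    "real \<Rightarrow> ('a::metric_space \<Rightarrow> (real \<Rightarrow> 'a) set measure) \<Rightarrow> 'a \<Rightarrow> (real \<Rightarrow> 'a) measure" where
  "bowen_margulis \<delta> \<mu> x = distr
     (density (restrict_space (\<mu> x \<Otimes>\<^sub>M (\<mu> x \<Otimes>\<^sub>M lborel)) {(\<xi>, \<eta>, t). \<xi> \<noteq> \<eta>})
              (\<lambda>(\<xi>, \<eta>, t). ennreal (1 / visual_dist x \<xi> \<eta> powr (2 * \<delta>))))
     (borel_of geodesic_lines_topology)
     (the_inv_into geodesic_lines (hopf_coords x))"


section \<open>Growth, slow variation and Liouville lines\<close>

definition comparable :: "(nat \<Rightarrow> real) \<Rightarrow> (nat \<Rightarrow> real) \<Rightarrow> bool" where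
  "comparable u v \<longleftrightarrow> (\<exists>c\<ge>1. \<forall>n. 1 / c * u n \<le> v n \<and> v n \<le> c * u n)"

text \<open>Maps defined on \<open>[0, \<infinity>[\<close> are total functions whose values at negative reals are ignored.\<close>

definition slowly_varying :: "(real \<Rightarrow> real) \<Rightarrow> bool" where
  "slowly_varying \<psi> \<longleftrightarrow>
     (\<forall>x\<ge>0. \<psi> x > 0) \<and> \<psi> \<in> borel_measurable (lebesgue_on {0..}) \<and>
     (\<exists>B>0. \<exists>A\<ge>1. \<forall>x\<ge>0. \<forall>y\<ge>0. \<bar>x - y\<bar> \<le> B \<longrightarrow> \<psi> y \<le> A * \<psi> x)"

text \<open>\<^const>\<open>infdist\<close> to the empty set is 0, hence the first conjunct.\<close>

definition closed_nbhd :: "real \<Rightarrow> 'a::metric_space set \<Rightarrow> 'a set" where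
  "closed_nbhd \<epsilon> A = {x. A \<noteq> {} \<and> infdist x A \<le> \<epsilon>}"

definition liouville ::
    "real \<Rightarrow> (real \<Rightarrow> real) \<Rightarrow> ('a::metric_space \<Rightarrow> 'a) set \<Rightarrow> ('a \<Rightarrow> 'a) set \<Rightarrow> (real \<Rightarrow> 'a) \<Rightarrow> bool"
  where
  "liouville \<epsilon> g \<Gamma> \<Gamma>\<^sub>0 l \<longleftrightarrow>
     (\<exists>(\<tau>::nat \<Rightarrow> real) (\<gamma>::nat \<Rightarrow> 'a \<Rightarrow> 'a).
        (\<forall>n. \<tau> n > 0) \<and> filterlim \<tau> at_top sequentially \<and> (\<forall>n. \<gamma> n \<in> \<Gamma>) \<and>
        (\<forall>n. \<forall>t\<in>{\<tau> n..\<tau> n + g (\<tau> n)}.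
           l t \<in> closed_nbhd \<epsilon> (\<gamma> n ` hull_at_infinity (limit_set \<Gamma>\<^sub>0))))"

end

theory Submission
  imports Defs "HOL-Real_Asymp.Real_Asymp"
begin

text \<open>
  Let \<open>b\<close> be a point of the convex hull of a subgroup \<open>H\<close> of the family, with exponent \<open>d\<close>. A line ending at \<open>\<xi>\<close>
  is Liouville if and only if, up to bounded errors, the ray from \<open>b\<close> to \<open>\<xi>\<close> passes near \<open>\<alpha> b\<close> at time \<open>t\<close> and near
  \<open>\<alpha> (h b)\<close> at time \<open>t + g t\<close>, with \<open>\<alpha> \<in> \<Gamma>\<close> and \<open>h \<in> H\<close>, for arbitrarily large \<open>t\<close>. There are about \<open>exp (\<delta> t)\<close>
  such \<open>\<alpha>\<close> and \<open>exp (d g t)\<close> such \<open>h\<close>, and by Sullivan's shadow lemma the shadow of \<open>\<alpha> (h b)\<close> has measure about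
  \<open>exp (- \<delta> (t + g t))\<close>: the crossings at time \<open>t\<close> have measure about \<open>f t powr (\<delta> - d)\<close>. In the convergent case the
  Borel-Cantelli lemma concludes. In the divergent case, almost malnormality bounds the time during which
  two translates of the hull run close to each other, so that crossings at different times are quasi-independent
  and a second moment estimate gives positive measure to the set of spiraling directions, for every conformal
  density of dimension \<open>\<delta>\<close>. As this set is invariant, its complement is null: otherwise the density
  restricted to the complement would contradict what has just been said. Hence no ergodicity is needed. The
  Bowen-Margulis measure enters only through its null sets, as the Liouville property depends on the positive endpoint alone.
\<close>

section \<open>Comparison with the hyperbolic plane\<close>

text \<open>Three obstacles shape the proof. The subgroups are given with their critical exponents
  only, whereas the moment estimates need their orbits counted up to a factor at the exponent
  itself; cocompactness on the hull makes words almost factor through orbit points, and this is what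
  yields such counts. Next, a ray accompanies a translate of the hull for a long time, so one
  crossing could be attributed to many \<open>\<alpha>\<close>. Shortest coset representatives fix
  the entry point, and the gap \<open>d < \<delta>\<close>, itself a consequence of almost
  malnormality, shows that representatives of nearly prescribed length are still numerous enough.
  Finally, bounded errors in space and time must become the exact run \<open>g\<close> and an
  arbitrary \<open>\<epsilon>\<close>. Errors in time are absorbed by asking for runs of length
  \<open>g + k\<close> for every \<open>k\<close>: adding a constant to \<open>g\<close> changes
  neither the divergence nor the lower bound for the measure. Errors in space disappear because
  geodesics with nearby ends are exponentially close in the middle.\<close>

text \<open>The point with polar coordinates \<open>(s, \<theta>)\<close> around \<open>\<i>\<close>: the hyperboloid point
  \<open>(T, U, V) = (cosh s, sinh s cos \<theta>, sinh s sin \<theta>)\<close> corresponds to \<open>(V + \<i>) / (T - U)\<close>.\<close>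

definition hyp_polar :: "real \<Rightarrow> real \<Rightarrow> complex" where
  "hyp_polar s \<theta> = Complex (sinh s * sin \<theta> / (cosh s - sinh s * cos \<theta>)) (1 / (cosh s - sinh s * cos \<theta>))"

lemma hyp_polar_denom_pos: "cosh s - sinh s * cos \<theta> > (0::real)"
proof -
  have "\<bar>sinh s * cos \<theta>\<bar> \<le> \<bar>sinh s\<bar> * 1"
    unfolding abs_mult by (intro mult_left_mono) auto
  also have "\<bar>sinh s\<bar> < cosh s"
  proof -
    have "\<bar>sinh s\<bar>\<^sup>2 < (cosh s)\<^sup>2" by (simp add: cosh_square_eq)
    then show ?thesis using cosh_real_pos[of s] by (meson less_imp_le power_less_imp_less_base)
  qed
  finally show ?thesis by linarith
qed

lemma hyp_polar_in: "hyp_polar s \<theta> \<in> hyp_plane"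
  using hyp_polar_denom_pos[of s \<theta>] by (simp add: hyp_polar_def hyp_plane_def)

text \<open>The hyperbolic law of cosines: the argument of \<open>arcosh\<close> on the right is the
  Lorentz product T T' - U U' - V V' of the two hyperboloid points.\<close>

lemma hyp_dist_polar:
  "hyp_dist (hyp_polar s \<theta>) (hyp_polar t \<phi>) =
     arcosh (cosh s * cosh t - sinh s * sinh t * cos (\<theta> - \<phi>))"
proof -
  define D where "D = cosh s - sinh s * cos \<theta>"
  define E where "E = cosh t - sinh t * cos \<phi>"
  define V where "V = sinh s * sin \<theta>"
  define W where "W = sinh t * sin \<phi>"
  define A where "A = cosh s + sinh s * cos \<theta>"
  define B where "B = cosh t + sinh t * cos \<phi>"
  have pos: "D > 0" "E > 0"
    using hyp_polar_denom_pos by (auto simp: D_def E_def)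
  have gen: "(cosh r)\<^sup>2 - (sinh r * cos \<psi>)\<^sup>2 = 1 + (sinh r * sin \<psi>)\<^sup>2" for r \<psi> :: real
  proof -
    have "(sinh r * cos \<psi>)\<^sup>2 + (sinh r * sin \<psi>)\<^sup>2 = (sinh r)\<^sup>2 * ((sin \<psi>)\<^sup>2 + (cos \<psi>)\<^sup>2)"
      by (simp only: power_mult_distrib distrib_left add.commute)
    then show ?thesis using cosh_square_eq[of r] by simp
  qed
  \<comment> \<open>The points lie on the hyperboloid: (T - U) (T + U) = 1 + V^2. The denominators
    \<open>D\<close> and \<open>E\<close> are the factors T - U.\<close>
  have DA: "D * A = 1 + V\<^sup>2" and EB: "E * B = 1 + W\<^sup>2"
    using gen[of s \<theta>] gen[of t \<phi>]
    by (simp_all add: D_def A_def V_def E_def B_def W_def algebra_simps power2_eq_square)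
  have "(cmod (hyp_polar s \<theta> - hyp_polar t \<phi>))\<^sup>2 = (V / D - W / E)\<^sup>2 + (1 / D - 1 / E)\<^sup>2"
    by (simp add: hyp_polar_def cmod_power2 D_def E_def V_def W_def)
  then have "1 + (cmod (hyp_polar s \<theta> - hyp_polar t \<phi>))\<^sup>2 /
      (2 * Im (hyp_polar s \<theta>) * Im (hyp_polar t \<phi>)) =
      1 + ((V / D - W / E)\<^sup>2 + (1 / D - 1 / E)\<^sup>2) / (2 * (1 / D) * (1 / E))"
    by (simp add: hyp_polar_def D_def E_def)
  also have "\<dots> = 1 + ((V * E - W * D)\<^sup>2 + (E - D)\<^sup>2) / (2 * D * E)"
    using pos by (simp add: field_simps power2_eq_square)
  also have "(V * E - W * D)\<^sup>2 + (E - D)\<^sup>2 = E\<^sup>2 * (1 + V\<^sup>2) + D\<^sup>2 * (1 + W\<^sup>2) - 2 * D * E * (1 + V * W)"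
    by (simp add: power2_eq_square algebra_simps)
  also have "\<dots> = 2 * D * E * ((E * A + D * B) / 2 - 1 - V * W)"
    unfolding DA[symmetric] EB[symmetric] by (simp add: power2_eq_square algebra_simps)
  also have "1 + \<dots> / (2 * D * E) = (E * A + D * B) / 2 - V * W"
    using pos by simp
  also have "\<dots> = cosh s * cosh t - sinh s * sinh t * cos (\<theta> - \<phi>)"
    by (simp add: A_def B_def D_def E_def V_def W_def cos_diff field_simps)
  finally show ?thesis by (simp add: hyp_dist_def)
qed

lemma arcosh_cosh_abs: "arcosh (cosh (x::real)) = \<bar>x\<bar>"
  by (metis abs_ge_zero arcosh_cosh_real cosh_real_abs)

lemma geodesic_hyp_polar:
  assumes "a \<ge> 0"
  shows "geodesic_segment hyp_plane hyp_dist (hyp_polar 0 0) (hyp_polar a \<theta>) (\<lambda>s. hyp_polar s \<theta>)"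
    and "hyp_dist (hyp_polar 0 0) (hyp_polar a \<theta>) = a"
proof -
  have *: "hyp_dist (hyp_polar s \<theta>) (hyp_polar t \<theta>) = \<bar>s - t\<bar>" for s t
    by (simp add: hyp_dist_polar arcosh_cosh_abs flip: cosh_diff)
  have z: "hyp_polar 0 0 = hyp_polar 0 \<theta>" by (simp add: hyp_polar_def)
  show d: "hyp_dist (hyp_polar 0 0) (hyp_polar a \<theta>) = a"
    using *[of 0 a] assms unfolding z by simp
  show "geodesic_segment hyp_plane hyp_dist (hyp_polar 0 0) (hyp_polar a \<theta>) (\<lambda>s. hyp_polar s \<theta>)"
    unfolding geodesic_segment_def d by (auto simp: * hyp_polar_in z)
qed

section \<open>Betweenness and the comparison inequalities\<close>

definition between :: "'a::metric_space \<Rightarrow> 'a \<Rightarrow> 'a \<Rightarrow> bool" where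
  "between p m q \<longleftrightarrow> dist p m + dist m q = dist p q"

lemma between_sym: "between p m q \<Longrightarrow> between q m p"
  by (simp add: between_def dist_commute add.commute)

lemma between_ends [simp]: "between p p q" "between p q q"
  by (auto simp: between_def)

text \<open>The point \<open>pt\<close> fixes the type of the space and serves as base point
  wherever any one will do.\<close>

locale cat_space =
  fixes pt :: "'a::metric_space"
  assumes proper: "\<forall>(x::'a) R. compact (cball x R)"
    and geodesic: "geodesic_space (UNIV :: 'a set) dist"
    and CAT: "CAT_minus_one (UNIV :: 'a set) dist"
begin

lemma ex_segment: "\<exists>c. geodesic_segment UNIV dist (x::'a) y c"
  using geodesic by (auto simp: geodesic_space_def)

text \<open>In the hyperbolic plane this is an equality, Stewart's theorem, obtained by eliminating
  the angle at \<open>p\<close> from two laws of cosines. It turns the CAT(-1) condition into an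
  inequality between numbers, and all later geometric estimates rest on it.\<close>

lemma segment_comparison:
  assumes c: "geodesic_segment UNIV dist (p::'a) q c" and s: "0 \<le> s" "s \<le> dist p q"
  shows "sinh (dist p q) * cosh (dist r (c s))
           \<le> sinh (dist p q - s) * cosh (dist r p) + sinh s * cosh (dist r q)"
proof -
  define a b e where "a = dist p q" and "b = dist p r" and "e = dist q r"
  have dps: "dist p (c s) = s"
    using c s unfolding geodesic_segment_def by (metis abs_of_nonneg atLeastAtMost_iff abs_minus_commute diff_zero zero_le_dist order_refl)
  consider "a = 0" | "b = 0" | "a > 0" "b > 0"
    by (metis a_def b_def zero_less_dist_iff dist_eq_0_iff)
  then show ?thesis
  proof cases
    case 1
    then show ?thesis using s by (simp add: a_def)
  next
    case 2
    then have "r = p" by (simp add: b_def)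
    then show ?thesis using dps by (simp add: sinh_diff)
  next
    case 3
    have se: "sinh a > 0" "sinh b > 0" using 3 by auto
    \<comment> \<open>The cosine of the angle at \<open>p\<close> of the comparison triangle; the
      triangle inequalities put it in [-1, 1].\<close>
    define w where "w = (cosh a * cosh b - cosh e) / (sinh a * sinh b)"
    have tri: "\<bar>a - b\<bar> \<le> e" "e \<le> a + b"
      unfolding a_def b_def e_def
      by (metis abs_le_iff dist_triangle3 dist_triangle dist_commute diff_le_eq minus_diff_eq,
          metis dist_triangle dist_commute)
    have "cosh (a - b) \<le> cosh e" "cosh e \<le> cosh (a + b)"
      using tri cosh_real_nonneg_le_iff[of "\<bar>a - b\<bar>" e] cosh_real_nonneg_le_iff[of e "a + b"]
      by (auto simp: e_def)
    then have "- 1 \<le> w" "w \<le> 1"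
      unfolding w_def using se by (auto simp: cosh_diff cosh_add field_simps)
    then have cw: "cos (arccos w) = w" by simp
    obtain c' where c': "geodesic_segment UNIV dist p r c'" using ex_segment by blast
    have "hyp_dist (hyp_polar a 0) (hyp_polar b (arccos w)) = arcosh (cosh e)"
      unfolding hyp_dist_polar using cw se by (simp add: w_def)
    then have hqr: "hyp_dist (hyp_polar a 0) (hyp_polar b (arccos w)) = e"
      by (simp add: arcosh_cosh_abs e_def)
    have "\<forall>s\<in>{0..dist p q}. \<forall>t\<in>{0..dist p r}. dist (c s) (c' t) \<le>
       hyp_dist ((\<lambda>s. hyp_polar s 0) s) ((\<lambda>s. hyp_polar s (arccos w)) t)"
      using CAT[unfolded CAT_minus_one_def, rule_format, of p q r c c' "hyp_polar 0 0" "hyp_polar a 0"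
          "hyp_polar b (arccos w)" "\<lambda>s. hyp_polar s 0" "\<lambda>s. hyp_polar s (arccos w)"]
        c c' hqr geodesic_hyp_polar[of a 0] geodesic_hyp_polar[of b "arccos w"] 3
      by (auto simp: hyp_polar_in a_def b_def e_def)
    then have "dist (c s) (c' b) \<le> arcosh (cosh s * cosh b - sinh s * sinh b * w)"
      using s cw by (auto simp: b_def hyp_dist_polar)
    moreover have "c' b = r" using c' by (simp add: geodesic_segment_def b_def)
    ultimately have le: "dist r (c s) \<le> arcosh (cosh s * cosh b - sinh s * sinh b * w)"
      by (simp add: dist_commute)
    have ge1: "1 \<le> cosh s * cosh b - sinh s * sinh b * w"
    proof -
      have "sinh s * sinh b * w \<le> sinh s * sinh b * 1"
        using \<open>w \<le> 1\<close> se s by (intro mult_left_mono) auto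
      moreover have "cosh (s - b) \<ge> 1" by (rule cosh_real_ge_1)
      ultimately show ?thesis by (simp add: cosh_diff)
    qed
    have "cosh (dist r (c s)) \<le> cosh (arcosh (cosh s * cosh b - sinh s * sinh b * w))"
      using le ge1 by (subst cosh_real_nonneg_le_iff) auto
    also have "\<dots> = cosh s * cosh b - sinh s * (sinh b * w)"
      using ge1 by simp
    also have "sinh b * w = (cosh a * cosh b - cosh e) / sinh a"
      using se by (simp add: w_def)
    finally have "sinh a * cosh (dist r (c s)) \<le> sinh a * (cosh s * cosh b - sinh s * ((cosh a * cosh b - cosh e) / sinh a))"
      using se by (intro mult_left_mono) auto
    also have "\<dots> = sinh (a - s) * cosh b + sinh s * cosh e"
      using se by (simp add: sinh_diff field_simps)
    finally show ?thesis by (simp add: a_def b_def e_def dist_commute)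
  qed
qed

text \<open>Segments from \<open>p\<close> to \<open>m\<close> and from \<open>m\<close> to
  \<open>q\<close> concatenate to a geodesic, since a shortcut between the two pieces would make
  \<open>dist p q\<close> too small.\<close>

lemma between_segment:
  assumes "between (p::'a) m q"
  obtains c where "geodesic_segment UNIV dist p q c" "c (dist p m) = m"
proof -
  obtain c1 where c1: "geodesic_segment UNIV dist p m c1" using ex_segment by blast
  obtain c2 where c2: "geodesic_segment UNIV dist m q c2" using ex_segment by blast
  define u where "u = dist p m"
  define v where "v = dist m q"
  have uv: "dist p q = u + v" "u \<ge> 0" "v \<ge> 0" using assms by (auto simp: between_def u_def v_def)
  define c where "c s = (if s \<le> u then c1 s else c2 (s - u))" for s
  have c1': "c1 0 = p" "c1 u = m" "\<And>s t. 0 \<le> s \<Longrightarrow> s \<le> u \<Longrightarrow> 0 \<le> t \<Longrightarrow> t \<le> u \<Longrightarrow> dist (c1 s) (c1 t) = \<bar>s - t\<bar>"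
    using c1 by (auto simp: geodesic_segment_def u_def)
  have c2': "c2 0 = m" "c2 v = q" "\<And>s t. 0 \<le> s \<Longrightarrow> s \<le> v \<Longrightarrow> 0 \<le> t \<Longrightarrow> t \<le> v \<Longrightarrow> dist (c2 s) (c2 t) = \<bar>s - t\<bar>"
    using c2 by (auto simp: geodesic_segment_def v_def)
  have mix: "dist (c1 s) (c2 t) = u - s + t" if "0 \<le> s" "s \<le> u" "0 \<le> t" "t \<le> v" for s t
  proof -
    have "dist (c1 s) (c2 t) \<le> dist (c1 s) m + dist m (c2 t)" by (rule dist_triangle)
    moreover have "dist (c1 s) m = u - s" using c1'(3)[of s u] c1'(2) that by auto
    moreover have "dist m (c2 t) = t" using c2'(3)[of 0 t] c2'(1) that by auto
    moreover have "dist p q \<le> dist p (c1 s) + dist (c1 s) (c2 t) + dist (c2 t) q"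
      using dist_triangle[of p q "c2 t"] dist_triangle[of p "c2 t" "c1 s"] by linarith
    moreover have "dist p (c1 s) = s" using c1'(3)[of 0 s] c1'(1) that by auto
    moreover have "dist (c2 t) q = v - t" using c2'(3)[of t v] c2'(2) that by auto
    ultimately show ?thesis using uv by linarith
  qed
  have iso: "dist (c s) (c t) = \<bar>s - t\<bar>" if "0 \<le> s" "s \<le> u + v" "0 \<le> t" "t \<le> u + v" for s t
  proof -
    consider "s \<le> u" "t \<le> u" | "s \<le> u" "t > u" | "s > u" "t \<le> u" | "s > u" "t > u" by linarith
    then show ?thesis
    proof cases
      case 1 then show ?thesis using c1'(3) that by (simp add: c_def)
    next
      case 2 then show ?thesis using mix[of s "t - u"] that by (simp add: c_def)
    next
      case 3 then show ?thesis using mix[of t "s - u"] that by (simp add: c_def dist_commute)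
    next
      case 4 then show ?thesis using c2'(3)[of "s - u" "t - u"] that by (simp add: c_def)
    qed
  qed
  have "c (u + v) = q"
  proof (cases "v = 0")
    case True
    then have "m = q" by (simp add: v_def)
    then show ?thesis using True c1' by (simp add: c_def)
  next
    case False
    then show ?thesis using uv c2' by (simp add: c_def)
  qed
  moreover have "c 0 = p" "c u = m" using uv c1' by (auto simp: c_def)
  ultimately have "geodesic_segment UNIV dist p q c"
    using iso uv by (auto simp: geodesic_segment_def)
  then show ?thesis using that[of c] \<open>c u = m\<close> by (simp add: u_def)
qed

lemma between_comparison:
  assumes "between (p::'a) m q"
  shows "sinh (dist p q) * cosh (dist r m)
           \<le> sinh (dist m q) * cosh (dist r p) + sinh (dist p m) * cosh (dist r q)"
proof -
  obtain c where c: "geodesic_segment UNIV dist p q c" "c (dist p m) = m"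
    using between_segment[OF assms] .
  have "dist p q - dist p m = dist m q" "dist p m \<le> dist p q"
    using assms zero_le_dist[of m q] by (auto simp: between_def simp del: zero_le_dist)
  then show ?thesis using segment_comparison[OF c(1), of "dist p m" r] c(2) by simp
qed

lemma ex_between:
  assumes "0 \<le> u" "u \<le> dist (p::'a) q"
  shows "\<exists>m. between p m q \<and> dist p m = u"
proof -
  obtain c where c: "geodesic_segment UNIV dist p q c" using ex_segment by blast
  then have iso: "\<And>s t. s \<in> {0..dist p q} \<Longrightarrow> t \<in> {0..dist p q} \<Longrightarrow> dist (c s) (c t) = \<bar>s - t\<bar>"
    and e: "c 0 = p" "c (dist p q) = q"
    by (auto simp: geodesic_segment_def)
  have "dist (c 0) (c u) = u" "dist (c u) (c (dist p q)) = dist p q - u"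
    using iso[of 0 u] iso[of u "dist p q"] assms by auto
  with e show ?thesis by (intro exI[of _ "c u"]) (auto simp: between_def)
qed

lemma sinh_quotient_le:
  assumes "0 \<le> s" "s \<le> (a::real)"
  shows "sinh (a - s) \<le> exp (- s) * sinh a"
proof -
  have "exp (s - a) \<ge> exp (- s - a)" using assms by simp
  then show ?thesis by (simp add: sinh_field_def field_simps exp_add exp_diff exp_minus)
qed

lemma thin_cosh:
  assumes "between (p::'a) m q"
  shows "cosh (dist r m) \<le> exp (- dist p m) * cosh (dist r p) + exp (- dist m q) * cosh (dist r q)"
proof (cases "p = q")
  case True
  then have "m = p" using assms by (auto simp: between_def dist_commute)
  then show ?thesis using True by simp
next
  case False
  then have s: "sinh (dist p q) > 0" by simp
  have sub: "dist p q - dist p m = dist m q" "dist p q - dist m q = dist p m" "dist p m \<le> dist p q" "dist m q \<le> dist p q"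
    if "between p m q" for p m q :: 'a
    using that zero_le_dist[of p m] zero_le_dist[of m q] by (auto simp: between_def simp del: zero_le_dist)
  have 1: "sinh (dist m q) \<le> exp (- dist p m) * sinh (dist p q)"
    using sinh_quotient_le[of "dist p m" "dist p q"] sub[of p m q] assms by simp
  have 2: "sinh (dist p m) \<le> exp (- dist m q) * sinh (dist p q)"
    using sinh_quotient_le[of "dist m q" "dist p q"] sub[of p m q] assms by simp
  have "sinh (dist p q) * cosh (dist r m)
           \<le> sinh (dist m q) * cosh (dist r p) + sinh (dist p m) * cosh (dist r q)"
    by (rule between_comparison[OF assms])
  also have "\<dots> \<le> (exp (- dist p m) * sinh (dist p q)) * cosh (dist r p) +
                (exp (- dist m q) * sinh (dist p q)) * cosh (dist r q)"
    by (intro add_mono mult_right_mono 1 2) auto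
  also have "\<dots> = sinh (dist p q) * (exp (- dist p m) * cosh (dist r p) + exp (- dist m q) * cosh (dist r q))"
    by (simp add: algebra_simps)
  finally show ?thesis using s by simp
qed

lemma cosh_ge_half_exp: "exp x / 2 \<le> cosh (x::real)"
  by (simp add: cosh_field_def)

lemma cosh_le_exp: "0 \<le> x \<Longrightarrow> cosh (x::real) \<le> exp x"
  by (simp add: cosh_field_def)

lemma exp_2_gt_4: "exp (2::real) > 4"
proof -
  have "(1 + 1 + 1 / 2 :: real) \<le> exp 1" using exp_lower_Taylor_quadratic[of "1::real"] by simp
  then have "(2.5::real) * 2.5 \<le> exp 1 * exp 1" by (intro mult_mono) auto
  then show ?thesis by (simp flip: exp_add)
qed

text \<open>Logarithmic form of \<open>thin_cosh\<close>: passing from \<open>cosh\<close> to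
  \<open>exp\<close> costs a factor 2, the sum of two exponentials another 2, and the constant 2
  absorbs their product because 4 < e^2.\<close>

lemma thin:
  assumes "between (p::'a) m q"
  shows "dist r m \<le> max (dist r p - dist p m) (dist r q - dist m q) + 2"
proof -
  define M where "M = max (dist r p - dist p m) (dist r q - dist m q)"
  have "exp (dist r m) / 2 \<le> cosh (dist r m)" by (rule cosh_ge_half_exp)
  also have "\<dots> \<le> exp (- dist p m) * cosh (dist r p) + exp (- dist m q) * cosh (dist r q)"
    by (rule thin_cosh[OF assms])
  also have "\<dots> \<le> exp (- dist p m) * exp (dist r p) + exp (- dist m q) * exp (dist r q)"
    by (intro add_mono mult_left_mono cosh_le_exp) auto
  also have "\<dots> = exp (dist r p - dist p m) + exp (dist r q - dist m q)"
    by (simp flip: exp_add)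
  also have "\<dots> \<le> exp M + exp M" by (intro add_mono) (auto simp: M_def)
  finally have "exp (dist r m) \<le> 4 * exp M" by simp
  also have "\<dots> \<le> exp (M + 2)" using exp_2_gt_4 by (simp add: exp_add)
  finally show ?thesis by (simp add: M_def)
qed

text \<open>Comparison is applied twice, to the side from \<open>x\<close> to \<open>y\<close> seen
  from \<open>m'\<close> and to the side from \<open>x\<close> to \<open>z\<close> seen from
  \<open>y\<close>. The exponent is twice the difference between \<open>u\<close> and the Gromov
  product of \<open>y\<close> and \<open>z\<close> at \<open>x\<close>.\<close>

lemma thin_pair:
  assumes "between (x::'a) m y" "between x m' z" "dist x m = u" "dist x m' = u"
  shows "cosh (dist m m') \<le> 1 + exp (2 * u + dist y z - dist x y - dist x z)"
proof (cases "u = 0")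
  case True
  then have "m = x" "m' = x" using assms by auto
  then show ?thesis by simp
next
  case False
  define a b c where "a = dist x y" and "b = dist x z" and "c = dist y z"
  have u: "u > 0" using False assms(3) zero_le_dist[of x m] by linarith
  have ua: "dist m y = a - u" "u \<le> a" "dist m' z = b - u" "u \<le> b"
    using assms zero_le_dist[of m y] zero_le_dist[of m' z] by (auto simp: between_def a_def b_def simp del: zero_le_dist)
  have pos: "sinh a > 0" "sinh b > 0" "sinh u > 0" using u ua by auto
  have 1: "sinh a * cosh (dist m' m) \<le> sinh (a - u) * cosh u + sinh u * cosh (dist m' y)"
    using between_comparison[OF assms(1), of m'] assms ua by (simp add: a_def dist_commute)
  have 2: "sinh b * cosh (dist y m') \<le> sinh (b - u) * cosh a + sinh u * cosh c"
    using between_comparison[OF assms(2), of y] assms ua by (simp add: a_def b_def c_def dist_commute)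
  have "sinh b * (sinh a * cosh (dist m m')) \<le> sinh b * (sinh (a - u) * cosh u + sinh u * cosh (dist m' y))"
    using 1 pos by (intro mult_left_mono) (auto simp: dist_commute)
  also have "\<dots> = sinh b * sinh (a - u) * cosh u + sinh u * (sinh b * cosh (dist y m'))"
    by (simp add: algebra_simps dist_commute)
  also have "\<dots> \<le> sinh b * sinh (a - u) * cosh u + sinh u * (sinh (b - u) * cosh a + sinh u * cosh c)"
    using 2 pos by (intro add_left_mono mult_left_mono) auto
  also have "\<dots> = sinh a * sinh b * ((cosh u)\<^sup>2 - (sinh u)\<^sup>2) + (sinh u)\<^sup>2 * (cosh c - cosh (a - b)) - (sinh u)\<^sup>2 * 0
       + sinh a * sinh b * ((sinh u)\<^sup>2 - (sinh u)\<^sup>2)"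
    by (simp add: sinh_diff cosh_diff cosh_square_eq power2_eq_square algebra_simps)
  also have "\<dots> \<le> sinh a * sinh b + (sinh u)\<^sup>2 * cosh c"
    by (simp add: hyperbolic_pythagoras mult_left_mono)
  also have "(sinh u)\<^sup>2 * cosh c \<le> (exp (u - a) * sinh a) * (exp (u - b) * sinh b) * exp c"
  proof -
    have "sinh u \<le> exp (u - a) * sinh a" "sinh u \<le> exp (u - b) * sinh b"
      using sinh_quotient_le[of "a - u" a] sinh_quotient_le[of "b - u" b] ua u by auto
    then have "sinh u * sinh u \<le> (exp (u - a) * sinh a) * (exp (u - b) * sinh b)"
      using pos by (intro mult_mono) auto
    moreover have "cosh c \<le> exp c" by (intro cosh_le_exp) (simp add: c_def)
    ultimately show ?thesis unfolding power2_eq_square using pos ua by (rule_tac mult_mono) (auto intro: mult_nonneg_nonneg)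
  qed
  also have "sinh a * sinh b + (exp (u - a) * sinh a) * (exp (u - b) * sinh b) * exp c
     = sinh b * (sinh a * (1 + exp (2 * u + c - a - b)))"
  proof -
    have "(exp (u - a) * sinh a) * (exp (u - b) * sinh b) * exp c = sinh a * sinh b * (exp (u - a) * exp (u - b) * exp c)"
      by (simp only: mult_ac)
    also have "exp (u - a) * exp (u - b) * exp c = exp (2 * u + c - a - b)" by (simp flip: exp_add)
    finally show ?thesis by (simp add: distrib_left mult_ac)
  qed
  finally have "cosh (dist m m') \<le> 1 + exp (2 * u + c - a - b)"
    using pos by (simp only: mult_le_cancel_left_pos)
  then show ?thesis by (simp add: a_def b_def c_def)
qed

end

section \<open>Rays and the boundary\<close>

lemma cosh_lower_quadratic: "1 + x\<^sup>2 / 4 \<le> cosh (x::real)"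
proof -
  have *: "1 + y\<^sup>2 / 4 \<le> cosh y" if "y \<ge> 0" for y :: real
    using exp_lower_Taylor_quadratic[OF that] exp_ge_add_one_self[of "- y"]
    by (simp add: cosh_field_def)
  show ?thesis using *[of "\<bar>x\<bar>"] by simp
qed

lemma mono_bounded_tendsto_at_top:
  fixes f :: "real \<Rightarrow> real"
  assumes mono: "\<And>s t. 0 \<le> s \<Longrightarrow> s \<le> t \<Longrightarrow> f s \<le> f t" and bd: "\<And>t. 0 \<le> t \<Longrightarrow> f t \<le> K"
  obtains b where "(f \<longlongrightarrow> b) at_top" "f 0 \<le> b" "b \<le> K" "\<And>t. 0 \<le> t \<Longrightarrow> f t \<le> b"
proof -
  define b where "b = Sup (f ` {0..})"
  have bdd: "bdd_above (f ` {0..})" using bd by (auto intro!: bdd_aboveI[of _ K])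
  have up: "f t \<le> b" if "0 \<le> t" for t
    unfolding b_def using that bdd by (intro cSUP_upper) auto
  have "b \<le> K" unfolding b_def using bd by (intro cSUP_least) auto
  moreover have "(f \<longlongrightarrow> b) at_top"
  proof (rule increasing_tendsto)
    show "\<forall>\<^sub>F t in at_top. f t \<le> b"
      using eventually_ge_at_top[of 0] by eventually_elim (rule up)
  next
    fix y assume "y < b"
    then obtain s where s: "0 \<le> s" "y < f s"
      using less_cSUP_iff[OF _ bdd] by (auto simp: b_def)
    show "\<forall>\<^sub>F t in at_top. y < f t"
      using eventually_ge_at_top[of s] by eventually_elim (use mono s in \<open>force intro: less_le_trans\<close>)
  qed
  ultimately show ?thesis using that up by blast
qed

section \<open>Rays, asymptotic classes and time shifts\<close>

lemma ray_dist: "r \<in> geodesic_rays \<Longrightarrow> 0 \<le> s \<Longrightarrow> 0 \<le> t \<Longrightarrow> dist (r s) (r t) = \<bar>s - t\<bar>"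
  by (simp add: geodesic_rays_def)

lemma ray_between: "r \<in> geodesic_rays \<Longrightarrow> 0 \<le> s \<Longrightarrow> s \<le> t \<Longrightarrow> t \<le> v \<Longrightarrow> between (r s) (r t) (r v)"
  by (simp add: between_def ray_dist)

lemma ray_tendsto:
  assumes "r \<in> geodesic_rays" "(f \<longlongrightarrow> a) F" "\<forall>\<^sub>F x in F. f x \<ge> 0" "a \<ge> 0"
  shows "((\<lambda>x. r (f x)) \<longlongrightarrow> r a) F"
proof (rule tendstoI)
  fix e :: real assume "e > 0"
  from tendstoD[OF assms(2) this] assms(3) show "\<forall>\<^sub>F x in F. dist (r (f x)) (r a) < e"
    by eventually_elim (use assms in \<open>simp add: ray_dist dist_real_def\<close>)
qed

lemma asymptotic_sym: "(r, r') \<in> asymptotic \<Longrightarrow> (r', r) \<in> asymptotic"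
  by (auto simp: asymptotic_def dist_commute)

lemma boundary_rays: "\<xi> \<in> boundary \<Longrightarrow> r \<in> \<xi> \<Longrightarrow> r \<in> geodesic_rays"
  unfolding boundary_def using equiv_asymptotic in_quotient_imp_subset by blast

lemma boundary_asymptotic: "\<xi> \<in> boundary \<Longrightarrow> r \<in> \<xi> \<Longrightarrow> r' \<in> \<xi> \<longleftrightarrow> (r, r') \<in> asymptotic"
  unfolding boundary_def
  using in_quotient_imp_closed[OF equiv_asymptotic, of \<xi> r r']
    in_quotient_imp_in_rel[OF equiv_asymptotic, of \<xi> r r'] by auto

lemma boundary_eqI:
  "\<xi> \<in> boundary \<Longrightarrow> \<eta> \<in> boundary \<Longrightarrow> r \<in> \<xi> \<Longrightarrow> s \<in> \<eta> \<Longrightarrow> (r, s) \<in> asymptotic \<Longrightarrow> \<xi> = \<eta>"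
  using quotient_eq_iff[OF equiv_asymptotic] unfolding boundary_def by blast

lemma boundary_nonempty: "\<xi> \<in> boundary \<Longrightarrow> \<exists>r. r \<in> \<xi>"
  unfolding boundary_def using equiv_asymptotic in_quotient_imp_non_empty by blast

lemma asymptotic_class: "r \<in> geodesic_rays \<Longrightarrow> asymptotic `` {r} \<in> boundary \<and> r \<in> asymptotic `` {r}"
  unfolding boundary_def using equiv_class_self[OF equiv_asymptotic] quotientI by fast

lemma asymptoticI:
  "r \<in> geodesic_rays \<Longrightarrow> r' \<in> geodesic_rays \<Longrightarrow> (\<And>t. t \<ge> 0 \<Longrightarrow> dist (r t) (r' t) \<le> C) \<Longrightarrow> (r, r') \<in> asymptotic"
  by (auto simp: asymptotic_def)

lemma asymptoticE:
  assumes "(r, r') \<in> asymptotic"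
  obtains C where "r \<in> geodesic_rays" "r' \<in> geodesic_rays" "\<And>t. t \<ge> 0 \<Longrightarrow> dist (r t) (r' t) \<le> C"
  using assms by (auto simp: asymptotic_def)

text \<open>By the triangle inequality the defect is nondecreasing and bounded. Its limit is the
  Busemann function between \<open>r 0\<close> and \<open>x\<close>.\<close>

lemma ray_time_defect_tendsto:
  assumes r: "r \<in> geodesic_rays"
  obtains b where "((\<lambda>t. t - dist x (r t)) \<longlongrightarrow> b) at_top" "\<bar>b\<bar> \<le> dist x (r 0)"
    "\<And>t. 0 \<le> t \<Longrightarrow> t - dist x (r t) \<le> b"
proof -
  have "s - dist x (r s) \<le> t - dist x (r t)" if "0 \<le> s" "s \<le> t" for s t
    using dist_triangle[of x "r t" "r s"] ray_dist[OF r, of s t] that by auto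
  moreover have "t - dist x (r t) \<le> dist x (r 0)" if "0 \<le> t" for t
    using dist_triangle[of "r 0" "r t" x] ray_dist[OF r, of 0 t] that by (auto simp: dist_commute)
  ultimately show ?thesis
  proof (rule mono_bounded_tendsto_at_top)
    fix b
    assume "((\<lambda>t. t - dist x (r t)) \<longlongrightarrow> b) at_top" "0 - dist x (r 0) \<le> b" "b \<le> dist x (r 0)"
      "\<And>t. 0 \<le> t \<Longrightarrow> t - dist x (r t) \<le> b"
    then show ?thesis by (intro that[of b]) auto
  qed
qed

context cat_space
begin

text \<open>Geodesics from \<open>x\<close> are within 2 of each other up to the Gromov product of
  their ends, and exponentially close well before it. The exponential rate is kept because it later
  yields every \<open>\<epsilon>\<close>.\<close>

lemma thin_dist:
  assumes "between (x::'a) m y" "between x m' z" "dist x m = u" "dist x m' = u"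
  shows "dist m m' \<le> 2 * exp (u + (dist y z - dist x y - dist x z) / 2)"
proof -
  define E where "E = u + (dist y z - dist x y - dist x z) / 2"
  have "2 * u + dist y z - dist x y - dist x z = 2 * E" by (simp add: E_def field_simps)
  then have "1 + (dist m m')\<^sup>2 / 4 \<le> 1 + exp (2 * E)"
    using cosh_lower_quadratic[of "dist m m'"] thin_pair[OF assms] by simp
  then have "(dist m m')\<^sup>2 \<le> (2 * exp E)\<^sup>2"
    by (simp add: power_mult_distrib exp_double)
  then show ?thesis unfolding E_def by (rule power2_le_imp_le) simp
qed

lemma between_unique:
  assumes "between (x::'a) m y" "between x m' y" "dist x m = dist x m'"
  shows "m = m'"
proof (cases "x = y")
  case True
  then show ?thesis using assms by (auto simp: between_def dist_commute)
next
  case False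
  have d: "dist m y = dist m' y" "dist x y = dist x m + dist m y" using assms by (auto simp: between_def)
  have "sinh (dist x y) * cosh (dist m' m) \<le> sinh (dist m y) * cosh (dist x m) + sinh (dist x m) * cosh (dist m y)"
    using between_comparison[OF assms(1), of m'] assms(3) d by (simp add: dist_commute)
  also have "\<dots> = sinh (dist x y) * 1" unfolding d(2) sinh_add by simp
  finally have "cosh (dist m' m) \<le> 1" using False by (subst (asm) mult_le_cancel_left_pos) auto
  then have "(dist m' m)\<^sup>2 \<le> 0" using cosh_lower_quadratic[of "dist m' m"] by linarith
  then show ?thesis by simp
qed

lemma Cauchy_convergent_proper:
  assumes "Cauchy (X :: nat \<Rightarrow> 'a)"
  shows "convergent X"
proof -
  obtain x e where "range X \<subseteq> cball x e"
    using cauchy_imp_bounded[OF assms] by (meson bounded_subset_cball)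
  moreover have "complete (cball x e)" using proper by (simp add: compact_imp_complete)
  ultimately show ?thesis using assms unfolding complete_def convergent_def by blast
qed

lemma rays_eq:
  assumes "((r::real \<Rightarrow> 'a), r') \<in> asymptotic" "r 0 = r' 0" "u \<ge> 0"
  shows "r u = r' u"
proof -
  obtain C where r: "r \<in> geodesic_rays" "r' \<in> geodesic_rays" "\<And>t. t \<ge> 0 \<Longrightarrow> dist (r t) (r' t) \<le> C"
    using asymptoticE[OF assms(1)] by blast
  have "dist (r u) (r' u) \<le> 2 * exp (u + C / 2 - t)" if "t \<ge> u" for t
  proof -
    have "dist (r u) (r' u) \<le> 2 * exp (u + (dist (r t) (r' t) - dist (r 0) (r t) - dist (r 0) (r' t)) / 2)"
    proof (rule thin_dist)
      show "between (r 0) (r u) (r t)" "between (r 0) (r' u) (r' t)"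
        using ray_between[OF r(1), of 0 u t] ray_between[OF r(2), of 0 u t] that assms by auto
      show "dist (r 0) (r u) = u" "dist (r 0) (r' u) = u"
        using ray_dist[OF r(1), of 0 u] ray_dist[OF r(2), of 0 u] assms by auto
    qed
    also have "\<dots> \<le> 2 * exp (u + C / 2 - t)"
      using r(3)[of t] ray_dist[OF r(1), of 0 t] ray_dist[OF r(2), of 0 t] that assms
      by (simp add: field_simps)
    finally show ?thesis .
  qed
  then have "\<forall>\<^sub>F t in at_top. dist (r u) (r' u) \<le> 2 * exp (u + C / 2 - t)"
    using eventually_ge_at_top[of u] by (rule eventually_mono[rotated])
  moreover have "((\<lambda>t. 2 * exp (u + C / 2 - t)) \<longlongrightarrow> 0) at_top" by real_asymp
  ultimately have "dist (r u) (r' u) \<le> 0"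
    using tendsto_lowerbound[of _ 0 at_top] by fastforce
  then show ?thesis by simp
qed

text \<open>The segments from \<open>x\<close> to the points \<open>r n\<close> converge: for
  \<open>n \<le> m\<close> the Gromov product of \<open>r n\<close> and \<open>r m\<close> at
  \<open>x\<close> is at least \<open>n - D\<close>, so \<open>thin_dist\<close> makes the sequence
  Cauchy at each time. Thinness of the approximating triangles keeps the limit within
  \<open>D + 2\<close> of \<open>r\<close>.\<close>

lemma ex_ray_from:
  assumes r: "(r::real \<Rightarrow> 'a) \<in> geodesic_rays"
  obtains r' where "(r, r') \<in> asymptotic" "\<forall>t\<le>0. r' t = x"
proof -
  define D where "D = dist x (r 0)"
  have "\<forall>n. \<exists>c. geodesic_segment UNIV dist x (r (real n)) c" using ex_segment by blast
  then obtain c where c: "\<And>n. geodesic_segment UNIV dist x (r (real n)) (c n)" by metis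
  define a where "a n = dist x (r (real n))" for n
  have aD: "real n - D \<le> a n" "a n \<le> real n + D" for n
    using dist_triangle[of "r 0" "r (real n)" x] dist_triangle[of x "r (real n)" "r 0"] ray_dist[OF r, of 0 "real n"]
    by (auto simp: a_def D_def dist_commute)
  have iso: "dist (c n s) (c n t) = \<bar>s - t\<bar>" if "0 \<le> s" "s \<le> a n" "0 \<le> t" "t \<le> a n" for n s t
    using c[of n] that by (auto simp: geodesic_segment_def a_def)
  have ends: "c n 0 = x" "c n (a n) = r (real n)" for n
    using c[of n] by (auto simp: geodesic_segment_def a_def)
  have bet: "between x (c n s) (r (real n))" "dist x (c n s) = s" "dist (c n s) (r (real n)) = a n - s"
    if "0 \<le> s" "s \<le> a n" for n s
    using iso[of 0 n s] iso[of s n "a n"] ends[of n] that by (auto simp: between_def a_def)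
  have cau: "dist (c n s) (c m s) \<le> 2 * exp (s + D - real n)"
    if "0 \<le> s" "s + D \<le> real n" "n \<le> m" for n m s
  proof -
    have "dist (c n s) (c m s) \<le> 2 * exp (s + (dist (r (real n)) (r (real m)) - a n - a m) / 2)"
      using bet[of s n] bet[of s m] aD[of n] aD[of m] that unfolding a_def
      by (intro thin_dist) auto
    also have "dist (r (real n)) (r (real m)) = real m - real n" using ray_dist[OF r, of n m] that by simp
    also have "2 * exp (s + (real m - real n - a n - a m) / 2) \<le> 2 * exp (s + D - real n)"
      using aD[of n] aD[of m] by simp
    finally show ?thesis .
  qed
  have conv: "convergent (\<lambda>n. c n s)" if "0 \<le> s" for s
  proof (rule Cauchy_convergent_proper, rule metric_CauchyI)
    fix e :: real assume "e > 0"
    have "((\<lambda>n. 2 * exp (s + D - real n)) \<longlongrightarrow> 0) sequentially" by real_asymp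
    then have "\<forall>\<^sub>F n in sequentially. 2 * exp (s + D - real n) < e"
      using \<open>e > 0\<close> by (rule order_tendstoD)
    moreover have "\<forall>\<^sub>F n in sequentially. s + D \<le> real n" by real_asymp
    ultimately obtain N where N: "\<And>n. n \<ge> N \<Longrightarrow> 2 * exp (s + D - real n) < e \<and> s + D \<le> real n"
      by (metis (mono_tags, lifting) eventually_conj eventually_sequentially)
    have "dist (c m s) (c n s) < e" if "m \<ge> N" "n \<ge> N" for m n
      using cau[OF \<open>0 \<le> s\<close>, of m n] cau[OF \<open>0 \<le> s\<close>, of n m] N[OF that(1)] N[OF that(2)]
      by (cases "m \<le> n") (auto simp: dist_commute intro: le_less_trans)
    then show "\<exists>M. \<forall>m\<ge>M. \<forall>n\<ge>M. dist (c m s) (c n s) < e" by blast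
  qed
  define r' where "r' s = (if s \<le> 0 then x else lim (\<lambda>n. c n s))" for s
  have lim: "(\<lambda>n. c n s) \<longlonglongrightarrow> r' s" if "0 \<le> s" for s
  proof (cases "s = 0")
    case True
    then show ?thesis by (simp add: r'_def ends)
  next
    case False
    then show ?thesis using conv[OF that] that by (simp add: r'_def convergent_LIMSEQ_iff)
  qed
  have large: "\<forall>\<^sub>F n in sequentially. s + D \<le> real n" for s by real_asymp
  have "r' \<in> geodesic_rays"
    unfolding geodesic_rays_def
  proof (intro CollectI allI impI)
    fix s t :: real assume st: "0 \<le> s" "0 \<le> t"
    have "(\<lambda>n. dist (c n s) (c n t)) \<longlonglongrightarrow> dist (r' s) (r' t)" by (intro tendsto_dist lim st)
    moreover have "\<forall>\<^sub>F n in sequentially. dist (c n s) (c n t) = \<bar>s - t\<bar>"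
      using large[of s] large[of t]
    proof eventually_elim
      case (elim n)
      then show ?case using aD(1)[of n] st by (intro iso) linarith+
    qed
    then have "(\<lambda>n. dist (c n s) (c n t)) \<longlonglongrightarrow> \<bar>s - t\<bar>" by (rule tendsto_eventually)
    ultimately show "dist (r' s) (r' t) = \<bar>s - t\<bar>" by (rule LIMSEQ_unique)
  qed
  moreover have "dist (r s) (r' s) \<le> D + 2" if "0 \<le> s" for s
  proof -
    have "(\<lambda>n. dist (r s) (c n s)) \<longlonglongrightarrow> dist (r s) (r' s)" by (intro tendsto_dist lim that tendsto_const)
    moreover have "\<forall>\<^sub>F n in sequentially. dist (r s) (c n s) \<le> D + 2"
      using large[of s]
    proof eventually_elim
      case (elim n)
      have sa: "s \<le> a n" using aD[of n] elim by linarith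
      have D0: "D \<ge> 0" by (simp add: D_def)
      have "dist (r s) (c n s) \<le> max (dist (r s) x - s) (dist (r s) (r (real n)) - (a n - s)) + 2"
        using thin[OF bet(1)[OF that sa], of "r s"] bet(2,3)[OF that sa] by simp
      moreover have "dist (r s) x \<le> s + D"
        using dist_triangle[of "r s" x "r 0"] ray_dist[OF r, of s 0] that by (simp add: D_def dist_commute)
      moreover have "dist (r s) (r (real n)) = real n - s" using ray_dist[OF r, of s n] elim that D0 by simp
      ultimately show ?case using aD[of n] by linarith
    qed
    ultimately show ?thesis by (intro tendsto_upperbound) auto
  qed
  ultimately have "(r, r') \<in> asymptotic" using r by (intro asymptoticI[of _ _ "D + 2"]) auto
  then show ?thesis using that[of r'] by (simp add: r'_def)
qed

text \<open>The segment from \<open>r' 0\<close> to \<open>r t\<close> mediates. Seen from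
  \<open>r' 0\<close> it follows \<open>r'\<close>, with an error vanishing as \<open>t\<close>
  grows; seen from \<open>r t\<close> it follows \<open>r\<close>, with an error decaying in
  \<open>s\<close>. Equal distances from \<open>r t\<close> correspond to the time
  \<open>s + (t - a t)\<close> on \<open>r\<close>, which tends to \<open>s + b\<close>.\<close>

lemma asymptotic_close:
  assumes "((r::real \<Rightarrow> 'a), r') \<in> asymptotic" and "((\<lambda>t. t - dist (r' 0) (r t)) \<longlongrightarrow> b) at_top"
    and "s \<ge> dist (r 0) (r' 0)"
  shows "dist (r' s) (r (s + b)) \<le> 2 * exp (dist (r 0) (r' 0) - s)"
proof -
  define D where "D = dist (r 0) (r' 0)"
  obtain C where r: "r \<in> geodesic_rays" "r' \<in> geodesic_rays" and C: "\<And>t. t \<ge> 0 \<Longrightarrow> dist (r t) (r' t) \<le> C"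
    using asymptoticE[OF assms(1)] by blast
  define a where "a t = dist (r' 0) (r t)" for t
  have aD: "t - D \<le> a t" "a t \<le> t + D" if "t \<ge> 0" for t
    using dist_triangle[of "r 0" "r t" "r' 0"] dist_triangle[of "r' 0" "r t" "r 0"] ray_dist[OF r(1), of 0 t] that
    by (auto simp: a_def D_def dist_commute)
  have D0: "D \<ge> 0" by (simp add: D_def)
  have lim: "((\<lambda>t. t - a t) \<longlongrightarrow> b) at_top" using assms(2) by (simp add: a_def)
  have bD: "\<bar>b\<bar> \<le> D"
  proof -
    have "\<forall>\<^sub>F t in at_top. \<bar>t - a t\<bar> \<le> D"
      using eventually_ge_at_top[of 0] by eventually_elim (use aD in force)
    then show ?thesis using tendsto_upperbound[OF tendsto_rabs[OF lim]] by simp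
  qed
  have s: "s \<ge> D" using assms(3) by (simp add: D_def)
  have ev: "\<forall>\<^sub>F t in at_top. dist (r' s) (r (s + (t - a t))) \<le> 2 * exp (s + (C + D) / 2 - t) + 2 * exp (D - s)"
    using eventually_ge_at_top[of "s + D"]
  proof eventually_elim
    case (elim t)
    have t0: "t \<ge> 0" using elim s D0 by linarith
    have sa: "s \<le> a t" "s \<ge> 0" "s \<le> t" and ta: "0 \<le> s + (t - a t)" "s + (t - a t) \<le> t"
      using elim aD[OF t0] s D0 by linarith+
    obtain m where m: "between (r' 0) m (r t)" "dist (r' 0) m = s"
      using ex_between[of s "r' 0" "r t"] sa by (auto simp: a_def)
    have "dist m (r' s) \<le> 2 * exp (s + (dist (r t) (r' t) - a t - dist (r' 0) (r' t)) / 2)"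
      unfolding a_def
      by (rule thin_dist[OF m(1) _ m(2)]) (use ray_between[OF r(2), of 0 s t] ray_dist[OF r(2), of 0 s] sa in auto)
    also have "\<dots> \<le> 2 * exp (s + (C + D) / 2 - t)"
      using C[OF t0] aD[OF t0] ray_dist[OF r(2), of 0 t] t0 by simp
    finally have 1: "dist m (r' s) \<le> 2 * exp (s + (C + D) / 2 - t)" .
    have "dist m (r (s + (t - a t))) \<le> 2 * exp ((a t - s) + (dist (r' 0) (r 0) - dist (r t) (r' 0) - dist (r t) (r 0)) / 2)"
    proof (rule thin_dist)
      show "between (r t) m (r' 0)" by (rule between_sym[OF m(1)])
      show "between (r t) (r (s + (t - a t))) (r 0)" using ta r by (intro between_sym[OF ray_between]) auto
      show "dist (r t) m = a t - s" using m by (simp add: between_def a_def dist_commute)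
      show "dist (r t) (r (s + (t - a t))) = a t - s" using r ta t0 by (simp add: ray_dist)
    qed
    also have "\<dots> = 2 * exp ((a t - t) / 2 + D / 2 - s)"
      using ray_dist[OF r(1), of t 0] t0 by (simp add: a_def D_def dist_commute field_simps)
    also have "(a t - t) / 2 + D / 2 - s \<le> D - s" using aD[OF t0] by (simp add: field_simps)
    finally have 2: "dist m (r (s + (t - a t))) \<le> 2 * exp (D - s)" by simp
    show ?case using dist_triangle[of "r' s" "r (s + (t - a t))" m] 1 2 dist_commute[of m "r' s"] by linarith
  qed
  have nn: "\<forall>\<^sub>F t in at_top. 0 \<le> s + (t - a t)"
    using eventually_ge_at_top[of 0] by eventually_elim (use aD s in force)
  have "((\<lambda>t. dist (r' s) (r (s + (t - a t)))) \<longlongrightarrow> dist (r' s) (r (s + b))) at_top"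
    using bD s by (intro tendsto_intros ray_tendsto[OF r(1)] lim nn) auto
  moreover have "((\<lambda>t. 2 * exp (s + (C + D) / 2 - t) + 2 * exp (D - s)) \<longlongrightarrow> 0 + 2 * exp (D - s)) at_top"
    by (intro tendsto_add tendsto_const) real_asymp
  ultimately have "dist (r' s) (r (s + b)) \<le> 0 + 2 * exp (D - s)"
    by (intro tendsto_le[OF trivial_limit_at_top_linorder _ _ ev])
  then show ?thesis by (simp add: D_def)
qed

text \<open>Negative curvature improves bounded distance to convergence, once the time is shifted by
  the Busemann function between the two origins.\<close>

lemma asymptotic_shift:
  assumes "((r::real \<Rightarrow> 'a), r') \<in> asymptotic"
  obtains b where "\<bar>b\<bar> \<le> dist (r 0) (r' 0)" "((\<lambda>s. dist (r' s) (r (s + b))) \<longlongrightarrow> 0) at_top"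
proof -
  have "r \<in> geodesic_rays" using assms by (auto simp: asymptotic_def)
  then obtain b where b: "((\<lambda>t. t - dist (r' 0) (r t)) \<longlongrightarrow> b) at_top" "\<bar>b\<bar> \<le> dist (r' 0) (r 0)"
    by (rule ray_time_defect_tendsto)
  have ev: "\<forall>\<^sub>F s in at_top. norm (dist (r' s) (r (s + b))) \<le> 2 * exp (dist (r 0) (r' 0) - s)"
    using eventually_ge_at_top[of "dist (r 0) (r' 0)"]
    by eventually_elim (use asymptotic_close[OF assms b(1)] in auto)
  have "((\<lambda>s. 2 * exp (dist (r 0) (r' 0) - s)) \<longlongrightarrow> 0) at_top" by real_asymp
  then have "((\<lambda>s. dist (r' s) (r (s + b))) \<longlongrightarrow> 0) at_top"
    by (rule Lim_null_comparison[OF ev])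
  then show ?thesis by (rule that[rotated]) (use b in \<open>simp add: dist_commute\<close>)
qed

text \<open>Justifies the definite description in \<open>busemann\<close>: rays of one class
  converge to each other after a time shift, and a shift does not affect the limit.\<close>

lemma busemann_tendsto:
  assumes \<xi>: "\<xi> \<in> boundary" "(r::real \<Rightarrow> 'a) \<in> \<xi>"
  shows "((\<lambda>t. dist x (r t) - dist y (r t)) \<longlongrightarrow> busemann \<xi> x y) at_top"
proof -
  have r: "r \<in> geodesic_rays" by (rule boundary_rays[OF \<xi>])
  obtain bx where bx: "((\<lambda>t. t - dist x (r t)) \<longlongrightarrow> bx) at_top" by (rule ray_time_defect_tendsto[OF r])
  obtain b2 where b2: "((\<lambda>t. t - dist y (r t)) \<longlongrightarrow> b2) at_top" by (rule ray_time_defect_tendsto[OF r])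
  have L: "((\<lambda>t. dist x (r t) - dist y (r t)) \<longlongrightarrow> b2 - bx) at_top"
    using tendsto_diff[OF b2 bx] by simp
  have all: "((\<lambda>t. dist x (r' t) - dist y (r' t)) \<longlongrightarrow> b2 - bx) at_top" if "r' \<in> \<xi>" for r'
  proof -
    have "(r, r') \<in> asymptotic" using boundary_asymptotic[OF \<xi>] that by simp
    then obtain c where c: "((\<lambda>s. dist (r' s) (r (s + c))) \<longlongrightarrow> 0) at_top" by (rule asymptotic_shift)
    have sh: "filterlim (\<lambda>s::real. s + c) at_top at_top" by real_asymp
    have "((\<lambda>s. dist z (r' s) - dist z (r (s + c))) \<longlongrightarrow> 0) at_top" for z
    proof (rule Lim_null_comparison[OF _ c], rule always_eventually, rule allI)
      fix s
      show "norm (dist z (r' s) - dist z (r (s + c))) \<le> dist (r' s) (r (s + c))"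
        using abs_dist_diff_le[of "r' s" z "r (s + c)"] by (simp add: dist_commute)
    qed
    from tendsto_diff[OF this[of x] this[of y]] filterlim_compose[OF L sh]
    have "((\<lambda>s. ((dist x (r' s) - dist x (r (s + c))) - (dist y (r' s) - dist y (r (s + c))))
       + (dist x (r (s + c)) - dist y (r (s + c)))) \<longlongrightarrow> (0 - 0) + (b2 - bx)) at_top"
      by (rule tendsto_add)
    then show ?thesis by simp
  qed
  have "busemann \<xi> x y = b2 - bx"
    unfolding busemann_def
  proof (rule the_equality)
    fix c assume "\<forall>r\<in>\<xi>. ((\<lambda>t. dist x (r t) - dist y (r t)) \<longlongrightarrow> c) at_top"
    then have "((\<lambda>t. dist x (r t) - dist y (r t)) \<longlongrightarrow> c) at_top" using \<xi>(2) by blast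
    then show "c = b2 - bx" using L by (rule tendsto_unique[OF trivial_limit_at_top_linorder])
  qed (rule ballI, rule all)
  then show ?thesis using L by simp
qed

lemma busemann_le: "\<xi> \<in> boundary \<Longrightarrow> busemann \<xi> x y \<le> dist (x::'a) y"
proof -
  assume \<xi>: "\<xi> \<in> boundary"
  obtain r where "r \<in> \<xi>" using boundary_nonempty[OF \<xi>] by blast
  have "dist x (r t) - dist y (r t) \<le> dist x y" for t
    using dist_triangle[of x "r t" y] by simp
  then have "\<forall>\<^sub>F t in at_top. dist x (r t) - dist y (r t) \<le> dist x y" by (rule always_eventually[OF allI])
  then show ?thesis
    by (rule tendsto_upperbound[OF busemann_tendsto[OF \<xi> \<open>r \<in> \<xi>\<close>]]) simp
qed

lemma busemann_add: "\<xi> \<in> boundary \<Longrightarrow> busemann \<xi> x y + busemann \<xi> y z = busemann \<xi> x (z::'a)"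
proof -
  assume \<xi>: "\<xi> \<in> boundary"
  obtain r where r: "r \<in> \<xi>" using boundary_nonempty[OF \<xi>] by blast
  have "((\<lambda>t. (dist x (r t) - dist y (r t)) + (dist y (r t) - dist z (r t))) \<longlongrightarrow> busemann \<xi> x y + busemann \<xi> y z) at_top"
    by (rule tendsto_add[OF busemann_tendsto[OF \<xi> r] busemann_tendsto[OF \<xi> r]])
  moreover have "(\<lambda>t. (dist x (r t) - dist y (r t)) + (dist y (r t) - dist z (r t))) = (\<lambda>t. dist x (r t) - dist z (r t))"
    by auto
  ultimately have "((\<lambda>t. dist x (r t) - dist z (r t)) \<longlongrightarrow> busemann \<xi> x y + busemann \<xi> y z) at_top"
    by simp
  then show ?thesis
    using busemann_tendsto[OF \<xi> r, of x z] by (rule tendsto_unique[OF trivial_limit_at_top_linorder])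
qed

lemma busemann_self [simp]: "\<xi> \<in> boundary \<Longrightarrow> busemann \<xi> x (x::'a) = 0"
  using busemann_add[of \<xi> x x x] by simp

lemma busemann_swap: "\<xi> \<in> boundary \<Longrightarrow> busemann \<xi> y x = - busemann \<xi> x (y::'a)"
  using busemann_add[of \<xi> x y x] by simp

section \<open>Rays from a base point and the action of isometries on them\<close>

abbreviation ray_to :: "'a \<Rightarrow> (real \<Rightarrow> 'a) set \<Rightarrow> real \<Rightarrow> 'a" where
  "ray_to x \<xi> \<equiv> gen_ray x (Inr \<xi>)"

lemma ray_to:
  assumes \<xi>: "\<xi> \<in> boundary"
  shows "ray_to x \<xi> \<in> \<xi>" "t \<le> 0 \<Longrightarrow> ray_to x \<xi> t = x" "ray_to x \<xi> \<in> geodesic_rays"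
    "c \<in> \<xi> \<Longrightarrow> (\<And>t. t \<le> 0 \<Longrightarrow> c t = x) \<Longrightarrow> ray_to x \<xi> = c"
proof -
  obtain r where r: "r \<in> \<xi>" using boundary_nonempty[OF \<xi>] by blast
  have "r \<in> geodesic_rays" by (rule boundary_rays[OF \<xi> r])
  then obtain r' where r': "(r, r') \<in> asymptotic" "\<forall>t\<le>0. r' t = x" by (rule ex_ray_from[where x = x])
  have r'\<xi>: "r' \<in> \<xi>" using boundary_asymptotic[OF \<xi> r] r' by simp
  have uni: "c = r'" if "c \<in> \<xi>" "\<And>t. t \<le> 0 \<Longrightarrow> c t = x" for c
  proof
    fix t
    have a: "(c, r') \<in> asymptotic" using boundary_asymptotic[OF \<xi> that(1)] r'\<xi> by simp
    have z: "c 0 = r' 0" using that(2)[of 0] r'(2) by simp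
    show "c t = r' t"
    proof (cases "t \<le> 0")
      case True
      then show ?thesis using that(2) r'(2) by simp
    next
      case False
      then show ?thesis using rays_eq[OF a z, of t] by simp
    qed
  qed
  have *: "ray_to x \<xi> = r'"
    unfolding gen_ray_def sum.case
  proof (rule the_equality)
    show "(\<forall>t\<le>0. r' t = x) \<and> r' \<in> \<xi>" using r'\<xi> r'(2) by blast
    show "c = r'" if "(\<forall>t\<le>0. c t = x) \<and> c \<in> \<xi>" for c
      by (rule uni) (use that in auto)
  qed
  show "ray_to x \<xi> \<in> \<xi>" "t \<le> 0 \<Longrightarrow> ray_to x \<xi> t = x" using * r'\<xi> r'(2) by auto
  show "ray_to x \<xi> = c" if "c \<in> \<xi>" "\<And>t. t \<le> 0 \<Longrightarrow> c t = x"
    using uni[OF that] * by simp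
  show "ray_to x \<xi> \<in> geodesic_rays" using boundary_rays[OF \<xi> r'\<xi>] * by simp
qed

lemma ray_to_dist: "\<xi> \<in> boundary \<Longrightarrow> 0 \<le> s \<Longrightarrow> 0 \<le> t \<Longrightarrow> dist (ray_to x \<xi> s) (ray_to x \<xi> t) = \<bar>s - t\<bar>"
  by (simp add: ray_to ray_dist)

lemma ray_to_dist0: "\<xi> \<in> boundary \<Longrightarrow> 0 \<le> t \<Longrightarrow> dist x (ray_to x \<xi> t) = t"
  using ray_to_dist[of \<xi> 0 t x] ray_to(2)[of \<xi> 0 x] by simp

lemma ray_to_between0: "\<xi> \<in> boundary \<Longrightarrow> 0 \<le> s \<Longrightarrow> s \<le> t \<Longrightarrow> between x (ray_to x \<xi> s) (ray_to x \<xi> t)"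
  using ray_between[OF ray_to(3), of \<xi> 0 s t x] ray_to(2)[of \<xi> 0 x] by simp

lemma ray_to_eqI: "\<xi> \<in> boundary \<Longrightarrow> r \<in> \<xi> \<Longrightarrow> r 0 = x \<Longrightarrow> t \<ge> 0 \<Longrightarrow> r t = ray_to x \<xi> t"
  using rays_eq[of r "ray_to x \<xi>" t] boundary_asymptotic ray_to(1,2) by fastforce

text \<open>Closeness at a time \<open>u\<close> propagates back to all earlier times with the bound
  \<open>2 * exp (C / 2)\<close>, so it is enough to have it at arbitrarily late times.\<close>

lemma ray_to_bounded_eq:
  assumes "\<xi> \<in> boundary" "\<eta> \<in> boundary" "\<And>t. 0 \<le> t \<Longrightarrow> \<exists>u\<ge>t. dist (ray_to x \<xi> u) (ray_to x \<eta> u) \<le> C"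
  shows "\<xi> = \<eta>"
proof (rule boundary_eqI[OF assms(1,2) ray_to(1) ray_to(1)])
  show "(ray_to x \<xi>, ray_to x \<eta>) \<in> asymptotic"
  proof (rule asymptoticI[of _ _ "2 * exp (C / 2)"])
    fix t :: real assume t: "t \<ge> 0"
    then obtain u where u: "u \<ge> t" "dist (ray_to x \<xi> u) (ray_to x \<eta> u) \<le> C" using assms(3) by blast
    have "dist (ray_to x \<xi> t) (ray_to x \<eta> t) \<le>
       2 * exp (t + (dist (ray_to x \<xi> u) (ray_to x \<eta> u) - dist x (ray_to x \<xi> u) - dist x (ray_to x \<eta> u)) / 2)"
      using t u assms by (intro thin_dist) (auto intro: ray_to_between0 simp: ray_to_dist0)
    also have "\<dots> \<le> 2 * exp (C / 2)" using t u assms by (simp add: ray_to_dist0 field_simps)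
    finally show "dist (ray_to x \<xi> t) (ray_to x \<eta> t) \<le> 2 * exp (C / 2)" .
  qed (use assms ray_to in auto)
qed (use assms in auto)

lemma gen_ray_Inl:
  shows "geodesic_segment UNIV dist x y (gen_ray x (Inl y))" "t \<le> 0 \<Longrightarrow> gen_ray x (Inl y) t = (x::'a)"
    "t \<ge> dist x y \<Longrightarrow> gen_ray x (Inl y) t = y"
    "geodesic_segment UNIV dist x y c \<Longrightarrow> (\<And>t. t \<le> 0 \<Longrightarrow> c t = x) \<Longrightarrow> (\<And>t. t \<ge> dist x y \<Longrightarrow> c t = y) \<Longrightarrow>
      gen_ray x (Inl y) = c"
proof -
  obtain c0 where c0: "geodesic_segment UNIV dist x y c0" using ex_segment by blast
  define c1 where "c1 t = c0 (max 0 (min t (dist x y)))" for t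
  have c1: "geodesic_segment UNIV dist x y c1" "\<And>t. t \<le> 0 \<Longrightarrow> c1 t = x" "\<And>t. t \<ge> dist x y \<Longrightarrow> c1 t = y"
  proof -
    have z: "dist x y \<ge> 0" by simp
    show "geodesic_segment UNIV dist x y c1" using c0 by (auto simp: c1_def geodesic_segment_def)
    show "c1 t = x" if "t \<le> 0" for t
      using c0 that z by (simp add: c1_def geodesic_segment_def min_absorb1)
    show "c1 t = y" if "t \<ge> dist x y" for t
      using c0 that z by (simp add: c1_def geodesic_segment_def)
  qed
  have uni: "c = c1" if c: "geodesic_segment UNIV dist x y c" "\<And>t. t \<le> 0 \<Longrightarrow> c t = x" "\<And>t. t \<ge> dist x y \<Longrightarrow> c t = y" for c
  proof
    fix t
    consider "t \<le> 0" | "t \<ge> dist x y" | "0 \<le> t" "t \<le> dist x y" by linarith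
    then show "c t = c1 t"
    proof cases
      case 3
      have *: "between x (d t) y \<and> dist x (d t) = t" if "geodesic_segment UNIV dist x y d" for d
      proof -
        have iso: "\<And>s t. s \<in> {0..dist x y} \<Longrightarrow> t \<in> {0..dist x y} \<Longrightarrow> dist (d s) (d t) = \<bar>s - t\<bar>"
          and "d 0 = x" "d (dist x y) = y"
          using that by (auto simp: geodesic_segment_def)
        with iso[of 0 t] iso[of t "dist x y"] 3 show ?thesis by (auto simp: between_def)
      qed
      show ?thesis using *[OF c(1)] *[OF c1(1)] by (metis between_unique)
    qed (use c c1 in auto)
  qed
  have *: "gen_ray x (Inl y) = c1"
    unfolding gen_ray_def sum.case
  proof (rule the_equality)
    show "(\<forall>t\<le>0. c1 t = x) \<and> geodesic_segment UNIV dist x y c1 \<and> (\<forall>t\<ge>dist x y. c1 t = y)" using c1 by blast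
    show "c = c1" if "(\<forall>t\<le>0. c t = x) \<and> geodesic_segment UNIV dist x y c \<and> (\<forall>t\<ge>dist x y. c t = y)" for c
      by (rule uni) (use that in auto)
  qed
  show "geodesic_segment UNIV dist x y (gen_ray x (Inl y))" "t \<le> 0 \<Longrightarrow> gen_ray x (Inl y) t = x"
    "t \<ge> dist x y \<Longrightarrow> gen_ray x (Inl y) t = y"
    using * c1 by auto
  show "gen_ray x (Inl y) = c" if "geodesic_segment UNIV dist x y c" "\<And>t. t \<le> 0 \<Longrightarrow> c t = x" "\<And>t. t \<ge> dist x y \<Longrightarrow> c t = y"
    using uni[OF that] * by simp
qed

lemma gen_ray_Inl_between:
  assumes "0 \<le> t" "t \<le> dist x y"
  shows "between (x::'a) (gen_ray x (Inl y) t) y" "dist x (gen_ray x (Inl y) t) = t"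
proof -
  have iso: "\<And>s t. s \<in> {0..dist x y} \<Longrightarrow> t \<in> {0..dist x y} \<Longrightarrow>
      dist (gen_ray x (Inl y) s) (gen_ray x (Inl y) t) = \<bar>s - t\<bar>"
    using gen_ray_Inl(1)[of x y] by (auto simp: geodesic_segment_def)
  have "dist (gen_ray x (Inl y) 0) (gen_ray x (Inl y) t) = t"
    "dist (gen_ray x (Inl y) t) (gen_ray x (Inl y) (dist x y)) = dist x y - t"
    using iso[of 0 t] iso[of t "dist x y"] assms by auto
  then show "between x (gen_ray x (Inl y) t) y" "dist x (gen_ray x (Inl y) t) = t"
    using gen_ray_Inl(2)[of 0 x y] gen_ray_Inl(3)[of x y "dist x y"] by (auto simp: between_def)
qed

lemma boundary_action:
  assumes g: "surj g" "\<And>x y. dist (g x) (g y) = dist x (y::'a)" and \<xi>: "\<xi> \<in> boundary"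
  shows "boundary_action g \<xi> \<in> boundary" "r \<in> \<xi> \<Longrightarrow> g \<circ> r \<in> boundary_action g \<xi>"
    "ray_to (g x) (boundary_action g \<xi>) = g \<circ> ray_to x \<xi>"
proof -
  define r0 where "r0 = ray_to x \<xi>"
  have inj: "inj g" by (metis g(2) dist_eq_0_iff injI)
  have gi: "g (inv_into UNIV g y) = y" for y by (simp add: surj_f_inv_f[OF g(1)])
  have ginv: "dist (inv_into UNIV g x) (inv_into UNIV g y) = dist x y" for x y using g(2)[of "inv_into UNIV g x" "inv_into UNIV g y"] gi by simp
  have r0: "r0 \<in> \<xi>" "r0 \<in> geodesic_rays" using ray_to[OF \<xi>] by (auto simp: r0_def)
  have gr: "g \<circ> r0 \<in> geodesic_rays" using r0 by (simp add: geodesic_rays_def g)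
  have "boundary_action g \<xi> = asymptotic `` {g \<circ> r0}"
  proof (intro Set.set_eqI iffI)
    fix s assume "s \<in> boundary_action g \<xi>"
    then obtain r where "s = g \<circ> r" "r \<in> \<xi>" by (auto simp: boundary_action_def)
    moreover from this have "(r0, r) \<in> asymptotic" using boundary_asymptotic[OF \<xi> r0(1)] by simp
    ultimately show "s \<in> asymptotic `` {g \<circ> r0}" by (auto simp: asymptotic_def geodesic_rays_def g)
  next
    fix s assume "s \<in> asymptotic `` {g \<circ> r0}"
    then obtain C where C: "s \<in> geodesic_rays" "\<And>t. t \<ge> 0 \<Longrightarrow> dist (g (r0 t)) (s t) \<le> C" by (auto simp: asymptotic_def)
    have "dist (r0 t) (inv_into UNIV g (s t)) = dist (g (r0 t)) (s t)" for t using g(2)[of "r0 t" "inv_into UNIV g (s t)"] gi by simp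
    then have "(r0, inv_into UNIV g \<circ> s) \<in> asymptotic"
      using r0 C by (intro asymptoticI[of _ _ C]) (auto simp: geodesic_rays_def ginv)
    then have "inv_into UNIV g \<circ> s \<in> \<xi>" using boundary_asymptotic[OF \<xi> r0(1)] by simp
    moreover have "s = g \<circ> (inv_into UNIV g \<circ> s)" by (auto simp: gi)
    ultimately show "s \<in> boundary_action g \<xi>" unfolding boundary_action_def by blast
  qed
  then show b: "boundary_action g \<xi> \<in> boundary" using asymptotic_class[OF gr] by simp
  show in_b: "g \<circ> r \<in> boundary_action g \<xi>" if "r \<in> \<xi>" for r using that by (auto simp: boundary_action_def)
  show "ray_to (g x) (boundary_action g \<xi>) = g \<circ> ray_to x \<xi>"
    by (rule ray_to(4)[OF b in_b[OF ray_to(1)[OF \<xi>]]]) (simp add: ray_to(2)[OF \<xi>])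
qed

lemma gen_ray_Inl_isometry:
  fixes g :: "'a \<Rightarrow> 'a"
  assumes g: "\<And>x y. dist (g x) (g y) = dist x y"
  shows "gen_ray (g x) (Inl (g y)) = g \<circ> gen_ray x (Inl y)"
  by (rule gen_ray_Inl(4)) (use gen_ray_Inl(1)[of x y] gen_ray_Inl(2,3) g in \<open>auto simp: geodesic_segment_def\<close>)

lemma busemann_isometry:
  assumes g: "surj g" "\<And>x y. dist (g x) (g y) = dist x (y::'a)" and \<xi>: "\<xi> \<in> boundary"
  shows "busemann (boundary_action g \<xi>) (g x) (g y) = busemann \<xi> x y"
proof -
  have "((\<lambda>t. dist (g x) ((g \<circ> ray_to x \<xi>) t) - dist (g y) ((g \<circ> ray_to x \<xi>) t))
       \<longlongrightarrow> busemann (boundary_action g \<xi>) (g x) (g y)) at_top"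
    by (rule busemann_tendsto[OF boundary_action(1)[OF g \<xi>] boundary_action(2)[OF g \<xi> ray_to(1)[OF \<xi>]]])
  then have "((\<lambda>t. dist x (ray_to x \<xi> t) - dist y (ray_to x \<xi> t))
       \<longlongrightarrow> busemann (boundary_action g \<xi>) (g x) (g y)) at_top"
    by (simp add: g)
  then show ?thesis
    using busemann_tendsto[OF \<xi> ray_to(1)[OF \<xi>, of x], of x y] by (rule tendsto_unique[OF trivial_limit_at_top_linorder])
qed

end

section \<open>Coarse geometry of segments, rays and lines\<close>

lemma line_ray:
  assumes "l \<in> geodesic_lines"
  shows "(\<lambda>s. l (a + s)) \<in> geodesic_rays" "(\<lambda>s. l (a - s)) \<in> geodesic_rays" "l \<in> geodesic_rays"
  using assms by (auto simp: geodesic_lines_def geodesic_rays_def)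

lemma line_dist: "l \<in> geodesic_lines \<Longrightarrow> dist (l s) (l t) = \<bar>s - t\<bar>"
  by (simp add: geodesic_lines_def)

lemma line_between: "l \<in> geodesic_lines \<Longrightarrow> s \<le> t \<Longrightarrow> t \<le> u \<Longrightarrow> between (l s) (l t) (l u)"
  by (simp add: between_def line_dist)

lemma line_ends:
  assumes "l \<in> geodesic_lines"
  shows "end_plus l \<in> boundary" "l \<in> end_plus l" "end_minus l \<in> boundary" "(\<lambda>t. l (- t)) \<in> end_minus l"
  using asymptotic_class[OF line_ray(3)[OF assms]] asymptotic_class[OF line_ray(2)[OF assms, of 0]]
  by (auto simp: end_plus_def end_minus_def)

context cat_space
begin

lemma between_dist_le: "between p m q \<Longrightarrow> dist p m \<le> dist p q \<and> dist m q \<le> dist p q"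
  using zero_le_dist[of p m] zero_le_dist[of m q] by (simp add: between_def del: zero_le_dist)

text \<open>This is \<open>thin\<close> with the far end sent to infinity along the ray; the
  difference of distances to that end becomes a Busemann function.\<close>

lemma thin_ray:
  assumes \<xi>: "\<xi> \<in> boundary" and u: "0 \<le> u"
  shows "dist (x::'a) (ray_to z \<xi> u) \<le> max (dist x z - u) (busemann \<xi> x (ray_to z \<xi> u)) + 2"
proof -
  define m where "m = ray_to z \<xi> u"
  have "((\<lambda>t. max (dist x z - u) (dist x (ray_to z \<xi> t) - dist m (ray_to z \<xi> t)) + 2)
      \<longlongrightarrow> max (dist x z - u) (busemann \<xi> x m) + 2) at_top"
    by (intro tendsto_add tendsto_max tendsto_const busemann_tendsto ray_to \<xi>)
  moreover have "\<forall>\<^sub>F t in at_top. dist x m \<le> max (dist x z - u) (dist x (ray_to z \<xi> t) - dist m (ray_to z \<xi> t)) + 2"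
    using eventually_ge_at_top[of u]
  proof eventually_elim
    case (elim t)
    have "between z m (ray_to z \<xi> t)" unfolding m_def by (rule ray_to_between0[OF \<xi> u elim])
    from thin[OF this, of x] show ?case using ray_to_dist0[OF \<xi> u, of z] by (simp add: m_def)
  qed
  ultimately have "dist x m \<le> max (dist x z - u) (busemann \<xi> x m) + 2"
    by (rule tendsto_lowerbound) simp
  then show ?thesis by (simp add: m_def)
qed

lemma busemann_ray_to:
  assumes \<xi>: "\<xi> \<in> boundary" and u: "0 \<le> u"
  shows "busemann \<xi> (z::'a) (ray_to z \<xi> u) = u"
proof -
  have "((\<lambda>t. dist z (ray_to z \<xi> t) - dist (ray_to z \<xi> u) (ray_to z \<xi> t)) \<longlongrightarrow> u) at_top"
  proof (rule tendsto_eventually)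
    show "\<forall>\<^sub>F t in at_top. dist z (ray_to z \<xi> t) - dist (ray_to z \<xi> u) (ray_to z \<xi> t) = u"
      using eventually_ge_at_top[of u]
      by eventually_elim (use u in \<open>simp add: ray_to_dist0[OF \<xi>] ray_to_dist[OF \<xi>]\<close>)
  qed
  then show ?thesis
    using tendsto_unique[OF trivial_limit_at_top_linorder busemann_tendsto[OF \<xi> ray_to(1)[OF \<xi>]]] by blast
qed

text \<open>This is \<open>thin_dist\<close> with one end at infinity:
  \<open>(dist x y + busemann \<xi> x y) / 2\<close> is the Gromov product of \<open>y\<close> and
  \<open>\<xi>\<close> at \<open>x\<close>.\<close>

lemma thin_ray_segment:
  assumes \<xi>: "\<xi> \<in> boundary" and m: "between (x::'a) m y"
  shows "dist m (ray_to x \<xi> (dist x m)) \<le> 2 * exp (dist x m - (dist x y + busemann \<xi> x y) / 2)"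
proof -
  define u where "u = dist x m"
  have u: "u \<ge> 0" by (simp add: u_def)
  have "((\<lambda>t. 2 * exp (u - (dist x y + (dist x (ray_to x \<xi> t) - dist y (ray_to x \<xi> t))) / 2))
      \<longlongrightarrow> 2 * exp (u - (dist x y + busemann \<xi> x y) / 2)) at_top"
    by (intro tendsto_intros busemann_tendsto ray_to \<xi>) auto
  moreover have "\<forall>\<^sub>F t in at_top. dist m (ray_to x \<xi> u)
      \<le> 2 * exp (u - (dist x y + (dist x (ray_to x \<xi> t) - dist y (ray_to x \<xi> t))) / 2)"
    using eventually_ge_at_top[of u]
  proof eventually_elim
    case (elim t)
    have "dist m (ray_to x \<xi> u) \<le> 2 * exp (u + (dist y (ray_to x \<xi> t) - dist x y - dist x (ray_to x \<xi> t)) / 2)"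
      by (rule thin_dist[OF m ray_to_between0[OF \<xi> u elim]]) (use u in \<open>auto simp: ray_to_dist0[OF \<xi>] u_def\<close>)
    also have "u + (dist y (ray_to x \<xi> t) - dist x y - dist x (ray_to x \<xi> t)) / 2
      = u - (dist x y + (dist x (ray_to x \<xi> t) - dist y (ray_to x \<xi> t))) / 2" by (simp add: field_simps)
    finally show ?case .
  qed
  ultimately show ?thesis unfolding u_def by (rule tendsto_lowerbound) simp
qed

lemma thin_rays:
  assumes "\<xi> \<in> boundary" "\<eta> \<in> boundary" "0 \<le> u" "u \<le> t"
  shows "dist (ray_to x \<xi> u) (ray_to x \<eta> u) \<le> 2 * exp (u - t + dist (ray_to x \<xi> t) (ray_to x \<eta> t) / 2)"
proof -
  have "dist (ray_to x \<xi> u) (ray_to x \<eta> u) \<le>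
       2 * exp (u + (dist (ray_to x \<xi> t) (ray_to x \<eta> t) - dist x (ray_to x \<xi> t) - dist x (ray_to x \<eta> t)) / 2)"
    using assms by (intro thin_dist) (auto intro: ray_to_between0 simp: ray_to_dist0)
  then show ?thesis using assms by (simp add: ray_to_dist0 field_simps)
qed

text \<open>The diagonal from \<open>p\<close> to \<open>q'\<close> cuts the quadrilateral into two
  triangles, each costing \<open>2 * exp (D - c)\<close>.\<close>

lemma quadrilateral:
  assumes m: "between (p::'a) m q" and D: "dist p p' \<le> D" "dist q q' \<le> D"
    and c: "D \<le> c" "c \<le> dist p m" "c \<le> dist m q"
  obtains m' where "between p' m' q'" "dist m m' \<le> 4 * exp (D - c)"
proof -
  define u where "u = dist p m"
  have pq: "dist p q = u + dist m q" using m by (simp add: between_def u_def)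
  have pq': "dist p q' \<ge> dist p q - D" using dist_triangle[of p q q'] D(2) by (simp add: dist_commute)
  obtain m1 where m1: "between p m1 q'" "dist p m1 = u"
    using ex_between[of u p q'] pq' pq c by (auto simp: u_def)
  have "dist m m1 \<le> 2 * exp (u + (dist q q' - dist p q - dist p q') / 2)"
    by (rule thin_dist[OF m m1(1) _ m1(2)]) (simp add: u_def)
  also have "u + (dist q q' - dist p q - dist p q') / 2 \<le> D - c"
    using pq pq' D c by (simp add: field_simps)
  finally have 1: "dist m m1 \<le> 2 * exp (D - c)" by simp
  define v where "v = dist q' m1"
  have v: "dist p q' = u + v" using m1 by (simp add: between_def v_def dist_commute)
  have qp': "dist q' p' \<ge> dist p q' - D" using dist_triangle[of q' p p'] D(1) by (simp add: dist_commute)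
  obtain m2 where m2: "between q' m2 p'" "dist q' m2 = v"
    using ex_between[of v q' p'] v qp' c by (auto simp: v_def u_def)
  have "dist m1 m2 \<le> 2 * exp (v + (dist p p' - dist q' p - dist q' p') / 2)"
    by (rule thin_dist[OF between_sym[OF m1(1)] m2(1) _ m2(2)]) (simp add: v_def)
  also have "v + (dist p p' - dist q' p - dist q' p') / 2 \<le> D - c"
    using v qp' D c dist_commute[of q' p] by (simp add: field_simps u_def)
  finally have 2: "dist m1 m2 \<le> 2 * exp (D - c)" by simp
  show ?thesis
    by (rule that[OF between_sym[OF m2(1)]]) (use 1 2 dist_triangle[of m m2 m1] in linarith)
qed

text \<open>A point within \<open>D\<close> of a corner is sent to the corresponding corner of the
  other side; the remaining points fall under \<open>quadrilateral\<close> with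
  \<open>c = D\<close>.\<close>

lemma quadrilateral_coarse:
  assumes m: "between (p::'a) m q" and D: "dist p p' \<le> D" "dist q q' \<le> D"
  obtains m' where "between p' m' q'" "dist m m' \<le> 2 * D + 4"
proof -
  have D0: "D \<ge> 0" using D(1) zero_le_dist[of p p'] by linarith
  consider "dist p m \<le> D" | "dist m q \<le> D" | "D \<le> dist p m" "D \<le> dist m q" by linarith
  then show ?thesis
  proof cases
    case 1
    then show ?thesis using D0 D dist_triangle[of m p' p] by (intro that[of p']) (auto simp: dist_commute)
  next
    case 2
    then show ?thesis using D0 D dist_triangle[of m q' q] by (intro that[of q']) (auto simp: dist_commute)
  next
    case 3
    obtain m' where "between p' m' q'" "dist m m' \<le> 4 * exp (D - D)"
      using quadrilateral[OF m D order_refl 3] .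
    then show ?thesis using D0 by (intro that[of m']) auto
  qed
qed

text \<open>Both lines are started at time \<open>- n\<close>, where they are within
  \<open>K\<close> of each other because their negative endpoints agree. Then
  \<open>asymptotic_close\<close> bounds the distance at time \<open>t\<close> by a quantity tending
  to 0 with growing \<open>n\<close>.\<close>

lemma lines_equal_ends:
  assumes l: "(l::real \<Rightarrow> 'a) \<in> geodesic_lines" "l' \<in> geodesic_lines"
    and e: "end_plus l = end_plus l'" "end_minus l = end_minus l'"
  obtains b where "\<forall>t. l' t = l (t + b)"
proof -
  have "(l, l') \<in> asymptotic" using boundary_asymptotic[OF line_ends(1,2)[OF l(1)]] line_ends(2)[OF l(2)] e by simp
  then obtain b where b: "((\<lambda>s. dist (l' s) (l (s + b))) \<longlongrightarrow> 0) at_top" by (rule asymptotic_shift)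
  have "((\<lambda>t. l (- t)), (\<lambda>t. l' (- t))) \<in> asymptotic"
    using boundary_asymptotic[OF line_ends(3,4)[OF l(1)]] line_ends(4)[OF l(2)] e by simp
  then obtain C where C: "\<And>t. t \<ge> 0 \<Longrightarrow> dist (l (- t)) (l' (- t)) \<le> C" using asymptoticE by blast
  define K where "K = C + \<bar>b\<bar>"
  have "dist (l' t) (l (t + b)) \<le> 2 * exp (K - real n - t)" if n: "real n \<ge> K - t" for n t
  proof -
    define r r' where "r s = l (b - real n + s)" and "r' s = l' (- real n + s)" for s
    have rr: "r \<in> geodesic_rays" "r' \<in> geodesic_rays"
      unfolding r_def r'_def by (intro line_ray l)+
    have "filterlim (\<lambda>s::real. s - real n) at_top at_top" by real_asymp
    from filterlim_compose[OF b this] have lim: "((\<lambda>s. dist (r' s) (r s)) \<longlongrightarrow> 0) at_top"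
      by (simp add: r_def r'_def algebra_simps)
    then have "\<forall>\<^sub>F s in at_top. dist (r' s) (r s) < 1" by (rule order_tendstoD) simp
    then obtain S where S: "\<And>s. s \<ge> S \<Longrightarrow> dist (r' s) (r s) < 1" by (auto simp: eventually_at_top_linorder)
    have "dist (r s) (r' s) \<le> 2 * \<bar>S\<bar> + 1 + dist (r 0) (r' 0)" if "s \<ge> 0" for s
    proof (cases "s \<ge> S")
      case True
      then show ?thesis using S[of s] zero_le_dist[of "r 0" "r' 0"] by (simp add: dist_commute del: zero_le_dist)
    next
      case False
      have "dist (r s) (r' s) \<le> dist (r s) (r 0) + dist (r 0) (r' 0) + dist (r' 0) (r' s)"
        using dist_triangle[of "r s" "r' s" "r 0"] dist_triangle[of "r 0" "r' s" "r' 0"] by linarith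
      then show ?thesis using ray_dist[OF rr(1), of s 0] ray_dist[OF rr(2), of 0 s] that False by simp
    qed
    then have as: "(r, r') \<in> asymptotic" by (rule asymptoticI[OF rr])
    \<comment> \<open>The shift between these two rays is 0, as \<open>b\<close> is already built
      into \<open>r\<close>.\<close>
    have def0: "((\<lambda>t. t - dist (r' 0) (r t)) \<longlongrightarrow> 0) at_top"
    proof (rule Lim_null_comparison[OF _ lim])
      show "\<forall>\<^sub>F t in at_top. norm (t - dist (r' 0) (r t)) \<le> dist (r' t) (r t)"
        using eventually_ge_at_top[of 0]
      proof eventually_elim
        case (elim t)
        then show ?case
          using abs_dist_diff_le[of "r' t" "r' 0" "r t"] ray_dist[OF rr(2), of t 0] by simp
      qed
    qed
    have dK: "dist (r 0) (r' 0) \<le> K"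
    proof -
      have "dist (r 0) (r' 0) \<le> dist (r 0) (l (- real n)) + dist (l (- real n)) (l' (- real n))"
        unfolding r'_def by (simp add: dist_triangle)
      then show ?thesis using C[of "real n"] by (simp add: r_def line_dist[OF l(1)] K_def)
    qed
    have "dist (r' (real n + t)) (r (real n + t + 0)) \<le> 2 * exp (dist (r 0) (r' 0) - (real n + t))"
      by (rule asymptotic_close[OF as def0]) (use dK n in linarith)
    also have "\<dots> \<le> 2 * exp (K - real n - t)" using dK by simp
    finally show ?thesis by (simp add: r_def r'_def add.commute)
  qed
  then have ev: "\<forall>\<^sub>F n in sequentially. dist (l' t) (l (t + b)) \<le> 2 * exp (K - real n - t)" for t
    by (rule_tac eventually_mono[of "\<lambda>n. real n \<ge> K - t"]) (real_asymp, auto)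
  have lim: "(\<lambda>n. 2 * exp (K - real n - t)) \<longlonglongrightarrow> 0" for t by real_asymp
  have "dist (l' t) (l (t + b)) \<le> 0" for t
    by (rule tendsto_lowerbound[OF lim ev]) simp
  then show ?thesis using that[of b] by simp
qed

subsection \<open>Limits of sequences of segments\<close>

text \<open>Arzela-Ascoli for 1-Lipschitz curves: sequential compactness of the product of balls
  over the rational times gives convergence on a dense set, and the Lipschitz bound extends it to
  all times.\<close>

lemma lipschitz_subsequence:
  fixes c :: "nat \<Rightarrow> real \<Rightarrow> 'a"
  assumes lip: "\<And>n s t. dist (c n s) (c n t) \<le> \<bar>s - t\<bar>" and bd: "\<And>n. dist x (c n 0) \<le> K"
  obtains \<phi> l where "strict_mono \<phi>" "\<forall>t. (\<lambda>n. c (\<phi> n) t) \<longlonglongrightarrow> l t"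
proof -
  define S :: "rat \<Rightarrow> 'a set" where "S q = cball x (K + \<bar>of_rat q\<bar>)" for q
  have "compactin (product_topology (\<lambda>_. euclidean) UNIV) (PiE UNIV S)"
    unfolding compactin_PiE using proper by (auto simp: S_def compactin_euclidean_iff)
  then have "compact (PiE UNIV S)"
    by (simp add: euclidean_product_topology compactin_euclidean_iff)
  then have "seq_compact (PiE UNIV S)" by (rule compact_imp_seq_compact)
  moreover have "\<forall>n. (\<lambda>q. c n (of_rat q)) \<in> PiE UNIV S"
  proof
    fix n
    have "dist x (c n (of_rat q)) \<le> K + \<bar>of_rat q\<bar>" for q
      using dist_triangle[of x "c n (of_rat q)" "c n 0"] bd[of n] lip[of n 0 "of_rat q"] by simp
    then show "(\<lambda>q. c n (of_rat q)) \<in> PiE UNIV S" by (auto simp: S_def)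
  qed
  ultimately obtain L \<phi> where \<phi>: "strict_mono (\<phi>::nat \<Rightarrow> nat)" and L: "((\<lambda>n q. c n (of_rat q)) \<circ> \<phi>) \<longlonglongrightarrow> L"
    by (elim seq_compactE)
  have Lq: "(\<lambda>n. c (\<phi> n) (of_rat q)) \<longlonglongrightarrow> L q" for q
  proof -
    have "isCont (\<lambda>f::rat \<Rightarrow> 'a. f q) L"
      using continuous_on_eq_continuous_at[OF open_UNIV] continuous_on_product_coordinates by (metis UNIV_I)
    from isCont_tendsto_compose[OF this L] show ?thesis by (simp add: o_def)
  qed
  have "convergent (\<lambda>n. c (\<phi> n) t)" for t
  proof (rule Cauchy_convergent_proper, rule metric_CauchyI)
    fix e :: real assume "e > 0"
    then obtain q where q': "t - e / 3 < of_rat q" "of_rat q < t + e / 3"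
      using of_rat_dense[of "t - e / 3" "t + e / 3"] by auto
    have q: "\<bar>t - of_rat q\<bar> < e / 3" using q' unfolding abs_less_iff by linarith
    have "Cauchy (\<lambda>n. c (\<phi> n) (of_rat q))" using Lq by (rule LIMSEQ_imp_Cauchy)
    then obtain N where N: "\<And>m n. m \<ge> N \<Longrightarrow> n \<ge> N \<Longrightarrow> dist (c (\<phi> m) (of_rat q)) (c (\<phi> n) (of_rat q)) < e / 3"
      using \<open>e > 0\<close> metric_CauchyD[of _ "e / 3"] by (metis divide_pos_pos zero_less_numeral)
    have "dist (c (\<phi> m) t) (c (\<phi> n) t) < e" if "m \<ge> N" "n \<ge> N" for m n
    proof -
      have "dist (c (\<phi> m) t) (c (\<phi> n) t) \<le> dist (c (\<phi> m) t) (c (\<phi> m) (of_rat q)) +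
         dist (c (\<phi> m) (of_rat q)) (c (\<phi> n) (of_rat q)) + dist (c (\<phi> n) (of_rat q)) (c (\<phi> n) t)"
        using dist_triangle[of "c (\<phi> m) t" "c (\<phi> n) t" "c (\<phi> m) (of_rat q)"]
          dist_triangle[of "c (\<phi> m) (of_rat q)" "c (\<phi> n) t" "c (\<phi> n) (of_rat q)"] by linarith
      then show ?thesis
        using N[OF that] lip[of "\<phi> m" t "of_rat q"] lip[of "\<phi> n" "of_rat q" t] q by linarith
    qed
    then show "\<exists>M. \<forall>m\<ge>M. \<forall>n\<ge>M. dist (c (\<phi> m) t) (c (\<phi> n) t) < e" by blast
  qed
  then show ?thesis using that[OF \<phi>, of "\<lambda>t. lim (\<lambda>n. c (\<phi> n) t)"] by (simp add: convergent_LIMSEQ_iff)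
qed

text \<open>The segments from \<open>\<rho> n\<close> to \<open>\<sigma> n\<close> stay within
  bounded distance of \<open>x\<close>, as otherwise the two rays would be asymptotic; parametrized
  from their midpoints they subconverge to a line. Thinness keeps its halves within
  \<open>K + 2\<close> of the rays.\<close>

lemma ex_line:
  assumes \<xi>: "\<xi> \<in> boundary" and \<eta>: "\<eta> \<in> boundary" and ne: "\<xi> \<noteq> \<eta>"
  obtains l :: "real \<Rightarrow> 'a" where "l \<in> geodesic_lines" "end_minus l = \<xi>" "end_plus l = \<eta>"
proof -
  define x where "x = pt"
  define \<rho> \<sigma> where "\<rho> = ray_to x \<xi>" and "\<sigma> = ray_to x \<eta>"
  define d where "d n = dist (\<rho> (real n)) (\<sigma> (real n))" for n
  \<comment> \<open>The bounded quantity is the Gromov product of \<open>\<rho> n\<close> and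
    \<open>\<sigma> n\<close> at \<open>x\<close>.\<close>
  have "\<exists>K. \<forall>n. real n - d n / 2 \<le> K"
  proof (rule ccontr)
    assume "\<nexists>K. \<forall>n. real n - d n / 2 \<le> K"
    then have K: "\<exists>n. real n - d n / 2 > K" for K by (meson not_le)
    have "\<xi> = \<eta>"
    proof (rule ray_to_bounded_eq[OF \<xi> \<eta>])
      fix t :: real assume t: "0 \<le> t"
      obtain n where n: "real n - d n / 2 > t" using K by blast
      moreover have "d n \<ge> 0" by (simp add: d_def)
      ultimately have "real n \<ge> t" by linarith
      have "dist (\<rho> t) (\<sigma> t) \<le> 2 * exp (t - real n + d n / 2)"
        unfolding \<rho>_def \<sigma>_def d_def by (rule thin_rays[OF \<xi> \<eta> t \<open>real n \<ge> t\<close>])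
      also have "\<dots> \<le> 2 * exp 0" using n by simp
      finally show "\<exists>u\<ge>t. dist (ray_to x \<xi> u) (ray_to x \<eta> u) \<le> 2" by (auto simp: \<rho>_def \<sigma>_def)
    qed
    then show False using ne by simp
  qed
  then obtain K where K: "\<And>n. real n - d n / 2 \<le> K" by blast
  have \<rho>d: "dist (\<rho> s) (\<rho> t) = \<bar>s - t\<bar>" "dist (\<sigma> s) (\<sigma> t) = \<bar>s - t\<bar>" if "0 \<le> s" "0 \<le> t" for s t
    using ray_to_dist \<xi> \<eta> that by (auto simp: \<rho>_def \<sigma>_def)
  have x0: "\<rho> 0 = x" "\<sigma> 0 = x" using ray_to(2) \<xi> \<eta> by (auto simp: \<rho>_def \<sigma>_def)
  \<comment> \<open>Time 0 is the midpoint; clamping makes the curves 1-Lipschitz on the whole real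
    line.\<close>
  define c where "c n t = gen_ray (\<rho> (real n)) (Inl (\<sigma> (real n))) (max 0 (min (d n) (t + d n / 2)))" for n t
  have d0: "d n \<ge> 0" for n by (simp add: d_def)
  have iso: "dist (gen_ray (\<rho> (real n)) (Inl (\<sigma> (real n))) s) (gen_ray (\<rho> (real n)) (Inl (\<sigma> (real n))) t) = \<bar>s - t\<bar>"
    if "0 \<le> s" "s \<le> d n" "0 \<le> t" "t \<le> d n" for n s t
    using gen_ray_Inl(1)[of "\<rho> (real n)" "\<sigma> (real n)"] that unfolding geodesic_segment_def d_def by auto
  have lip: "dist (c n s) (c n t) \<le> \<bar>s - t\<bar>" for n s t
  proof -
    have "dist (c n s) (c n t) = \<bar>max 0 (min (d n) (s + d n / 2)) - max 0 (min (d n) (t + d n / 2))\<bar>"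
      unfolding c_def using d0[of n] by (intro iso) auto
    then show ?thesis by (auto simp: max_def min_def abs_if split: if_splits)
  qed
  have cb: "between (\<rho> (real n)) (c n t) (\<sigma> (real n))" "dist (\<rho> (real n)) (c n t) = t + d n / 2"
      "dist (c n t) (\<sigma> (real n)) = d n / 2 - t"
    if "\<bar>t\<bar> \<le> d n / 2" for n t
  proof -
    have "max 0 (min (d n) (t + d n / 2)) = t + d n / 2" "0 \<le> t + d n / 2" "t + d n / 2 \<le> d n" using that by auto
    then show "between (\<rho> (real n)) (c n t) (\<sigma> (real n))" "dist (\<rho> (real n)) (c n t) = t + d n / 2"
      using gen_ray_Inl_between[of "t + d n / 2" "\<rho> (real n)" "\<sigma> (real n)"] by (auto simp: c_def d_def)
    then show "dist (c n t) (\<sigma> (real n)) = d n / 2 - t" by (simp add: between_def d_def)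
  qed
  have near: "dist z (c n t) \<le> max (dist z (\<rho> (real n)) - (t + d n / 2)) (dist z (\<sigma> (real n)) - (d n / 2 - t)) + 2"
    if "\<bar>t\<bar> \<le> d n / 2" for n t z
    using thin[OF cb(1)[OF that], of z] cb(2,3)[OF that] by simp
  have "dist x (c n 0) \<le> K + 2" for n
    using near[of 0 n x] K[of n] d0[of n] \<rho>d[of 0 "real n"] x0 by auto
  with lip obtain \<phi> l where \<phi>: "strict_mono \<phi>" and lim': "\<forall>t. (\<lambda>n. c (\<phi> n) t) \<longlonglongrightarrow> l t"
    by (rule lipschitz_subsequence)
  note lim = lim'[rule_format]
  have "\<forall>\<^sub>F n in sequentially. \<bar>t\<bar> \<le> d n / 2" for t
  proof -
    have "\<forall>\<^sub>F n in sequentially. \<bar>t\<bar> + K \<le> real n" by real_asymp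
    then show ?thesis
    proof eventually_elim
      case (elim n)
      then show ?case using K[of n] by linarith
    qed
  qed
  then have large: "\<forall>\<^sub>F n in sequentially. \<bar>t\<bar> \<le> d (\<phi> n) / 2" for t
    using filterlim_subseq[OF \<phi>] unfolding filterlim_iff by blast
  have "\<forall>\<^sub>F n in sequentially. t \<le> real n" for t by real_asymp
  then have large': "\<forall>\<^sub>F n in sequentially. t \<le> real (\<phi> n)" for t
    using filterlim_subseq[OF \<phi>] unfolding filterlim_iff by blast
  have ll: "l \<in> geodesic_lines"
    unfolding geodesic_lines_def
  proof (intro CollectI allI)
    fix s t
    have "(\<lambda>n. dist (c (\<phi> n) s) (c (\<phi> n) t)) \<longlonglongrightarrow> dist (l s) (l t)" by (intro tendsto_dist lim)
    moreover have "\<forall>\<^sub>F n in sequentially. dist (c (\<phi> n) s) (c (\<phi> n) t) = \<bar>s - t\<bar>"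
      using large[of s] large[of t]
    proof eventually_elim
      case (elim n)
      have "max 0 (min (d (\<phi> n)) (s + d (\<phi> n) / 2)) = s + d (\<phi> n) / 2"
        "max 0 (min (d (\<phi> n)) (t + d (\<phi> n) / 2)) = t + d (\<phi> n) / 2" using elim by auto
      then show ?case unfolding c_def using elim by (subst iso) (auto simp: abs_le_iff)
    qed
    then have "(\<lambda>n. dist (c (\<phi> n) s) (c (\<phi> n) t)) \<longlonglongrightarrow> \<bar>s - t\<bar>" by (rule tendsto_eventually)
    ultimately show "dist (l s) (l t) = \<bar>s - t\<bar>" by (rule LIMSEQ_unique)
  qed
  have \<sigma>l: "dist (\<sigma> t) (l t) \<le> K + 2" if t: "t \<ge> 0" for t
  proof (rule tendsto_upperbound)
    show "(\<lambda>n. dist (\<sigma> t) (c (\<phi> n) t)) \<longlonglongrightarrow> dist (\<sigma> t) (l t)" by (intro tendsto_intros lim)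
    show "\<forall>\<^sub>F n in sequentially. dist (\<sigma> t) (c (\<phi> n) t) \<le> K + 2"
      using large[of t] large'[of t]
    proof eventually_elim
      case (elim n)
      have "dist (\<sigma> t) (\<rho> (real (\<phi> n))) \<le> t + real (\<phi> n)"
        using dist_triangle[of "\<sigma> t" "\<rho> (real (\<phi> n))" x] \<rho>d(2)[of t 0] \<rho>d(1)[of 0 "\<phi> n"] t x0 by simp
      moreover have "dist (\<sigma> t) (\<sigma> (real (\<phi> n))) = real (\<phi> n) - t" using \<rho>d(2)[of t "\<phi> n"] t elim by simp
      ultimately show ?case using near[of t "\<phi> n" "\<sigma> t"] elim K[of "\<phi> n"] by linarith
    qed
  qed simp
  have \<rho>l: "dist (\<rho> t) (l (- t)) \<le> K + 2" if t: "t \<ge> 0" for t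
  proof (rule tendsto_upperbound)
    show "(\<lambda>n. dist (\<rho> t) (c (\<phi> n) (- t))) \<longlonglongrightarrow> dist (\<rho> t) (l (- t))" by (intro tendsto_intros lim)
    show "\<forall>\<^sub>F n in sequentially. dist (\<rho> t) (c (\<phi> n) (- t)) \<le> K + 2"
      using large[of "- t"] large'[of t]
    proof eventually_elim
      case (elim n)
      have "dist (\<rho> t) (\<sigma> (real (\<phi> n))) \<le> t + real (\<phi> n)"
        using dist_triangle[of "\<rho> t" "\<sigma> (real (\<phi> n))" x] \<rho>d(1)[of t 0] \<rho>d(2)[of 0 "\<phi> n"] t x0 by simp
      moreover have "dist (\<rho> t) (\<rho> (real (\<phi> n))) = real (\<phi> n) - t" using \<rho>d(1)[of t "\<phi> n"] t elim by simp
      ultimately show ?case using near[of "- t" "\<phi> n" "\<rho> t"] elim K[of "\<phi> n"] by linarith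
    qed
  qed simp
  have "end_plus l = \<eta>"
  proof (rule boundary_eqI[OF line_ends(1)[OF ll] \<eta> line_ends(2)[OF ll]])
    show "\<sigma> \<in> \<eta>" by (simp add: \<sigma>_def ray_to \<eta>)
    show "(l, \<sigma>) \<in> asymptotic"
      by (rule asymptoticI[of _ _ "K + 2"]) (use line_ray ll \<sigma>l ray_to(3)[OF \<eta>] in \<open>auto simp: dist_commute \<sigma>_def\<close>)
  qed
  moreover have "end_minus l = \<xi>"
  proof (rule boundary_eqI[OF line_ends(3)[OF ll] \<xi> line_ends(4)[OF ll]])
    show "\<rho> \<in> \<xi>" by (simp add: \<rho>_def ray_to \<xi>)
    show "(\<lambda>t. l (- t), \<rho>) \<in> asymptotic"
      by (rule asymptoticI[of _ _ "K + 2"])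
        (use line_ray(2)[OF ll, of 0] \<rho>l ray_to(3)[OF \<xi>] in \<open>auto simp: dist_commute \<rho>_def\<close>)
  qed
  ultimately show ?thesis using that ll by blast
qed

subsection \<open>Hopf coordinates\<close>

text \<open>Uniqueness is strict convexity of the distance to a point: comparison at the midpoint of
  two closest points at distance \<open>2 * u\<close> gives \<open>cosh u \<le> 1\<close>. For
  existence, parameters beyond \<open>2 * f 0\<close> do no better than 0.\<close>

lemma line_projection:
  assumes l: "(l::real \<Rightarrow> 'a) \<in> geodesic_lines"
  shows "\<exists>!t. \<forall>s. dist x (l t) \<le> dist x (l s)"
proof (rule ex_ex1I)
  define f where "f t = dist x (l t)" for t
  define R where "R = 2 * f 0"
  have R: "R \<ge> 0" by (simp add: R_def f_def)
  have "continuous_on {-R..R} l"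
    by (rule continuous_onI) (metis dist_real_def l line_dist order_le_less)
  then have "continuous_on {-R..R} f" unfolding f_def by (intro continuous_intros)
  then obtain t where t: "t \<in> {-R..R}" "\<And>s. s \<in> {-R..R} \<Longrightarrow> f t \<le> f s"
    using continuous_attains_inf[of "{-R..R}" f] R by auto
  have "f t \<le> f s" for s
  proof (cases "s \<in> {-R..R}")
    case False
    have "\<bar>s\<bar> \<le> f 0 + f s" using dist_triangle[of "l 0" "l s" x] line_dist[OF l, of 0 s] by (simp add: f_def dist_commute)
    then have "f 0 \<le> f s" using False by (auto simp: R_def)
    then show ?thesis using t(2)[of 0] R by auto
  qed (use t in auto)
  then show "\<exists>t. \<forall>s. dist x (l t) \<le> dist x (l s)" by (auto simp: f_def)
next
  fix s t assume s: "\<forall>u. dist x (l s) \<le> dist x (l u)" and t: "\<forall>u. dist x (l t) \<le> dist x (l u)"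
  define d where "d = dist x (l s)"
  have dt: "dist x (l t) = d" using s t by (simp add: d_def order_antisym)
  define u where "u = \<bar>s - t\<bar> / 2"
  define m where "m = l ((s + t) / 2)"
  have m: "between (l s) m (l t)" "dist (l s) m = u" "dist m (l t) = u" "dist (l s) (l t) = 2 * u"
    unfolding between_def m_def u_def line_dist[OF l] by (auto simp: abs_if field_simps)
  have "sinh (2 * u) * cosh d \<le> sinh (2 * u) * cosh (dist x m)"
  proof (rule mult_left_mono)
    show "cosh d \<le> cosh (dist x m)" using s by (auto simp: d_def m_def cosh_real_nonneg_le_iff)
  qed (simp add: u_def)
  also have "\<dots> \<le> sinh u * cosh d + sinh u * cosh d"
    using between_comparison[OF m(1), of x] m dt by (simp add: d_def)
  finally have "(2 * sinh u * cosh d) * cosh u \<le> (2 * sinh u * cosh d) * 1"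
    using sinh_add[of u u] by (simp add: algebra_simps)
  moreover have "cosh u > 1" if "u > 0" using cosh_lower_quadratic[of u] that
    by (smt (verit) divide_pos_pos zero_less_power)
  ultimately have "\<not> u > 0" by (auto simp: mult_le_cancel_left_pos not_le)
  then show "s = t" by (simp add: u_def)
qed

lemma hopf_coords_inj: "inj_on (hopf_coords (x::'a)) geodesic_lines"
proof (rule inj_onI)
  fix l l' :: "real \<Rightarrow> 'a"
  assume l: "l \<in> geodesic_lines" "l' \<in> geodesic_lines" and eq: "hopf_coords x l = hopf_coords x l'"
  define T where "T = (THE t. \<forall>s. dist x (l t) \<le> dist x (l s))"
  have "end_plus l = end_plus l'" "end_minus l = end_minus l'" and T': "(THE t. \<forall>s. dist x (l' t) \<le> dist x (l' s)) = T"
    using eq by (auto simp: hopf_coords_def T_def)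
  then obtain b where b: "\<forall>t. l' t = l (t + b)" using lines_equal_ends[OF l] by blast
  have 1: "\<forall>s. dist x (l T) \<le> dist x (l s)" unfolding T_def by (rule theI'[OF line_projection[OF l(1)]])
  have "\<forall>s. dist x (l' T) \<le> dist x (l' s)" using theI'[OF line_projection[OF l(2), of x]] T' by simp
  then have "\<forall>s. dist x (l (T + b)) \<le> dist x (l s)" unfolding b[rule_format] by (metis diff_add_cancel)
  then have "T = T + b" using line_projection[OF l(1), of x] 1 by blast
  then show "l = l'" using b by auto
qed

lemma hopf_coords_onto:
  assumes "\<xi> \<in> boundary" "\<eta> \<in> boundary" "\<xi> \<noteq> \<eta>"
  shows "\<exists>l\<in>geodesic_lines. hopf_coords (x::'a) l = (\<xi>, \<eta>, t)"
proof -
  obtain l :: "real \<Rightarrow> 'a" where l: "l \<in> geodesic_lines" "end_minus l = \<xi>" "end_plus l = \<eta>"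
    using ex_line[OF assms] by blast
  define T where "T = (THE t. \<forall>s. dist x (l t) \<le> dist x (l s))"
  have T: "\<forall>s. dist x (l T) \<le> dist x (l s)" unfolding T_def by (rule theI'[OF line_projection[OF l(1)]])
  define l' where "l' s = l (s + (T - t))" for s
  have l': "l' \<in> geodesic_lines" using l(1) by (simp add: geodesic_lines_def l'_def)
  have "\<forall>s. dist x (l' t) \<le> dist x (l' s)" using T by (simp add: l'_def)
  then have "(THE t. \<forall>s. dist x (l' t) \<le> dist x (l' s)) = t"
    by (intro the1_equality line_projection l')
  moreover have "end_plus l' = \<eta>"
    unfolding l(3)[symmetric]
  proof (rule boundary_eqI[OF line_ends(1)[OF l'] line_ends(1)[OF l(1)] line_ends(2)[OF l'] line_ends(2)[OF l(1)]])
    show "(l', l) \<in> asymptotic"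
      by (rule asymptoticI[of _ _ "\<bar>T - t\<bar>"]) (use line_ray(3) l l' in \<open>auto simp: l'_def line_dist[OF l(1)]\<close>)
  qed
  moreover have "end_minus l' = \<xi>"
    unfolding l(2)[symmetric]
  proof (rule boundary_eqI[OF line_ends(3)[OF l'] line_ends(3)[OF l(1)] line_ends(4)[OF l'] line_ends(4)[OF l(1)]])
    show "(\<lambda>t. l' (- t), \<lambda>t. l (- t)) \<in> asymptotic"
      by (rule asymptoticI[of _ _ "\<bar>T - t\<bar>"])
        (use line_ray(2)[OF l(1), of 0] line_ray(2)[OF l', of 0] in \<open>auto simp: l'_def line_dist[OF l(1)]\<close>)
  qed
  ultimately show ?thesis using l' by (auto simp: hopf_coords_def)
qed

text \<open>Transfers null sets of positive endpoints to null sets of lines, without any description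
  of the inverse Hopf coordinates.\<close>

lemma end_plus_inv_hopf:
  assumes "\<xi> \<in> boundary" "\<eta> \<in> boundary" "\<xi> \<noteq> \<eta>"
  shows "end_plus (the_inv_into geodesic_lines (hopf_coords (x::'a)) (\<xi>, \<eta>, t)) = \<eta>"
proof -
  obtain l :: "real \<Rightarrow> 'a" where l: "l \<in> geodesic_lines" "hopf_coords x l = (\<xi>, \<eta>, t)"
    using hopf_coords_onto[OF assms] by blast
  then show ?thesis using the_inv_into_f_f[OF hopf_coords_inj l(1), of x] by (auto simp: hopf_coords_def)
qed

end

section \<open>Topologies, measurability and discreteness\<close>

text \<open>By induction on the generation of the open set. Continuity of \<open>f\<close> makes the
  image of \<open>K\<close> compact, hence surrounded by a uniform neighbourhood inside the given
  open set.\<close>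

lemma compact_open_nbhd:
  fixes f :: "'b::topological_space \<Rightarrow> 'a::metric_space"
  assumes "openin compact_open_topology U" "f \<in> U" "continuous_on UNIV f"
  obtains K e where "compact K" "e > 0" "\<forall>f'. (\<forall>x\<in>K. dist (f x) (f' x) < e) \<longrightarrow> f' \<in> U"
proof -
  have "generate_topology_on {{f :: 'b \<Rightarrow> 'a. f ` K \<subseteq> U} | K U. compact K \<and> open U} U"
    using assms(1) by (simp add: compact_open_topology_def openin_topology_generated_by_iff)
  then have "\<exists>K e. compact K \<and> e > 0 \<and> (\<forall>f'. (\<forall>x\<in>K. dist (f x) (f' x) < e) \<longrightarrow> f' \<in> U)"
    using assms(2)
  proof (induction rule: generate_topology_on.induct)
    case (Int a b)
    then obtain K e K' e' where "compact K" "e > 0" "\<forall>f'. (\<forall>x\<in>K. dist (f x) (f' x) < e) \<longrightarrow> f' \<in> a"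
      "compact K'" "e' > 0" "\<forall>f'. (\<forall>x\<in>K'. dist (f x) (f' x) < e') \<longrightarrow> f' \<in> b" by auto
    then show ?case
      by (intro exI[of _ "K \<union> K'"] exI[of _ "min e e'"]) (auto simp: compact_Un)
  next
    case (UN \<K>)
    then show ?case by (meson Union_iff)
  next
    case (Basis s)
    then obtain K V where s: "s = {f. f ` K \<subseteq> V}" "compact K" "open V" by auto
    have "compact (f ` K)" using s(2) assms(3) by (meson compact_continuous_image continuous_on_subset top_greatest)
    then obtain e where "e > 0" "(\<Union>x\<in>f ` K. ball x e) \<subseteq> V"
      using compact_subset_open_imp_ball_epsilon_subset[of "f ` K" V] s Basis by auto
    then show ?case using s by (intro exI[of _ K] exI[of _ e]) (auto simp: subset_iff)
  qed auto
  then show ?thesis using that by blast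
qed

lemma openin_compact_open_eval: "open V \<Longrightarrow> openin compact_open_topology {f. f t \<in> V}"
  unfolding compact_open_topology_def
  by (rule topology_generated_by_Basis) (auto intro!: exI[of _ "{t}"] exI[of _ V])

lemma topspace_compact_open [simp]: "topspace compact_open_topology = UNIV"
proof -
  have "UNIV \<in> {{f. f ` K \<subseteq> U} | K U. compact K \<and> open U}" by (auto intro!: exI[of _ "{}"])
  then show ?thesis unfolding compact_open_topology_def by auto
qed

lemma openin_compact_open_compose:
  assumes U: "openin compact_open_topology U" and g: "continuous_on UNIV g"
  shows "openin compact_open_topology {f. g \<circ> f \<in> U}"
proof -
  have "continuous_map compact_open_topology compact_open_topology (\<lambda>f. g \<circ> f)"
    unfolding compact_open_topology_def[where 'a='b]
  proof (rule continuous_on_generated_topo)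
    fix W assume "W \<in> {{f. f ` K \<subseteq> U} | K (U::'b set). compact K \<and> open U}"
    then obtain K V where W: "W = {f. f ` K \<subseteq> V}" "compact K" "open V" by blast
    have "open (g -` V)" using W(3) g by (rule open_vimage)
    then have "openin compact_open_topology {f. f ` K \<subseteq> g -` V}"
      unfolding compact_open_topology_def by (intro topology_generated_by_Basis) (use W in blast)
    moreover have "(\<lambda>f. g \<circ> f) -` W \<inter> topspace compact_open_topology = {f. f ` K \<subseteq> g -` V}" by (auto simp: W)
    ultimately show "openin compact_open_topology ((\<lambda>f. g \<circ> f) -` W \<inter> topspace compact_open_topology)" by simp
  next
    show "(\<lambda>f. g \<circ> f) ` topspace compact_open_topology \<subseteq> \<Union>{{f. f ` K \<subseteq> U} |K (U::'b set). compact K \<and> open U}"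
      using topspace_compact_open[where 'a='b] unfolding compact_open_topology_def topology_generated_by_topspace by auto
  qed
  from openin_continuous_map_preimage[OF this U] show ?thesis by simp
qed

lemma topspace_cone [simp]: "topspace cone_topology = bordification"
proof -
  have "{z \<in> bordification. gen_ray x z \<in> UNIV} \<in> {{z \<in> bordification. gen_ray x z \<in> U} | x U. openin compact_open_topology U}" for x :: 'a
    using openin_topspace[of compact_open_topology] by (auto intro!: exI[of _ x] exI[of _ UNIV])
  then show ?thesis unfolding cone_topology_def by auto
qed

lemma openin_cone: "openin compact_open_topology U \<Longrightarrow> openin cone_topology {z \<in> bordification. gen_ray x z \<in> U}"
  unfolding cone_topology_def by (rule topology_generated_by_Basis) blast

lemma topspace_boundary [simp]: "topspace boundary_topology = boundary"
  by (auto simp: boundary_topology_def topspace_pullback_topology bordification_def)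

lemma openin_boundary:
  assumes "openin compact_open_topology U"
  shows "openin boundary_topology {\<xi> \<in> boundary. gen_ray x (Inr \<xi>) \<in> U}"
  unfolding boundary_topology_def openin_pullback_topology
  by (rule exI[of _ "{z \<in> bordification. gen_ray x z \<in> U}"])
    (use openin_cone[OF assms] in \<open>auto simp: bordification_def\<close>)

lemma continuous_map_cone:
  assumes "f ` topspace T \<subseteq> bordification"
    and "\<And>x U. openin compact_open_topology U \<Longrightarrow> openin T {z \<in> topspace T. gen_ray x (f z) \<in> U}"
  shows "continuous_map T cone_topology f"
  unfolding cone_topology_def
proof (rule continuous_on_generated_topo)
  fix W :: "('a + (real \<Rightarrow> 'a) set) set"
  assume "W \<in> {{z \<in> bordification. gen_ray x z \<in> U} | x U. openin compact_open_topology U}"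
  then obtain x U where W: "W = {z \<in> bordification. gen_ray x z \<in> U}" "openin compact_open_topology U" by blast
  have "f -` W \<inter> topspace T = {z \<in> topspace T. gen_ray x (f z) \<in> U}" using assms(1) by (auto simp: W)
  then show "openin T (f -` W \<inter> topspace T)" using assms(2)[OF W(2)] by simp
next
  show "f ` topspace T \<subseteq> \<Union>{{z \<in> bordification. gen_ray x z \<in> U} |x U. openin compact_open_topology U}"
    using assms(1) topspace_cone[where 'a='a] unfolding cone_topology_def topology_generated_by_topspace by simp
qed

lemma continuous_map_boundary:
  assumes "f ` topspace T \<subseteq> boundary"
    and "\<And>x U. openin compact_open_topology U \<Longrightarrow> openin T {z \<in> topspace T. gen_ray x (Inr (f z)) \<in> U}"
  shows "continuous_map T boundary_topology f"
  unfolding boundary_topology_def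
proof (rule continuous_map_pullback')
  show "continuous_map T cone_topology (Inr \<circ> f)"
    by (rule continuous_map_cone) (use assms in \<open>auto simp: bordification_def\<close>)
  show "topspace T \<subseteq> f -` boundary" using assms(1) by auto
qed

section \<open>The Borel structure of the boundary\<close>

lemma sets_borel_of: "sets (borel_of T) = sigma_sets (topspace T) {U. openin T U}"
  unfolding borel_of_def by (intro sets_measure_of) (auto dest: openin_subset)

lemma space_borel_of [simp]: "space (borel_of T) = topspace T"
  unfolding borel_of_def by (intro space_measure_of) (auto dest: openin_subset)

lemma openin_borel_of: "openin T U \<Longrightarrow> U \<in> sets (borel_of T)"
  by (auto simp: sets_borel_of)

lemma continuous_map_borel_of:
  assumes "continuous_map S T f"
  shows "f \<in> measurable (borel_of S) (borel_of T)"
  unfolding borel_of_def[of T]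
proof (rule measurable_measure_of)
  show "f \<in> space (borel_of S) \<rightarrow> topspace T" using continuous_map_funspace[OF assms] by auto
  show "f -` U \<inter> space (borel_of S) \<in> sets (borel_of S)" if "U \<in> {U. openin T U}" for U
  proof -
    have "f -` U \<inter> space (borel_of S) = {x \<in> topspace S. f x \<in> U}" by auto
    then show ?thesis using openin_continuous_map_preimage[OF assms] that by (simp add: openin_borel_of)
  qed
qed (auto dest: openin_subset)

abbreviation bdry_borel :: "(real \<Rightarrow> 'a::metric_space) set measure" where
  "bdry_borel \<equiv> borel_of boundary_topology"

lemma measurable_ray [measurable]:
  "(\<lambda>\<xi>. gen_ray x (Inr \<xi>) t) \<in> borel_measurable bdry_borel"
proof (rule borel_measurableI)
  fix S :: "'a set" assume "open S"
  then have "openin boundary_topology {\<xi> \<in> boundary. gen_ray x (Inr \<xi>) \<in> {f. f t \<in> S}}"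
    by (intro openin_boundary openin_compact_open_eval)
  moreover have "(\<lambda>\<xi>. gen_ray x (Inr \<xi>) t) -` S \<inter> space bdry_borel = {\<xi> \<in> boundary. gen_ray x (Inr \<xi>) \<in> {f. f t \<in> S}}"
    by auto
  ultimately show "(\<lambda>\<xi>. gen_ray x (Inr \<xi>) t) -` S \<inter> space bdry_borel \<in> sets bdry_borel"
    by (simp add: openin_borel_of)
qed

lemma measurable_dist_ray [measurable]:
  "(\<lambda>\<xi>. dist y (gen_ray x (Inr \<xi>) t)) \<in> borel_measurable bdry_borel"
proof -
  have "(\<lambda>z. dist y z) \<in> borel_measurable borel"
    by (intro borel_measurable_continuous_onI continuous_intros)
  from measurable_compose[OF measurable_ray this] show ?thesis .
qed

context cat_space
begin

lemma measurable_busemann: "(\<lambda>\<xi>. busemann \<xi> x (y::'a)) \<in> borel_measurable bdry_borel"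
proof (rule borel_measurable_LIMSEQ_real)
  fix \<xi> :: "(real \<Rightarrow> 'a) set" assume "\<xi> \<in> space bdry_borel"
  then have \<xi>: "\<xi> \<in> boundary" by simp
  show "(\<lambda>n. dist x (ray_to x \<xi> (real n)) - dist y (ray_to x \<xi> (real n))) \<longlonglongrightarrow> busemann \<xi> x y"
    by (rule filterlim_compose[OF busemann_tendsto[OF \<xi> ray_to(1)[OF \<xi>]] filterlim_real_sequentially])
qed measurable

lemma ray_to_lipschitz: "\<xi> \<in> boundary \<Longrightarrow> dist (ray_to x \<xi> s) (ray_to x \<xi> t) \<le> \<bar>s - t\<bar>"
proof -
  assume \<xi>: "\<xi> \<in> boundary"
  have "ray_to x \<xi> u = ray_to x \<xi> (max 0 u)" for u using ray_to(2)[OF \<xi>, of u x] ray_to(2)[OF \<xi>, of 0 x] by (auto simp: max_def)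
  then have "dist (ray_to x \<xi> s) (ray_to x \<xi> t) = \<bar>max 0 s - max 0 t\<bar>"
    using ray_to_dist[OF \<xi>, of "max 0 s" "max 0 t" x] by simp
  then show ?thesis by (auto simp: max_def)
qed

lemma continuous_ray_to: "\<xi> \<in> boundary \<Longrightarrow> continuous_on UNIV (ray_to x \<xi>)"
  by (rule continuous_onI) (use ray_to_lipschitz in \<open>metis dist_real_def le_less_trans less_imp_le\<close>)

text \<open>Serves the continuity of \<open>end_plus\<close>. Each ray is compared with the segment
  from \<open>x\<close> to its line at time \<open>T\<close>, and the two segments with each other;
  three comparisons of at most \<open>2 * exp (u - T + dist x (l 0) + 2)\<close> give the factor
  6.\<close>

lemma ray_to_end_close:
  assumes l: "(l::real \<Rightarrow> 'a) \<in> geodesic_lines" "l' \<in> geodesic_lines"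
    and c: "dist (l 0) (l' 0) \<le> 1" "dist (l T) (l' T) \<le> 1"
    and u: "0 \<le> u" "u + dist x (l 0) + 1 \<le> T"
  shows "dist (ray_to x (end_plus l) u) (ray_to x (end_plus l') u) \<le> 6 * exp (u - T + dist x (l 0) + 2)"
proof -
  define A where "A = dist x (l 0) + 1"
  have T: "T \<ge> 0" using u zero_le_dist[of x "l 0"] by linarith
  have A': "dist x (l' 0) \<le> A" using dist_triangle[of x "l' 0" "l 0"] c by (simp add: A_def)
  have side: "dist m (ray_to x (end_plus k) u) \<le> 2 * exp (u - T + A) \<and> T - A \<le> dist x (k T)"
    if k: "k \<in> geodesic_lines" "dist x (k 0) \<le> A" and m: "between x m (k T)" "dist x m = u" for k m
  proof -
    have dT: "T - A \<le> dist x (k T)"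
      using dist_triangle[of "k 0" "k T" x] line_dist[OF k(1), of 0 T] T k(2) by (simp add: dist_commute)
    have b: "end_plus k \<in> boundary" using line_ends[OF k(1)] by simp
    have "((\<lambda>t. dist (k 0) (k t) - dist (k T) (k t)) \<longlongrightarrow> T) at_top"
    proof (rule tendsto_eventually)
      show "\<forall>\<^sub>F t in at_top. dist (k 0) (k t) - dist (k T) (k t) = T"
        using eventually_ge_at_top[of T] by eventually_elim (use T in \<open>simp add: line_dist[OF k(1)]\<close>)
    qed
    then have "busemann (end_plus k) (k 0) (k T) = T"
      using tendsto_unique[OF trivial_limit_at_top_linorder busemann_tendsto[OF b line_ends(2)[OF k(1)]]] by blast
    moreover have "busemann (end_plus k) x (k T) = busemann (end_plus k) x (k 0) + busemann (end_plus k) (k 0) (k T)"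
      by (simp add: busemann_add b)
    moreover have "busemann (end_plus k) (k 0) x \<le> dist (k 0) x" by (rule busemann_le[OF b])
    ultimately have "T - A \<le> busemann (end_plus k) x (k T)"
      using busemann_swap[OF b, of "k 0" x] k(2) by (simp add: dist_commute)
    then have "u - (dist x (k T) + busemann (end_plus k) x (k T)) / 2 \<le> u - T + A"
      using dT by (simp add: field_simps)
    moreover have "dist m (ray_to x (end_plus k) u) \<le> 2 * exp (u - (dist x (k T) + busemann (end_plus k) x (k T)) / 2)"
      using thin_ray_segment[OF b m(1)] m(2) by simp
    ultimately show ?thesis using dT by (meson exp_le_cancel_iff mult_left_mono order_trans zero_le_numeral)
  qed
  have ex: "\<exists>m. between x m (k T) \<and> dist x m = u" if k: "k \<in> geodesic_lines" "dist x (k 0) \<le> A" for k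
  proof (rule ex_between[OF u(1)])
    show "u \<le> dist x (k T)"
      using dist_triangle[of "k 0" "k T" x] line_dist[OF k(1), of 0 T] T k(2) u(2) by (simp add: A_def dist_commute)
  qed
  obtain m where m: "between x m (l T)" "dist x m = u" using ex[OF l(1)] by (auto simp: A_def)
  obtain m' where m': "between x m' (l' T)" "dist x m' = u" using ex[OF l(2) A'] by auto
  have s: "dist m (ray_to x (end_plus l) u) \<le> 2 * exp (u - T + A)" "T - A \<le> dist x (l T)"
    using side[OF l(1) _ m] by (auto simp: A_def)
  have s': "dist m' (ray_to x (end_plus l') u) \<le> 2 * exp (u - T + A)" "T - A \<le> dist x (l' T)"
    using side[OF l(2) A' m'] by auto
  have "dist m m' \<le> 2 * exp (u + (dist (l T) (l' T) - dist x (l T) - dist x (l' T)) / 2)"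
    by (rule thin_dist[OF m(1) m'(1) m(2) m'(2)])
  also have "u + (dist (l T) (l' T) - dist x (l T) - dist x (l' T)) / 2 \<le> u - T + A + 1"
    using s(2) s'(2) c by (simp add: field_simps)
  finally have mm: "dist m m' \<le> 2 * exp (u - T + A + 1)" by simp
  have "exp (u - T + A) \<le> exp (u - T + A + 1)" by simp
  moreover have "dist (ray_to x (end_plus l) u) (ray_to x (end_plus l') u) \<le>
     dist m (ray_to x (end_plus l) u) + dist m m' + dist m' (ray_to x (end_plus l') u)"
    using dist_triangle[of "ray_to x (end_plus l) u" "ray_to x (end_plus l') u" m]
      dist_triangle[of m "ray_to x (end_plus l') u" m'] by (simp add: dist_commute)
  ultimately have "dist (ray_to x (end_plus l) u) (ray_to x (end_plus l') u) \<le> 6 * exp (u - T + A + 1)"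
    using s(1) s'(1) mm by linarith
  then show ?thesis by (simp add: A_def algebra_simps)
qed

lemma continuous_map_end_plus:
  "continuous_map geodesic_lines_topology boundary_topology (end_plus :: (real \<Rightarrow> 'a) \<Rightarrow> _)"
proof (rule continuous_map_boundary)
  have top: "topspace geodesic_lines_topology = (geodesic_lines :: (real \<Rightarrow> 'a) set)"
    by (simp add: geodesic_lines_topology_def)
  show "end_plus ` topspace geodesic_lines_topology \<subseteq> (boundary :: (real \<Rightarrow> 'a) set set)"
    using line_ends(1) by (auto simp: top)
  fix x :: 'a and U :: "(real \<Rightarrow> 'a) set" assume U: "openin compact_open_topology U"
  show "openin geodesic_lines_topology {l \<in> topspace geodesic_lines_topology. ray_to x (end_plus l) \<in> U}"
    unfolding top
  proof (subst openin_subopen, safe)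
    fix l :: "real \<Rightarrow> 'a" assume l: "l \<in> geodesic_lines" and lU: "ray_to x (end_plus l) \<in> U"
    have b: "end_plus l \<in> boundary" using line_ends[OF l] by simp
    obtain K e where K: "compact K" "e > 0" "\<forall>f'. (\<forall>t\<in>K. dist (ray_to x (end_plus l) t) (f' t) < e) \<longrightarrow> f' \<in> U"
      by (rule compact_open_nbhd[OF U lU continuous_ray_to[OF b]])
    obtain S where S: "\<And>t. t \<in> K \<Longrightarrow> \<bar>t\<bar> \<le> S" "S > 0"
      using compact_imp_bounded[OF K(1)] by (auto simp: bounded_pos)
    define A where "A = dist x (l 0) + 2"
    \<comment> \<open>Late enough for the bound of \<open>ray_to_end_close\<close> to be at most
      \<open>e / 2\<close> at all times up to \<open>S\<close>.\<close>
    define T where "T = max (S + A) (S + A - ln (e / 12))"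
    have T: "S + A \<le> T" "S + A - T \<le> ln (e / 12)" by (auto simp: T_def)
    define V where "V = {f. f 0 \<in> ball (l 0) 1} \<inter> {f. f T \<in> ball (l T) 1}"
    have "openin geodesic_lines_topology (geodesic_lines \<inter> V)"
      unfolding geodesic_lines_topology_def V_def
      by (intro openin_subtopology_Int2 openin_Int openin_compact_open_eval) auto
    moreover have "l \<in> geodesic_lines \<inter> V" using l by (simp add: V_def)
    moreover have "geodesic_lines \<inter> V \<subseteq> {l \<in> geodesic_lines. ray_to x (end_plus l) \<in> U}"
    proof safe
      fix l' assume l': "l' \<in> geodesic_lines" "l' \<in> V"
      have b': "end_plus l' \<in> boundary" using line_ends[OF l'(1)] by simp
      have "dist (ray_to x (end_plus l) t) (ray_to x (end_plus l') t) < e" if "t \<in> K" for t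
      proof (cases "t \<le> 0")
        case True
        then show ?thesis using ray_to(2)[OF b True] ray_to(2)[OF b' True] K(2) by simp
      next
        case False
        have tS: "t \<le> S" using S(1)[OF that] by simp
        have "dist (ray_to x (end_plus l) t) (ray_to x (end_plus l') t) \<le> 6 * exp (t - T + dist x (l 0) + 2)"
          by (rule ray_to_end_close[OF l l'(1)]) (use l'(2) False tS T in \<open>auto simp: V_def A_def\<close>)
        also have "\<dots> \<le> 6 * exp (ln (e / 12))" using T tS by (simp add: A_def)
        also have "\<dots> < e" using K(2) by simp
        finally show ?thesis .
      qed
      then show "ray_to x (end_plus l') \<in> U" using K(3) by blast
    qed
    ultimately show "\<exists>T. openin geodesic_lines_topology T \<and> l \<in> T \<and> T \<subseteq> {l \<in> geodesic_lines. ray_to x (end_plus l) \<in> U}"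
      by blast
  qed
qed

end

section \<open>Groups of isometries\<close>

text \<open>Discreteness appears as \<open>finite_ball\<close>. The group laws are stated for maps,
  so that the ambient group and its subgroups are instances on an equal footing.\<close>

locale isom_action = cat_space pt for pt :: "'a::metric_space" +
  fixes \<Gamma> :: "('a \<Rightarrow> 'a) set"
  assumes id_mem: "id \<in> \<Gamma>"
    and comp_mem: "g \<in> \<Gamma> \<Longrightarrow> h \<in> \<Gamma> \<Longrightarrow> g \<circ> h \<in> \<Gamma>"
    and inv_mem: "g \<in> \<Gamma> \<Longrightarrow> inv_into UNIV g \<in> \<Gamma>"
    and surj: "g \<in> \<Gamma> \<Longrightarrow> surj g"
    and iso [simp]: "g \<in> \<Gamma> \<Longrightarrow> dist (g x) (g y) = dist x y"
    and finite_ball: "finite {g \<in> \<Gamma>. dist x (g x) \<le> R}"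
begin

lemma inj: "g \<in> \<Gamma> \<Longrightarrow> inj g"
  by (metis dist_eq_0_iff injI iso)

lemma inv_left [simp]: "g \<in> \<Gamma> \<Longrightarrow> inv_into UNIV g (g x) = x"
  using inj by simp

lemma inv_right [simp]: "g \<in> \<Gamma> \<Longrightarrow> g (inv_into UNIV g x) = x"
  using surj by (simp add: surj_f_inv_f)

lemma iso_inv: "g \<in> \<Gamma> \<Longrightarrow> dist (inv_into UNIV g x) y = dist x (g y)"
  using iso[of g "inv_into UNIV g x" y] by simp

lemma cancel_left: "g \<in> \<Gamma> \<Longrightarrow> g \<circ> h = g \<circ> h' \<Longrightarrow> h = h'"
  by (rule ext) (metis inj comp_apply injD)

lemma continuous_elem: "g \<in> \<Gamma> \<Longrightarrow> continuous_on UNIV g"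
  by (rule continuous_onI) (auto intro: less_imp_le)

lemma action:
  assumes "g \<in> \<Gamma>" "\<xi> \<in> boundary"
  shows "boundary_action g \<xi> \<in> boundary" "r \<in> \<xi> \<Longrightarrow> g \<circ> r \<in> boundary_action g \<xi>"
    "ray_to (g x) (boundary_action g \<xi>) = g \<circ> ray_to x \<xi>"
    "busemann (boundary_action g \<xi>) (g x) (g y) = busemann \<xi> x y"
  using boundary_action[OF surj iso assms(2), OF assms(1) assms(1)] busemann_isometry[OF surj iso assms(2), OF assms(1) assms(1)]
  by auto

lemma action_inv:
  assumes "g \<in> \<Gamma>"
  shows "boundary_action (inv_into UNIV g) (boundary_action g \<xi>) = \<xi>"
    "boundary_action g (boundary_action (inv_into UNIV g) \<xi>) = \<xi>"
proof -
  have "inv_into UNIV g \<circ> g = id" "g \<circ> inv_into UNIV g = id" using assms by auto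
  then show "boundary_action (inv_into UNIV g) (boundary_action g \<xi>) = \<xi>"
    "boundary_action g (boundary_action (inv_into UNIV g) \<xi>) = \<xi>"
    by (simp_all add: boundary_action_def image_image comp_assoc[symmetric])
qed

lemma ray_to_action:
  assumes "g \<in> \<Gamma>" "\<xi> \<in> boundary"
  shows "ray_to x (boundary_action g \<xi>) = g \<circ> ray_to (inv_into UNIV g x) \<xi>"
  using action(3)[OF assms, of "inv_into UNIV g x"] assms by simp

lemma continuous_map_action:
  assumes g: "g \<in> \<Gamma>"
  shows "continuous_map boundary_topology boundary_topology (boundary_action g)"
proof (rule continuous_map_boundary)
  show "boundary_action g ` topspace boundary_topology \<subseteq> boundary" using action(1)[OF g] by auto
  fix x :: 'a and U assume U: "openin compact_open_topology (U :: (real \<Rightarrow> 'a) set)"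
  have "{z \<in> topspace boundary_topology. ray_to x (boundary_action g z) \<in> U} =
     {\<xi> \<in> boundary. ray_to (inv_into UNIV g x) \<xi> \<in> {f. g \<circ> f \<in> U}}"
    using ray_to_action[OF g] by auto
  then show "openin boundary_topology {z \<in> topspace boundary_topology. ray_to x (boundary_action g z) \<in> U}"
    using openin_boundary[OF openin_compact_open_compose[OF U continuous_elem[OF g]]] by simp
qed

lemma measurable_action: "g \<in> \<Gamma> \<Longrightarrow> boundary_action g \<in> measurable bdry_borel bdry_borel"
  by (intro continuous_map_borel_of continuous_map_action)

text \<open>The map \<open>\<Phi>\<close> extends \<open>g\<close> continuously to the bordification
  and preserves orbits. The subbasis of the cone topology contains all base points, so continuity
  only requires moving the base point \<open>y\<close> to its preimage under
  \<open>g\<close>.\<close>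

lemma limit_set_action:
  assumes g: "g \<in> \<Gamma>" and \<xi>: "\<xi> \<in> limit_set \<Gamma>"
  shows "boundary_action g \<xi> \<in> limit_set \<Gamma>"
proof -
  define \<Phi> where "\<Phi> = map_sum g (boundary_action g)"
  obtain x where b: "\<xi> \<in> boundary" and x: "Inr \<xi> \<in> cone_topology closure_of (Inl ` isom_orbit \<Gamma> x)"
    using \<xi> by (auto simp: limit_set_def)
  have "continuous_map cone_topology cone_topology \<Phi>"
  proof (rule continuous_map_cone)
    show "\<Phi> ` topspace cone_topology \<subseteq> bordification"
      using action(1)[OF g] by (auto simp: \<Phi>_def bordification_def)
    fix y :: 'a and U assume U: "openin compact_open_topology (U :: (real \<Rightarrow> 'a) set)"
    have "gen_ray y (\<Phi> z) = g \<circ> gen_ray (inv_into UNIV g y) z" if "z \<in> bordification" for z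
      using that ray_to_action[OF g] gen_ray_Inl_isometry[OF iso[OF g], of "inv_into UNIV g y"] g
      by (auto simp: bordification_def \<Phi>_def)
    then have "{z \<in> topspace cone_topology. gen_ray y (\<Phi> z) \<in> U} =
       {z \<in> bordification. gen_ray (inv_into UNIV g y) z \<in> {f. g \<circ> f \<in> U}}" by auto
    then show "openin cone_topology {z \<in> topspace cone_topology. gen_ray y (\<Phi> z) \<in> U}"
      using openin_cone[OF openin_compact_open_compose[OF U continuous_elem[OF g]]] by simp
  qed
  from continuous_map_image_closure_subset[OF this, of "Inl ` isom_orbit \<Gamma> x"]
  have "\<Phi> (Inr \<xi>) \<in> cone_topology closure_of (\<Phi> ` Inl ` isom_orbit \<Gamma> x)" using x by blast
  moreover have "\<Phi> ` Inl ` isom_orbit \<Gamma> x \<subseteq> Inl ` isom_orbit \<Gamma> x"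
  proof -
    have "g (h x) \<in> isom_orbit \<Gamma> x" if "h \<in> \<Gamma>" for h
      using comp_mem[OF g that] unfolding isom_orbit_def by (metis comp_apply image_eqI)
    then show ?thesis by (auto simp: \<Phi>_def isom_orbit_def)
  qed
  ultimately have "\<Phi> (Inr \<xi>) \<in> cone_topology closure_of (Inl ` isom_orbit \<Gamma> x)"
    using closure_of_mono by blast
  then show ?thesis using action(1)[OF g b] by (auto simp: limit_set_def \<Phi>_def)
qed

section \<open>The convex hull of the limit set\<close>

abbreviation "chull \<equiv> hull_at_infinity (limit_set \<Gamma>)"

text \<open>The preimage under \<open>g\<close> of a set in the defining family belongs to that
  family again, as \<open>g\<close> preserves lines and the limit set.\<close>

lemma hull_action:
  assumes g: "g \<in> \<Gamma>" and p: "p \<in> chull"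
  shows "g p \<in> chull"
  unfolding hull_at_infinity_def
proof (rule InterI)
  fix E assume E: "E \<in> {C. closed C \<and> geodesically_convex C \<and>
     (\<forall>l\<in>geodesic_lines. end_minus l \<in> limit_set \<Gamma> \<longrightarrow> end_plus l \<in> limit_set \<Gamma> \<longrightarrow> range l \<subseteq> C)}"
  have "closed (g -` E)"
    using E continuous_elem[OF g] by (simp add: closed_vimage)
  moreover have "geodesically_convex (g -` E)"
    unfolding geodesically_convex_def
  proof (intro ballI allI impI)
    fix x y c assume "x \<in> g -` E" "y \<in> g -` E" "geodesic_segment UNIV dist x y c"
    moreover from this have "geodesic_segment UNIV dist (g x) (g y) (g \<circ> c)"
      using g by (auto simp: geodesic_segment_def)
    ultimately have "(g \<circ> c) ` {0..dist (g x) (g y)} \<subseteq> E" using E unfolding geodesically_convex_def by blast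
    then show "c ` {0..dist x y} \<subseteq> g -` E" using g by auto
  qed
  moreover have "range l \<subseteq> g -` E"
    if l: "l \<in> geodesic_lines" "end_minus l \<in> limit_set \<Gamma>" "end_plus l \<in> limit_set \<Gamma>" for l
  proof -
    have gl: "g \<circ> l \<in> geodesic_lines" using l g by (simp add: geodesic_lines_def)
    have bl: "end_plus l \<in> boundary" "end_minus l \<in> boundary" using line_ends[OF l(1)] by auto
    have "end_plus (g \<circ> l) = boundary_action g (end_plus l)"
      using action(2)[OF g bl(1) line_ends(2)[OF l(1)]] boundary_asymptotic[OF action(1)[OF g bl(1)]]
        line_ends(1,2)[OF gl] boundary_eqI[OF line_ends(1)[OF gl] action(1)[OF g bl(1)]]
      by blast
    moreover have "end_minus (g \<circ> l) = boundary_action g (end_minus l)"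
    proof -
      have e: "(\<lambda>t. (g \<circ> l) (- t)) = g \<circ> (\<lambda>t. l (- t))" by auto
      show ?thesis
        using action(2)[OF g bl(2) line_ends(4)[OF l(1)]] boundary_asymptotic[OF action(1)[OF g bl(2)]]
          line_ends(3,4)[OF gl] boundary_eqI[OF line_ends(3)[OF gl] action(1)[OF g bl(2)]]
        unfolding e by blast
    qed
    ultimately have "end_plus (g \<circ> l) \<in> limit_set \<Gamma>" "end_minus (g \<circ> l) \<in> limit_set \<Gamma>"
      using limit_set_action[OF g] l by simp_all
    then have "range (g \<circ> l) \<subseteq> E" using E gl by blast
    then show ?thesis by auto
  qed
  ultimately have "chull \<subseteq> g -` E" unfolding hull_at_infinity_def by (intro Inter_lower) auto
  then show "g p \<in> E" using p by auto
qed

lemma hull_between: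
  assumes "x \<in> chull" "y \<in> chull" "between x m y"
  shows "m \<in> chull"
proof -
  obtain c where c: "geodesic_segment UNIV dist x y c" "c (dist x m) = m"
    using between_segment[OF assms(3)] .
  have "m \<in> c ` {0..dist x y}" 
    by (rule image_eqI[of _ _ "dist x m"]) (use c(2) between_dist_le[OF assms(3)] in auto)
  then show ?thesis using assms c(1) unfolding hull_at_infinity_def geodesically_convex_def by blast
qed

text \<open>The images \<open>W n\<close> of balls around \<open>x\<close> cover the compact
  quotient, and a finite subcover gives \<open>D\<close>. They are open because the preimage of
  \<open>W n\<close> in the hull is the trace of all translates of a ball.\<close>

lemma hull_cocompact:
  assumes cc: "convex_cocompact \<Gamma>"
  shows "chull \<noteq> {}" "x \<in> chull \<Longrightarrow> \<exists>D. \<forall>p\<in>chull. \<exists>g\<in>\<Gamma>. dist p (g x) \<le> D"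
proof -
  obtain \<xi> \<eta> where \<xi>: "\<xi> \<in> limit_set \<Gamma>" "\<eta> \<in> limit_set \<Gamma>" "\<xi> \<noteq> \<eta>" using cc by (auto simp: convex_cocompact_def)
  then obtain l :: "real \<Rightarrow> 'a" where l: "l \<in> geodesic_lines" "end_minus l = \<xi>" "end_plus l = \<eta>"
    using ex_line[of \<xi> \<eta>] by (auto simp: limit_set_def)
  then have "l 0 \<in> chull" using \<xi> unfolding hull_at_infinity_def by blast
  then show "chull \<noteq> {}" by blast
next
  assume x: "x \<in> chull"
  obtain T where q: "quotient_map (top_of_set chull) T (isom_orbit \<Gamma>)" and T: "compact_space T"
    using cc by (auto simp: convex_cocompact_def)
  have surjT: "isom_orbit \<Gamma> ` chull = topspace T" using quotient_imp_surjective_map[OF q] by simp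
  define W where "W n = isom_orbit \<Gamma> ` (chull \<inter> ball x (real n))" for n
  have orbit_eq: "p \<in> isom_orbit \<Gamma> p'" if "isom_orbit \<Gamma> p = isom_orbit \<Gamma> p'" for p p'
  proof -
    have "p \<in> isom_orbit \<Gamma> p" unfolding isom_orbit_def using id_mem by (metis id_apply image_eqI)
    then show ?thesis using that by simp
  qed
  have "openin T (W n)" for n
  proof -
    have sub: "W n \<subseteq> topspace T" using surjT by (auto simp: W_def)
    have "{p \<in> chull. isom_orbit \<Gamma> p \<in> W n} = (\<Union>g\<in>\<Gamma>. chull \<inter> g -` ball x (real n))"
    proof (intro equalityI subsetI)
      fix p assume "p \<in> {p \<in> chull. isom_orbit \<Gamma> p \<in> W n}"
      then obtain p' where p: "p \<in> chull" "p' \<in> ball x (real n)" "isom_orbit \<Gamma> p = isom_orbit \<Gamma> p'"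
        by (auto simp: W_def)
      then have "p' \<in> isom_orbit \<Gamma> p" using orbit_eq[of p' p] by simp
      then obtain g where "g \<in> \<Gamma>" "p' = g p" unfolding isom_orbit_def by blast
      then show "p \<in> (\<Union>g\<in>\<Gamma>. chull \<inter> g -` ball x (real n))" using p by blast
    next
      fix p assume "p \<in> (\<Union>g\<in>\<Gamma>. chull \<inter> g -` ball x (real n))"
      then obtain g where g: "g \<in> \<Gamma>" "p \<in> chull" "g p \<in> ball x (real n)" by auto
      have "isom_orbit \<Gamma> (g p) = isom_orbit \<Gamma> p"
      proof (intro equalityI subsetI)
        fix z assume "z \<in> isom_orbit \<Gamma> (g p)"
        then obtain h where "h \<in> \<Gamma>" "z = (h \<circ> g) p" by (auto simp: isom_orbit_def)
        then show "z \<in> isom_orbit \<Gamma> p" using comp_mem[OF _ g(1)] unfolding isom_orbit_def by blast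
      next
        fix z assume "z \<in> isom_orbit \<Gamma> p"
        then obtain h where "h \<in> \<Gamma>" "z = (h \<circ> inv_into UNIV g) (g p)" using g by (auto simp: isom_orbit_def)
        then show "z \<in> isom_orbit \<Gamma> (g p)" using comp_mem[OF _ inv_mem[OF g(1)]] unfolding isom_orbit_def by blast
      qed
      then have "isom_orbit \<Gamma> p \<in> W n" using g hull_action[OF g(1,2)] unfolding W_def by (metis IntI imageI)
      then show "p \<in> {p \<in> chull. isom_orbit \<Gamma> p \<in> W n}" using g by simp
    qed
    moreover have "openin (top_of_set chull) (\<Union>g\<in>\<Gamma>. chull \<inter> g -` ball x (real n))"
      by (intro openin_Union) (auto intro!: openin_open_Int open_vimage continuous_elem)
    ultimately show ?thesis using q sub unfolding quotient_map_def by auto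
  qed
  moreover have "topspace T \<subseteq> \<Union>(range W)"
  proof
    fix z assume "z \<in> topspace T"
    then obtain p where p: "p \<in> chull" "z = isom_orbit \<Gamma> p" using surjT by blast
    obtain n where "dist x p < real n" using reals_Archimedean2 by blast
    then have "z \<in> W n" using p by (auto simp: W_def)
    then show "z \<in> \<Union>(range W)" by blast
  qed
  ultimately obtain F where F: "finite F" "F \<subseteq> range W" "topspace T \<subseteq> \<Union>F"
    using T[unfolded compact_space_alt, rule_format, of "range W"] by blast
  obtain N where N: "finite N" "F = W ` N" using finite_subset_image[OF F(1,2)] by blast
  have "\<exists>g\<in>\<Gamma>. dist p (g x) \<le> real (Max (insert 0 N))" if p: "p \<in> chull" for p
  proof -
    have "isom_orbit \<Gamma> p \<in> \<Union>F" using F(3) surjT p by blast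
    then obtain n p' where n: "n \<in> N" "p' \<in> ball x (real n)" "isom_orbit \<Gamma> p = isom_orbit \<Gamma> p'"
      by (auto simp: N W_def)
    obtain g where g: "g \<in> \<Gamma>" "p = g p'" using orbit_eq[OF n(3)] by (auto simp: isom_orbit_def)
    have "dist p (g x) = dist p' x" using g by simp
    also have "\<dots> \<le> real n" using n(2) by (simp add: dist_commute)
    also have "\<dots> \<le> real (Max (insert 0 N))" using N(1) n(1) by simp
    finally show ?thesis using g(1) by blast
  qed
  then show "\<exists>D. \<forall>p\<in>chull. \<exists>g\<in>\<Gamma>. dist p (g x) \<le> D" by blast
qed

text \<open>Two times are controlled at once: in \<open>limit_point_horospherical\<close> one bounds
  the length of the segment to \<open>g x\<close> from below and the other gives its
  direction.\<close>

lemma limit_point_nbhd: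
  assumes "\<xi> \<in> limit_set \<Gamma>"
  obtains x where "\<forall>s t. \<exists>g\<in>\<Gamma>. dist (gen_ray x (Inl (g x)) s) (ray_to x \<xi> s) < 1 \<and>
     dist (gen_ray x (Inl (g x)) t) (ray_to x \<xi> t) < 1"
proof -
  obtain x where b: "\<xi> \<in> boundary" and x: "Inr \<xi> \<in> cone_topology closure_of (Inl ` isom_orbit \<Gamma> x)"
    using assms by (auto simp: limit_set_def)
  have "\<exists>g\<in>\<Gamma>. dist (gen_ray x (Inl (g x)) s) (ray_to x \<xi> s) < 1 \<and> dist (gen_ray x (Inl (g x)) t) (ray_to x \<xi> t) < 1" for s t
  proof -
    define V where "V = {f. f s \<in> ball (ray_to x \<xi> s) 1} \<inter> {f. f t \<in> ball (ray_to x \<xi> t) 1}"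
    have "openin cone_topology {z \<in> bordification. gen_ray x z \<in> V}"
      unfolding V_def by (intro openin_cone openin_Int openin_compact_open_eval) auto
    moreover have "Inr \<xi> \<in> {z \<in> bordification. gen_ray x z \<in> V}" using b by (auto simp: V_def bordification_def)
    ultimately have "\<exists>z. z \<in> Inl ` isom_orbit \<Gamma> x \<and> z \<in> {z \<in> bordification. gen_ray x z \<in> V}"
      using x[unfolded in_closure_of, THEN conjunct2, THEN spec[of _ "{z \<in> bordification. gen_ray x z \<in> V}"]] by simp
    then obtain z where "z \<in> Inl ` isom_orbit \<Gamma> x" "gen_ray x z \<in> V" by blast
    then obtain g where "g \<in> \<Gamma>" "gen_ray x (Inl (g x)) \<in> V" unfolding isom_orbit_def by blast
    then show ?thesis by (intro bexI[of _ g]) (auto simp: V_def dist_commute)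
  qed
  then show ?thesis by (intro that[of x] allI)
qed

lemma gen_ray_Inl_dist_le: "dist x (gen_ray x (Inl y) t) \<le> dist x (y::'a)"
  using gen_ray_Inl_between(2)[of t x y] gen_ray_Inl(2)[of t x y] gen_ray_Inl(3)[of x y t]
  by (cases "t \<le> 0"; cases "t \<le> dist x y") auto

lemma orbit_unbounded:
  assumes "limit_set \<Gamma> \<noteq> {}"
  shows "\<exists>g\<in>\<Gamma>. R < dist y (g y)"
proof -
  obtain \<xi> where \<xi>: "\<xi> \<in> limit_set \<Gamma>" using assms by blast
  have b: "\<xi> \<in> boundary" using \<xi> by (simp add: limit_set_def)
  obtain x where x: "\<forall>s t. \<exists>g\<in>\<Gamma>. dist (gen_ray x (Inl (g x)) s) (ray_to x \<xi> s) < 1 \<and>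
     dist (gen_ray x (Inl (g x)) t) (ray_to x \<xi> t) < 1" using limit_point_nbhd[OF \<xi>] .
  define s where "s = \<bar>R\<bar> + 2 * dist x y + 1"
  obtain g where g: "g \<in> \<Gamma>" "dist (gen_ray x (Inl (g x)) s) (ray_to x \<xi> s) < 1" using x by blast
  have "s = dist x (ray_to x \<xi> s)" using ray_to_dist0[OF b] by (simp add: s_def)
  also have "\<dots> < dist x (g x) + 1"
    using dist_triangle[of x "ray_to x \<xi> s" "gen_ray x (Inl (g x)) s"] g(2) gen_ray_Inl_dist_le[of x "g x" s] by linarith
  also have "dist x (g x) \<le> dist x y + dist y (g y) + dist y x"
    using dist_triangle[of x "g x" y] dist_triangle[of y "g x" "g y"] iso[OF g(1), of y x] by linarith
  finally have "R < dist y (g y)" by (simp add: s_def dist_commute)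
  then show ?thesis using g(1) by blast
qed

text \<open>An orbit on a single horosphere accumulates only at its centre: the Gromov product of
  \<open>g x\<close> and \<open>\<xi>\<close> at \<open>x\<close> is half of
  \<open>dist x (g x)\<close>, so long segments to the orbit follow the ray to \<open>\<xi>\<close>.
  This will exclude densities carried by one atom.\<close>

lemma limit_point_horospherical:
  assumes \<xi>: "\<xi> \<in> boundary" and B: "\<And>g x. g \<in> \<Gamma> \<Longrightarrow> busemann \<xi> x (g x) = 0" and \<eta>: "\<eta> \<in> limit_set \<Gamma>"
  shows "\<eta> = \<xi>"
proof -
  have b: "\<eta> \<in> boundary" using \<eta> by (simp add: limit_set_def)
  obtain x where x: "\<forall>s t. \<exists>g\<in>\<Gamma>. dist (gen_ray x (Inl (g x)) s) (ray_to x \<eta> s) < 1 \<and>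
     dist (gen_ray x (Inl (g x)) t) (ray_to x \<eta> t) < 1" using limit_point_nbhd[OF \<eta>] .
  show ?thesis
  proof (rule ray_to_bounded_eq[OF b \<xi>])
    fix t :: real assume t: "0 \<le> t"
    obtain g where g: "g \<in> \<Gamma>" "dist (gen_ray x (Inl (g x)) (2 * t + 1)) (ray_to x \<eta> (2 * t + 1)) < 1"
      "dist (gen_ray x (Inl (g x)) t) (ray_to x \<eta> t) < 1" using x[rule_format, of "2 * t + 1" t] by blast
    have "2 * t + 1 = dist x (ray_to x \<eta> (2 * t + 1))" using ray_to_dist0[OF b] t by simp
    also have "\<dots> < dist x (g x) + 1"
      using dist_triangle[of x "ray_to x \<eta> (2 * t + 1)" "gen_ray x (Inl (g x)) (2 * t + 1)"] g(2)
        gen_ray_Inl_dist_le[of x "g x" "2 * t + 1"] by linarith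
    finally have d: "2 * t < dist x (g x)" by simp
    have m: "between x (gen_ray x (Inl (g x)) t) (g x)" "dist x (gen_ray x (Inl (g x)) t) = t"
      using gen_ray_Inl_between[of t x "g x"] t d by auto
    have "dist (gen_ray x (Inl (g x)) t) (ray_to x \<xi> t) \<le> 2 * exp (t - (dist x (g x) + 0) / 2)"
      using thin_ray_segment[OF \<xi> m(1)] m(2) B[OF g(1), of x] by simp
    also have "\<dots> \<le> 2 * exp 0" using d by simp
    finally have "dist (ray_to x \<eta> t) (ray_to x \<xi> t) \<le> 3"
      using g(3) dist_triangle[of "ray_to x \<eta> t" "ray_to x \<xi> t" "gen_ray x (Inl (g x)) t"] by (simp add: dist_commute)
    then show "\<exists>u\<ge>t. dist (ray_to x \<eta> u) (ray_to x \<xi> u) \<le> 3" by blast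
  qed
qed

end

section \<open>From discreteness to finiteness of balls\<close>

lemma inv_isom_group:
  assumes "g \<in> carrier isom_group"
  shows "inv\<^bsub>isom_group\<^esub> g = inv_into UNIV g"
proof
  fix y
  have sj: "surj g" and "\<And>x y. dist (g x) (g y) = dist x y" using assms by (auto simp: isom_group_def)
  then have "inj g" by (metis dist_eq_0_iff injI)
  moreover have "inv\<^bsub>isom_group\<^esub> g \<otimes>\<^bsub>isom_group\<^esub> g = \<one>\<^bsub>isom_group\<^esub>"
    by (rule group.l_inv[OF group_isom_group assms])
  then have "(inv\<^bsub>isom_group\<^esub> g) (g x) = x" for x by (simp add: isom_group_def fun_eq_iff)
  ultimately show "(inv\<^bsub>isom_group\<^esub> g) y = inv_into UNIV g y" using sj by (metis inv_f_f surj_f_inv_f)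
qed

lemma isom_subgroupD:
  assumes "subgroup \<Gamma> isom_group"
  shows "id \<in> \<Gamma>" "g \<in> \<Gamma> \<Longrightarrow> h \<in> \<Gamma> \<Longrightarrow> g \<circ> h \<in> \<Gamma>" "g \<in> \<Gamma> \<Longrightarrow> inv_into UNIV g \<in> \<Gamma>"
  using subgroup.one_closed[OF assms] subgroup.m_closed[OF assms, of g h] subgroup.m_inv_closed[OF assms, of g]
    inv_isom_group[of g] subgroup.subset[OF assms] by (auto simp: isom_group_def)

text \<open>Some neighbourhood of \<open>id\<close>, given by a compact \<open>K\<close> and a
  radius \<open>e\<close>, meets the group only in \<open>id\<close>. Elements moving
  \<open>x\<close> by at most \<open>R\<close> are coded by maps from a finite net of
  \<open>K\<close> to a finite net of a ball, and two elements with the same code differ by an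
  element of that neighbourhood.\<close>

lemma (in cat_space) isom_action_discrete:
  assumes "discrete_isometry_group (\<Gamma> :: ('a \<Rightarrow> 'a) set)"
  shows "isom_action \<Gamma>"
proof -
  have sg: "subgroup \<Gamma> isom_group" and top: "subtopology compact_open_topology \<Gamma> = discrete_topology \<Gamma>"
    using assms by (auto simp: discrete_isometry_group_def)
  have car: "g \<in> carrier isom_group" if "g \<in> \<Gamma>" for g using subgroup.subset[OF sg] that by blast
  note id = isom_subgroupD(1)[OF sg] and comp = isom_subgroupD(2)[OF sg] and inv = isom_subgroupD(3)[OF sg]
  have sj: "surj g" and iso: "\<And>x y. dist (g x) (g y) = dist x y" if "g \<in> \<Gamma>" for g
    using car[OF that] by (auto simp: isom_group_def)
  have fin: "finite {g \<in> \<Gamma>. dist x (g x) \<le> R}" for x R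
  proof -
    define A where "A = {g \<in> \<Gamma>. dist x (g x) \<le> R}"
    have "openin (subtopology compact_open_topology \<Gamma>) {id}" using top id by simp
    then obtain U where U: "openin compact_open_topology U" "{id} = U \<inter> \<Gamma>" by (auto simp: openin_subtopology)
    have "id \<in> U" using U by blast
    obtain K e where K: "compact K" "e > 0" "\<forall>f'. (\<forall>x\<in>K. dist (id x) (f' x) < e) \<longrightarrow> f' \<in> U"
      by (rule compact_open_nbhd[OF U(1) \<open>id \<in> U\<close> continuous_on_id'])
    obtain r where r: "K \<subseteq> cball x r" using compact_imp_bounded[OF K(1)] by (auto simp: bounded_any_center[of K x] subset_iff)
    have net: "\<exists>N. N \<subseteq> S \<and> finite N \<and> S \<subseteq> (\<Union>p\<in>N. ball p (e / 4))" if S: "compact S" for S :: "'a set"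
    proof -
      have "S \<subseteq> (\<Union>p\<in>S. ball p (e / 4))" using K(2) by auto
      from compactE_image[OF S _ this] show ?thesis by (metis open_ball)
    qed
    obtain N where N: "finite N" "N \<subseteq> K" "K \<subseteq> (\<Union>p\<in>N. ball p (e / 4))"
      using net[OF K(1)] by auto
    have "compact (cball x (R + r))" using proper by blast
    then obtain M where M: "finite M" "cball x (R + r) \<subseteq> (\<Union>p\<in>M. ball p (e / 4))"
      using net[OF \<open>compact (cball x (R + r))\<close>] by auto
    have "\<exists>m\<in>M. dist m (g p) < e / 4" if "g \<in> A" "p \<in> N" for g p
    proof -
      have "dist x (g p) \<le> dist x (g x) + dist (g x) (g p)" by (rule dist_triangle)
      also have "\<dots> \<le> R + r" using that N(2) r iso[of g x p] by (auto simp: A_def subset_iff intro!: add_mono)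
      finally have "g p \<in> cball x (R + r)" by simp
      then show ?thesis using M(2) by fastforce
    qed
    then have "\<exists>m. \<forall>g\<in>A. \<forall>p\<in>N. m g p \<in> M \<and> dist (m g p) (g p) < e / 4" by metis
    then obtain m where m: "\<And>g p. g \<in> A \<Longrightarrow> p \<in> N \<Longrightarrow> m g p \<in> M \<and> dist (m g p) (g p) < e / 4" by blast
    have "inj_on (\<lambda>g. restrict (m g) N) A"
    proof (rule inj_onI)
      fix g h assume gh: "g \<in> A" "h \<in> A" and eq: "restrict (m g) N = restrict (m h) N"
      have G: "g \<in> \<Gamma>" "h \<in> \<Gamma>" using gh by (auto simp: A_def)
      have "dist (id y) ((inv_into UNIV g \<circ> h) y) < e" if "y \<in> K" for y
      proof -
        obtain p where p: "p \<in> N" "dist p y < e / 4" using subsetD[OF N(3) \<open>y \<in> K\<close>] by auto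
        have "m g p = m h p" using eq p(1) by (metis restrict_apply')
        \<comment> \<open>Two quarters of \<open>e\<close> come from the common code; the other two
          replace \<open>y\<close> by \<open>p\<close>.\<close>
        then have "dist (g p) (h p) < e / 4 + e / 4"
          using m[OF gh(1) p(1)] m[OF gh(2) p(1)] dist_triangle3[of "g p" "h p" "m g p"] by simp
        moreover have "dist (g y) (h y) \<le> dist (g y) (g p) + dist (g p) (h p) + dist (h p) (h y)"
          using dist_triangle[of "g y" "h y" "g p"] dist_triangle[of "g p" "h y" "h p"] by linarith
        ultimately have "dist (g y) (h y) < e"
          using p(2) iso[OF G(1), of y p] iso[OF G(2), of p y] by (simp add: dist_commute)
        moreover have "dist y (inv_into UNIV g (h y)) = dist (g y) (h y)"
          using iso[OF G(1), of y "inv_into UNIV g (h y)"] surj_f_inv_f[OF sj[OF G(1)], of "h y"] by simp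
        ultimately show ?thesis by simp
      qed
      then have "inv_into UNIV g \<circ> h \<in> U" using K(3) by blast
      moreover have "inv_into UNIV g \<circ> h \<in> \<Gamma>" by (intro comp inv G)
      ultimately have "inv_into UNIV g \<circ> h = id" using U(2) by blast
      then have "g (inv_into UNIV g (h y)) = g y" for y by (metis comp_apply id_apply)
      then show "g = h" using surj_f_inv_f[OF sj[OF G(1)]] by (intro ext) metis
    qed
    moreover have "(\<lambda>g. restrict (m g) N) ` A \<subseteq> PiE N (\<lambda>_. M)" using m by auto
    moreover have "finite (PiE N (\<lambda>_. M))" using N(1) M(1) by (intro finite_PiE) auto
    ultimately show ?thesis unfolding A_def[symmetric] by (meson inj_on_finite)
  qed
  show ?thesis by unfold_locales (use id comp inv sj iso fin in auto)
qed

section \<open>Orbit growth of convex-cocompact groups\<close>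

lemma sum_le_fibres:
  fixes u :: "'b \<Rightarrow> real" and v :: "'c \<Rightarrow> real"
  assumes X: "finite X" and m: "\<And>w. w \<in> \<phi> ` X \<Longrightarrow> real (card {x \<in> X. \<phi> x = w}) \<le> m"
    and u: "\<And>x. x \<in> X \<Longrightarrow> u x \<le> v (\<phi> x)" and v: "\<And>w. w \<in> \<phi> ` X \<Longrightarrow> 0 \<le> v w"
  shows "sum u X \<le> m * sum v (\<phi> ` X)"
proof -
  have "sum u X = (\<Sum>w\<in>\<phi> ` X. \<Sum>x | x \<in> X \<and> \<phi> x = w. u x)" by (rule sum.image_gen[OF X])
  also have "\<dots> \<le> (\<Sum>w\<in>\<phi> ` X. m * v w)"
  proof (rule sum_mono)
    fix w assume w: "w \<in> \<phi> ` X"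
    have "(\<Sum>x | x \<in> X \<and> \<phi> x = w. u x) \<le> real (card {x \<in> X. \<phi> x = w}) * v w"
      using u by (intro sum_bounded_above) auto
    also have "\<dots> \<le> m * v w" by (intro mult_right_mono m v w)
    finally show "(\<Sum>x | x \<in> X \<and> \<phi> x = w. u x) \<le> m * v w" .
  qed
  finally show ?thesis by (simp add: sum_distrib_left)
qed

lemma card_le_fibres:
  assumes "finite X" "\<phi> ` X \<subseteq> Y" "finite Y" "\<And>w. w \<in> \<phi> ` X \<Longrightarrow> card {x \<in> X. \<phi> x = w} \<le> m"
  shows "card X \<le> m * card Y"
proof -
  have "real (card X) \<le> real m * real (card (\<phi> ` X))"
    using sum_le_fibres[OF assms(1), of \<phi> "real m" "\<lambda>_. 1" "\<lambda>_. 1"] assms(4) by simp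
  also have "\<dots> \<le> real m * real (card Y)" using card_mono[OF assms(3,2)] by (intro mult_left_mono) auto
  finally show ?thesis by (metis of_nat_le_iff of_nat_mult)
qed

context isom_action
begin

lemma inv_inv: "g \<in> \<Gamma> \<Longrightarrow> inv_into UNIV (inv_into UNIV g) = g"
  by (rule ext) (metis inv_left inv_mem inv_right)

lemma len_inv: "g \<in> \<Gamma> \<Longrightarrow> dist b (inv_into UNIV g b) = dist b (g b)"
  using iso_inv[of g b b] by (simp add: dist_commute)

lemma len_comp: "g \<in> \<Gamma> \<Longrightarrow> dist b ((g \<circ> h) b) \<le> dist b (g b) + dist b (h b)"
  using dist_triangle[of b "g (h b)" "g b"] by simp

lemma dist_orbit: "g \<in> \<Gamma> \<Longrightarrow> dist (g b) (h b) = dist b ((inv_into UNIV g \<circ> h) b)"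
  using iso[of g b "inv_into UNIV g (h b)"] by simp

lemma finite_near: "finite {g \<in> \<Gamma>. dist x (g b) \<le> R}"
proof (rule finite_subset[OF _ finite_ball[of b "dist b x + R"]])
  show "{g \<in> \<Gamma>. dist x (g b) \<le> R} \<subseteq> {g \<in> \<Gamma>. dist b (g b) \<le> dist b x + R}"
  proof clarify
    fix g assume "dist x (g b) \<le> R"
    then show "dist b (g b) \<le> dist b x + R" using dist_triangle[of b "g b" x] by linarith
  qed
qed

lemma card_near: "card {g \<in> \<Gamma>. dist x (g b) \<le> R} \<le> card {g \<in> \<Gamma>. dist b (g b) \<le> 2 * R}"
proof (cases "{g \<in> \<Gamma>. dist x (g b) \<le> R} = {}")
  case False
  then obtain g where g: "g \<in> \<Gamma>" "dist x (g b) \<le> R" by blast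
  show ?thesis
  proof (rule card_inj_on_le)
    show "inj_on (\<lambda>h. inv_into UNIV g \<circ> h) {g \<in> \<Gamma>. dist x (g b) \<le> R}"
      using cancel_left[OF inv_mem[OF g(1)]] by (auto intro: inj_onI)
    show "(\<lambda>h. inv_into UNIV g \<circ> h) ` {g \<in> \<Gamma>. dist x (g b) \<le> R} \<subseteq> {g \<in> \<Gamma>. dist b (g b) \<le> 2 * R}"
    proof clarify
      fix h assume h: "h \<in> \<Gamma>" "dist x (h b) \<le> R"
      have "dist (g b) (h b) \<le> 2 * R" using dist_triangle3[of "g b" "h b" x] g h by simp
      then show "inv_into UNIV g \<circ> h \<in> \<Gamma> \<and> dist b ((inv_into UNIV g \<circ> h) b) \<le> 2 * R"
        using dist_orbit[OF g(1), of b h] comp_mem[OF inv_mem[OF g(1)] h(1)] by simp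
    qed
  qed (rule finite_ball)
next
  case True
  show ?thesis unfolding True by simp
qed

section \<open>Poincare series and the critical exponent\<close>

lemma poincare_shift:
  assumes "poincare_converges \<Gamma> x s" "s \<ge> 0"
  shows "poincare_converges \<Gamma> y s"
proof -
  have "(\<lambda>g. exp (2 * s * dist x y) * exp (- s * dist x (g x))) summable_on \<Gamma>"
    using assms(1) unfolding poincare_converges_def by (rule summable_on_cmult_right)
  moreover have "exp (- s * dist y (g y)) \<le> exp (2 * s * dist x y) * exp (- s * dist x (g x))" if "g \<in> \<Gamma>" for g
  proof -
    have "dist x (g x) \<le> dist y (g y) + 2 * dist x y"
      using dist_triangle[of x "g x" y] dist_triangle[of y "g x" "g y"] iso[OF that, of y x] by (simp add: dist_commute)
    then have "s * dist x (g x) \<le> s * (dist y (g y) + 2 * dist x y)" using assms(2) by (rule mult_left_mono)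
    then show ?thesis by (simp add: algebra_simps flip: exp_add)
  qed
  ultimately show ?thesis unfolding poincare_converges_def
    by (rule summable_on_comparison_test) auto
qed

lemma poincare_mono:
  assumes "poincare_converges \<Gamma> x s" "s \<le> t"
  shows "poincare_converges \<Gamma> x t"
  using assms(1) unfolding poincare_converges_def
proof (rule summable_on_comparison_test)
  fix g show "exp (- t * dist x (g x)) \<le> exp (- s * dist x (g x))"
    using mult_right_mono[OF assms(2), of "dist x (g x)"] by simp
qed simp

text \<open>The definite description denotes the infimum of the convergent exponents. Two distinct
  candidates would be separated by a real exponent at which the series both converges and
  diverges.\<close>

lemma critical_exponentD:
  assumes "critical_exponent \<Gamma> = ereal d"
  shows "0 \<le> d" "d < s \<Longrightarrow> poincare_converges \<Gamma> x s" "0 \<le> s \<Longrightarrow> s < d \<Longrightarrow> \<not> poincare_converges \<Gamma> x s"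
proof -
  define P where "P \<delta> \<longleftrightarrow> 0 \<le> \<delta> \<and> (\<forall>x. \<forall>s\<ge>0. (ereal s > \<delta> \<longrightarrow> poincare_converges \<Gamma> x s) \<and>
                 (ereal s < \<delta> \<longrightarrow> \<not> poincare_converges \<Gamma> x s))" for \<delta>
  define E where "E = {ereal s | s. 0 \<le> s \<and> poincare_converges \<Gamma> pt s}"
  have ex: "P (Inf E)"
    unfolding P_def
  proof (intro conjI allI impI)
    show "0 \<le> Inf E" by (rule Inf_greatest) (auto simp: E_def)
  next
    fix x s assume s: "0 \<le> s" "Inf E < ereal s"
    then obtain t where t: "0 \<le> t" "poincare_converges \<Gamma> pt t" "t < s" by (auto simp: Inf_less_iff E_def)
    have "poincare_converges \<Gamma> pt s" using poincare_mono[OF t(2)] t(3) by simp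
    then show "poincare_converges \<Gamma> x s" using poincare_shift s by blast
  next
    fix x s assume s: "0 \<le> s" "ereal s < Inf E"
    show "\<not> poincare_converges \<Gamma> x s"
    proof
      assume "poincare_converges \<Gamma> x s"
      then have "ereal s \<in> E" using poincare_shift s by (auto simp: E_def)
      then show False using s(2) Inf_lower leD by blast
    qed
  qed
  have uni: "\<not> \<delta> < \<delta>'" if \<delta>: "P \<delta>" "P \<delta>'" for \<delta> \<delta>'
  proof
    assume "\<delta> < \<delta>'"
    then obtain s :: real where s: "\<delta> < ereal s" "ereal s < \<delta>'" using ereal_dense2 by blast
    have "0 \<le> \<delta>" using \<delta>(1) by (simp add: P_def)
    then have "0 \<le> s" using s(1) by (metis ereal_less_eq(5) less_imp_le order_trans)
    then show False using \<delta> s unfolding P_def by blast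
  qed
  have "P (critical_exponent \<Gamma>)"
    unfolding critical_exponent_def P_def[symmetric]
  proof (rule theI)
    show "P (Inf E)" by (rule ex)
    show "\<delta> = Inf E" if "P \<delta>" for \<delta> using uni[OF that ex] uni[OF ex that] by (simp add: not_less)
  qed
  then have "P (ereal d)" using assms by simp
  then show "0 \<le> d" "d < s \<Longrightarrow> poincare_converges \<Gamma> x s" "0 \<le> s \<Longrightarrow> s < d \<Longrightarrow> \<not> poincare_converges \<Gamma> x s"
    by (auto simp: P_def)
qed

end

text \<open>Here \<open>C\<close> abstracts the convex hull: convexity, invariance and cocompactness
  are what the counting uses. As \<open>b\<close> lies in \<open>C\<close>, so does its orbit, and
  points of segments between orbit points are within \<open>D\<close> of the orbit.\<close>

locale cocompact_hull = isom_action pt H for pt :: "'a::metric_space" and H +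
  fixes b :: 'a and C :: "'a set" and D :: real
  assumes b_mem: "b \<in> C"
    and C_between: "x \<in> C \<Longrightarrow> y \<in> C \<Longrightarrow> between x m y \<Longrightarrow> m \<in> C"
    and C_action: "h \<in> H \<Longrightarrow> x \<in> C \<Longrightarrow> h x \<in> C"
    and C_cocompact: "x \<in> C \<Longrightarrow> \<exists>h\<in>H. dist x (h b) \<le> D"
    and unbounded: "\<exists>h\<in>H. R < dist b (h b)"
begin

abbreviation "len h \<equiv> dist b (h b)"

lemma orbit_mem: "h \<in> H \<Longrightarrow> h b \<in> C"
  using C_action b_mem by blast

lemma D_nonneg: "0 \<le> D"
  using C_cocompact[OF b_mem] zero_le_dist order_trans by blast

text \<open>Makes the counting function of the orbit submultiplicative up to constants.\<close>

lemma factorization: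
  assumes w: "w \<in> H" and N: "0 \<le> N" "N \<le> len w"
  obtains h h' where "h \<in> H" "h' \<in> H" "w = h \<circ> h'" "\<bar>len h - N\<bar> \<le> D" "\<bar>len h' - (len w - N)\<bar> \<le> D"
proof -
  obtain m where m: "between b m (w b)" "dist b m = N" using ex_between[OF N] by blast
  have "m \<in> C" using C_between[OF b_mem orbit_mem[OF w] m(1)] .
  then obtain h where h: "h \<in> H" "dist m (h b) \<le> D" using C_cocompact by blast
  define h' where "h' = inv_into UNIV h \<circ> w"
  have h': "h' \<in> H" unfolding h'_def by (intro comp_mem inv_mem h w)
  have "w = h \<circ> h'" using h(1) by (auto simp: h'_def)
  moreover have "\<bar>len h - N\<bar> \<le> D"
    using abs_dist_diff_le[of "h b" b m] m(2) h(2) by (simp add: dist_commute)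
  moreover have "len h' = dist (h b) (w b)" unfolding h'_def using dist_orbit[OF h(1)] by simp
  moreover have "\<bar>dist (h b) (w b) - dist m (w b)\<bar> \<le> D"
    using abs_dist_diff_le[of "h b" "w b" m] h(2) by (simp add: dist_commute)
  moreover have "dist m (w b) = len w - N" using m by (simp add: between_def)
  ultimately show ?thesis using that[OF h(1) h'] by simp
qed

section \<open>Lower bound for the number of elements in an annulus\<close>

definition S :: "real \<Rightarrow> real \<Rightarrow> real" where
  "S s T = (\<Sum>h | h \<in> H \<and> len h \<le> T. exp (- s * len h))"

lemma poincare_S_bounded:
  assumes "\<And>T. S s T \<le> K"
  shows "poincare_converges H b s"
  unfolding poincare_converges_def
proof (rule nonneg_bdd_above_summable_on)
  show "bdd_above (sum (\<lambda>h. exp (- s * len h)) ` {F. F \<subseteq> H \<and> finite F})"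
  proof (rule bdd_aboveI2)
    fix F assume F: "F \<in> {F. F \<subseteq> H \<and> finite F}"
    define T where "T = Max (insert 0 (len ` F))"
    have "sum (\<lambda>h. exp (- s * len h)) F \<le> S s T"
      unfolding S_def by (rule sum_mono2) (use F finite_ball in \<open>auto simp: T_def\<close>)
    then show "sum (\<lambda>h. exp (- s * len h)) F \<le> K" using assms[of T] by simp
  qed
qed simp

text \<open>If the annulus \<open>A\<close> is sparse, its part \<open>Q\<close> of the series is at
  most \<open>exp (- 2 * D * s) / 2\<close>. Every word longer than \<open>N\<close> factors with
  first factor in \<open>A\<close>, at the cost of \<open>exp (2 * D * s)\<close>; hence
  \<open>S s T \<le> S s N + S s T / 2\<close>, and the series converges. The \<open>3 * D\<close>
  collects \<open>D\<close> from the width of \<open>A\<close> and \<open>2 * D\<close> from the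
  factorization.\<close>

lemma card_annulus_lower_aux:
  assumes s: "0 \<le> s" and div: "\<not> poincare_converges H b s" and N: "0 \<le> N"
  shows "exp (s * (N - 3 * D)) / 2 \<le> real (card {h \<in> H. \<bar>len h - N\<bar> \<le> D})"
proof (rule ccontr)
  define A where "A = {h \<in> H. \<bar>len h - N\<bar> \<le> D}"
  define Q where "Q = (\<Sum>h\<in>A. exp (- s * len h))"
  have finA: "finite A"
    by (rule finite_subset[OF _ finite_ball[of b "N + D"]]) (auto simp: A_def)
  assume "\<not> ?thesis"
  then have lt: "real (card A) < exp (s * (N - 3 * D)) / 2" by (simp add: A_def)
  have "Q \<le> real (card A) * exp (- s * (N - D))"
    unfolding Q_def
  proof (rule sum_bounded_above)
    fix h assume "h \<in> A"
    then have "N - D \<le> len h" by (auto simp: A_def)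
    then have "s * (N - D) \<le> s * len h" using s by (rule mult_left_mono)
    then show "exp (- s * len h) \<le> exp (- s * (N - D))" by simp
  qed
  also have "\<dots> \<le> exp (s * (N - 3 * D)) / 2 * exp (- s * (N - D))"
    using lt by (intro mult_right_mono) auto
  also have "\<dots> = exp (- 2 * D * s) / 2" by (simp add: algebra_simps flip: exp_add)
  finally have Q: "exp (2 * D * s) * Q \<le> 1 / 2"
    by (simp add: exp_minus field_simps)
  have "S s T \<le> 2 * S s N" for T
  proof -
    \<comment> \<open>Makes the second factor no longer than \<open>w\<close>, so that it is counted
      by \<open>S s T\<close>. If \<open>N \<le> D\<close>, the identity alone makes
      \<open>A\<close> large enough.\<close>
    have ND: "N > D"
    proof (rule ccontr)
      assume "\<not> N > D"
      then have "id \<in> A" using N id_mem by (simp add: A_def)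
      then have "card A \<ge> 1" using finA by (auto simp: Suc_le_eq card_gt_0_iff)
      moreover have "exp (s * (N - 3 * D)) \<le> 1"
        using \<open>\<not> N > D\<close> s D_nonneg by (simp add: mult_nonneg_nonpos)
      ultimately show False using lt by simp
    qed
    define E where "E = {w \<in> H. len w \<le> T \<and> \<not> len w \<le> N}"
    have finE: "finite E" by (rule finite_subset[OF _ finite_ball[of b T]]) (auto simp: E_def)
    have finT: "finite {h \<in> H. len h \<le> T}" by (rule finite_ball)
    have "\<forall>w\<in>E. \<exists>h h'. h \<in> A \<and> h' \<in> H \<and> len h' \<le> T \<and> w = h \<circ> h' \<and> len h + len h' \<le> len w + 2 * D"
    proof
      fix w assume "w \<in> E"
      then have w: "w \<in> H" "len w \<le> T" "N \<le> len w" by (auto simp: E_def)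
      obtain h h' where "h \<in> H" "h' \<in> H" "w = h \<circ> h'" "\<bar>len h - N\<bar> \<le> D" "\<bar>len h' - (len w - N)\<bar> \<le> D"
        using factorization[OF w(1) N w(3)] by blast
      then show "\<exists>h h'. h \<in> A \<and> h' \<in> H \<and> len h' \<le> T \<and> w = h \<circ> h' \<and> len h + len h' \<le> len w + 2 * D"
        using w(2) ND by (intro exI[of _ h] exI[of _ h']) (auto simp: A_def)
    qed
    then obtain p q where pq: "\<And>w. w \<in> E \<Longrightarrow> p w \<in> A \<and> q w \<in> H \<and> len (q w) \<le> T \<and> w = p w \<circ> q w \<and>
        len (p w) + len (q w) \<le> len w + 2 * D" by metis
    have inj: "inj_on (\<lambda>w. (p w, q w)) E" by (rule inj_onI) (metis pq Pair_inject)
    have "(\<Sum>w\<in>E. exp (- s * len w)) \<le> (\<Sum>w\<in>E. exp (2 * D * s) * (exp (- s * len (p w)) * exp (- s * len (q w))))"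
    proof (rule sum_mono)
      fix w assume "w \<in> E"
      then have "s * (len (p w) + len (q w)) \<le> s * (len w + 2 * D)" using pq s by (intro mult_left_mono) auto
      then show "exp (- s * len w) \<le> exp (2 * D * s) * (exp (- s * len (p w)) * exp (- s * len (q w)))"
        by (simp add: algebra_simps flip: exp_add)
    qed
    also have "\<dots> = exp (2 * D * s) * (\<Sum>z\<in>(\<lambda>w. (p w, q w)) ` E. exp (- s * len (fst z)) * exp (- s * len (snd z)))"
      by (simp add: sum.reindex[OF inj] sum_distrib_left o_def)
    also have "\<dots> \<le> exp (2 * D * s) * (\<Sum>z\<in>A \<times> {h \<in> H. len h \<le> T}. exp (- s * len (fst z)) * exp (- s * len (snd z)))"
      using finA finT pq by (intro mult_left_mono sum_mono2) auto
    also have "\<dots> = exp (2 * D * s) * Q * S s T"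
      by (simp add: Q_def S_def sum_product sum.cartesian_product split_def)
    also have "\<dots> \<le> 1 / 2 * S s T"
      by (intro mult_right_mono Q) (auto simp: S_def intro: sum_nonneg)
    finally have E: "(\<Sum>w\<in>E. exp (- s * len w)) \<le> S s T / 2" by simp
    have "S s T \<le> (\<Sum>w\<in>{h \<in> H. len h \<le> N} \<union> E. exp (- s * len w))"
      unfolding S_def using finE finite_ball by (intro sum_mono2) (auto simp: E_def)
    also have "\<dots> = S s N + (\<Sum>w\<in>E. exp (- s * len w))"
      unfolding S_def by (intro sum.union_disjoint finE finite_ball) (auto simp: E_def)
    finally show ?thesis using E by simp
  qed
  then have "poincare_converges H b s" by (rule poincare_S_bounded)
  then show False using div by simp
qed

lemma not_poincare_0: "\<not> poincare_converges H b 0"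
proof
  assume "poincare_converges H b 0"
  then have "(\<lambda>h. 1::real) summable_on H" by (simp add: poincare_converges_def)
  then have "real (card F) \<le> (\<Sum>\<^sub>\<infinity>h\<in>H. 1::real)" if "F \<subseteq> H" "finite F" for F
    using finite_sum_le_infsum[of "\<lambda>_. 1::real" H F] that by simp
  then have "card F \<le> nat \<lceil>\<Sum>\<^sub>\<infinity>h\<in>H. 1::real\<rceil>" if "F \<subseteq> H" "finite F" for F
    using that by (smt (verit) of_nat_le_iff real_nat_ceiling_ge)
  then have "finite H" using finite_if_finite_subsets_card_bdd[of H] by blast
  then have "finite (len ` H)" by simp
  then obtain R where "\<forall>h\<in>H. len h \<le> R" by (meson finite_imageI Max_ge image_eqI)
  then show False using unbounded[of R] by (meson not_le)
qed

text \<open>Divergence is known strictly below \<open>d\<close>, so the bound is taken to the limit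
  from the left. For \<open>d = 0\<close> no such \<open>s\<close> is available; divergence at 0
  comes from the infinity of \<open>H\<close>.\<close>

lemma card_annulus_lower:
  assumes crit: "critical_exponent H = ereal d" and N: "0 \<le> N"
  shows "exp (d * (N - 3 * D)) / 2 \<le> real (card {h \<in> H. \<bar>len h - N\<bar> \<le> D})"
proof (cases "d = 0")
  case True
  then show ?thesis using card_annulus_lower_aux[OF _ not_poincare_0 N] by simp
next
  case False
  have d: "0 < d" using critical_exponentD(1)[OF crit] False by simp
  have "((\<lambda>s. exp (s * (N - 3 * D)) / 2) \<longlongrightarrow> exp (d * (N - 3 * D)) / 2) (at_left d)"
    by (intro tendsto_intros) auto
  moreover have "\<forall>\<^sub>F s in at_left d. exp (s * (N - 3 * D)) / 2 \<le> real (card {h \<in> H. \<bar>len h - N\<bar> \<le> D})"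
    using eventually_at_left_real[OF d]
    by eventually_elim (use critical_exponentD(3)[OF crit] card_annulus_lower_aux N in auto)
  ultimately show ?thesis by (rule tendsto_upperbound) simp
qed

text \<open>Products \<open>h f h'\<close> with \<open>h'\<close> in the annulus and a suitable
  \<open>f\<close> in \<open>F\<close> have nearly additive length and boundedly many
  representations. For \<open>s > d\<close>, the total series times the annulus sum is therefore at
  most a constant times the total series. Cancelling bounds the annulus sum by a constant that
  survives the limit \<open>s\<close> to \<open>d\<close>.\<close>

lemma card_annulus_upper_spread:
  assumes crit: "critical_exponent H = ereal d"
    and F: "finite F" "F \<subseteq> H" "\<And>h h'. h \<in> H \<Longrightarrow> h' \<in> H \<Longrightarrow> \<exists>f\<in>F. len h + len h' - c \<le> len (h \<circ> f \<circ> h')"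
  shows "\<exists>K. \<forall>N\<ge>0. real (card {h \<in> H. N \<le> len h \<and> len h \<le> N + 1}) \<le> K * exp (d * N)"
proof -
  define cF where "cF = Max (insert 0 (len ` F))"
  have cF: "len f \<le> cF" if "f \<in> F" for f using that F(1) by (simp add: cF_def)
  have cF0: "cF \<ge> 0" using F(1) by (simp add: cF_def)
  define R where "R = \<bar>c\<bar> + cF + 3"
  define M where "M = card {g \<in> H. len g \<le> 2 * R} * card F"
  have F0: "F \<noteq> {}" using F(3)[OF id_mem id_mem] by blast
  have main: "real (card {h \<in> H. N \<le> len h \<and> len h \<le> N + 1}) \<le> real M * exp (s * (cF + 1)) * exp (s * N)"
    if N: "0 \<le> N" and s: "d < s" for N s
  proof -
    have s0: "0 \<le> s" using critical_exponentD(1)[OF crit] s by simp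
    define B where "B = {h \<in> H. N \<le> len h \<and> len h \<le> N + 1}"
    have finB: "finite B" by (rule finite_subset[OF _ finite_ball[of b "N + 1"]]) (auto simp: B_def)
    define f where "f h = exp (- s * len h)" for h :: "'a \<Rightarrow> 'a"
    have f0: "f h > 0" for h by (simp add: f_def)
    have summ: "f summable_on H" using critical_exponentD(2)[OF crit s, of b] by (simp add: poincare_converges_def f_def[abs_def])
    define \<Sigma> where "\<Sigma> = infsum f H"
    obtain \<kappa> where \<kappa>: "\<And>h h'. h \<in> H \<Longrightarrow> h' \<in> H \<Longrightarrow> \<kappa> h h' \<in> F \<and> len h + len h' - c \<le> len (h \<circ> \<kappa> h h' \<circ> h')"
      using F(3) by metis
    define \<phi> where "\<phi> z = fst z \<circ> \<kappa> (fst z) (snd z) \<circ> snd z" for z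
    have fin_le: "sum f E * sum f B \<le> real M * exp (s * cF) * \<Sigma>" if E: "finite E" "E \<subseteq> H" for E
    proof -
      have mem: "\<phi> z \<in> H" if "z \<in> E \<times> B" for z
      proof -
        have "fst z \<in> H" "snd z \<in> H" using that E by (auto simp: B_def)
        moreover from this have "\<kappa> (fst z) (snd z) \<in> H" using \<kappa> F(2) by blast
        ultimately show ?thesis unfolding \<phi>_def by (intro comp_mem)
      qed
      have "sum f E * sum f B = (\<Sum>z\<in>E \<times> B. f (fst z) * f (snd z))"
        by (simp add: sum_product sum.cartesian_product split_def)
      also have "\<dots> \<le> real M * (\<Sum>w\<in>\<phi> ` (E \<times> B). exp (s * cF) * f w)"
      proof (rule sum_le_fibres)
        show "finite (E \<times> B)" using E finB by simp
        show "0 \<le> exp (s * cF) * f w" for w by (simp add: f_def)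
        show "f (fst z) * f (snd z) \<le> exp (s * cF) * f (\<phi> z)" if "z \<in> E \<times> B" for z
        proof -
          obtain h h' where z: "z = (h, h')" "h \<in> H" "h' \<in> H" using \<open>z \<in> E \<times> B\<close> E by (auto simp: B_def)
          have k: "\<kappa> h h' \<in> F" using \<kappa> z by blast
          have "len (h \<circ> (\<kappa> h h' \<circ> h')) \<le> len h + (len (\<kappa> h h') + len h')"
            using len_comp[OF z(2), of b "\<kappa> h h' \<circ> h'"] len_comp[of "\<kappa> h h'" b h'] k F(2) by fastforce
          then have "len (\<phi> z) \<le> len h + cF + len h'" using cF[OF k] z by (simp add: \<phi>_def o_assoc)
          then have "s * len (\<phi> z) \<le> s * (len h + cF + len h')" using s0 by (rule mult_left_mono)
          then show ?thesis using z by (simp add: f_def algebra_simps flip: exp_add)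
        qed
        fix w assume "w \<in> \<phi> ` (E \<times> B)"
        then have w: "w \<in> H" using mem by blast
        \<comment> \<open>Since \<open>h'\<close> has length about \<open>N\<close>, the point
          \<open>h b\<close> must lie near the point of the segment at distance \<open>N\<close>
          from \<open>w b\<close>; the minimum covers the case of a shorter
          \<open>w\<close>.\<close>
        obtain m where m: "between (w b) m b" "dist (w b) m = min N (len w)"
          using ex_between[of "min N (len w)" "w b" b] N by (auto simp: dist_commute)
        have dm: "dist b m = len w - min N (len w)" using m by (simp add: between_def dist_commute)
        have near: "dist m (h b) \<le> R \<and> h' = inv_into UNIV (\<kappa> h h') \<circ> (inv_into UNIV h \<circ> w)"
          if z: "(h, h') \<in> E \<times> B" "\<phi> (h, h') = w" for h h'
        proof -
          have hh: "h \<in> H" "h' \<in> H" "N \<le> len h'" "len h' \<le> N + 1" using z E by (auto simp: B_def)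
          have k: "\<kappa> h h' \<in> F" "\<kappa> h h' \<in> H" "len h + len h' - c \<le> len w" using \<kappa>[OF hh(1,2)] F(2) z(2) by (auto simp: \<phi>_def)
          have weq: "w = h \<circ> (\<kappa> h h' \<circ> h')" using z(2) by (simp add: \<phi>_def o_assoc)
          have "dist (h b) (w b) = len (\<kappa> h h' \<circ> h')" unfolding weq using hh(1) by simp
          also have "\<dots> \<le> cF + (N + 1)" using len_comp[OF k(2), of b h'] cF[OF k(1)] hh(4) by simp
          finally have 1: "dist (h b) (w b) \<le> cF + N + 1" by simp
          have "dist (h b) m \<le> max (dist (h b) (w b) - dist (w b) m) (dist (h b) b - dist m b) + 2"
            by (rule thin[OF m(1)])
          moreover have "dist (h b) b - dist m b \<le> R - 2"
            using dm k(3) hh(3) cF0 by (auto simp: dist_commute R_def)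
          moreover have "dist (h b) (w b) - dist (w b) m \<le> R - 2"
          proof (cases "N \<le> len w")
            case True
            then show ?thesis using 1 m(2) by (simp add: R_def)
          next
            case False
            have "dist (h b) (w b) \<le> len h + len w" using dist_triangle[of "h b" "w b" b] by (simp add: dist_commute)
            then show ?thesis using False m(2) k(3) hh(3) cF0 by (simp add: R_def)
          qed
          ultimately have "dist m (h b) \<le> R" by (simp add: dist_commute)
          moreover have "h' = inv_into UNIV (\<kappa> h h') \<circ> (inv_into UNIV h \<circ> w)"
            unfolding weq using hh(1) k(2) by (auto simp: fun_eq_iff)
          ultimately show ?thesis by blast
        qed
        \<comment> \<open>Given \<open>w\<close>, a pair is determined by \<open>h\<close> and the
          connecting element, and \<open>h b\<close> is confined to a ball around
          \<open>m\<close>.\<close>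
        have "card {z \<in> E \<times> B. \<phi> z = w} \<le> card ({g \<in> H. dist m (g b) \<le> R} \<times> F)"
        proof (rule card_inj_on_le)
          show "inj_on (\<lambda>z. (fst z, \<kappa> (fst z) (snd z))) {z \<in> E \<times> B. \<phi> z = w}"
            by (rule inj_onI) (clarsimp, metis mem_Sigma_iff near)
          show "(\<lambda>z. (fst z, \<kappa> (fst z) (snd z))) ` {z \<in> E \<times> B. \<phi> z = w} \<subseteq> {g \<in> H. dist m (g b) \<le> R} \<times> F"
          proof (rule image_subsetI)
            fix z assume "z \<in> {z \<in> E \<times> B. \<phi> z = w}"
            then obtain h h' where z: "z = (h, h')" "(h, h') \<in> E \<times> B" "\<phi> (h, h') = w" by (cases z) auto
            then have "h \<in> H" "h' \<in> H" using E by (auto simp: B_def)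
            then show "(fst z, \<kappa> (fst z) (snd z)) \<in> {g \<in> H. dist m (g b) \<le> R} \<times> F"
              using near[OF z(2,3)] \<kappa>[of h h'] z(1) by auto
          qed
          show "finite ({g \<in> H. dist m (g b) \<le> R} \<times> F)" using F(1) finite_near by simp
        qed
        also have "\<dots> \<le> M" unfolding M_def card_cartesian_product by (intro mult_right_mono card_near) simp
        finally show "real (card {z \<in> E \<times> B. \<phi> z = w}) \<le> real M" by simp
      qed
      also have "\<dots> = real M * exp (s * cF) * sum f (\<phi> ` (E \<times> B))" by (simp add: sum_distrib_left mult.assoc)
      also have "\<dots> \<le> real M * exp (s * cF) * \<Sigma>"
        unfolding \<Sigma>_def using E finB mem f0
        by (intro mult_left_mono finite_sum_le_infsum summ) (auto intro: less_imp_le)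
      finally show ?thesis .
    qed
    have \<Sigma>1: "1 \<le> \<Sigma>"
      using finite_sum_le_infsum[OF summ, of "{id}"] f0 id_mem by (auto simp: \<Sigma>_def f_def intro: less_imp_le)
    \<comment> \<open>The total series cancels: it is finite and at least 1, and its growth as
      \<open>s\<close> approaches \<open>d\<close> does not enter the bound.\<close>
    have B_le: "sum f B \<le> real M * exp (s * cF)"
    proof (cases "sum f B = 0")
      case False
      then have B0: "sum f B > 0" using f0 by (metis less_eq_real_def sum_nonneg)
      have "\<Sigma> \<le> real M * exp (s * cF) * \<Sigma> / sum f B"
        unfolding \<Sigma>_def
      proof (rule infsum_le_finite_sums[OF summ])
        fix E assume "finite E" "E \<subseteq> H"
        from fin_le[OF this] show "sum f E \<le> real M * exp (s * cF) * infsum f H / sum f B"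
          using B0 by (simp add: field_simps \<Sigma>_def)
      qed
      then have "\<Sigma> * sum f B \<le> \<Sigma> * (real M * exp (s * cF))" using B0 by (simp add: field_simps)
      then show ?thesis using \<Sigma>1 by simp
    qed simp
    have "real (card B) * exp (- s * (N + 1)) \<le> sum f B"
    proof (rule sum_bounded_below)
      fix h assume "h \<in> B"
      then have "s * len h \<le> s * (N + 1)" using s0 by (intro mult_left_mono) (auto simp: B_def)
      then show "exp (- s * (N + 1)) \<le> f h" by (simp add: f_def)
    qed
    with B_le have "real (card B) * exp (- s * (N + 1)) \<le> real M * exp (s * cF)" by simp
    then have "real (card B) * (exp (- s * (N + 1)) * exp (s * (N + 1))) \<le> real M * (exp (s * cF) * exp (s * (N + 1)))"
      unfolding mult.assoc[symmetric] by (rule mult_right_mono) simp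
    then show ?thesis by (simp add: B_def algebra_simps mult_exp_exp)
  qed
  have "real (card {h \<in> H. N \<le> len h \<and> len h \<le> N + 1}) \<le> real M * exp (d * (cF + 1)) * exp (d * N)" if "0 \<le> N" for N
  proof (rule tendsto_lowerbound)
    show "((\<lambda>s. real M * exp (s * (cF + 1)) * exp (s * N)) \<longlongrightarrow> real M * exp (d * (cF + 1)) * exp (d * N)) (at_right d)"
      by (intro tendsto_intros)
    show "\<forall>\<^sub>F s in at_right d. real (card {h \<in> H. N \<le> len h \<and> len h \<le> N + 1}) \<le> real M * exp (s * (cF + 1)) * exp (s * N)"
      unfolding eventually_at_right_field by (rule exI[of _ "d + 1"]) (use main[OF that] in auto)
  qed simp
  then show ?thesis by blast
qed

text \<open>Growth is bounded above either by means of a finite set that spreads products apart or, in its absence,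
  by means of the Busemann function of a fixed point at infinity.\<close>

lemma ex_fixed_point:
  assumes no: "\<And>F c. finite F \<Longrightarrow> F \<subseteq> H \<Longrightarrow> \<exists>h\<in>H. \<exists>h'\<in>H. \<forall>f\<in>F. len (h \<circ> f \<circ> h') < len h + len h' - c"
  obtains \<zeta> where "\<zeta> \<in> boundary" "\<forall>h\<in>H. boundary_action h \<zeta> = \<zeta>"
    "\<forall>u\<ge>0. \<exists>k\<in>H. dist (ray_to b \<zeta> u) (k b) \<le> D + 1"
proof -
  have "\<forall>n::nat. \<exists>h h'. h \<in> H \<and> h' \<in> H \<and> (\<forall>f\<in>H. len f \<le> real n \<longrightarrow> len (h \<circ> f \<circ> h') < len h + len h' - 2 * real n)"
  proof
    fix n :: nat
    show "\<exists>h h'. h \<in> H \<and> h' \<in> H \<and> (\<forall>f\<in>H. len f \<le> real n \<longrightarrow> len (h \<circ> f \<circ> h') < len h + len h' - 2 * real n)"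
      using no[OF finite_ball[of b "real n"], of "2 * real n"] by blast
  qed
  then obtain p q where pq: "\<And>n. p n \<in> H" "\<And>n. q n \<in> H"
    and short: "\<And>n f. f \<in> H \<Longrightarrow> len f \<le> real n \<Longrightarrow> len (p n \<circ> f \<circ> q n) < len (p n) + len (q n) - 2 * real n"
    by metis
  \<comment> \<open>In terms of \<open>y\<close> and \<open>z\<close>, the shortness of the products
    says that the Gromov product of \<open>y n\<close> and \<open>f (z n)\<close> at
    \<open>b\<close> exceeds \<open>n\<close> minus half the length of \<open>f\<close>. Hence the
    segments from \<open>b\<close> to \<open>z n\<close> and to \<open>f (z n)\<close> share a long
    initial piece.\<close>
  define y where "y n = inv_into UNIV (p n) b" for n
  define z where "z n = q n b" for n
  have ly: "dist b (y n) = len (p n)" for n unfolding y_def by (rule len_inv[OF pq(1)])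
  have yz: "dist (y n) (f (z n)) < dist b (y n) + dist b (z n) - 2 * real n" if "f \<in> H" "len f \<le> real n" for n f
  proof -
    have "dist (y n) (f (z n)) = len (p n \<circ> f \<circ> q n)" by (simp add: y_def z_def iso_inv pq)
    then show ?thesis using short[OF that] by (simp add: ly) (simp add: z_def)
  qed
  have yz0: "dist (y n) (z n) < dist b (y n) + dist b (z n) - 2 * real n" for n
    using yz[OF id_mem, of n] by simp
  have big: "real n < dist b (y n)" "real n < dist b (z n)" for n
    using yz0[of n] dist_triangle[of b "y n" "z n"] dist_triangle[of b "z n" "y n"] dist_commute[of "z n" "y n"] by linarith+
  define c where "c n = gen_ray b (Inl (z n))" for n
  have cb: "between b (c n t) (z n)" "dist b (c n t) = t" if "0 \<le> t" "t \<le> real n" for n t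
    using gen_ray_Inl_between[of t b "z n"] that big(2)[of n] by (auto simp: c_def)
  have iso_c: "dist (c n s) (c n t) = \<bar>s - t\<bar>" if "0 \<le> s" "s \<le> dist b (z n)" "0 \<le> t" "t \<le> dist b (z n)" for n s t
    using gen_ray_Inl(1)[of b "z n"] that by (auto simp: geodesic_segment_def c_def)
  have clamp: "c n t = c n (max 0 (min t (dist b (z n))))" for n t
    using gen_ray_Inl(2)[of t b "z n"] gen_ray_Inl(2)[of 0 b "z n"] gen_ray_Inl(3)[of b "z n" t] gen_ray_Inl(3)[of b "z n" "dist b (z n)"]
    by (auto simp: c_def max_def min_def)
  have lip: "dist (c n s) (c n t) \<le> \<bar>s - t\<bar>" for n s t
  proof -
    have "dist (c n s) (c n t) = \<bar>max 0 (min s (dist b (z n))) - max 0 (min t (dist b (z n)))\<bar>"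
      by (subst clamp, subst (2) clamp) (rule iso_c, auto)
    then show ?thesis by (auto simp: max_def min_def abs_if split: if_splits)
  qed
  have "dist b (c n 0) \<le> 0" for n by (simp add: c_def gen_ray_Inl(2))
  with lip obtain \<phi> \<rho> where \<phi>: "strict_mono \<phi>" and lim: "\<forall>t. (\<lambda>n. c (\<phi> n) t) \<longlonglongrightarrow> \<rho> t"
    by (rule lipschitz_subsequence)
  have "\<forall>\<^sub>F n in sequentially. t \<le> real n" for t by real_asymp
  then have large: "\<forall>\<^sub>F n in sequentially. t \<le> real (\<phi> n)" for t
    using filterlim_subseq[OF \<phi>] unfolding filterlim_iff by blast
  have ray: "\<rho> \<in> geodesic_rays"
    unfolding geodesic_rays_def
  proof (intro CollectI allI impI)
    fix s t :: real assume st: "0 \<le> s" "0 \<le> t"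
    have "(\<lambda>n. dist (c (\<phi> n) s) (c (\<phi> n) t)) \<longlonglongrightarrow> dist (\<rho> s) (\<rho> t)" using lim by (intro tendsto_dist) auto
    moreover have "\<forall>\<^sub>F n in sequentially. dist (c (\<phi> n) s) (c (\<phi> n) t) = \<bar>s - t\<bar>"
      using large[of s] large[of t]
    proof eventually_elim
      case (elim n)
      then show ?case using big(2)[of "\<phi> n"] st by (intro iso_c) auto
    qed
    then have "(\<lambda>n. dist (c (\<phi> n) s) (c (\<phi> n) t)) \<longlonglongrightarrow> \<bar>s - t\<bar>" by (rule tendsto_eventually)
    ultimately show "dist (\<rho> s) (\<rho> t) = \<bar>s - t\<bar>" by (rule LIMSEQ_unique)
  qed
  define \<zeta> where "\<zeta> = asymptotic `` {\<rho>}"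
  have \<zeta>: "\<zeta> \<in> boundary" "\<rho> \<in> \<zeta>" using asymptotic_class[OF ray] by (auto simp: \<zeta>_def)
  have fixed: "boundary_action f \<zeta> = \<zeta>" if f: "f \<in> H" for f
  proof (rule boundary_eqI[OF action(1)[OF f \<zeta>(1)] \<zeta>(1) action(2)[OF f \<zeta>] \<zeta>(2)], rule asymptotic_sym)
    show "(\<rho>, f \<circ> \<rho>) \<in> asymptotic"
    proof (rule asymptoticI[OF ray, of _ "len f + 6"])
      show "f \<circ> \<rho> \<in> geodesic_rays" using ray f by (simp add: geodesic_rays_def)
      fix u :: real assume u: "0 \<le> u"
      have "(\<lambda>n. dist (c (\<phi> n) u) (f (c (\<phi> n) u))) \<longlonglongrightarrow> dist (\<rho> u) (f (\<rho> u))"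
      proof (intro tendsto_dist)
        show "(\<lambda>n. c (\<phi> n) u) \<longlonglongrightarrow> \<rho> u" using lim by blast
        moreover have "isCont f (\<rho> u)" using continuous_elem[OF f] by (simp add: continuous_on_eq_continuous_at)
        ultimately show "(\<lambda>n. f (c (\<phi> n) u)) \<longlonglongrightarrow> f (\<rho> u)" by (rule isCont_tendsto_compose[rotated])
      qed
      moreover have "\<forall>\<^sub>F n in sequentially. dist (c (\<phi> n) u) (f (c (\<phi> n) u)) \<le> len f + 6"
        using large[of "u + len f"]
      proof eventually_elim
        case (elim n')
        define n where "n = \<phi> n'"
        have n: "u + len f \<le> real n" "len f \<le> real n" "u \<le> real n" using elim u zero_le_dist[of b "f b"] by (auto simp: n_def simp del: zero_le_dist)
        \<comment> \<open>The points \<open>m\<close>, \<open>m2\<close>, \<open>m3\<close> lie at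
          distance \<open>u\<close> from \<open>b\<close> on the segments to \<open>z n\<close>,
          \<open>y n\<close> and \<open>f (z n)\<close>; consecutive ones are within 2. Thinness of
          the translated segment then compares \<open>m3\<close> with \<open>f m\<close>.\<close>
        define m where "m = c n u"
        have m: "between b m (z n)" "dist b m = u" unfolding m_def using cb[OF u n(3)] by auto
        obtain m2 where m2: "between b m2 (y n)" "dist b m2 = u" using ex_between[OF u, of b "y n"] big(1)[of n] n by auto
        have lfz: "dist b (z n) - len f \<le> dist b (f (z n))" "dist b (f (z n)) \<le> dist b (z n) + len f"
          using dist_triangle[of "f b" "f (z n)" b] dist_triangle[of b "f (z n)" "f b"] f by (auto simp: dist_commute)
        obtain m3 where m3: "between b m3 (f (z n))" "dist b m3 = u"
          using ex_between[OF u, of b "f (z n)"] lfz big(2)[of n] n by auto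
        have "dist m m2 \<le> 2 * exp (u + (dist (z n) (y n) - dist b (z n) - dist b (y n)) / 2)"
          by (rule thin_dist[OF m(1) m2(1) m(2) m2(2)])
        also have "\<dots> \<le> 2 * exp 0" using yz0[of n] n(3) by (simp add: dist_commute field_simps)
        finally have 1: "dist m m2 \<le> 2" by simp
        have "dist m2 m3 \<le> 2 * exp (u + (dist (y n) (f (z n)) - dist b (y n) - dist b (f (z n))) / 2)"
          by (rule thin_dist[OF m2(1) m3(1) m2(2) m3(2)])
        also have "\<dots> \<le> 2 * exp 0" using yz[OF f n(2)] n(1) lfz zero_le_dist[of b "f b"] by (simp add: field_simps del: zero_le_dist)
        finally have 2: "dist m2 m3 \<le> 2" by simp
        have fm: "between (f b) (f m) (f (z n))" using m(1) f by (simp add: between_def)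
        have "dist m3 (f m) \<le> max (dist m3 (f b) - dist (f b) (f m)) (dist m3 (f (z n)) - dist (f m) (f (z n))) + 2"
          by (rule thin[OF fm])
        moreover have "dist m3 (f b) \<le> u + len f" using dist_triangle[of m3 "f b" b] m3(2) by (simp add: dist_commute)
        moreover have "dist (f b) (f m) = u" using m(2) f by simp
        moreover have "dist m3 (f (z n)) = dist b (f (z n)) - u" using m3 by (simp add: between_def)
        moreover have "dist (f m) (f (z n)) = dist b (z n) - u" using m f by (simp add: between_def)
        ultimately have 3: "dist m3 (f m) \<le> len f + 2" using lfz by linarith
        have "dist m (f m) \<le> dist m m2 + dist m2 m3 + dist m3 (f m)"
          using dist_triangle[of m "f m" m2] dist_triangle[of m2 "f m" m3] by linarith
        then show ?case using 1 2 3 by (simp add: m_def n_def)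
      qed
      ultimately show "dist (\<rho> u) ((f \<circ> \<rho>) u) \<le> len f + 6" unfolding o_apply by (rule tendsto_upperbound) simp
    qed
  qed
  have near: "\<exists>k\<in>H. dist (ray_to b \<zeta> u) (k b) \<le> D + 1" if u: "0 \<le> u" for u
  proof -
    have "(\<lambda>n. c (\<phi> n) 0) \<longlonglongrightarrow> \<rho> 0" using lim by blast
    then have "(\<lambda>n. b) \<longlonglongrightarrow> \<rho> 0" by (simp add: c_def gen_ray_Inl(2))
    then have "\<rho> 0 = b" by (simp add: tendsto_const_iff)
    then have eq: "ray_to b \<zeta> u = \<rho> u" using ray_to_eqI[OF \<zeta>, of b u] u by simp
    have "(\<lambda>n. c (\<phi> n) u) \<longlonglongrightarrow> \<rho> u" using lim by blast
    then have "\<forall>\<^sub>F n in sequentially. dist (c (\<phi> n) u) (\<rho> u) < 1" by (rule tendstoD) simp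
    with large[of u] have "\<forall>\<^sub>F n in sequentially. dist (c (\<phi> n) u) (\<rho> u) < 1 \<and> u \<le> real (\<phi> n)"
      by eventually_elim simp
    then obtain n where n: "dist (c (\<phi> n) u) (\<rho> u) < 1" "u \<le> real (\<phi> n)"
      using eventually_happens'[OF sequentially_bot] by blast
    have "c (\<phi> n) u \<in> C"
      by (rule C_between[OF b_mem orbit_mem[OF pq(2)] cb(1)[OF u n(2), unfolded z_def]])
    then obtain k where "k \<in> H" "dist (c (\<phi> n) u) (k b) \<le> D" using C_cocompact by blast
    then show ?thesis using n(1) dist_triangle3[of "\<rho> u" "k b" "c (\<phi> n) u"] eq by (intro bexI[of _ k]) auto
  qed
  show ?thesis
  proof (rule that[OF \<zeta>(1)])
    show "\<forall>h\<in>H. boundary_action h \<zeta> = \<zeta>" using fixed by blast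
    show "\<forall>u\<ge>0. \<exists>k\<in>H. dist (ray_to b \<zeta> u) (k b) \<le> D + 1" using near by blast
  qed
qed

text \<open>As \<open>\<zeta>\<close> is fixed, \<open>B\<close> is a homomorphism to the reals.
  Elements with \<open>B\<close> in a bounded window bring far points of the ray close together, so
  they are boundedly many; and the length of an element is the absolute value of \<open>B\<close> up
  to a constant, so two windows cover an annulus.\<close>

lemma card_annulus_upper_fixed:
  assumes \<zeta>: "\<zeta> \<in> boundary" and fx: "\<forall>h\<in>H. boundary_action h \<zeta> = \<zeta>"
    and near: "\<forall>u\<ge>0. \<exists>k\<in>H. dist (ray_to b \<zeta> u) (k b) \<le> D + 1"
  shows "\<exists>K. \<forall>N\<ge>0. card {h \<in> H. N \<le> len h \<and> len h \<le> N + 1} \<le> K"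
proof -
  define B where "B h = busemann \<zeta> b (h b)" for h :: "'a \<Rightarrow> 'a"
  define \<rho> where "\<rho> = ray_to b \<zeta>"
  have inv: "busemann \<zeta> (h x) (h y) = busemann \<zeta> x y" if "h \<in> H" for h x y
    using action(4)[OF that \<zeta>, of x y] fx that by simp
  have Bcomp: "B (g \<circ> h) = B g + B h" if "g \<in> H" for g h
    using busemann_add[OF \<zeta>, of b "g b" "g (h b)"] inv[OF that, of b "h b"] by (simp add: B_def)
  have Bid: "B id = 0" by (simp add: B_def \<zeta>)
  have Binv: "B (inv_into UNIV g) = - B g" if "g \<in> H" for g
  proof -
    have "inv_into UNIV g \<circ> g = id" using that by auto
    then show ?thesis using Bcomp[OF inv_mem[OF that], of g] Bid by simp
  qed
  have Blen: "\<bar>B h\<bar> \<le> len h" for h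
    using busemann_le[OF \<zeta>, of b "h b"] busemann_le[OF \<zeta>, of "h b" b] busemann_swap[OF \<zeta>, of b "h b"]
    by (simp add: B_def dist_commute)
  have \<rho>: "\<rho> \<in> \<zeta>" "\<rho> 0 = b" using ray_to[OF \<zeta>] by (auto simp: \<rho>_def)
  have h\<rho>: "h \<circ> \<rho> \<in> \<zeta>" if "h \<in> H" for h using action(2)[OF that \<zeta> \<rho>(1)] fx that by simp
  have B\<rho>: "busemann \<zeta> (h b) (h (\<rho> u)) = u" if "h \<in> H" "0 \<le> u" for h u
    using inv[OF that(1)] busemann_ray_to[OF \<zeta> that(2)] by (simp add: \<rho>_def)
  have merge: "\<forall>\<^sub>F s in at_top. dist (h' (\<rho> s)) (h (\<rho> s)) \<le> \<bar>B h - B h'\<bar> + 2" if hh: "h \<in> H" "h' \<in> H" for h h'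
  proof -
    have "(h \<circ> \<rho>, h' \<circ> \<rho>) \<in> asymptotic" using boundary_asymptotic[OF \<zeta> h\<rho>[OF hh(1)]] h\<rho>[OF hh(2)] by simp
    then obtain a where "((\<lambda>s. dist ((h' \<circ> \<rho>) s) ((h \<circ> \<rho>) (s + a))) \<longlongrightarrow> 0) at_top"
      by (rule asymptotic_shift)
    then have "\<forall>\<^sub>F s in at_top. dist ((h' \<circ> \<rho>) s) ((h \<circ> \<rho>) (s + a)) < 1" by (rule order_tendstoD) simp
    with eventually_ge_at_top[of "\<bar>a\<bar>"] show ?thesis
    proof eventually_elim
      case (elim s)
      define x y where "x = h' (\<rho> s)" and "y = h (\<rho> (s + a))"
      have s: "0 \<le> s" "0 \<le> s + a" using elim by auto
      have xy: "dist x y < 1" using elim by (simp add: x_def y_def)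
      have "busemann \<zeta> (h' b) (h b) = busemann \<zeta> (h' b) x + busemann \<zeta> x y - busemann \<zeta> (h b) y"
        using busemann_add[OF \<zeta>, of "h' b" x "h b"] busemann_add[OF \<zeta>, of x y "h b"] busemann_swap[OF \<zeta>, of "h b" y] by simp
      moreover have "busemann \<zeta> (h' b) x = s" "busemann \<zeta> (h b) y = s + a" using B\<rho> hh s by (auto simp: x_def y_def)
      moreover have "busemann \<zeta> (h' b) (h b) = B h - B h'"
        using busemann_add[OF \<zeta>, of "h' b" b "h b"] busemann_swap[OF \<zeta>, of b "h' b"] by (simp add: B_def)
      moreover have "\<bar>busemann \<zeta> x y\<bar> \<le> 1"
        using busemann_le[OF \<zeta>, of x y] busemann_le[OF \<zeta>, of y x] busemann_swap[OF \<zeta>, of x y] xy by (simp add: dist_commute)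
      ultimately have "\<bar>a\<bar> \<le> \<bar>B h - B h'\<bar> + 1" by linarith
      moreover have "dist y (h (\<rho> s)) = \<bar>a\<bar>"
        using ray_to_dist[OF \<zeta> s(2,1), of b] hh(1) by (simp add: y_def \<rho>_def)
      ultimately show ?case using dist_triangle[of x "h (\<rho> s)" y] xy by (simp add: x_def)
    qed
  qed
  define M where "M v = card {g \<in> H. len g \<le> 2 * (v + 2 * D + 4)}" for v
  have window: "finite {h \<in> H. s \<le> B h \<and> B h \<le> s + v} \<and> card {h \<in> H. s \<le> B h \<and> B h \<le> s + v} \<le> M v" for s v
  proof (rule finite_if_finite_subsets_card_bdd)
    \<comment> \<open>The window is not known to be finite, so finite subsets are bounded: their
      finitely many translated rays are close at one common time.\<close>
    fix E assume E: "E \<subseteq> {h \<in> H. s \<le> B h \<and> B h \<le> s + v}" "finite E"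
    show "card E \<le> M v"
    proof (cases "E = {}")
      case False
      then obtain h0 where h0: "h0 \<in> E" by blast
      have "\<forall>\<^sub>F s in at_top. \<forall>h\<in>E. dist (h0 (\<rho> s)) (h (\<rho> s)) \<le> \<bar>B h - B h0\<bar> + 2"
        using E h0 by (intro eventually_ball_finite ballI merge) auto
      then have "\<forall>\<^sub>F s in at_top. 0 \<le> s \<and> (\<forall>h\<in>E. dist (h0 (\<rho> s)) (h (\<rho> s)) \<le> \<bar>B h - B h0\<bar> + 2)"
        using eventually_ge_at_top[of 0] by eventually_elim simp
      then obtain t where t: "0 \<le> t" "\<And>h. h \<in> E \<Longrightarrow> dist (h0 (\<rho> t)) (h (\<rho> t)) \<le> \<bar>B h - B h0\<bar> + 2"
        using eventually_happens'[OF trivial_limit_at_top_linorder] by blast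
      obtain k where k: "k \<in> H" "dist (\<rho> t) (k b) \<le> D + 1" using near t(1) by (auto simp: \<rho>_def)
      have "card E \<le> card {g \<in> H. dist (h0 (k b)) (g b) \<le> v + 2 * D + 4}"
      proof (rule card_inj_on_le)
        show "inj_on (\<lambda>h. h \<circ> k) E"
        proof (rule inj_onI)
          fix h h' assume "h \<circ> k = h' \<circ> k"
          then have "h (k (inv_into UNIV k x)) = h' (k (inv_into UNIV k x))" for x by (metis comp_apply)
          then show "h = h'" using k(1) by auto
        qed
        show "(\<lambda>h. h \<circ> k) ` E \<subseteq> {g \<in> H. dist (h0 (k b)) (g b) \<le> v + 2 * D + 4}"
        proof clarify
          fix h assume h: "h \<in> E"
          have H: "h \<in> H" "h0 \<in> H" using h h0 E by auto
          have "\<bar>B h - B h0\<bar> \<le> v" using subsetD[OF E(1) h] subsetD[OF E(1) h0] by (auto simp: abs_le_iff)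
          then have "dist (h0 (\<rho> t)) (h (\<rho> t)) \<le> v + 2" using t(2)[OF h] by linarith
          moreover have "dist (h0 (k b)) (h0 (\<rho> t)) \<le> D + 1" "dist (h (\<rho> t)) (h (k b)) \<le> D + 1"
            using k H by (auto simp: dist_commute)
          moreover have "dist (h0 (k b)) (h (k b)) \<le> dist (h0 (k b)) (h0 (\<rho> t)) + dist (h0 (\<rho> t)) (h (\<rho> t)) + dist (h (\<rho> t)) (h (k b))"
            using dist_triangle[of "h0 (k b)" "h (k b)" "h0 (\<rho> t)"] dist_triangle[of "h0 (\<rho> t)" "h (k b)" "h (\<rho> t)"] by linarith
          ultimately show "h \<circ> k \<in> H \<and> dist (h0 (k b)) ((h \<circ> k) b) \<le> v + 2 * D + 4"
            using comp_mem[OF H(1) k(1)] by simp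
        qed
      qed (rule finite_near)
      also have "\<dots> \<le> M v" unfolding M_def by (rule card_near)
      finally show ?thesis .
    qed simp
  qed
  define W where "W = {h \<in> H. - (D + 1) \<le> B h \<and> B h \<le> - (D + 1) + 2 * (D + 1)}"
  have finW: "finite W" unfolding W_def using window by blast
  define c1 where "c1 = Max (insert 0 (len ` W))"
  have c1: "len h \<le> c1" if "h \<in> H" "\<bar>B h\<bar> \<le> D + 1" for h
    using that finW by (auto simp: c1_def W_def abs_le_iff)
  have lenB: "len h \<le> \<bar>B h\<bar> + D + 1 + c1" if h: "h \<in> H" for h
  proof -
    \<comment> \<open>The orbit point \<open>k b\<close> near the ray at time \<open>B h\<close> has
      nearly the same value of \<open>B\<close>. So \<open>h\<close> is \<open>k\<close> times an
      element of the finite window \<open>W\<close>, whose length is at most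
      \<open>c1\<close>.\<close>
    have *: "len h \<le> B h + D + 1 + c1" if h: "h \<in> H" "0 \<le> B h" for h
    proof -
      obtain k where k: "k \<in> H" "dist (\<rho> (B h)) (k b) \<le> D + 1" using near h(2) by (auto simp: \<rho>_def)
      have Bk: "\<bar>B h - B k\<bar> \<le> D + 1"
        using busemann_add[OF \<zeta>, of b "\<rho> (B h)" "k b"] busemann_ray_to[OF \<zeta> h(2), of b] k(2)
          busemann_le[OF \<zeta>, of "\<rho> (B h)" "k b"] busemann_le[OF \<zeta>, of "k b" "\<rho> (B h)"] busemann_swap[OF \<zeta>, of "\<rho> (B h)" "k b"]
        by (simp add: B_def \<rho>_def dist_commute)
      have "B (inv_into UNIV k \<circ> h) = B h - B k"
        unfolding Bcomp[OF inv_mem[OF k(1)]] Binv[OF k(1)] by simp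
      then have "\<bar>B (inv_into UNIV k \<circ> h)\<bar> \<le> D + 1" using Bk by (simp only:)
      then have "len (inv_into UNIV k \<circ> h) \<le> c1"
        by (intro c1 comp_mem inv_mem k h)
      moreover have "h = k \<circ> (inv_into UNIV k \<circ> h)" using k(1) by auto
      then have "len h \<le> len k + len (inv_into UNIV k \<circ> h)" using len_comp[OF k(1)] by metis
      moreover have "len k \<le> B h + (D + 1)"
        using dist_triangle[of b "k b" "\<rho> (B h)"] ray_to_dist0[OF \<zeta> h(2), of b] k(2) by (simp add: \<rho>_def)
      ultimately show ?thesis by linarith
    qed
    show ?thesis
    proof (cases "0 \<le> B h")
      case False
      then show ?thesis using *[OF inv_mem[OF h]] Binv[OF h] len_inv[OF h, of b] by simp
    qed (use *[OF h] in auto)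
  qed
  \<comment> \<open>The width that \<open>Blen\<close> and \<open>lenB\<close> leave to
    \<open>B\<close> on the annulus, for either sign.\<close>
  define v where "v = D + c1 + 3"
  have "card {h \<in> H. N \<le> len h \<and> len h \<le> N + 1} \<le> M v + M v" for N
  proof -
    have "{h \<in> H. N \<le> len h \<and> len h \<le> N + 1} \<subseteq>
       {h \<in> H. N - D - 1 - c1 \<le> B h \<and> B h \<le> (N - D - 1 - c1) + v} \<union> {h \<in> H. - N - 1 \<le> B h \<and> B h \<le> (- N - 1) + v}"
    proof clarify
      fix h assume h: "h \<in> H" "N \<le> len h" "len h \<le> N + 1" "\<not> (- N - 1 \<le> B h \<and> B h \<le> - N - 1 + v)"
      then show "N - D - 1 - c1 \<le> B h \<and> B h \<le> N - D - 1 - c1 + v"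
        using lenB[OF h(1)] Blen[of h] by (auto simp: v_def abs_if split: if_splits)
    qed
    then have "card {h \<in> H. N \<le> len h \<and> len h \<le> N + 1} \<le>
      card ({h \<in> H. N - D - 1 - c1 \<le> B h \<and> B h \<le> (N - D - 1 - c1) + v} \<union> {h \<in> H. - N - 1 \<le> B h \<and> B h \<le> (- N - 1) + v})"
      using window by (intro card_mono) auto
    also have "\<dots> \<le> M v + M v"
      using window by (intro order.trans[OF card_Un_le] add_mono) auto
    finally show ?thesis .
  qed
  then show ?thesis by blast
qed

lemma card_annulus_upper:
  assumes crit: "critical_exponent H = ereal d"
  shows "\<exists>K. \<forall>N\<ge>0. real (card {h \<in> H. N \<le> len h \<and> len h \<le> N + 1}) \<le> K * exp (d * N)"
proof (cases "\<exists>F c. finite F \<and> F \<subseteq> H \<and> (\<forall>h\<in>H. \<forall>h'\<in>H. \<exists>f\<in>F. len h + len h' - c \<le> len (h \<circ> f \<circ> h'))")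
  case True
  then obtain F c where F: "finite F" "F \<subseteq> H"
    "\<forall>h\<in>H. \<forall>h'\<in>H. \<exists>f\<in>F. len h + len h' - c \<le> len (h \<circ> f \<circ> h')" by blast
  show ?thesis by (rule card_annulus_upper_spread[OF crit F(1,2)]) (rule F(3)[rule_format])
next
  case False
  have no: "\<exists>h\<in>H. \<exists>h'\<in>H. \<forall>f\<in>F. len (h \<circ> f \<circ> h') < len h + len h' - c" if "finite F" "F \<subseteq> H" for F c
    using False that by (force simp: not_le)
  obtain \<zeta> where \<zeta>: "\<zeta> \<in> boundary" "\<forall>h\<in>H. boundary_action h \<zeta> = \<zeta>"
    "\<forall>u\<ge>0. \<exists>k\<in>H. dist (ray_to b \<zeta> u) (k b) \<le> D + 1"
    by (rule ex_fixed_point[OF no])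
  obtain K where K: "\<forall>N\<ge>0. card {h \<in> H. N \<le> len h \<and> len h \<le> N + 1} \<le> K"
    using card_annulus_upper_fixed[OF \<zeta>] by blast
  have "real (card {h \<in> H. N \<le> len h \<and> len h \<le> N + 1}) \<le> real K * exp (d * N)" if N: "N \<ge> 0" for N
  proof -
    have "real (card {h \<in> H. N \<le> len h \<and> len h \<le> N + 1}) \<le> real K * 1" using K[rule_format, OF N] by simp
    also have "\<dots> \<le> real K * exp (d * N)"
      using critical_exponentD(1)[OF crit] N by (intro mult_left_mono) auto
    finally show ?thesis .
  qed
  then show ?thesis by blast
qed

end

section \<open>Almost malnormal convex-cocompact subgroups\<close>

text \<open>The exponent \<open>\<delta>\<close> enters here through the orbit growth seen from
  \<open>b\<close>; the conformal density is added in \<open>khinchin\<close>.\<close>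

locale malnormal_subgroup = cocompact_hull pt H b C D + G: isom_action pt \<Gamma>
  for pt :: "'a::metric_space" and \<Gamma> H b C D +
  fixes \<delta> d K :: real
  assumes sub: "H \<subseteq> \<Gamma>"
    and malnormal: "w \<in> \<Gamma> \<Longrightarrow> w \<notin> H \<Longrightarrow> finite {h \<in> H. w \<circ> h \<circ> inv_into UNIV w \<in> H}"
    and proper_sub: "\<exists>a. a \<in> \<Gamma> \<and> a \<notin> H"
    and crit: "critical_exponent H = ereal d"
    and growth_upper: "0 \<le> t \<Longrightarrow> real (card {g \<in> \<Gamma>. dist b (g b) \<le> t}) \<le> K * exp (\<delta> * t)"
    and growth_lower: "0 \<le> t \<Longrightarrow> exp (\<delta> * t) \<le> K * real (card {g \<in> \<Gamma>. dist b (g b) \<le> t})"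
begin

lemma d_nonneg: "0 \<le> d"
  using critical_exponentD(1)[OF crit] .

lemma K_pos: "0 < K"
proof (rule ccontr)
  assume "\<not> 0 < K"
  then have "K * real (card {g \<in> \<Gamma>. dist b (g b) \<le> 0}) \<le> 0" by (simp add: mult_nonpos_nonneg)
  then show False using growth_lower[of 0] by simp
qed

lemma sub_mem: "h \<in> H \<Longrightarrow> h \<in> \<Gamma>"
  using sub by blast

text \<open>The words \<open>h a h'\<close> with \<open>h, h' \<in> H\<close> are too numerous if the exponents agree.\<close>

lemma exponent_less: "d < \<delta>"
proof (rule ccontr)
  assume "\<not> d < \<delta>"
  then have le: "\<delta> \<le> d" by simp
  obtain a where a: "a \<in> \<Gamma>" "a \<notin> H" using proper_sub by blast
  \<comment> \<open>A spacing above \<open>2 * D\<close> makes the annuli \<open>A j\<close>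
    disjoint.\<close>
  define q where "q = nat \<lceil>2 * D\<rceil> + 1"
  have q: "2 * D < real q" "0 < real q" by (auto simp: q_def) linarith
  define A where "A j = {h \<in> H. \<bar>len h - real j * real q\<bar> \<le> D}" for j :: nat
  have finA: "finite (A j)" for j
    by (rule finite_subset[OF _ finite_ball[of b "real j * real q + D"]]) (auto simp: A_def)
  define c where "c = exp (- 3 * D * d) / 2"
  have c0: "c > 0" by (simp add: c_def)
  have cardA: "c * exp (d * (real j * real q)) \<le> real (card (A j))" for j
    using card_annulus_lower[OF crit, of "real j * real q"]
    by (simp add: A_def c_def algebra_simps flip: exp_add)
  \<comment> \<open>Two words \<open>h a h'\<close> with the same value differ by an element of
    \<open>H\<close> that \<open>a\<close> conjugates into \<open>H\<close>; there are
    \<open>M\<close> of these.\<close>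
  define M where "M = card {h \<in> H. a \<circ> h \<circ> inv_into UNIV a \<in> H}"
  define Z where "Z = real M * K * exp (\<delta> * (2 * D + dist b (a b)))"
  \<comment> \<open>The \<open>J + 1\<close> ways of splitting the total length produce a linear
    factor, which rules out even the equality of the exponents.\<close>
  have "real (Suc J) * c\<^sup>2 \<le> Z" for J
  proof -
    define X where "X = (\<Union>j\<in>{..J}. A j \<times> A (J - j))"
    define L where "L = real J * real q + 2 * D + dist b (a b)"
    have L0: "0 \<le> L" using D_nonneg by (simp add: L_def)
    have finX: "finite X" using finA by (simp add: X_def)
    have XH: "fst z \<in> H" "snd z \<in> H" if "z \<in> X" for z using that by (auto simp: X_def A_def)
    define \<phi> where "\<phi> z = fst z \<circ> a \<circ> snd z" for z :: "('a \<Rightarrow> 'a) \<times> ('a \<Rightarrow> 'a)"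
    have disj: "A i \<inter> A j = {}" if "i \<noteq> j" for i j
    proof -
      have "\<bar>real i - real j\<bar> \<ge> 1" using that by linarith
      then have "\<bar>real i - real j\<bar> * real q \<ge> 1 * real q" using q by (intro mult_right_mono) auto
      moreover have "\<bar>real i * real q - real j * real q\<bar> = \<bar>real i - real j\<bar> * real q"
        by (simp add: abs_mult flip: left_diff_distrib)
      ultimately have "\<bar>real i * real q - real j * real q\<bar> > 2 * D" using q by linarith
      then show ?thesis by (auto simp: A_def)
    qed
    have "card X = (\<Sum>j\<in>{..J}. card (A j \<times> A (J - j)))"
      unfolding X_def by (intro card_UN_disjoint) (use finA disj in auto)
    then have "real (card X) = (\<Sum>j\<in>{..J}. real (card (A j)) * real (card (A (J - j))))"
      by (simp add: card_cartesian_product)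
    also have "\<dots> \<ge> (\<Sum>j\<in>{..J}. c\<^sup>2 * exp (d * (real J * real q)))"
    proof (rule sum_mono)
      fix j assume "j \<in> {..J}"
      then have "c\<^sup>2 * exp (d * (real J * real q)) = (c * exp (d * (real j * real q))) * (c * exp (d * (real (J - j) * real q)))"
        by (simp add: power2_eq_square of_nat_diff algebra_simps mult_exp_exp)
      also have "\<dots> \<le> real (card (A j)) * real (card (A (J - j)))"
        using c0 by (intro mult_mono cardA) auto
      finally show "c\<^sup>2 * exp (d * (real J * real q)) \<le> real (card (A j)) * real (card (A (J - j)))" .
    qed
    finally have lower: "real (Suc J) * c\<^sup>2 * exp (d * (real J * real q)) \<le> real (card X)" by (simp add: mult.assoc)
    have "card X \<le> M * card {g \<in> \<Gamma>. dist b (g b) \<le> L}"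
    proof (rule card_le_fibres[OF finX])
      show "\<phi> ` X \<subseteq> {g \<in> \<Gamma>. dist b (g b) \<le> L}"
      proof (rule image_subsetI)
        fix z assume z: "z \<in> X"
        then obtain j where j: "j \<le> J" "fst z \<in> A j" "snd z \<in> A (J - j)" by (auto simp: X_def)
        have m: "fst z \<in> \<Gamma>" "snd z \<in> \<Gamma>" using XH[OF z] sub by auto
        have "dist b (\<phi> z b) \<le> len (fst z) + (dist b (a b) + len (snd z))"
          using G.len_comp[OF m(1), of b "a \<circ> snd z"] G.len_comp[OF a(1), of b "snd z"] by (simp add: \<phi>_def)
        also have "\<dots> \<le> (real j * real q + D) + (dist b (a b) + (real (J - j) * real q + D))"
          using j by (intro add_mono) (auto simp: A_def)
        also have "\<dots> = L" using j(1) by (simp add: L_def of_nat_diff algebra_simps)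
        finally show "\<phi> z \<in> {g \<in> \<Gamma>. dist b (g b) \<le> L}" using G.comp_mem m a(1) by (simp add: \<phi>_def)
      qed
      show "finite {g \<in> \<Gamma>. dist b (g b) \<le> L}" by (rule G.finite_ball)
      fix w assume "w \<in> \<phi> ` X"
      then obtain z0 where z0: "z0 \<in> X" "\<phi> z0 = w" by blast
      show "card {z \<in> X. \<phi> z = w} \<le> M"
        unfolding M_def
      proof (rule card_inj_on_le)
        let ?\<psi> = "\<lambda>z. snd z \<circ> inv_into UNIV (snd z0)"
        show "inj_on ?\<psi> {z \<in> X. \<phi> z = w}"
        proof (rule inj_onI, clarify)
          fix h k h' k' assume z: "(h, k) \<in> X" "(h', k') \<in> X"
            and e: "?\<psi> (h, k) = ?\<psi> (h', k')" and w: "\<phi> (h', k') = \<phi> (h, k)"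
          have H: "h \<in> H" "h' \<in> H" "k \<in> H" "k' \<in> H" "snd z0 \<in> H" using XH[OF z(1)] XH[OF z(2)] XH[OF z0(1)] by auto
          have "k (inv_into UNIV (snd z0) x) = k' (inv_into UNIV (snd z0) x)" for x using fun_cong[OF e, of x] by simp
          then have kk: "k = k'" using inv_left[OF H(5)] by (metis ext)
          have "h (a (k x)) = h' (a (k x))" for x using fun_cong[OF w, of x] kk by (simp add: \<phi>_def)
          from this[of "inv_into UNIV k (inv_into UNIV a x)" for x]
          have "h x = h' x" for x using inv_right[OF H(3)] G.inv_right[OF a(1)] by simp
          then show "h = h' \<and> k = k'" using kk by auto
        qed
        show "?\<psi> ` {z \<in> X. \<phi> z = w} \<subseteq> {h \<in> H. a \<circ> h \<circ> inv_into UNIV a \<in> H}"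
        proof (rule image_subsetI)
          fix z assume z: "z \<in> {z \<in> X. \<phi> z = w}"
          define h k h0 k0 where "h = fst z" and "k = snd z" and "h0 = fst z0" and "k0 = snd z0"
          have H: "h \<in> H" "k \<in> H" "h0 \<in> H" "k0 \<in> H" using XH z z0 by (auto simp: h_def k_def h0_def k0_def)
          have e: "h (a (k x)) = h0 (a (k0 x))" for x
            using z z0 by (auto simp: \<phi>_def h_def k_def h0_def k0_def dest: fun_cong[of _ _ x])
          have "a \<circ> (k \<circ> inv_into UNIV k0) \<circ> inv_into UNIV a = inv_into UNIV h \<circ> h0"
          proof
            fix x
            have "h (a (k (inv_into UNIV k0 (inv_into UNIV a x)))) = h0 x"
              unfolding e using inv_right[OF H(4)] G.inv_right[OF a(1)] by simp
            then have "a (k (inv_into UNIV k0 (inv_into UNIV a x))) = inv_into UNIV h (h0 x)"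
              using inv_left[OF H(1)] by metis
            then show "(a \<circ> (k \<circ> inv_into UNIV k0) \<circ> inv_into UNIV a) x = (inv_into UNIV h \<circ> h0) x" by simp
          qed
          moreover have "inv_into UNIV h \<circ> h0 \<in> H" "k \<circ> inv_into UNIV k0 \<in> H" by (intro comp_mem inv_mem H)+
          ultimately show "?\<psi> z \<in> {h \<in> H. a \<circ> h \<circ> inv_into UNIV a \<in> H}" by (simp add: k_def k0_def)
        qed
        show "finite {h \<in> H. a \<circ> h \<circ> inv_into UNIV a \<in> H}" by (rule malnormal[OF a])
      qed
    qed
    then have "real (card X) \<le> real (M * card {g \<in> \<Gamma>. dist b (g b) \<le> L})" by (simp only: of_nat_le_iff)
    then have "real (card X) \<le> real M * real (card {g \<in> \<Gamma>. dist b (g b) \<le> L})" by simp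
    also have "\<dots> \<le> real M * (K * exp (\<delta> * L))" by (intro mult_left_mono growth_upper L0) simp
    also have "\<dots> = Z * exp (\<delta> * (real J * real q))" by (simp add: Z_def L_def algebra_simps mult_exp_exp)
    also have "\<dots> \<le> Z * exp (d * (real J * real q))"
      using le K_pos by (intro mult_left_mono) (auto simp: Z_def mult_right_mono)
    finally have "real (card X) \<le> Z * exp (d * (real J * real q))" .
    with lower have "real (Suc J) * c\<^sup>2 * exp (d * (real J * real q)) \<le> Z * exp (d * (real J * real q))" by linarith
    then show ?thesis by (simp only: mult_le_cancel_right_pos exp_gt_zero)
  qed
  moreover obtain J where "Z / c\<^sup>2 < real J" using reals_Archimedean2 by blast
  then have "Z < real J * c\<^sup>2" using c0 by (simp add: field_simps)
  then have "Z < real (Suc J) * c\<^sup>2" using c0 by (simp add: algebra_simps add_strict_increasing)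
  ultimately show False by (meson not_le)
qed

lemma \<delta>_pos: "0 < \<delta>"
  using exponent_less d_nonneg by linarith

text \<open>Almost malnormality: distinct translates of \<open>C\<close> run close to each other only for a bounded time.\<close>

lemma overlap:
  obtains c0 where "\<forall>\<beta> h1 h2 k1 k2. \<beta> \<in> \<Gamma> \<longrightarrow> \<beta> \<notin> H \<longrightarrow> h1 \<in> H \<longrightarrow> h2 \<in> H \<longrightarrow> k1 \<in> H \<longrightarrow> k2 \<in> H \<longrightarrow>
    dist (h1 b) (\<beta> (k1 b)) \<le> R \<longrightarrow> dist (h2 b) (\<beta> (k2 b)) \<le> R \<longrightarrow> dist (h1 b) (h2 b) \<le> c0"
proof -
  define R' where "R' = 2 * D + 2 * R + 4"
  \<comment> \<open>Multiplying \<open>\<beta>\<close> on both sides by elements of \<open>H\<close>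
    makes it one of finitely many short elements; \<open>M\<close> counts the elements of
    \<open>H\<close> conjugated into \<open>H\<close> by one of them.\<close>
  define W where "W = {w \<in> \<Gamma>. w \<notin> H \<and> dist b (w b) \<le> R'}"
  have finW: "finite W" by (rule finite_subset[OF _ G.finite_ball[of b R']]) (auto simp: W_def)
  define M where "M = (\<Sum>w\<in>W. card {h \<in> H. w \<circ> h \<circ> inv_into UNIV w \<in> H})"
  define q where "q = 2 * D + 1"
  have q: "q > 0" using D_nonneg by (simp add: q_def)
  have "dist (h1 b) (h2 b) \<le> real M * q"
    if \<beta>: "\<beta> \<in> \<Gamma>" "\<beta> \<notin> H" and H: "h1 \<in> H" "h2 \<in> H" "k1 \<in> H" "k2 \<in> H"
      and cl: "dist (h1 b) (\<beta> (k1 b)) \<le> R" "dist (h2 b) (\<beta> (k2 b)) \<le> R" for \<beta> h1 h2 k1 k2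
  proof -
    define L where "L = dist (h1 b) (h2 b)"
    define n where "n = nat \<lfloor>L / q\<rfloor>"
    have n: "real j * q \<le> L" if "j \<le> n" for j
    proof -
      have "real n \<le> L / q" using q by (simp add: n_def L_def)
      then have "real j \<le> L / q" using that by (meson of_nat_le_iff order_trans)
      then show ?thesis using q by (simp add: field_simps)
    qed
    have nL: "L \<le> real (Suc n) * q"
    proof -
      have "L / q \<le> real (Suc n)" using q unfolding n_def by linarith
      then show ?thesis using q by (simp add: field_simps)
    qed
    have "\<forall>j\<in>{..n}. \<exists>h k. h \<in> H \<and> k \<in> H \<and> \<bar>dist (h1 b) (h b) - real j * q\<bar> \<le> D \<and> dist (h b) (\<beta> (k b)) \<le> R'"
    proof
      fix j assume j: "j \<in> {..n}"
      obtain m where m: "between (h1 b) m (h2 b)" "dist (h1 b) m = real j * q"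
        using ex_between[of "real j * q" "h1 b" "h2 b"] n[of j] j q by (auto simp: L_def)
      have "m \<in> C" using C_between[OF orbit_mem[OF H(1)] orbit_mem[OF H(2)] m(1)] .
      then obtain h where h: "h \<in> H" "dist m (h b) \<le> D" using C_cocompact by blast
      obtain m' where m': "between (\<beta> (k1 b)) m' (\<beta> (k2 b))" "dist m m' \<le> 2 * R + 4"
        using quadrilateral_coarse[OF m(1) cl] .
      have "between (k1 b) (inv_into UNIV \<beta> m') (k2 b)"
        using m'(1) G.iso_inv[OF \<beta>(1), of m' "k2 b"] G.iso_inv[OF \<beta>(1), of m' "k1 b"] G.iso[OF \<beta>(1)]
        by (simp add: between_def dist_commute)
      then have "inv_into UNIV \<beta> m' \<in> C" using C_between[OF orbit_mem[OF H(3)] orbit_mem[OF H(4)]] by blast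
      then obtain k where k: "k \<in> H" "dist (inv_into UNIV \<beta> m') (k b) \<le> D" using C_cocompact by blast
      have "dist m' (\<beta> (k b)) \<le> D" using k(2) G.iso_inv[OF \<beta>(1)] by simp
      then have "dist (h b) (\<beta> (k b)) \<le> R'"
        using h(2) m'(2) dist_triangle[of "h b" "\<beta> (k b)" m] dist_triangle[of m "\<beta> (k b)" m'] dist_commute[of "h b" m]
        by (simp add: R'_def)
      moreover have "\<bar>dist (h1 b) (h b) - real j * q\<bar> \<le> D"
        using abs_dist_diff_le[of "h b" "h1 b" m] m(2) h(2) by (simp add: dist_commute)
      ultimately show "\<exists>h k. h \<in> H \<and> k \<in> H \<and> \<bar>dist (h1 b) (h b) - real j * q\<bar> \<le> D \<and> dist (h b) (\<beta> (k b)) \<le> R'"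
        using h(1) k(1) by blast
    qed
    then obtain h k where hk: "\<And>j. j \<le> n \<Longrightarrow> h j \<in> H \<and> k j \<in> H \<and> \<bar>dist (h1 b) (h j b) - real j * q\<bar> \<le> D \<and> dist (h j b) (\<beta> (k j b)) \<le> R'"
      unfolding Ball_def atMost_iff by metis
    \<comment> \<open>The common run is sampled every \<open>q\<close>. Samples with the same
      \<open>w j = v\<close> yield distinct elements of \<open>H\<close> conjugated into
      \<open>H\<close> by \<open>v\<close>, so there are at most \<open>M\<close> samples.\<close>
    define w where "w j = inv_into UNIV (h j) \<circ> \<beta> \<circ> k j" for j
    have hdist: "i = j" if "i \<le> n" "j \<le> n" "h i = h j" for i j
    proof (rule ccontr)
      assume "i \<noteq> j"
      then have "\<bar>real i - real j\<bar> \<ge> 1" by linarith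
      then have "\<bar>real i - real j\<bar> * q \<ge> 1 * q" using q by (intro mult_right_mono) auto
      moreover have "\<bar>real i * q - real j * q\<bar> = \<bar>real i - real j\<bar> * q"
        using q by (simp add: abs_mult flip: left_diff_distrib)
      ultimately have "\<bar>real i * q - real j * q\<bar> > 2 * D" using q_def by linarith
      then show False using hk[OF that(1)] hk[OF that(2)] that(3) by auto
    qed
    have wW: "w j \<in> W" if "j \<le> n" for j
    proof -
      have m: "h j \<in> H" "k j \<in> H" using hk[OF that] by auto
      have "w j \<in> \<Gamma>" unfolding w_def using m sub by (intro G.comp_mem G.inv_mem \<beta>) auto
      moreover have "w j \<notin> H"
      proof
        assume "w j \<in> H"
        then have "h j \<circ> w j \<circ> inv_into UNIV (k j) \<in> H" using m by (intro comp_mem inv_mem) auto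
        moreover have "h j \<circ> w j \<circ> inv_into UNIV (k j) = \<beta>" using m by (auto simp: w_def)
        ultimately show False using \<beta>(2) by simp
      qed
      moreover have "dist b (w j b) = dist (h j b) (\<beta> (k j b))"
        using iso[OF m(1), of b "w j b"] m by (simp add: w_def)
      ultimately show ?thesis using hk[OF that] by (simp add: W_def)
    qed
    have "Suc n = card {..n}" by simp
    also have "\<dots> = (\<Sum>v\<in>W. card {j \<in> {..n}. w j = v})"
      using sum.group[of "{..n}" W w "\<lambda>_. 1::nat"] finW wW by (auto simp: image_subset_iff)
    also have "\<dots> \<le> M"
      unfolding M_def
    proof (rule sum_mono)
      fix v assume v: "v \<in> W"
      then have v\<Gamma>: "v \<in> \<Gamma>" "v \<notin> H" by (auto simp: W_def)
      show "card {j \<in> {..n}. w j = v} \<le> card {h \<in> H. v \<circ> h \<circ> inv_into UNIV v \<in> H}"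
      proof (cases "{j \<in> {..n}. w j = v} = {}")
        case False
        then obtain i where i: "i \<le> n" "w i = v" by auto
        have hi: "h i \<in> H" "k i \<in> H" using hk[OF i(1)] by auto
        have conj: "v \<circ> (inv_into UNIV (k j) \<circ> k i) \<circ> inv_into UNIV v = inv_into UNIV (h j) \<circ> h i"
          if j: "j \<le> n" "w j = v" for j
        proof
          fix x
          have hj: "h j \<in> H" "k j \<in> H" using hk[OF j(1)] by auto
          have wj: "v y = inv_into UNIV (h j) (\<beta> (k j y))" for y using j(2) by (auto simp: w_def)
          have wi: "v y = inv_into UNIV (h i) (\<beta> (k i y))" for y using i(2) by (auto simp: w_def)
          have "v (inv_into UNIV (k j) (k i y)) = inv_into UNIV (h j) (\<beta> (k i y))" for y
            unfolding wj using inv_right[OF hj(2)] by simp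
          moreover have "\<beta> (k i y) = h i (v y)" for y unfolding wi using inv_right[OF hi(1)] by simp
          ultimately show "(v \<circ> (inv_into UNIV (k j) \<circ> k i) \<circ> inv_into UNIV v) x = (inv_into UNIV (h j) \<circ> h i) x"
            using G.inv_right[OF v\<Gamma>(1)] by simp
        qed
        show ?thesis
        proof (rule card_inj_on_le)
          show "inj_on (\<lambda>j. inv_into UNIV (k j) \<circ> k i) {j \<in> {..n}. w j = v}"
          proof (rule inj_onI)
            fix j l assume "j \<in> {j \<in> {..n}. w j = v}" "l \<in> {j \<in> {..n}. w j = v}"
              and e: "inv_into UNIV (k j) \<circ> k i = inv_into UNIV (k l) \<circ> k i"
            then have jl: "j \<le> n" "w j = v" "l \<le> n" "w l = v" by auto
            have m: "h j \<in> H" "h l \<in> H" using hk jl by auto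
            have "inv_into UNIV (h j) \<circ> h i = inv_into UNIV (h l) \<circ> h i" using conj[OF jl(1,2)] conj[OF jl(3,4)] e by simp
            then have "inv_into UNIV (h j) (h i (inv_into UNIV (h i) x)) = inv_into UNIV (h l) (h i (inv_into UNIV (h i) x))" for x
              by (metis comp_apply)
            then have "inv_into UNIV (h j) x = inv_into UNIV (h l) x" for x using inv_right[OF hi(1)] by simp
            then have "h j = h l" using inv_inv[OF m(1)] inv_inv[OF m(2)] by (metis ext)
            then show "j = l" using hdist jl by blast
          qed
          show "(\<lambda>j. inv_into UNIV (k j) \<circ> k i) ` {j \<in> {..n}. w j = v} \<subseteq> {h \<in> H. v \<circ> h \<circ> inv_into UNIV v \<in> H}"
          proof (rule image_subsetI)
            fix j assume "j \<in> {j \<in> {..n}. w j = v}"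
            then have j: "j \<le> n" "w j = v" by auto
            have m: "h j \<in> H" "k j \<in> H" using hk[OF j(1)] by auto
            have "inv_into UNIV (k j) \<circ> k i \<in> H" "inv_into UNIV (h j) \<circ> h i \<in> H" by (intro comp_mem inv_mem m hi)+
            then show "inv_into UNIV (k j) \<circ> k i \<in> {h \<in> H. v \<circ> h \<circ> inv_into UNIV v \<in> H}" using conj[OF j] by simp
          qed
          show "finite {h \<in> H. v \<circ> h \<circ> inv_into UNIV v \<in> H}" by (rule malnormal[OF v\<Gamma>])
        qed
      next
        case True
        show ?thesis unfolding True by simp
      qed
    qed
    finally have "real (Suc n) \<le> real M" by (simp only: of_nat_le_iff)
    then have "real (Suc n) * q \<le> real M * q" using q by (intro mult_right_mono) auto
    then show ?thesis using nL by (simp add: L_def)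
  qed
  then show ?thesis by (intro that[of "real M * q"]) blast
qed

text \<open>A shortest representative of the coset of \<open>\<alpha>\<close>: up to a bounded
  error, \<open>\<alpha> b\<close> is the point where the translate of \<open>C\<close> is entered
  from \<open>b\<close>.\<close>

definition reduced :: "('a \<Rightarrow> 'a) \<Rightarrow> bool" where
  "reduced \<alpha> \<longleftrightarrow> \<alpha> \<in> \<Gamma> \<and> (\<forall>h\<in>H. dist b (\<alpha> b) \<le> dist b (\<alpha> (h b)))"

lemma reduced_mem: "reduced \<alpha> \<Longrightarrow> \<alpha> \<in> \<Gamma>"
  by (simp add: reduced_def)

text \<open>Here \<open>P\<close> is the Gromov product of \<open>b\<close> and
  \<open>\<alpha> (h b)\<close> at \<open>\<alpha> b\<close>. The point at distance \<open>P\<close>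
  on the segment in the translate is near some \<open>\<alpha> (k b)\<close>, which minimality keeps
  at least as far from \<open>b\<close> as \<open>\<alpha> b\<close>; this forces
  \<open>P \<le> D + 2\<close>.\<close>

lemma reduced_len:
  assumes \<alpha>: "reduced \<alpha>" and h: "h \<in> H"
  shows "len \<alpha> + len h - 2 * D - 4 \<le> len (\<alpha> \<circ> h)" "len \<alpha> \<le> len (\<alpha> \<circ> h)"
proof -
  have \<alpha>\<Gamma>: "\<alpha> \<in> \<Gamma>" using \<alpha> by (rule reduced_mem)
  show "len \<alpha> \<le> len (\<alpha> \<circ> h)" using \<alpha> h by (simp add: reduced_def)
  define z w where "z = \<alpha> b" and "w = \<alpha> (h b)"
  define P where "P = (dist z b + dist z w - dist b w) / 2"
  have zw: "dist z w = len h" using \<alpha>\<Gamma> by (simp add: z_def w_def)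
  have P: "0 \<le> P" "P \<le> dist z b" "P \<le> dist z w"
    using dist_triangle[of b w z] dist_triangle[of z w b] dist_triangle[of z b w] by (auto simp: P_def dist_commute)
  obtain m where m: "between z m b" "dist z m = P" using ex_between[OF P(1,2)] by blast
  obtain m' where m': "between z m' w" "dist z m' = P" using ex_between[OF P(1,3)] by blast
  have "dist m m' \<le> 2 * exp (P + (dist b w - dist z b - dist z w) / 2)"
    by (rule thin_dist[OF m(1) m'(1) m(2) m'(2)])
  also have "\<dots> = 2" by (simp add: P_def field_simps)
  finally have mm: "dist m m' \<le> 2" .
  have "between b (inv_into UNIV \<alpha> m') (h b)"
    using m'(1) G.iso_inv[OF \<alpha>\<Gamma>, of m' "h b"] G.iso_inv[OF \<alpha>\<Gamma>, of m' b] \<alpha>\<Gamma>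
    by (simp add: between_def dist_commute z_def w_def)
  then have "inv_into UNIV \<alpha> m' \<in> C" using C_between[OF b_mem orbit_mem[OF h]] by blast
  then obtain k where k: "k \<in> H" "dist (inv_into UNIV \<alpha> m') (k b) \<le> D" using C_cocompact by blast
  have "dist m' (\<alpha> (k b)) \<le> D" using k(2) G.iso_inv[OF \<alpha>\<Gamma>] by simp
  moreover have "len \<alpha> \<le> dist b (\<alpha> (k b))" using \<alpha> k(1) by (simp add: reduced_def)
  moreover have "dist b (\<alpha> (k b)) \<le> dist b m + dist m m' + dist m' (\<alpha> (k b))"
    using dist_triangle[of b "\<alpha> (k b)" m] dist_triangle[of m "\<alpha> (k b)" m'] by linarith
  moreover have "dist b m = len \<alpha> - P" using m by (simp add: between_def z_def dist_commute)
  ultimately have "P \<le> D + 2" using mm by linarith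
  then show "len \<alpha> + len h - 2 * D - 4 \<le> len (\<alpha> \<circ> h)"
    using zw by (simp add: P_def z_def w_def dist_commute)
qed

lemma ex_reduced:
  assumes g: "g \<in> \<Gamma>"
  obtains \<alpha> h where "reduced \<alpha>" "h \<in> H" "g = \<alpha> \<circ> h"
proof -
  define Y where "Y = {k \<in> H. dist b ((g \<circ> k) b) \<le> dist b (g b)}"
  have "Y \<subseteq> {k \<in> H. dist (inv_into UNIV g b) (k b) \<le> dist b (g b)}" by (auto simp: Y_def G.iso_inv[OF g])
  then have finY: "finite Y" using finite_near finite_subset by blast
  have "id \<in> Y" using id_mem by (simp add: Y_def)
  then have neY: "Y \<noteq> {}" by blast
  define k where "k = arg_min_on (\<lambda>k. dist b ((g \<circ> k) b)) Y"
  have k: "k \<in> Y" "\<And>l. l \<in> Y \<Longrightarrow> dist b ((g \<circ> k) b) \<le> dist b ((g \<circ> l) b)"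
    using arg_min_if_finite(1)[OF finY neY, of "\<lambda>k. dist b ((g \<circ> k) b)"]
      arg_min_least[OF finY neY, of _ "\<lambda>k. dist b ((g \<circ> k) b)"] by (auto simp: k_def)
  have kH: "k \<in> H" using k(1) by (simp add: Y_def)
  have "reduced (g \<circ> k)"
    unfolding reduced_def
  proof (intro conjI ballI)
    show "g \<circ> k \<in> \<Gamma>" using G.comp_mem g kH sub by blast
    fix h assume h: "h \<in> H"
    show "dist b ((g \<circ> k) b) \<le> dist b ((g \<circ> k) (h b))"
    proof (cases "k \<circ> h \<in> Y")
      case True
      then show ?thesis using k(2)[OF True] by simp
    next
      case False
      then have "dist b (g b) < dist b (g (k (h b)))" using comp_mem[OF kH h] by (simp add: Y_def)
      then show ?thesis using k(1) by (simp add: Y_def)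
    qed
  qed
  moreover have "g = (g \<circ> k) \<circ> inv_into UNIV k" using kH by auto
  ultimately show ?thesis using that inv_mem[OF kH] by blast
qed

text \<open>Contrapositively, reduced elements of different lengths belong to different translates;
  \<open>no_overlap\<close> uses it in this form.\<close>

lemma reduced_coset:
  assumes "reduced \<alpha>" "reduced \<alpha>'" "inv_into UNIV \<alpha> \<circ> \<alpha>' \<in> H"
  shows "len \<alpha> = len \<alpha>'"
proof (rule antisym)
  define h where "h = inv_into UNIV \<alpha> \<circ> \<alpha>'"
  have m: "\<alpha> \<in> \<Gamma>" "\<alpha>' \<in> \<Gamma>" using assms by (auto simp: reduced_mem)
  have e: "\<alpha>' x = \<alpha> (h x)" for x using m by (simp add: h_def)
  show "len \<alpha> \<le> len \<alpha>'" using assms(1,3) by (simp add: e h_def[symmetric] reduced_def)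
  have "\<alpha>' (inv_into UNIV h b) = \<alpha> b" using assms(3) by (simp add: e h_def[symmetric])
  moreover have "inv_into UNIV h \<in> H" using assms(3) inv_mem by (simp add: h_def)
  ultimately show "len \<alpha>' \<le> len \<alpha>" using assms(2) unfolding reduced_def by metis
qed

section \<open>Counting reduced elements\<close>

lemma sum_geometric_exp_le:
  fixes e :: real
  assumes "0 < e"
  shows "(\<Sum>j\<le>n. exp (- e * real j)) \<le> 1 / (1 - exp (- e))"
proof -
  have "(\<Sum>j\<le>n. exp (- e * real j)) = (\<Sum>j<Suc n. exp (- e) ^ j)"
    by (simp add: lessThan_Suc_atMost mult.commute flip: exp_of_nat_mult)
  also have "\<dots> = (1 - exp (- e) ^ Suc n) / (1 - exp (- e))"
    using assms by (subst sum_gp_strict) auto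
  also have "\<dots> \<le> 1 / (1 - exp (- e))" using assms by (intro divide_right_mono) auto
  finally show ?thesis .
qed

text \<open>The weight of \<open>g\<close> is dominated by its contributions to the balls of radius
  \<open>u - j\<close> containing it. Exchanging the sums leaves a geometric series of ratio
  \<open>exp (- (\<delta> - e))\<close>.\<close>

lemma weighted_ball_sum:
  assumes e: "e < \<delta>" "0 \<le> e" and u: "0 \<le> u"
  shows "(\<Sum>g | g \<in> \<Gamma> \<and> len g \<le> u. exp (e * (u - len g))) \<le> exp e * K / (1 - exp (- (\<delta> - e))) * exp (\<delta> * u)"
proof -
  define n where "n = nat \<lfloor>u\<rfloor>"
  have n: "real n \<le> u" "u < real n + 1" using u by (auto simp: n_def)
  have fin: "finite {g \<in> \<Gamma>. len g \<le> v}" for v by (rule G.finite_ball)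
  have "(\<Sum>g | g \<in> \<Gamma> \<and> len g \<le> u. exp (e * (u - len g)))
     \<le> (\<Sum>g | g \<in> \<Gamma> \<and> len g \<le> u. \<Sum>j\<le>n. if len g \<le> u - real j then exp e * exp (e * real j) else 0)"
  proof (rule sum_mono)
    fix g assume "g \<in> {g \<in> \<Gamma>. len g \<le> u}"
    then have g: "len g \<le> u" by simp
    define i where "i = nat \<lfloor>u - len g\<rfloor>"
    have i: "real i \<le> u - len g" "u - len g < real i + 1" using g by (auto simp: i_def)
    have "real i < real n + 1" using i(1) n(2) zero_le_dist[of b "g b"] by linarith
    then have "i \<le> n" by linarith
    have "e * (u - len g) \<le> e * (real i + 1)" using i(2) e(2) by (intro mult_left_mono) auto
    then have "exp (e * (u - len g)) \<le> exp e * exp (e * real i)" by (simp add: algebra_simps mult_exp_exp)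
    also have "\<dots> = (if len g \<le> u - real i then exp e * exp (e * real i) else 0)" using i(1) by auto
    also have "\<dots> \<le> (\<Sum>j\<le>n. if len g \<le> u - real j then exp e * exp (e * real j) else 0)"
      using \<open>i \<le> n\<close> by (intro member_le_sum) auto
    finally show "exp (e * (u - len g)) \<le> \<dots>" .
  qed
  also have "\<dots> = (\<Sum>j\<le>n. \<Sum>g | g \<in> \<Gamma> \<and> len g \<le> u. if len g \<le> u - real j then exp e * exp (e * real j) else 0)"
    by (rule sum.swap)
  also have "\<dots> = (\<Sum>j\<le>n. \<Sum>g | g \<in> \<Gamma> \<and> len g \<le> u - real j. exp e * exp (e * real j))"
  proof (rule sum.cong[OF refl])
    fix j
    have "{g \<in> \<Gamma>. len g \<le> u - real j} = {g \<in> {g \<in> \<Gamma>. len g \<le> u}. len g \<le> u - real j}" by auto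
    then show "(\<Sum>g | g \<in> \<Gamma> \<and> len g \<le> u. if len g \<le> u - real j then exp e * exp (e * real j) else 0)
      = (\<Sum>g | g \<in> \<Gamma> \<and> len g \<le> u - real j. exp e * exp (e * real j))"
      by (simp only: sum.inter_filter[OF fin])
  qed
  also have "\<dots> \<le> (\<Sum>j\<le>n. exp e * K * exp (\<delta> * u) * exp (- (\<delta> - e) * real j))"
  proof (rule sum_mono)
    fix j assume "j \<in> {..n}"
    then have "0 \<le> u - real j" using n(1) by (auto simp: of_nat_le_iff intro: order_trans)
    then have "real (card {g \<in> \<Gamma>. len g \<le> u - real j}) * (exp e * exp (e * real j)) \<le> K * exp (\<delta> * (u - real j)) * (exp e * exp (e * real j))"
      by (intro mult_right_mono growth_upper) auto
    also have "\<dots> = exp e * K * exp (\<delta> * u) * exp (- (\<delta> - e) * real j)"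
      by (simp add: algebra_simps mult_exp_exp)
    finally show "(\<Sum>g | g \<in> \<Gamma> \<and> len g \<le> u - real j. exp e * exp (e * real j)) \<le> exp e * K * exp (\<delta> * u) * exp (- (\<delta> - e) * real j)"
      by simp
  qed
  also have "\<dots> = exp e * K * exp (\<delta> * u) * (\<Sum>j\<le>n. exp (- (\<delta> - e) * real j))" by (simp add: sum_distrib_left)
  also have "\<dots> \<le> exp e * K * exp (\<delta> * u) * (1 / (1 - exp (- (\<delta> - e))))"
    using e K_pos by (intro mult_left_mono sum_geometric_exp_le) auto
  finally show ?thesis by (simp add: algebra_simps)
qed

text \<open>Annuli are summed geometrically, which requires a positive exponent; \<open>e\<close>
  provides it when \<open>d = 0\<close>.\<close>

lemma card_ball_sub:
  assumes e: "d \<le> e" "0 < e"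
  shows "\<exists>M>0. \<forall>x\<ge>0. real (card {h \<in> H. len h \<le> x}) \<le> M * exp (e * x)"
proof -
  obtain M where M: "\<forall>N\<ge>0. real (card {h \<in> H. N \<le> len h \<and> len h \<le> N + 1}) \<le> M * exp (d * N)"
    using card_annulus_upper[OF crit] by blast
  have M0: "0 \<le> M"
  proof -
    have "0 \<le> M * exp (d * 0)" using M[rule_format, of 0] of_nat_0_le_iff order_trans by blast
    then show ?thesis by simp
  qed
  have "real (card {h \<in> H. len h \<le> x}) \<le> (M / (1 - exp (- e)) + 1) * exp (e * x)" if x: "0 \<le> x" for x
  proof -
    define n where "n = nat \<lfloor>x\<rfloor>"
    have n: "real n \<le> x" "x < real n + 1" using x by (auto simp: n_def)
    have fin: "finite {h \<in> H. N \<le> len h \<and> len h \<le> N + 1}" for N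
      by (rule finite_subset[OF _ finite_ball[of b "N + 1"]]) auto
    have "{h \<in> H. len h \<le> x} \<subseteq> (\<Union>j\<in>{..n}. {h \<in> H. real j \<le> len h \<and> len h \<le> real j + 1})"
    proof
      fix h assume h: "h \<in> {h \<in> H. len h \<le> x}"
      define i where "i = nat \<lfloor>len h\<rfloor>"
      have i: "real i \<le> len h" "len h \<le> real i + 1" by (auto simp: i_def)
      have "real i < real n + 1" using i h n by auto
      then have "i \<in> {..n}" by simp
      then show "h \<in> (\<Union>j\<in>{..n}. {h \<in> H. real j \<le> len h \<and> len h \<le> real j + 1})" using i h by blast
    qed
    then have "card {h \<in> H. len h \<le> x} \<le> card (\<Union>j\<in>{..n}. {h \<in> H. real j \<le> len h \<and> len h \<le> real j + 1})"
      using fin by (intro card_mono) auto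
    also have "\<dots> \<le> (\<Sum>j\<le>n. card {h \<in> H. real j \<le> len h \<and> len h \<le> real j + 1})"
      by (rule card_UN_le) simp
    finally have "real (card {h \<in> H. len h \<le> x}) \<le> real (\<Sum>j\<le>n. card {h \<in> H. real j \<le> len h \<and> len h \<le> real j + 1})"
      by (simp only: of_nat_le_iff)
    also have "\<dots> = (\<Sum>j\<le>n. real (card {h \<in> H. real j \<le> len h \<and> len h \<le> real j + 1}))" by simp
    also have "\<dots> \<le> (\<Sum>j\<le>n. M * exp (e * real j))"
    proof (rule sum_mono)
      fix j
      have "real (card {h \<in> H. real j \<le> len h \<and> len h \<le> real j + 1}) \<le> M * exp (d * real j)" using M by simp
      also have "\<dots> \<le> M * exp (e * real j)" using M0 e(1) by (intro mult_left_mono) (auto simp: mult_right_mono)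
      finally show "real (card {h \<in> H. real j \<le> len h \<and> len h \<le> real j + 1}) \<le> M * exp (e * real j)" .
    qed
    also have "\<dots> = (\<Sum>j\<le>n. M * exp (e * real n) * exp (- e * real j))"
    proof (rule sum.reindex_bij_witness[of _ "\<lambda>j. n - j" "\<lambda>j. n - j"])
      fix j assume "j \<in> {..n}"
      then show "M * exp (e * real n) * exp (- e * real (n - j)) = M * exp (e * real j)"
        by (simp add: of_nat_diff algebra_simps mult_exp_exp)
    qed auto
    also have "\<dots> = M * exp (e * real n) * (\<Sum>j\<le>n. exp (- e * real j))" by (simp add: sum_distrib_left)
    also have "\<dots> \<le> M * exp (e * x) * (1 / (1 - exp (- e)))"
      using M0 n(1) e(2) by (intro mult_mono sum_geometric_exp_le) (auto intro!: sum_nonneg mult_left_mono)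
    also have "\<dots> \<le> (M / (1 - exp (- e)) + 1) * exp (e * x)" by (simp add: algebra_simps)
    finally show ?thesis .
  qed
  moreover have "M / (1 - exp (- e)) + 1 > 0" using M0 e(2) by (simp add: add_nonneg_pos)
  ultimately show ?thesis by blast
qed

text \<open>Every element of the ball of radius \<open>t\<close> is some
  \<open>\<alpha> \<circ> h\<close> with \<open>\<alpha>\<close> reduced and \<open>h\<close> of
  length at most \<open>t - len \<alpha> + c1\<close>. Short \<open>\<alpha>\<close> cannot produce
  the whole ball, because their stabilizer directions grow at a rate below \<open>\<delta>\<close>;
  so those of length within \<open>k\<close> of \<open>t\<close> must be numerous.\<close>

lemma reduced_count:
  obtains k c where "0 < k" "0 < c" "\<forall>t\<ge>k. c * exp (\<delta> * t) \<le> real (card {\<alpha>. reduced \<alpha> \<and> t - k < len \<alpha> \<and> len \<alpha> \<le> t})"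
proof -
  \<comment> \<open>Strictly between the exponents: positive even if \<open>d = 0\<close>, and below
    \<open>\<delta>\<close> as \<open>weighted_ball_sum\<close> requires.\<close>
  define e where "e = (d + \<delta>) / 2"
  have e: "d \<le> e" "0 < e" "e < \<delta>" using exponent_less d_nonneg by (auto simp: e_def)
  obtain M where M: "M > 0" "\<forall>x\<ge>0. real (card {h \<in> H. len h \<le> x}) \<le> M * exp (e * x)"
    using card_ball_sub[OF e(1,2)] by blast
  define c1 where "c1 = 2 * D + 4"
  have c1: "c1 > 0" using D_nonneg by (simp add: c1_def)
  define K3 where "K3 = exp e * K / (1 - exp (- (\<delta> - e)))"
  have K3: "K3 > 0" using e K_pos by (simp add: K3_def)
  define A where "A = M * exp (e * c1)"
  have A: "A > 0" using M by (simp add: A_def)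
  \<comment> \<open>Makes the representatives of length at most \<open>t - k\<close> account for at
    most half of the growth bound.\<close>
  define k where "k = max 1 (ln (2 * K * A * K3) / (\<delta> - e))"
  have k: "0 < k" "2 * K * A * K3 \<le> exp ((\<delta> - e) * k)"
  proof -
    have "ln (2 * K * A * K3) / (\<delta> - e) \<le> k" by (simp add: k_def)
    then have "ln (2 * K * A * K3) \<le> (\<delta> - e) * k" using e by (simp add: field_simps)
    then have "exp (ln (2 * K * A * K3)) \<le> exp ((\<delta> - e) * k)" by simp
    then show "2 * K * A * K3 \<le> exp ((\<delta> - e) * k)" using A K3 K_pos by simp
  qed (simp add: k_def)
  define c where "c = 1 / (2 * K * A * exp (e * k))"
  have c: "c > 0" using A K_pos by (simp add: c_def)
  have "c * exp (\<delta> * t) \<le> real (card {\<alpha>. reduced \<alpha> \<and> t - k < len \<alpha> \<and> len \<alpha> \<le> t})" if t: "t \<ge> k" for t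
  proof -
    define E where "E = {\<alpha>. reduced \<alpha> \<and> len \<alpha> \<le> t}"
    define E1 where "E1 = {\<alpha>. reduced \<alpha> \<and> t - k < len \<alpha> \<and> len \<alpha> \<le> t}"
    define E2 where "E2 = {\<alpha>. reduced \<alpha> \<and> len \<alpha> \<le> t - k}"
    have finE: "finite E" by (rule finite_subset[OF _ G.finite_ball[of b t]]) (auto simp: E_def reduced_mem)
    have E12: "E = E1 \<union> E2" "E1 \<inter> E2 = {}" using k(1) by (auto simp: E_def E1_def E2_def)
    have fin12: "finite E1" "finite E2" using finE E12 by auto
    have t0: "0 \<le> t" using t k by simp
    define Y where "Y = Sigma E (\<lambda>\<alpha>. {h \<in> H. len h \<le> t - len \<alpha> + c1})"
    have finY: "finite Y" unfolding Y_def using finE finite_ball by (intro finite_SigmaI) auto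
    have "{g \<in> \<Gamma>. len g \<le> t} \<subseteq> (\<lambda>z. fst z \<circ> snd z) ` Y"
    proof
      fix g assume g: "g \<in> {g \<in> \<Gamma>. len g \<le> t}"
      then obtain \<alpha> h where ah: "reduced \<alpha>" "h \<in> H" "g = \<alpha> \<circ> h" using ex_reduced by blast
      have "(\<alpha>, h) \<in> Y" using reduced_len[OF ah(1,2)] ah g by (auto simp: Y_def E_def c1_def)
      then show "g \<in> (\<lambda>z. fst z \<circ> snd z) ` Y" using ah(3) by force
    qed
    then have "card {g \<in> \<Gamma>. len g \<le> t} \<le> card Y"
      using finY by (meson card_image_le card_mono finite_imageI order_trans)
    then have "K * real (card {g \<in> \<Gamma>. len g \<le> t}) \<le> K * real (card Y)"
      using K_pos by (intro mult_left_mono) auto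
    then have "exp (\<delta> * t) \<le> K * real (card Y)"
      using growth_lower[OF t0] by linarith
    also have "real (card Y) = (\<Sum>\<alpha>\<in>E. real (card {h \<in> H. len h \<le> t - len \<alpha> + c1}))"
      unfolding Y_def using finE finite_ball by (subst card_SigmaI) auto
    also have "\<dots> \<le> (\<Sum>\<alpha>\<in>E. A * exp (e * (t - len \<alpha>)))"
    proof (rule sum_mono)
      fix \<alpha> assume "\<alpha> \<in> E"
      then have "0 \<le> t - len \<alpha> + c1" using c1 by (simp add: E_def)
      from M(2)[rule_format, OF this] show "real (card {h \<in> H. len h \<le> t - len \<alpha> + c1}) \<le> A * exp (e * (t - len \<alpha>))"
        by (simp add: A_def algebra_simps mult_exp_exp)
    qed
    also have "\<dots> = A * (\<Sum>\<alpha>\<in>E1. exp (e * (t - len \<alpha>))) + A * (\<Sum>\<alpha>\<in>E2. exp (e * (t - len \<alpha>)))"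
      unfolding E12(1) by (simp add: sum.union_disjoint[OF fin12 E12(2)] sum_distrib_left)
    also have "(\<Sum>\<alpha>\<in>E1. exp (e * (t - len \<alpha>))) \<le> real (card E1) * exp (e * k)"
    proof (rule sum_bounded_above)
      fix \<alpha> assume "\<alpha> \<in> E1"
      then show "exp (e * (t - len \<alpha>)) \<le> exp (e * k)" using e by (auto simp: E1_def intro!: mult_left_mono)
    qed
    also have "(\<Sum>\<alpha>\<in>E2. exp (e * (t - len \<alpha>))) \<le> K3 * exp (\<delta> * t) / exp ((\<delta> - e) * k)"
    proof -
      have "(\<Sum>\<alpha>\<in>E2. exp (e * (t - len \<alpha>))) = (\<Sum>\<alpha>\<in>E2. exp (e * k) * exp (e * (t - k - len \<alpha>)))"
        by (simp add: algebra_simps mult_exp_exp)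
      also have "\<dots> = exp (e * k) * (\<Sum>\<alpha>\<in>E2. exp (e * (t - k - len \<alpha>)))" by (simp add: sum_distrib_left)
      also have "(\<Sum>\<alpha>\<in>E2. exp (e * (t - k - len \<alpha>))) \<le> (\<Sum>g | g \<in> \<Gamma> \<and> len g \<le> t - k. exp (e * (t - k - len g)))"
        by (rule sum_mono2) (auto simp: E2_def reduced_mem G.finite_ball)
      also have "\<dots> \<le> K3 * exp (\<delta> * (t - k))"
        unfolding K3_def using e t by (intro weighted_ball_sum) auto
      finally have "(\<Sum>\<alpha>\<in>E2. exp (e * (t - len \<alpha>))) \<le> exp (e * k) * (K3 * exp (\<delta> * (t - k)))" by simp
      also have "\<dots> = K3 * exp (\<delta> * t) / exp ((\<delta> - e) * k)"
        by (simp add: field_simps mult_exp_exp exp_diff)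
      finally show ?thesis .
    qed
    finally have "exp (\<delta> * t) \<le> K * (A * (real (card E1) * exp (e * k)) + A * (K3 * exp (\<delta> * t) / exp ((\<delta> - e) * k)))"
      using K_pos A by (simp add: mult_left_mono)
    moreover have "K * (A * (K3 * exp (\<delta> * t) / exp ((\<delta> - e) * k))) \<le> exp (\<delta> * t) / 2"
    proof -
      have "(2 * K * A * K3) * exp (\<delta> * t) \<le> exp ((\<delta> - e) * k) * exp (\<delta> * t)" using k(2) by (intro mult_right_mono) auto
      then show ?thesis by (simp add: field_simps)
    qed
    ultimately have "exp (\<delta> * t) / 2 \<le> K * (A * (real (card E1) * exp (e * k)))"
      unfolding distrib_left by linarith
    then show ?thesis using A K_pos by (simp add: c_def E1_def field_simps)
  qed
  then show ?thesis using that[OF k(1) c] by blast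
qed

end

section \<open>Conformal densities\<close>

locale conformal_action = isom_action pt \<Gamma> for pt :: "'a::metric_space" and \<Gamma> +
  fixes \<delta> :: real and \<nu> :: "'a \<Rightarrow> (real \<Rightarrow> 'a) set measure"
  assumes conf: "conformal_density \<Gamma> \<delta> \<nu>"
    and dim_pos: "0 < \<delta>"
    and two_limit_points: "\<exists>\<xi>\<in>limit_set \<Gamma>. \<exists>\<eta>\<in>limit_set \<Gamma>. \<xi> \<noteq> \<eta>"
begin

lemma sets_\<nu> [measurable_cong]: "sets (\<nu> x) = sets bdry_borel"
  using conf by (auto simp: conformal_density_def)

lemma space_\<nu> [simp]: "space (\<nu> x) = boundary"
  using sets_eq_imp_space_eq[OF sets_\<nu>[of x]] by simp

lemma finite_\<nu>: "finite_measure (\<nu> x)"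
  using conf by (auto simp: conformal_density_def)

lemma fin: "emeasure (\<nu> x) A = ennreal (measure (\<nu> x) A)"
  using finite_measure.emeasure_eq_measure[OF finite_\<nu>] .

lemma total_pos: "0 < measure (\<nu> x) boundary"
proof -
  have "emeasure (\<nu> x) (space (\<nu> x)) \<noteq> 0" using conf by (auto simp: conformal_density_def)
  then show ?thesis unfolding space_\<nu> fin by (simp add: less_le)
qed

lemma equivariance:
  assumes g: "g \<in> \<Gamma>" and A: "A \<in> sets bdry_borel"
  shows "measure (\<nu> (g x)) A = measure (\<nu> x) {\<xi> \<in> boundary. boundary_action g \<xi> \<in> A}"
proof -
  have "\<nu> (g x) = distr (\<nu> x) bdry_borel (boundary_action g)"
    using conf g by (auto simp: conformal_density_def)
  moreover have "boundary_action g \<in> measurable (\<nu> x) bdry_borel"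
    using measurable_action[OF g] measurable_cong_sets[OF sets_\<nu> refl] by blast
  ultimately have "measure (\<nu> (g x)) A = measure (\<nu> x) (boundary_action g -` A \<inter> space (\<nu> x))"
    by (simp add: measure_distr A)
  also have "boundary_action g -` A \<inter> space (\<nu> x) = {\<xi> \<in> boundary. boundary_action g \<xi> \<in> A}" by auto
  finally show ?thesis .
qed

lemma total_mass: "g \<in> \<Gamma> \<Longrightarrow> measure (\<nu> (g x)) boundary = measure (\<nu> x) boundary"
proof -
  assume g: "g \<in> \<Gamma>"
  have e: "{\<xi> \<in> boundary. boundary_action g \<xi> \<in> boundary} = boundary" using action(1)[OF g] by auto
  have "boundary \<in> sets (bdry_borel :: (real \<Rightarrow> 'a) set measure)" using sets.top[of bdry_borel] by simp
  from equivariance[OF g this, of x] show ?thesis unfolding e .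
qed

lemma change_base:
  assumes A: "A \<in> sets bdry_borel" and c: "\<And>\<xi>. \<xi> \<in> A \<Longrightarrow> c \<le> busemann \<xi> x y"
  shows "measure (\<nu> x) A \<le> exp (- \<delta> * c) * measure (\<nu> y) A"
proof -
  have meas: "(\<lambda>\<xi>. ennreal (exp (- \<delta> * busemann \<xi> x y))) \<in> borel_measurable (\<nu> y)"
  proof -
    have "(\<lambda>\<xi>. busemann \<xi> x y) \<in> borel_measurable (\<nu> y)"
      using measurable_busemann measurable_cong_sets[OF sets_\<nu> refl] by blast
    then show ?thesis by measurable
  qed
  have A': "A \<in> sets (\<nu> y)" using A by (simp add: sets_\<nu>)
  have "\<nu> x = density (\<nu> y) (\<lambda>\<xi>. ennreal (exp (- \<delta> * busemann \<xi> x y)))"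
    using conf unfolding conformal_density_def by blast
  then have "emeasure (\<nu> x) A = (\<integral>\<^sup>+ \<xi>. ennreal (exp (- \<delta> * busemann \<xi> x y)) * indicator A \<xi> \<partial>\<nu> y)"
    using emeasure_density[OF meas A'] by simp
  also have "\<dots> \<le> (\<integral>\<^sup>+ \<xi>. ennreal (exp (- \<delta> * c)) * indicator A \<xi> \<partial>\<nu> y)"
    using c dim_pos by (intro nn_integral_mono) (auto split: split_indicator intro!: ennreal_leI mult_left_mono)
  also have "\<dots> = ennreal (exp (- \<delta> * c)) * emeasure (\<nu> y) A"
    using A' by (simp add: nn_integral_cmult)
  finally show ?thesis by (simp add: fin flip: ennreal_mult')
qed

lemma change_base':
  assumes A: "A \<in> sets bdry_borel" and c: "\<And>\<xi>. \<xi> \<in> A \<Longrightarrow> busemann \<xi> x y \<le> c"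
  shows "exp (- \<delta> * c) * measure (\<nu> y) A \<le> measure (\<nu> x) A"
proof -
  have "A \<subseteq> boundary" using sets.sets_into_space[OF A] by simp
  then have "- c \<le> busemann \<xi> y x" if "\<xi> \<in> A" for \<xi>
    using c[OF that] busemann_swap[of \<xi> x y] that by auto
  from change_base[OF A this] have "measure (\<nu> y) A \<le> exp (\<delta> * c) * measure (\<nu> x) A" by simp
  then have "exp (- \<delta> * c) * measure (\<nu> y) A \<le> exp (- \<delta> * c) * (exp (\<delta> * c) * measure (\<nu> x) A)"
    by (rule mult_left_mono) simp
  then show ?thesis by (simp add: mult.assoc[symmetric] mult_exp_exp)
qed

lemma null_sets_base: "A \<in> sets bdry_borel \<Longrightarrow> measure (\<nu> y) A = 0 \<Longrightarrow> measure (\<nu> x) A = 0"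
proof -
  assume A: "A \<in> sets bdry_borel" "measure (\<nu> y) A = 0"
  have "A \<subseteq> boundary" using sets.sets_into_space[OF A(1)] by simp
  then have "- dist y x \<le> busemann \<xi> x y" if "\<xi> \<in> A" for \<xi>
    using busemann_le[of \<xi> y x] busemann_swap[of \<xi> x y] that by auto
  from change_base[OF A(1) this] show ?thesis using A(2) by (simp add: measure_le_0_iff)
qed

section \<open>Shadows and the shadow lemma\<close>

lemma measurable_ray_set [measurable]: "{\<xi> \<in> boundary. dist y (ray_to x \<xi> t) \<le> R} \<in> sets bdry_borel"
proof -
  have "{\<xi> \<in> space bdry_borel. dist y (ray_to x \<xi> t) \<le> R} \<in> sets bdry_borel" by measurable
  then show ?thesis by simp
qed

text \<open>The ray is tested at the single time \<open>dist b y\<close>, which makes the set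
  visibly Borel; a ray meeting the ball of radius \<open>R\<close> around \<open>y\<close> at any
  time lies in the shadow of radius \<open>2 * R\<close>.\<close>

definition shadow :: "'a \<Rightarrow> real \<Rightarrow> 'a \<Rightarrow> (real \<Rightarrow> 'a) set set" where
  "shadow b R y = {\<xi> \<in> boundary. dist y (ray_to b \<xi> (dist b y)) \<le> R}"

lemma shadow_sets [measurable]: "shadow b R y \<in> sets bdry_borel"
  unfolding shadow_def by (rule measurable_ray_set)

text \<open>On the shadow the Busemann function is at least \<open>dist b (g b) - R\<close>, and the
  total mass is the same seen from \<open>g b\<close> as from \<open>b\<close>.\<close>

lemma shadow_upper:
  assumes g: "g \<in> \<Gamma>"
  shows "measure (\<nu> b) (shadow b R (g b)) \<le> exp (\<delta> * R) * measure (\<nu> b) boundary * exp (- \<delta> * dist b (g b))"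
proof -
  have "measure (\<nu> b) (shadow b R (g b)) \<le> exp (- \<delta> * (dist b (g b) - R)) * measure (\<nu> (g b)) (shadow b R (g b))"
  proof (rule change_base[OF shadow_sets])
    fix \<xi> assume "\<xi> \<in> shadow b R (g b)"
    then have \<xi>: "\<xi> \<in> boundary" "dist (g b) (ray_to b \<xi> (dist b (g b))) \<le> R" by (auto simp: shadow_def)
    define m where "m = ray_to b \<xi> (dist b (g b))"
    have "busemann \<xi> b (g b) = busemann \<xi> b m + busemann \<xi> m (g b)" by (simp add: busemann_add \<xi>)
    moreover have "busemann \<xi> b m = dist b (g b)" unfolding m_def by (rule busemann_ray_to[OF \<xi>(1)]) simp
    moreover have "busemann \<xi> (g b) m \<le> R" using busemann_le[OF \<xi>(1), of "g b" m] \<xi>(2) by (simp add: m_def)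
    ultimately show "dist b (g b) - R \<le> busemann \<xi> b (g b)" using busemann_swap[OF \<xi>(1), of m "g b"] by simp
  qed
  also have "measure (\<nu> (g b)) (shadow b R (g b)) \<le> measure (\<nu> (g b)) boundary"
  proof -
    have "shadow b R (g b) \<subseteq> space (\<nu> (g b))" by (auto simp: shadow_def)
    then show ?thesis using finite_measure.bounded_measure[OF finite_\<nu>, of "g b"] by simp
  qed
  also have "\<dots> = measure (\<nu> b) boundary" by (rule total_mass[OF g])
  finally show ?thesis by (simp add: algebra_simps mult_exp_exp)
qed

text \<open>A density carried by one point would have this point fixed, and equality of the masses
  along an orbit would make the Busemann function vanish on it. By
  \<open>limit_point_horospherical\<close> there would be only one limit point.\<close>

lemma no_atom_full:
  assumes "\<xi>0 \<in> boundary" and A: "{\<xi>0} \<in> sets bdry_borel" and full: "measure (\<nu> b) (boundary - {\<xi>0}) = 0"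
  shows False
proof -
  have B: "boundary \<in> sets (bdry_borel :: (real \<Rightarrow> 'a) set measure)" using sets.top[of bdry_borel] by simp
  have A': "boundary - {\<xi>0} \<in> sets bdry_borel" using A B by auto
  have null: "measure (\<nu> x) (boundary - {\<xi>0}) = 0" for x by (rule null_sets_base[OF A' full])
  have pos: "measure (\<nu> x) {\<xi>0} > 0" for x
  proof -
    have "measure (\<nu> x) boundary = measure (\<nu> x) (boundary - {\<xi>0}) + measure (\<nu> x) {\<xi>0}"
      using finite_measure.finite_measure_Diff[OF finite_\<nu>, of boundary x "{\<xi>0}"] A B assms(1) by (simp add: sets_\<nu>)
    then show ?thesis using null total_pos[of x] by simp
  qed
  have fx: "boundary_action g \<xi>0 = \<xi>0" if g: "g \<in> \<Gamma>" for g
  proof (rule ccontr)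
    assume ne: "boundary_action g \<xi>0 \<noteq> \<xi>0"
    have "measure (\<nu> (g b)) (boundary - {\<xi>0}) = measure (\<nu> b) {\<xi> \<in> boundary. boundary_action g \<xi> \<in> boundary - {\<xi>0}}"
      by (rule equivariance[OF g A'])
    moreover have "measure (\<nu> b) {\<xi>0} \<le> measure (\<nu> b) {\<xi> \<in> boundary. boundary_action g \<xi> \<in> boundary - {\<xi>0}}"
    proof (rule finite_measure.finite_measure_mono[OF finite_\<nu>])
      show "{\<xi>0} \<subseteq> {\<xi> \<in> boundary. boundary_action g \<xi> \<in> boundary - {\<xi>0}}" using ne assms(1) action(1)[OF g] by auto
      have "boundary_action g -` (boundary - {\<xi>0}) \<inter> space bdry_borel \<in> sets bdry_borel"
        by (rule measurable_sets[OF measurable_action[OF g] A'])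
      moreover have "boundary_action g -` (boundary - {\<xi>0}) \<inter> space bdry_borel = {\<xi> \<in> boundary. boundary_action g \<xi> \<in> boundary - {\<xi>0}}" by auto
      ultimately show "{\<xi> \<in> boundary. boundary_action g \<xi> \<in> boundary - {\<xi>0}} \<in> sets (\<nu> b)" by (simp add: sets_\<nu>)
    qed
    ultimately show False using null[of "g b"] pos[of b] by simp
  qed
  have le: "busemann \<xi>0 (g x) x \<le> 0" if g: "g \<in> \<Gamma>" for g x
  proof -
    have "{\<xi> \<in> boundary. boundary_action g \<xi> \<in> {\<xi>0}} = {\<xi>0}"
      using fx[OF g] fx[OF inv_mem[OF g]] action_inv(1)[OF g] assms(1) by auto
    then have "measure (\<nu> (g x)) {\<xi>0} = measure (\<nu> x) {\<xi>0}" using equivariance[OF g A, of x] by simp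
    moreover have "measure (\<nu> (g x)) {\<xi>0} \<le> exp (- \<delta> * busemann \<xi>0 (g x) x) * measure (\<nu> x) {\<xi>0}"
      by (rule change_base[OF A]) simp
    ultimately have "1 \<le> exp (- \<delta> * busemann \<xi>0 (g x) x)" using pos[of x] by simp
    then show ?thesis using dim_pos by (simp add: mult_le_0_iff)
  qed
  have "busemann \<xi>0 x (g x) = 0" if g: "g \<in> \<Gamma>" for g x
    using le[OF g, of x] le[OF inv_mem[OF g], of "g x"] g busemann_swap[OF assms(1), of x "g x"] by simp
  then have "\<eta> = \<xi>0" if "\<eta> \<in> limit_set \<Gamma>" for \<eta> using limit_point_horospherical[OF assms(1) _ that] by blast
  then show False using two_limit_points by metis
qed

text \<open>The shadow of \<open>b\<close> seen from \<open>z\<close> has mass bounded below,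
  uniformly in \<open>z\<close>. Otherwise there are points \<open>z n\<close> for which all but a
  summable part of the mass points towards \<open>z n\<close> up to time \<open>n\<close>; by
  Borel-Cantelli almost all directions agree, and the density is carried by one point.\<close>

lemma spread:
  obtains R c where "R \<ge> 0" "c > 0"
    "\<forall>z. c \<le> measure (\<nu> b) {\<xi> \<in> boundary. dist b (ray_to z \<xi> (dist b z)) \<le> R}"
proof -
  define good where "good R z = {\<xi> \<in> boundary. dist b (ray_to z \<xi> (dist b z)) \<le> R}" for R z
  have good_sets: "good R z \<in> sets bdry_borel" for R z unfolding good_def by (rule measurable_ray_set)
  have "\<exists>R\<ge>0. \<exists>c>0. \<forall>z. c \<le> measure (\<nu> b) (good R z)"
  proof (rule ccontr)
    assume "\<not> ?thesis"
    then have no: "\<exists>z. measure (\<nu> b) (good R z) < c" if "0 \<le> R" "0 < c" for R c using that by (meson not_le)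
    have "\<forall>n::nat. \<exists>z. measure (\<nu> b) (good (2 * real n + 2) z) < (1/2)^n" using no by simp
    then obtain z where z: "\<And>n. measure (\<nu> b) (good (2 * real n + 2) (z n)) < (1/2)^n" by metis
    define w where "w n = gen_ray b (Inl (z n)) (real n)" for n
    \<comment> \<open>\<open>V n\<close> consists of the directions leaving the segment to
      \<open>z n\<close> before time \<open>n\<close>. A direction outside the good set has Gromov
      product at least \<open>n\<close> with \<open>z n\<close> at \<open>b\<close>, so
      \<open>V n\<close> lies in the good set and is small.\<close>
    define V where "V n = {\<xi> \<in> boundary. \<not> dist (w n) (ray_to b \<xi> (real n)) \<le> 2}" for n
    have V_sets: "V n \<in> sets (\<nu> b)" for n
    proof -
      have "V n = boundary - {\<xi> \<in> boundary. dist (w n) (ray_to b \<xi> (real n)) \<le> 2}" by (auto simp: V_def)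
      then show ?thesis using sets.compl_sets[OF measurable_ray_set[of "w n" b "real n" 2]] by (simp add: sets_\<nu>)
    qed
    have V_good: "V n \<subseteq> good (2 * real n + 2) (z n)" for n
    proof
      fix \<xi> assume v: "\<xi> \<in> V n"
      then have \<xi>: "\<xi> \<in> boundary" by (simp add: V_def)
      show "\<xi> \<in> good (2 * real n + 2) (z n)"
      proof (rule ccontr)
        assume "\<xi> \<notin> good (2 * real n + 2) (z n)"
        then have far: "dist b (ray_to (z n) \<xi> (dist b (z n))) > 2 * real n + 2" using \<xi> by (simp add: good_def)
        define m where "m = ray_to (z n) \<xi> (dist b (z n))"
        have "dist b m \<le> max (dist b (z n) - dist b (z n)) (busemann \<xi> b m) + 2"
          unfolding m_def by (rule thin_ray[OF \<xi>]) simp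
        then have 1: "2 * real n \<le> busemann \<xi> b m" using far by (simp add: m_def)
        have "busemann \<xi> (z n) m = dist b (z n)" unfolding m_def by (rule busemann_ray_to[OF \<xi>]) simp
        then have 2: "2 * real n - dist b (z n) \<le> busemann \<xi> b (z n)"
          using 1 busemann_add[OF \<xi>, of b m "z n"] busemann_swap[OF \<xi>, of "z n" m] by simp
        have "dist b m \<le> dist b (z n) + dist (z n) m" by (rule dist_triangle)
        also have "dist (z n) m = dist b (z n)" unfolding m_def by (rule ray_to_dist0[OF \<xi>]) simp
        finally have "real n \<le> dist b (z n)" using far by (simp add: m_def)
        then have wn: "between b (w n) (z n)" "dist b (w n) = real n"
          using gen_ray_Inl_between[of "real n" b "z n"] by (auto simp: w_def)
        have "dist (w n) (ray_to b \<xi> (real n)) \<le> 2 * exp (real n - (dist b (z n) + busemann \<xi> b (z n)) / 2)"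
          using thin_ray_segment[OF \<xi> wn(1)] wn(2) by simp
        also have "\<dots> \<le> 2 * exp 0" using 2 by (simp add: field_simps)
        finally show False using v by (simp add: V_def)
      qed
    qed
    have Vn: "measure (\<nu> b) (V n) \<le> (1/2)^n" for n
    proof -
      have "measure (\<nu> b) (V n) \<le> measure (\<nu> b) (good (2 * real n + 2) (z n))"
        using V_good good_sets by (intro finite_measure.finite_measure_mono[OF finite_\<nu>]) (auto simp: sets_\<nu>)
      then show ?thesis using z[of n] by simp
    qed
    have summ: "summable (\<lambda>n. measure (\<nu> b) (V n))"
    proof (rule summable_comparison_test)
      show "\<exists>N. \<forall>n\<ge>N. norm (measure (\<nu> b) (V n)) \<le> (1/2)^n" using Vn by simp
      show "summable (\<lambda>n. (1/2::real)^n)" by (rule summable_geometric) simp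
    qed
    have "AE \<xi> in \<nu> b. eventually (\<lambda>n. \<xi> \<in> space (\<nu> b) - V n) sequentially"
      by (rule borel_cantelli_AE1[OF V_sets _ summ]) (simp add: fin)
    moreover define E where "E = {\<xi> \<in> boundary. \<exists>N. \<forall>n\<ge>N. \<xi> \<notin> V n}"
    ultimately have AE: "AE \<xi> in \<nu> b. \<xi> \<in> E"
      by (auto simp: eventually_sequentially)
    have E_sets: "E \<in> sets bdry_borel"
    proof -
      have e: "E = (\<Union>N. \<Inter>n\<in>{N..}. boundary - V n)" by (auto simp: E_def)
      have m: "boundary - V n \<in> sets bdry_borel" for n using sets.compl_sets[OF V_sets[of n]] by (simp add: sets_\<nu>)
      show ?thesis unfolding e by (intro sets.countable_UN'' sets.countable_INT' image_subsetI m) (auto intro: m)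
    qed
    have null: "measure (\<nu> b) (boundary - E) = 0"
    proof -
      have "boundary - E \<in> null_sets (\<nu> b)"
        using AE_iff_null_sets[of "boundary - E" "\<nu> b"] AE sets.compl_sets[OF E_sets] by (auto simp: sets_\<nu>)
      then show ?thesis by (simp add: null_sets_def measure_def)
    qed
    then have "E \<noteq> {}" using total_pos[of b] by auto
    then obtain \<xi>0 where \<xi>0: "\<xi>0 \<in> E" by blast
    have "\<xi> = \<xi>0" if \<xi>: "\<xi> \<in> E" for \<xi>
    proof (rule ray_to_bounded_eq[where C = 4 and x = b])
      show "\<xi> \<in> boundary" "\<xi>0 \<in> boundary" using \<xi> \<xi>0 by (auto simp: E_def)
      obtain N N' where N: "\<And>n. n \<ge> N \<Longrightarrow> \<xi> \<notin> V n" "\<And>n. n \<ge> N' \<Longrightarrow> \<xi>0 \<notin> V n" using \<xi> \<xi>0 by (auto simp: E_def)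
      fix t :: real assume "0 \<le> t"
      define n where "n = max (max N N') (nat \<lceil>t\<rceil>)"
      have n: "n \<ge> N" "n \<ge> N'" by (auto simp: n_def)
      have nt: "real n \<ge> t" unfolding n_def by linarith
      have "dist (w n) (ray_to b \<xi> (real n)) \<le> 2" "dist (w n) (ray_to b \<xi>0 (real n)) \<le> 2"
        using N(1)[OF n(1)] N(2)[OF n(2)] \<xi> \<xi>0 by (auto simp: V_def E_def)
      then have "dist (ray_to b \<xi> (real n)) (ray_to b \<xi>0 (real n)) \<le> 4"
        using dist_triangle3[of "ray_to b \<xi> (real n)" "ray_to b \<xi>0 (real n)" "w n"] by simp
      then show "\<exists>u\<ge>t. dist (ray_to b \<xi> u) (ray_to b \<xi>0 u) \<le> 4" using nt by blast
    qed
    then have "E = {\<xi>0}" using \<xi>0 by blast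
    then show False using no_atom_full[of \<xi>0 b] \<xi>0 E_sets null by (auto simp: E_def)
  qed
  then show ?thesis using that unfolding good_def by blast
qed

text \<open>Pulled back by \<open>g\<close>, the shadow consists of the directions of rays from the
  preimage of \<open>b\<close> that pass near \<open>b\<close>, and \<open>spread\<close> applies.
  Returning to the base point \<open>b\<close> costs at most the factor
  \<open>exp (- \<delta> * dist b (g b))\<close>.\<close>

lemma shadow_lower:
  obtains R c where "R \<ge> 0" "c > 0"
    "\<forall>g\<in>\<Gamma>. c * exp (- \<delta> * dist b (g b)) \<le> measure (\<nu> b) (shadow b R (g b))"
proof -
  obtain R c where R: "R \<ge> 0" "c > 0" "\<forall>z. c \<le> measure (\<nu> b) {\<xi> \<in> boundary. dist b (ray_to z \<xi> (dist b z)) \<le> R}"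
    by (rule spread)
  have "c * exp (- \<delta> * dist b (g b)) \<le> measure (\<nu> b) (shadow b R (g b))" if g: "g \<in> \<Gamma>" for g
  proof -
    define z where "z = inv_into UNIV g b"
    have gz: "g z = b" using g by (simp add: z_def)
    have bz: "dist b z = dist b (g b)" using iso[OF g, of z b] gz by (simp add: dist_commute)
    have "{\<xi> \<in> boundary. boundary_action g \<xi> \<in> shadow b R (g b)} = {\<xi> \<in> boundary. dist b (ray_to z \<xi> (dist b z)) \<le> R}"
      using action(1)[OF g] ray_to_action[OF g, of _ b] g by (auto simp: shadow_def bz[symmetric] z_def[symmetric])
    then have "c \<le> measure (\<nu> (g b)) (shadow b R (g b))" using R(3) equivariance[OF g shadow_sets] by simp
    then have "exp (- \<delta> * dist b (g b)) * c \<le> exp (- \<delta> * dist b (g b)) * measure (\<nu> (g b)) (shadow b R (g b))"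
      by (rule mult_left_mono) simp
    also have "\<dots> \<le> measure (\<nu> b) (shadow b R (g b))"
      by (rule change_base'[OF shadow_sets]) (auto simp: shadow_def intro: busemann_le)
    finally show ?thesis by (simp add: mult.commute)
  qed
  then show ?thesis using that R by blast
qed

text \<open>This replaces the ergodicity of the action on the boundary.\<close>

lemma conformal_density_restrict:
  assumes A: "A \<in> sets bdry_borel" and inv: "\<And>g \<xi>. g \<in> \<Gamma> \<Longrightarrow> \<xi> \<in> boundary \<Longrightarrow> boundary_action g \<xi> \<in> A \<longleftrightarrow> \<xi> \<in> A"
    and pos: "measure (\<nu> b) A \<noteq> 0"
  shows "conformal_density \<Gamma> \<delta> (\<lambda>x. density (\<nu> x) (indicator A))"
  unfolding conformal_density_def
proof (intro conjI allI ballI)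
  have A': "A \<in> sets (\<nu> x)" for x using A by (simp add: sets_\<nu>)
  have ind: "(indicator A :: _ \<Rightarrow> ennreal) \<in> borel_measurable (\<nu> x)" for x using A'[of x] by simp
  have em: "emeasure (density (\<nu> x) (indicator A)) (space (density (\<nu> x) (indicator A))) = emeasure (\<nu> x) A" for x
  proof -
    have "emeasure (density (\<nu> x) (indicator A)) (space (\<nu> x)) = (\<integral>\<^sup>+ \<xi>. indicator A \<xi> * indicator (space (\<nu> x)) \<xi> \<partial>\<nu> x)"
      by (rule emeasure_density[OF ind sets.top])
    also have "\<dots> = (\<integral>\<^sup>+ \<xi>. indicator A \<xi> \<partial>\<nu> x)" by (intro nn_integral_cong) auto
    finally show ?thesis using A' by simp
  qed
  show "sets (density (\<nu> x) (indicator A)) = sets bdry_borel" for x by (simp add: sets_\<nu>)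
  show "finite_measure (density (\<nu> x) (indicator A))" for x by (rule finite_measureI) (simp only: em fin ennreal_neq_top not_False_eq_True, simp)
  show "emeasure (density (\<nu> x) (indicator A)) (space (density (\<nu> x) (indicator A))) \<noteq> 0" for x
    unfolding em fin using null_sets_base[OF A, of x b] pos by (auto simp: ennreal_eq_0_iff measure_le_0_iff)
  show "distr (density (\<nu> x) (indicator A)) bdry_borel (boundary_action g) = density (\<nu> (g x)) (indicator A)" if g: "g \<in> \<Gamma>" for g x
  proof -
    have mg: "boundary_action g \<in> measurable (\<nu> x) bdry_borel"
      using measurable_action[OF g] measurable_cong_sets[OF sets_\<nu> refl] by blast
    have "density (\<nu> (g x)) (indicator A) = density (distr (\<nu> x) bdry_borel (boundary_action g)) (indicator A)"
      using conf g unfolding conformal_density_def by metis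
    also have "\<dots> = distr (density (\<nu> x) (\<lambda>\<xi>. indicator A (boundary_action g \<xi>))) bdry_borel (boundary_action g)"
      using A mg by (intro density_distr) auto
    also have "density (\<nu> x) (\<lambda>\<xi>. indicator A (boundary_action g \<xi>)) = density (\<nu> x) (indicator A)"
    proof (rule density_cong)
      show "(\<lambda>\<xi>. indicator A (boundary_action g \<xi>) :: ennreal) \<in> borel_measurable (\<nu> x)"
        using measurable_compose[OF mg, of "indicator A" borel] A by simp
      show "AE \<xi> in \<nu> x. indicator A (boundary_action g \<xi>) = (indicator A \<xi> :: ennreal)"
        using inv[OF g] by (intro AE_I2) (auto simp: indicator_def)
    qed (rule ind)
    finally show ?thesis by simp
  qed
  show "density (\<nu> x) (indicator A) = density (density (\<nu> y) (indicator A)) (\<lambda>\<xi>. ennreal (exp (- \<delta> * busemann \<xi> x y)))" for x y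
  proof -
    have "(\<lambda>\<xi>. busemann \<xi> x y) \<in> borel_measurable (\<nu> y)"
      using measurable_busemann measurable_cong_sets[OF sets_\<nu> refl] by blast
    then have h: "(\<lambda>\<xi>. ennreal (exp (- \<delta> * busemann \<xi> x y))) \<in> borel_measurable (\<nu> y)" by measurable
    have "\<nu> x = density (\<nu> y) (\<lambda>\<xi>. ennreal (exp (- \<delta> * busemann \<xi> x y)))"
      using conf unfolding conformal_density_def by blast
    then have "density (\<nu> x) (indicator A) = density (density (\<nu> y) (\<lambda>\<xi>. ennreal (exp (- \<delta> * busemann \<xi> x y)))) (indicator A)" by simp
    also have "\<dots> = density (density (\<nu> y) (indicator A)) (\<lambda>\<xi>. ennreal (exp (- \<delta> * busemann \<xi> x y)))"
      unfolding density_density_eq[OF h ind] density_density_eq[OF ind h] by (simp add: mult.commute)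
    finally show ?thesis .
  qed
qed

lemma measure_restrict:
  assumes A: "A \<in> sets bdry_borel" and E: "E \<in> sets bdry_borel"
  shows "measure (density (\<nu> x) (indicator A)) E = measure (\<nu> x) (A \<inter> E)"
proof -
  have "emeasure (density (\<nu> x) (indicator A)) E = (\<integral>\<^sup>+ \<xi>. indicator A \<xi> * indicator E \<xi> \<partial>\<nu> x)"
    using A E by (intro emeasure_density) (auto simp: sets_\<nu>)
  also have "\<dots> = (\<integral>\<^sup>+ \<xi>. indicator (A \<inter> E) \<xi> \<partial>\<nu> x)" by (simp add: indicator_inter_arith)
  also have "\<dots> = emeasure (\<nu> x) (A \<inter> E)" using A E by (intro nn_integral_indicator) (auto simp: sets_\<nu>)
  finally show ?thesis by (simp add: measure_def)
qed

end

section \<open>The divergence case\<close>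

text \<open>Cauchy-Schwarz for the counting function of a finite family of events.\<close>

lemma (in finite_measure) Chung_Erdos:
  assumes P: "finite P" and S: "\<And>p. p \<in> P \<Longrightarrow> S p \<in> sets M" "\<And>p. p \<in> P \<Longrightarrow> S p \<subseteq> U" and U: "U \<in> sets M"
  shows "(\<Sum>p\<in>P. measure M (S p))\<^sup>2 \<le> (\<Sum>p\<in>P. \<Sum>q\<in>P. measure M (S p \<inter> S q)) * measure M U"
proof -
  define f where "f x = (\<Sum>p\<in>P. indicator (S p) x :: ennreal)" for x
  have mf: "f \<in> borel_measurable M" unfolding f_def using S by measurable
  have mU: "(indicator U :: _ \<Rightarrow> ennreal) \<in> borel_measurable M" using U by simp
  have fU: "f x * indicator U x = f x" for x
    using S(2) by (auto simp: f_def indicator_def subset_iff intro!: sum.neutral)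
  have 1: "(\<integral>\<^sup>+x. f x * indicator U x \<partial>M) = ennreal (\<Sum>p\<in>P. measure M (S p))"
    unfolding fU unfolding f_def using S by (simp add: nn_integral_sum emeasure_eq_measure sum_nonneg)
  have ind2: "(indicator (S p) x :: ennreal) * indicator (S q) x = indicator (S p \<inter> S q) x" for p q x
    by (simp add: indicator_def)
  have "(f x)\<^sup>2 = (\<Sum>p\<in>P. \<Sum>q\<in>P. indicator (S p \<inter> S q) x)" for x
    unfolding f_def power2_eq_square sum_product ind2 ..
  then have "(\<integral>\<^sup>+x. (f x)\<^sup>2 \<partial>M) = (\<Sum>p\<in>P. \<Sum>q\<in>P. emeasure M (S p \<inter> S q))"
    using S(1) by (simp add: nn_integral_sum)
  also have "\<dots> = ennreal (\<Sum>p\<in>P. \<Sum>q\<in>P. measure M (S p \<inter> S q))"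
    by (simp add: emeasure_eq_measure sum_nonneg)
  finally have 2: "(\<integral>\<^sup>+x. (f x)\<^sup>2 \<partial>M) = ennreal (\<Sum>p\<in>P. \<Sum>q\<in>P. measure M (S p \<inter> S q))" .
  have "(\<integral>\<^sup>+x. (indicator U x)\<^sup>2 \<partial>M) = (\<integral>\<^sup>+x. indicator U x \<partial>M)"
    by (intro nn_integral_cong) (auto simp: indicator_def)
  then have 3: "(\<integral>\<^sup>+x. (indicator U x)\<^sup>2 \<partial>M) = ennreal (measure M U)" using U by (simp add: emeasure_eq_measure)
  have "(ennreal (\<Sum>p\<in>P. measure M (S p)))\<^sup>2 \<le> ennreal (\<Sum>p\<in>P. \<Sum>q\<in>P. measure M (S p \<inter> S q)) * ennreal (measure M U)"
    using Cauchy_Schwarz_nn_integral[OF mf mU] unfolding 1 2 3 .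
  also have "\<dots> = ennreal ((\<Sum>p\<in>P. \<Sum>q\<in>P. measure M (S p \<inter> S q)) * measure M U)"
    by (simp add: ennreal_mult sum_nonneg)
  finally show ?thesis by (simp add: ennreal_power sum_nonneg)
qed

locale khinchin = malnormal_subgroup pt \<Gamma> H b C D \<delta> d K + conformal_action pt \<Gamma> \<delta> \<nu>
  for pt :: "'a::metric_space" and \<Gamma> H b C D \<delta> d K \<nu>

text \<open>Collects the constants of \<open>reduced_count\<close>, \<open>shadow_lower\<close> and
  \<open>overlap\<close>. The radius in \<open>c0\<close> is \<open>2 * R2\<close> written out, as
  \<open>R2\<close> is defined only within the locale.\<close>

locale khinchin_consts = khinchin pt \<Gamma> H b C D \<delta> d K \<nu>
  for pt :: "'a::metric_space" and \<Gamma> H b C D \<delta> d K \<nu> +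
  fixes k :: nat and R cr cs c0 :: real
  assumes k: "1 \<le> k" and R: "0 \<le> R"
    and cr: "0 < cr" "real k \<le> t \<Longrightarrow> cr * exp (\<delta> * t) \<le> real (card {\<alpha>. reduced \<alpha> \<and> t - real k < dist b (\<alpha> b) \<and> dist b (\<alpha> b) \<le> t})"
    and cs: "0 < cs" "g \<in> \<Gamma> \<Longrightarrow> cs * exp (- \<delta> * dist b (g b)) \<le> measure (\<nu> b) (shadow b R (g b))"
    and c0: "\<beta> \<in> \<Gamma> \<Longrightarrow> \<beta> \<notin> H \<Longrightarrow> h1 \<in> H \<Longrightarrow> h2 \<in> H \<Longrightarrow> k1 \<in> H \<Longrightarrow> k2 \<in> H \<Longrightarrow>
      dist (h1 b) (\<beta> (k1 b)) \<le> 2 * (2 * (R + 2 * D + 6 + 2 * exp (R / 2)) + 4 + D) \<Longrightarrow>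
      dist (h2 b) (\<beta> (k2 b)) \<le> 2 * (2 * (R + 2 * D + 6 + 2 * exp (R / 2)) + 4 + D) \<Longrightarrow> dist (h1 b) (h2 b) \<le> c0"
begin

text \<open>The errors of \<open>shadow_ray\<close>: \<open>2 * D + 6\<close> and
  \<open>2 * exp (R / 2)\<close> at the entry, \<open>R\<close> and \<open>2 * D + 4\<close> at the
  exit.\<close>

definition R1 :: real where "R1 = R + 2 * D + 6 + 2 * exp (R / 2)"

definition R2 :: real where "R2 = 2 * R1 + 4 + D"

lemma R1_pos: "0 < R1" "R1 \<le> R2" "0 < R2"
proof -
  have "exp (R / 2) > 0" by simp
  then show 1: "0 < R1" using R D_nonneg unfolding R1_def by linarith
  then show "R1 \<le> R2" "0 < R2" using D_nonneg by (simp_all add: R2_def)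
qed

text \<open>By \<open>reduced_len\<close> the path from \<open>b\<close> through
  \<open>\<alpha> b\<close> to \<open>\<alpha> (h b)\<close> is a geodesic up to
  \<open>2 * D + 4\<close>, so a ray passing near its end also passes near \<open>\<alpha> b\<close>
  at time \<open>len \<alpha>\<close>.\<close>

lemma shadow_ray:
  assumes \<alpha>: "reduced \<alpha>" and h: "h \<in> H" and \<xi>: "\<xi> \<in> shadow b R ((\<alpha> \<circ> h) b)"
  shows "dist (\<alpha> b) (ray_to b \<xi> (len \<alpha>)) \<le> R1"
    "dist (\<alpha> (h b)) (ray_to b \<xi> (len \<alpha> + len h)) \<le> R1"
proof -
  define y where "y = \<alpha> (h b)"
  define Y where "Y = dist b y"
  have \<alpha>\<Gamma>: "\<alpha> \<in> \<Gamma>" using \<alpha> by (rule reduced_mem)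
  have b\<xi>: "\<xi> \<in> boundary" and near: "dist y (ray_to b \<xi> Y) \<le> R" using \<xi> by (auto simp: shadow_def y_def Y_def)
  have Y: "len \<alpha> + len h - 2 * D - 4 \<le> Y" "len \<alpha> \<le> Y" using reduced_len[OF \<alpha> h] by (auto simp: Y_def y_def)
  have dy: "dist (\<alpha> b) y = len h" using \<alpha>\<Gamma> by (simp add: y_def)
  have Y': "Y \<le> len \<alpha> + len h" using dist_triangle[of b y "\<alpha> b"] dy by (simp add: Y_def)
  have e0: "exp (R / 2) > 0" by simp
  have "dist (ray_to b \<xi> Y) (ray_to b \<xi> (len \<alpha> + len h)) \<le> 2 * D + 4"
    using ray_to_lipschitz[OF b\<xi>, of b Y "len \<alpha> + len h"] Y Y' D_nonneg by (auto simp: abs_le_iff)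
  then show "dist (\<alpha> (h b)) (ray_to b \<xi> (len \<alpha> + len h)) \<le> R1"
    using near dist_triangle[of y "ray_to b \<xi> (len \<alpha> + len h)" "ray_to b \<xi> Y"] e0 unfolding R1_def y_def by linarith
  obtain m where m: "between b m y" "dist b m = len \<alpha>" using ex_between[of "len \<alpha>" b y] Y(2) by (auto simp: Y_def)
  have my: "dist m y = Y - len \<alpha>" using m by (simp add: between_def Y_def)
  have 1: "dist (\<alpha> b) m \<le> 2 * D + 6"
    using thin[OF m(1), of "\<alpha> b"] m(2) my dy Y D_nonneg by (auto simp: dist_commute)
  have "dist m (ray_to b \<xi> (len \<alpha>)) \<le> 2 * exp (len \<alpha> + (dist y (ray_to b \<xi> Y) - dist b y - dist b (ray_to b \<xi> Y)) / 2)"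
  proof (rule thin_dist[OF m(1) _ m(2)])
    show "between b (ray_to b \<xi> (len \<alpha>)) (ray_to b \<xi> Y)" by (rule ray_to_between0[OF b\<xi> _ Y(2)]) simp
    show "dist b (ray_to b \<xi> (len \<alpha>)) = len \<alpha>" by (rule ray_to_dist0[OF b\<xi>]) simp
  qed
  also have "dist b (ray_to b \<xi> Y) = Y" by (rule ray_to_dist0[OF b\<xi>]) (simp add: Y_def)
  also have "len \<alpha> + (dist y (ray_to b \<xi> Y) - dist b y - Y) / 2 \<le> R / 2"
    using near Y(2) by (simp add: Y_def[symmetric] field_simps)
  finally have 2: "dist m (ray_to b \<xi> (len \<alpha>)) \<le> 2 * exp (R / 2)" by simp
  show "dist (\<alpha> b) (ray_to b \<xi> (len \<alpha>)) \<le> R1"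
    using 1 2 dist_triangle[of "\<alpha> b" "ray_to b \<xi> (len \<alpha>)" m] R unfolding R1_def by linarith
qed

lemma ray_near_translate:
  assumes \<alpha>: "\<alpha> \<in> \<Gamma>" and h: "h \<in> H" and \<xi>: "\<xi> \<in> boundary"
    and n: "dist (\<alpha> b) (ray_to b \<xi> s) \<le> R1" "dist (\<alpha> (h b)) (ray_to b \<xi> t) \<le> R1"
    and u: "0 \<le> s" "s \<le> u" "u \<le> t"
  obtains l where "l \<in> H" "dist (ray_to b \<xi> u) (\<alpha> (l b)) \<le> R2"
proof -
  have bt: "between (ray_to b \<xi> s) (ray_to b \<xi> u) (ray_to b \<xi> t)"
    using u ray_to_dist[OF \<xi>] by (simp add: between_def)
  obtain m where m: "between (\<alpha> b) m (\<alpha> (h b))" "dist (ray_to b \<xi> u) m \<le> 2 * R1 + 4"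
    by (rule quadrilateral_coarse[OF bt, of "\<alpha> b" R1 "\<alpha> (h b)"]) (use n in \<open>auto simp: dist_commute\<close>)
  have "between b (inv_into UNIV \<alpha> m) (h b)"
    using m(1) G.iso_inv[OF \<alpha>, of m "h b"] G.iso_inv[OF \<alpha>, of m b] \<alpha> by (simp add: between_def dist_commute)
  then have "inv_into UNIV \<alpha> m \<in> C" using C_between[OF b_mem orbit_mem[OF h]] by blast
  then obtain l where l: "l \<in> H" "dist (inv_into UNIV \<alpha> m) (l b) \<le> D" using C_cocompact by blast
  then have "dist m (\<alpha> (l b)) \<le> D" using G.iso_inv[OF \<alpha>] by simp
  then show ?thesis using m(2) dist_triangle[of "ray_to b \<xi> u" "\<alpha> (l b)" m] by (intro that[OF l(1)]) (simp add: R2_def)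
qed

text \<open>Exceeds every overlap \<open>c0\<close> by the two errors \<open>R2\<close> of passing
  from the ray to the orbit; the summand 1 makes the contradiction strict.\<close>

definition c1 :: real where "c1 = max 0 c0 + 2 * R2 + 1"

lemma c1_nonneg: "0 \<le> c1"
  using R1_pos by (simp add: c1_def)

text \<open>If the first run lasted more than \<open>c1\<close> beyond the entry of the second, the
  ray would accompany two distinct translates for a time excluded by \<open>c0\<close>. So the
  second entry comes at most \<open>c1\<close> before the first exit, and the absolute value in the
  triangle inequality is removed at the price of \<open>2 * c1\<close>.\<close>

lemma no_overlap:
  assumes \<alpha>: "reduced \<alpha>" "reduced \<alpha>'" "len \<alpha> < len \<alpha>'" and h: "h \<in> H" "h' \<in> H"
    and \<xi>: "\<xi> \<in> shadow b R ((\<alpha> \<circ> h) b)" "\<xi> \<in> shadow b R ((\<alpha>' \<circ> h') b)" and long: "c1 < len h'"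
  shows "dist (\<alpha> (h b)) (\<alpha>' b) \<le> len \<alpha>' - (len \<alpha> + len h) + 2 * R1 + 2 * c1"
proof -
  have m: "\<alpha> \<in> \<Gamma>" "\<alpha>' \<in> \<Gamma>" using \<alpha> by (auto simp: reduced_mem)
  have b\<xi>: "\<xi> \<in> boundary" using \<xi>(1) by (simp add: shadow_def)
  note n = shadow_ray[OF \<alpha>(1) h(1) \<xi>(1)] and n' = shadow_ray[OF \<alpha>(2) h(2) \<xi>(2)]
  define T2 where "T2 = len \<alpha> + len h"
  have nn: "0 \<le> len \<alpha>" "0 \<le> len \<alpha>'" "0 \<le> len h" "0 \<le> len h'" by simp_all
  have tri: "dist (\<alpha> (h b)) (\<alpha>' b) \<le> 2 * R1 + \<bar>len \<alpha>' - T2\<bar>"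
  proof -
    have "dist (ray_to b \<xi> T2) (ray_to b \<xi> (len \<alpha>')) = \<bar>T2 - len \<alpha>'\<bar>"
      using nn by (intro ray_to_dist[OF b\<xi>]) (auto simp: T2_def)
    then show ?thesis
      using n(2) n'(1) dist_triangle[of "\<alpha> (h b)" "\<alpha>' b" "ray_to b \<xi> T2"]
        dist_triangle[of "ray_to b \<xi> T2" "\<alpha>' b" "ray_to b \<xi> (len \<alpha>')"] by (simp add: T2_def dist_commute)
  qed
  have "T2 - len \<alpha>' \<le> c1"
  proof (rule ccontr)
    assume "\<not> ?thesis"
    then have gt: "len \<alpha>' + c1 < T2" by simp
    define q where "q = len \<alpha>' + c1"
    have q: "len \<alpha>' \<le> q" "q \<le> T2" "q \<le> len \<alpha>' + len h'" using gt long c1_nonneg by (auto simp: q_def)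
    obtain l1 where l1: "l1 \<in> H" "dist (ray_to b \<xi> (len \<alpha>')) (\<alpha> (l1 b)) \<le> R2"
      by (rule ray_near_translate[OF m(1) h(1) b\<xi> n, of "len \<alpha>'"]) (use \<alpha>(3) gt c1_nonneg nn in \<open>auto simp: T2_def\<close>)
    obtain l2 where l2: "l2 \<in> H" "dist (ray_to b \<xi> q) (\<alpha> (l2 b)) \<le> R2"
      by (rule ray_near_translate[OF m(1) h(1) b\<xi> n, of q]) (use \<alpha>(3) q nn in \<open>auto simp: T2_def\<close>)
    obtain k2 where k2: "k2 \<in> H" "dist (ray_to b \<xi> q) (\<alpha>' (k2 b)) \<le> R2"
      by (rule ray_near_translate[OF m(2) h(2) b\<xi> n', of q]) (use q nn in auto)
    define \<beta> where "\<beta> = inv_into UNIV \<alpha> \<circ> \<alpha>'"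
    have \<beta>: "\<beta> \<in> \<Gamma>" "\<beta> \<notin> H"
      using G.comp_mem[OF G.inv_mem[OF m(1)] m(2)] reduced_coset[OF \<alpha>(1,2)] \<alpha>(3) by (auto simp: \<beta>_def)
    have \<beta>d: "dist (l b) (\<beta> x) = dist (\<alpha> (l b)) (\<alpha>' x)" for l x
      using G.iso_inv[OF m(1), of "\<alpha>' x" "l b"] by (simp add: \<beta>_def dist_commute)
    have A: "dist (\<alpha> (l1 b)) (\<alpha>' (id b)) \<le> 2 * R2"
      using l1(2) n'(1) R1_pos(2) dist_triangle3[of "\<alpha> (l1 b)" "\<alpha>' b" "ray_to b \<xi> (len \<alpha>')"] by (simp add: dist_commute)
    have B: "dist (\<alpha> (l2 b)) (\<alpha>' (k2 b)) \<le> 2 * R2"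
      using l2(2) k2(2) dist_triangle3[of "\<alpha> (l2 b)" "\<alpha>' (k2 b)" "ray_to b \<xi> q"] by simp
    have "dist (l1 b) (l2 b) \<le> c0"
      by (rule c0[OF \<beta> l1(1) l2(1) id_mem k2(1)]) (use A B in \<open>simp_all only: \<beta>d R2_def R1_def\<close>)
    then have "dist (\<alpha> (l1 b)) (\<alpha> (l2 b)) \<le> c0" using m by simp
    moreover have "dist (ray_to b \<xi> (len \<alpha>')) (ray_to b \<xi> q) = c1"
      using ray_to_dist[OF b\<xi>, of "len \<alpha>'" q b] nn q c1_nonneg by (simp add: q_def)
    moreover have "dist (ray_to b \<xi> (len \<alpha>')) (ray_to b \<xi> q) \<le>
        dist (ray_to b \<xi> (len \<alpha>')) (\<alpha> (l1 b)) + dist (\<alpha> (l1 b)) (\<alpha> (l2 b)) + dist (\<alpha> (l2 b)) (ray_to b \<xi> q)"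
      using dist_triangle[of "ray_to b \<xi> (len \<alpha>')" "ray_to b \<xi> q" "\<alpha> (l1 b)"]
        dist_triangle[of "\<alpha> (l1 b)" "ray_to b \<xi> q" "\<alpha> (l2 b)"] by linarith
    ultimately show False using l1(2) l2(2) by (simp add: c1_def dist_commute)
  qed
  then show ?thesis using tri c1_nonneg unfolding T2_def by linarith
qed

end

lemma (in isom_action) card_near_orbit:
  assumes g: "g \<in> \<Gamma>"
  shows "card {h \<in> \<Gamma>. dist (g b) (h b) \<le> X} \<le> card {h \<in> \<Gamma>. dist b (h b) \<le> X}"
proof (rule card_inj_on_le)
  show "inj_on (\<lambda>h. inv_into UNIV g \<circ> h) {h \<in> \<Gamma>. dist (g b) (h b) \<le> X}"
    using cancel_left[OF inv_mem[OF g]] by (auto intro: inj_onI)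
  show "(\<lambda>h. inv_into UNIV g \<circ> h) ` {h \<in> \<Gamma>. dist (g b) (h b) \<le> X} \<subseteq> {h \<in> \<Gamma>. dist b (h b) \<le> X}"
  proof clarify
    fix h assume "h \<in> \<Gamma>" "dist (g b) (h b) \<le> X"
    then show "inv_into UNIV g \<circ> h \<in> \<Gamma> \<and> dist b ((inv_into UNIV g \<circ> h) b) \<le> X"
      using dist_orbit[OF g, of b h] comp_mem[OF inv_mem[OF g]] by simp
  qed
qed (rule finite_ball)

lemma (in isom_action) countable_group: "countable \<Gamma>"
proof -
  have "countable {g \<in> \<Gamma>. dist pt (g pt) \<le> real n}" for n by (rule countable_finite[OF finite_ball])
  then have "countable (\<Union>n::nat. {g \<in> \<Gamma>. dist pt (g pt) \<le> real n})" by (rule_tac countable_UN) auto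
  moreover have "\<Gamma> \<subseteq> (\<Union>n::nat. {g \<in> \<Gamma>. dist pt (g pt) \<le> real n})" using real_arch_simple by auto
  ultimately show ?thesis by (rule countable_subset[rotated])
qed

lemma limsup_set_eq: "{x \<in> S. \<forall>N. \<exists>j\<ge>N. P x j} = (\<Inter>N::nat. \<Union>j\<in>{N..}. {x \<in> S. P x j})"
  by (rule Set.set_eqI) (simp, blast)

lemma (in khinchin) near_pair_sets:
  "{\<xi> \<in> boundary. \<exists>\<alpha>\<in>\<Gamma>. \<exists>h\<in>H. dist (\<alpha> b) (ray_to x \<xi> s) \<le> r \<and> dist (\<alpha> (h b)) (ray_to x \<xi> t) \<le> r}
     \<in> sets bdry_borel"
proof -
  have "countable \<Gamma>" by (rule G.countable_group)
  moreover have "countable H" using countable_group .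
  moreover have "{\<xi> \<in> boundary. \<exists>\<alpha>\<in>\<Gamma>. \<exists>h\<in>H. dist (\<alpha> b) (ray_to x \<xi> s) \<le> r \<and> dist (\<alpha> (h b)) (ray_to x \<xi> t) \<le> r} =
    (\<Union>\<alpha>\<in>\<Gamma>. \<Union>h\<in>H. {\<xi> \<in> boundary. dist (\<alpha> b) (ray_to x \<xi> s) \<le> r} \<inter> {\<xi> \<in> boundary. dist (\<alpha> (h b)) (ray_to x \<xi> t) \<le> r})"
    by auto
  ultimately show ?thesis by (auto intro!: sets.countable_UN' sets.Int measurable_ray_set)
qed

context khinchin_consts
begin

section \<open>Crossings in a time window and their moments\<close>

definition Red :: "nat \<Rightarrow> ('a \<Rightarrow> 'a) set" where
  "Red j = {\<alpha>. reduced \<alpha> \<and> real k * real j < len \<alpha> \<and> len \<alpha> \<le> real k * (real j + 1)}"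

definition Ann :: "(nat \<Rightarrow> real) \<Rightarrow> nat \<Rightarrow> ('a \<Rightarrow> 'a) set" where
  "Ann G j = {h \<in> H. \<bar>len h - G j\<bar> \<le> D}"

definition Sp :: "('a \<Rightarrow> 'a) \<times> ('a \<Rightarrow> 'a) \<Rightarrow> (real \<Rightarrow> 'a) set set" where
  "Sp p = shadow b R ((fst p \<circ> snd p) b)"

text \<open>Up to constants, the measure of the crossings entered in window \<open>j\<close>: about
  exp (\<delta> k j) entries, \<open>card (Ann G j)\<close> exits for each, and shadows of measure
  about exp (- \<delta> (k j + G j)).\<close>

definition wt :: "(nat \<Rightarrow> real) \<Rightarrow> nat \<Rightarrow> real" where
  "wt G j = real (card (Ann G j)) * exp (- \<delta> * G j)"

abbreviation "Prs G j \<equiv> Red j \<times> Ann G j"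

lemma finite_Red: "finite (Red j)"
  by (rule finite_subset[OF _ G.finite_ball[of b "real k * (real j + 1)"]]) (auto simp: Red_def reduced_mem)

lemma finite_Ann: "finite (Ann G j)"
  by (rule finite_subset[OF _ finite_ball[of b "G j + D"]]) (auto simp: Ann_def)

lemma finite_Prs: "finite (Prs G j)"
  using finite_Red finite_Ann by simp

lemma Sp_sets: "Sp p \<in> sets (\<nu> b)"
  unfolding Sp_def sets_\<nu> by (rule shadow_sets)

lemma wt_nonneg: "0 \<le> wt G j"
  by (simp add: wt_def)

lemma Prs_mem:
  assumes "p \<in> Prs G j"
  shows "reduced (fst p)" "fst p \<in> \<Gamma>" "snd p \<in> H" "real k * real j < len (fst p)" "len (fst p) \<le> real k * (real j + 1)"
    "\<bar>len (snd p) - G j\<bar> \<le> D" "fst p \<circ> snd p \<in> \<Gamma>"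
  using assms sub G.comp_mem[of "fst p" "snd p"] by (auto simp: Red_def Ann_def reduced_mem)

definition "\<kappa>1 = cr * cs * exp (- \<delta> * D)"

lemma first_moment: "\<kappa>1 * wt G j \<le> (\<Sum>p\<in>Prs G j. measure (\<nu> b) (Sp p))"
proof -
  define t where "t = real k * (real j + 1)"
  have tk: "real k \<le> t" by (simp add: t_def mult_le_cancel_left1 distrib_left)
  have tk': "t - real k = real k * real j" by (simp add: t_def algebra_simps)
  have cR: "cr * exp (\<delta> * t) \<le> real (card (Red j))"
    using cr(2)[OF tk] unfolding Red_def tk' by (simp add: t_def)
  have "\<kappa>1 * wt G j = (cr * exp (\<delta> * t)) * (real (card (Ann G j)) * (cs * exp (- \<delta> * (t + G j + D))))"
    by (simp add: \<kappa>1_def wt_def algebra_simps mult_exp_exp)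
  also have "\<dots> \<le> real (card (Red j)) * (real (card (Ann G j)) * (cs * exp (- \<delta> * (t + G j + D))))"
    using cs(1) by (intro mult_right_mono cR) auto
  also have "\<dots> = real (card (Prs G j)) * (cs * exp (- \<delta> * (t + G j + D)))"
    by (simp add: card_cartesian_product)
  also have "\<dots> \<le> (\<Sum>p\<in>Prs G j. measure (\<nu> b) (Sp p))"
  proof (rule sum_bounded_below)
    fix p assume p: "p \<in> Prs G j"
    note m = Prs_mem[OF p]
    have "len (fst p \<circ> snd p) \<le> t + G j + D"
      using G.len_comp[OF m(2), of b "snd p"] m(5,6) by (simp add: t_def)
    then have "\<delta> * len (fst p \<circ> snd p) \<le> \<delta> * (t + G j + D)" using \<delta>_pos by (intro mult_left_mono) auto
    then have "cs * exp (- \<delta> * (t + G j + D)) \<le> cs * exp (- \<delta> * len (fst p \<circ> snd p))"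
      using cs(1) by simp
    also have "\<dots> \<le> measure (\<nu> b) (Sp p)" unfolding Sp_def by (rule cs(2)[OF m(7)])
    finally show "cs * exp (- \<delta> * (t + G j + D)) \<le> measure (\<nu> b) (Sp p)" .
  qed
  finally show ?thesis .
qed

definition "MM = card {g \<in> \<Gamma>. len g \<le> 2 * R1 + real k} * card {g \<in> \<Gamma>. len g \<le> 2 * R1 + real k + 2 * D}"

text \<open>When two shadows of one window meet, a common ray passes near all four ends at nearly
  the same entry and exit times. So each pair meets at most \<open>MM\<close> others, counting
  itself.\<close>

lemma diagonal:
  "(\<Sum>p\<in>Prs G j. \<Sum>q\<in>Prs G j. measure (\<nu> b) (Sp p \<inter> Sp q)) \<le> real MM * (\<Sum>p\<in>Prs G j. measure (\<nu> b) (Sp p))"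
proof -
  have "(\<Sum>q\<in>Prs G j. measure (\<nu> b) (Sp p \<inter> Sp q)) \<le> real MM * measure (\<nu> b) (Sp p)" if p: "p \<in> Prs G j" for p
  proof -
    note m = Prs_mem[OF p]
    define Q where "Q = {q \<in> Prs G j. Sp p \<inter> Sp q \<noteq> {}}"
    have finQ: "finite Q" using finite_Prs by (simp add: Q_def)
    have "card Q \<le> card ({g \<in> \<Gamma>. dist (fst p b) (g b) \<le> 2 * R1 + real k} \<times>
        {g \<in> \<Gamma>. dist ((fst p \<circ> snd p) b) (g b) \<le> 2 * R1 + real k + 2 * D})"
    proof (rule card_inj_on_le)
      show "inj_on (\<lambda>q. (fst q, fst q \<circ> snd q)) Q"
      proof (rule inj_onI)
        fix q q' assume q: "q \<in> Q" "q' \<in> Q" "(fst q, fst q \<circ> snd q) = (fst q', fst q' \<circ> snd q')"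
        have "fst q \<in> \<Gamma>" using q(1) Prs_mem(2) by (auto simp: Q_def)
        then show "q = q'" using q(3) G.cancel_left[of "fst q" "snd q" "snd q'"] by (auto intro: prod_eqI)
      qed
      show "(\<lambda>q. (fst q, fst q \<circ> snd q)) ` Q \<subseteq> {g \<in> \<Gamma>. dist (fst p b) (g b) \<le> 2 * R1 + real k} \<times>
        {g \<in> \<Gamma>. dist ((fst p \<circ> snd p) b) (g b) \<le> 2 * R1 + real k + 2 * D}"
      proof (rule image_subsetI)
        fix q assume "q \<in> Q"
        then obtain \<xi> where q: "q \<in> Prs G j" and \<xi>: "\<xi> \<in> Sp p" "\<xi> \<in> Sp q" by (auto simp: Q_def)
        note m' = Prs_mem[OF q]
        have b\<xi>: "\<xi> \<in> boundary" using \<xi>(1) by (simp add: Sp_def shadow_def)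
        note n = shadow_ray[OF m(1,3) \<xi>(1)[unfolded Sp_def]] and n' = shadow_ray[OF m'(1,3) \<xi>(2)[unfolded Sp_def]]
        have l: "dist (ray_to b \<xi> s) (ray_to b \<xi> t) \<le> X" if "\<bar>s - t\<bar> \<le> X" for s t X
          using ray_to_lipschitz[OF b\<xi>, of b s t] that by linarith
        have w: "real k * (real j + 1) = real k * real j + real k" by (simp add: algebra_simps)
        have "dist (ray_to b \<xi> (len (fst p))) (ray_to b \<xi> (len (fst q))) \<le> real k"
          using m(4,5) m'(4,5) w by (intro l) linarith
        then have 1: "dist (fst p b) (fst q b) \<le> 2 * R1 + real k"
          using n(1) n'(1) dist_triangle[of "fst p b" "fst q b" "ray_to b \<xi> (len (fst p))"]
            dist_triangle[of "ray_to b \<xi> (len (fst p))" "fst q b" "ray_to b \<xi> (len (fst q))"] by (simp add: dist_commute)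
        have "dist (ray_to b \<xi> (len (fst p) + len (snd p))) (ray_to b \<xi> (len (fst q) + len (snd q))) \<le> real k + 2 * D"
          using m(4,5,6) m'(4,5,6) w by (intro l) linarith
        then have 2: "dist ((fst p \<circ> snd p) b) ((fst q \<circ> snd q) b) \<le> 2 * R1 + real k + 2 * D"
          using n(2) n'(2) dist_triangle[of "fst p (snd p b)" "fst q (snd q b)" "ray_to b \<xi> (len (fst p) + len (snd p))"]
            dist_triangle[of "ray_to b \<xi> (len (fst p) + len (snd p))" "fst q (snd q b)" "ray_to b \<xi> (len (fst q) + len (snd q))"]
          by (simp add: dist_commute)
        show "(fst q, fst q \<circ> snd q) \<in> {g \<in> \<Gamma>. dist (fst p b) (g b) \<le> 2 * R1 + real k} \<times>
          {g \<in> \<Gamma>. dist ((fst p \<circ> snd p) b) (g b) \<le> 2 * R1 + real k + 2 * D}"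
          using 1 2 m'(2,7) by simp
      qed
      show "finite ({g \<in> \<Gamma>. dist (fst p b) (g b) \<le> 2 * R1 + real k} \<times>
        {g \<in> \<Gamma>. dist ((fst p \<circ> snd p) b) (g b) \<le> 2 * R1 + real k + 2 * D})" using G.finite_near by simp
    qed
    also have "\<dots> \<le> MM"
      unfolding card_cartesian_product MM_def by (intro mult_mono G.card_near_orbit m) auto
    finally have Q: "real (card Q) \<le> real MM" by simp
    have "(\<Sum>q\<in>Prs G j. measure (\<nu> b) (Sp p \<inter> Sp q)) = (\<Sum>q\<in>Q. measure (\<nu> b) (Sp p \<inter> Sp q))"
      by (intro sum.mono_neutral_right finite_Prs) (auto simp: Q_def)
    also have "\<dots> \<le> real (card Q) * measure (\<nu> b) (Sp p)"
      by (intro sum_bounded_above finite_measure.finite_measure_mono[OF finite_\<nu>] Sp_sets) auto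
    also have "\<dots> \<le> real MM * measure (\<nu> b) (Sp p)" by (intro mult_right_mono Q) simp
    finally show ?thesis .
  qed
  then show ?thesis unfolding sum_distrib_left by (rule sum_mono)
qed

definition "UU = exp (\<delta> * R) * measure (\<nu> b) boundary"

definition "\<kappa>2 = K * K * UU * exp (\<delta> * (2 * real k + 4 * D + 2 * R1 + 2 * c1 + 4))"

lemma UU_nonneg: "0 \<le> UU"
  by (simp add: UU_def)

lemma \<kappa>2_nonneg: "0 \<le> \<kappa>2"
  using K_pos UU_nonneg by (simp add: \<kappa>2_def)

text \<open>Quasi-independence: the next crossing starts essentially only after the previous one has ended.\<close>

lemma cross_terms:
  assumes ij: "i < j" and deep: "c1 + D < G j"
  shows "(\<Sum>p\<in>Prs G i. \<Sum>q\<in>Prs G j. measure (\<nu> b) (Sp p \<inter> Sp q)) \<le> \<kappa>2 * (wt G i * wt G j)"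
proof -
  \<comment> \<open>The bound of \<open>no_overlap\<close> for the distance from the exit of the
    first crossing to the entry of the second, with the lengths replaced by the extreme values of
    the windows.\<close>
  define X where "X = real k * (real j + 1) - (real k * real i + G i - D) + 2 * R1 + 2 * c1"
  define V where "V = UU * exp (- \<delta> * (real k * real j + G j - 3 * D - 4))"
  have V0: "0 \<le> V" using UU_nonneg by (simp add: V_def)
  have inner: "(\<Sum>q\<in>Prs G j. measure (\<nu> b) (Sp p \<inter> Sp q)) \<le> K * exp (\<delta> * X) * real (card (Ann G j)) * V"
    if p: "p \<in> Prs G i" for p
  proof -
    note m = Prs_mem[OF p]
    define Q where "Q = {q \<in> Prs G j. Sp p \<inter> Sp q \<noteq> {}}"
    have finQ: "finite Q" using finite_Prs by (simp add: Q_def)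
    define Near where "Near = {g \<in> \<Gamma>. dist ((fst p \<circ> snd p) b) (g b) \<le> X}"
    have finN: "finite Near" unfolding Near_def by (rule G.finite_near)
    have "Q \<subseteq> Near \<times> Ann G j"
    proof
      fix q assume "q \<in> Q"
      then obtain \<xi> where q: "q \<in> Prs G j" and \<xi>: "\<xi> \<in> Sp p" "\<xi> \<in> Sp q" by (auto simp: Q_def)
      note m' = Prs_mem[OF q]
      have "real i + 1 \<le> real j" using ij by linarith
      then have "real k * (real i + 1) \<le> real k * real j" by (intro mult_left_mono) auto
      then have lt: "len (fst p) < len (fst q)" using m(5) m'(4) by linarith
      have long: "c1 < len (snd q)" using m'(6) deep by linarith
      have "dist (fst p (snd p b)) (fst q b) \<le> len (fst q) - (len (fst p) + len (snd p)) + 2 * R1 + 2 * c1"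
        by (rule no_overlap[OF m(1) m'(1) lt m(3) m'(3) \<xi>(1)[unfolded Sp_def] \<xi>(2)[unfolded Sp_def] long])
      also have "\<dots> \<le> X" using m(4,6) m'(5) by (simp add: X_def)
      finally have "fst q \<in> Near" using m'(2) by (simp add: Near_def)
      then show "q \<in> Near \<times> Ann G j" using q by auto
    qed
    then have "card Q \<le> card (Near \<times> Ann G j)" using finN finite_Ann by (intro card_mono) auto
    then have "real (card Q) \<le> real (card Near) * real (card (Ann G j))" by (metis card_cartesian_product of_nat_le_iff of_nat_mult)
    also have "\<dots> \<le> K * exp (\<delta> * X) * real (card (Ann G j))"
    proof (rule mult_right_mono)
      show "real (card Near) \<le> K * exp (\<delta> * X)"
      proof (cases "0 \<le> X")
        case True
        have "card Near \<le> card {g \<in> \<Gamma>. len g \<le> X}" unfolding Near_def by (rule G.card_near_orbit[OF m(7)])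
        then show ?thesis using growth_upper[OF True] by linarith
      next
        case False
        have "Near = {}" using False by (auto simp: Near_def) (meson zero_le_dist order_trans)
        then show ?thesis using K_pos by simp
      qed
    qed simp
    finally have Q: "real (card Q) \<le> K * exp (\<delta> * X) * real (card (Ann G j))" .
    have "(\<Sum>q\<in>Prs G j. measure (\<nu> b) (Sp p \<inter> Sp q)) = (\<Sum>q\<in>Q. measure (\<nu> b) (Sp p \<inter> Sp q))"
      by (intro sum.mono_neutral_right finite_Prs) (auto simp: Q_def)
    also have "\<dots> \<le> real (card Q) * V"
    proof (rule sum_bounded_above)
      fix q assume "q \<in> Q"
      then have q: "q \<in> Prs G j" by (simp add: Q_def)
      note m' = Prs_mem[OF q]
      have "measure (\<nu> b) (Sp p \<inter> Sp q) \<le> measure (\<nu> b) (Sp q)"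
        by (intro finite_measure.finite_measure_mono[OF finite_\<nu>] Sp_sets) auto
      also have "\<dots> \<le> UU * exp (- \<delta> * len (fst q \<circ> snd q))" unfolding Sp_def UU_def by (rule shadow_upper[OF m'(7)])
      also have "\<dots> \<le> V"
      proof -
        have "real k * real j + G j - 3 * D - 4 \<le> len (fst q \<circ> snd q)"
          using reduced_len(1)[OF m'(1,3)] m'(4,6) by linarith
        then have "\<delta> * (real k * real j + G j - 3 * D - 4) \<le> \<delta> * len (fst q \<circ> snd q)" using \<delta>_pos by (intro mult_left_mono) auto
        then show ?thesis unfolding V_def by (intro mult_left_mono UU_nonneg) simp
      qed
      finally show "measure (\<nu> b) (Sp p \<inter> Sp q) \<le> V" .
    qed
    also have "\<dots> \<le> K * exp (\<delta> * X) * real (card (Ann G j)) * V" by (intro mult_right_mono Q V0)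
    finally show ?thesis .
  qed
  have "(\<Sum>p\<in>Prs G i. \<Sum>q\<in>Prs G j. measure (\<nu> b) (Sp p \<inter> Sp q)) \<le> real (card (Prs G i)) * (K * exp (\<delta> * X) * real (card (Ann G j)) * V)"
    by (rule sum_bounded_above[OF inner])
  also have "\<dots> \<le> (K * exp (\<delta> * (real k * (real i + 1))) * real (card (Ann G i))) * (K * exp (\<delta> * X) * real (card (Ann G j)) * V)"
  proof (rule mult_right_mono)
    have "card (Red i) \<le> card {g \<in> \<Gamma>. len g \<le> real k * (real i + 1)}"
      by (intro card_mono G.finite_ball) (auto simp: Red_def reduced_mem)
    then have "real (card (Red i)) \<le> K * exp (\<delta> * (real k * (real i + 1)))"
      using growth_upper[of "real k * (real i + 1)"] by simp
    then show "real (card (Prs G i)) \<le> K * exp (\<delta> * (real k * (real i + 1))) * real (card (Ann G i))"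
      by (simp add: card_cartesian_product mult_right_mono)
    show "0 \<le> K * exp (\<delta> * X) * real (card (Ann G j)) * V" using K_pos V0 by simp
  qed
  also have "\<dots> = K * K * UU * real (card (Ann G i)) * real (card (Ann G j)) *
     exp (\<delta> * (real k * (real i + 1)) + \<delta> * X - \<delta> * (real k * real j + G j - 3 * D - 4))"
    by (simp add: V_def exp_add exp_diff exp_minus field_simps)
  \<comment> \<open>The entry times \<open>k i\<close> and \<open>k j\<close> cancel: the number of
    possible second entries offsets the measure of reaching them. Only the factors exp (- \<delta>
    G) of the two runs remain, as for independent events.\<close>
  also have "\<delta> * (real k * (real i + 1)) + \<delta> * X - \<delta> * (real k * real j + G j - 3 * D - 4)
     = \<delta> * (2 * real k + 4 * D + 2 * R1 + 2 * c1 + 4) - \<delta> * G i - \<delta> * G j"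
    by (simp add: X_def algebra_simps)
  also have "K * K * UU * real (card (Ann G i)) * real (card (Ann G j)) *
      exp (\<delta> * (2 * real k + 4 * D + 2 * R1 + 2 * c1 + 4) - \<delta> * G i - \<delta> * G j) = \<kappa>2 * (wt G i * wt G j)"
    by (simp add: \<kappa>2_def wt_def exp_diff exp_minus exp_add field_simps)
  finally show ?thesis .
qed

definition "\<kappa> = 1 / (1 + \<kappa>2 / \<kappa>1\<^sup>2)"

lemma \<kappa>1_pos: "0 < \<kappa>1"
  using cr(1) cs(1) by (simp add: \<kappa>1_def)

lemma \<kappa>_pos: "0 < \<kappa>"
  unfolding \<kappa>_def using \<kappa>2_nonneg \<kappa>1_pos by (intro divide_pos_pos add_pos_nonneg) auto

text \<open>The Chung-Erdos inequality for all crossings in the windows \<open>N\<close> to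
  \<open>n\<close>. The second moment is at most a constant times the square of the first, and the
  constant involves neither \<open>N\<close> nor \<open>G\<close>.\<close>

lemma union_lower:
  assumes deep: "\<And>j. c1 + D < G j" and div: "\<not> summable (wt G)"
  shows "\<kappa> \<le> measure (\<nu> b) (\<Union>j\<in>{N..}. \<Union>p\<in>Prs G j. Sp p)"
proof -
  define U where "U = (\<Union>j\<in>{N..}. \<Union>p\<in>Prs G j. Sp p)"
  have U: "U \<in> sets (\<nu> b)"
    unfolding U_def by (intro sets.countable_UN'' sets.finite_UN finite_Prs Sp_sets) auto
  define a where "a n = (\<Sum>j=N..n. \<Sum>p\<in>Prs G j. measure (\<nu> b) (Sp p))" for n
  define W where "W n = (\<Sum>j=N..n. wt G j)" for n
  have aW: "\<kappa>1 * W n \<le> a n" for n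
    unfolding a_def W_def sum_distrib_left by (intro sum_mono first_moment)
  have W0: "0 \<le> W n" for n unfolding W_def by (intro sum_nonneg wt_nonneg)
  have "\<exists>n. B < W n" for B
  proof (rule ccontr)
    assume no: "\<nexists>n. B < W n"
    have "summable (wt G)"
    proof (rule summableI_nonneg_bounded[where x = "(\<Sum>j<N. wt G j) + B"])
      fix n
      have "(\<Sum>j<n. wt G j) \<le> (\<Sum>j\<in>{..<N} \<union> {N..n}. wt G j)"
        by (intro sum_mono2 wt_nonneg) auto
      also have "\<dots> = (\<Sum>j<N. wt G j) + W n" unfolding W_def by (intro sum.union_disjoint) auto
      also have "\<dots> \<le> (\<Sum>j<N. wt G j) + B" using no by (simp add: not_less)
      finally show "(\<Sum>j<n. wt G j) \<le> (\<Sum>j<N. wt G j) + B" .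
    qed (rule wt_nonneg)
    then show False using div by simp
  qed
  \<comment> \<open>Divergence makes the first moment exceed \<open>MM\<close>, so that the diagonal
    is absorbed in its square.\<close>
  then obtain n where n: "max 1 (real MM) / \<kappa>1 < W n" by blast
  then have "max 1 (real MM) < \<kappa>1 * W n" using \<kappa>1_pos by (simp add: field_simps)
  then have an: "1 \<le> a n" "real MM \<le> a n" using aW[of n] by auto
  define I where "I = (SIGMA j:{N..n}. Prs G j)"
  define Q where "Q i j = (\<Sum>p\<in>Prs G i. \<Sum>q\<in>Prs G j. measure (\<nu> b) (Sp p \<inter> Sp q))" for i j
  have finI: "finite I" unfolding I_def by (intro finite_SigmaI finite_Prs) auto
  have Q_sym: "Q i j = Q j i" for i j unfolding Q_def by (subst sum.swap) (simp add: Int_commute)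
  have Q_le: "Q i j \<le> (if i = j then real MM * (\<Sum>p\<in>Prs G j. measure (\<nu> b) (Sp p)) else 0) + \<kappa>2 * (wt G i * wt G j)" for i j
  proof -
    have nn: "0 \<le> \<kappa>2 * (wt G i * wt G j)" using \<kappa>2_nonneg wt_nonneg by simp
    consider "i = j" | "i < j" | "j < i" by linarith
    then show ?thesis
    proof cases
      case 1
      then show ?thesis using diagonal[where G = G and j = j] nn by (simp add: Q_def)
    next
      case 2
      then show ?thesis using cross_terms[OF 2, of G] deep by (simp add: Q_def)
    next
      case 3
      then show ?thesis using cross_terms[OF 3, of G] deep Q_sym[of i j] by (simp add: Q_def mult.commute)
    qed
  qed
  have CE: "(\<Sum>z\<in>I. measure (\<nu> b) (Sp (snd z)))\<^sup>2 \<le> (\<Sum>z\<in>I. \<Sum>y\<in>I. measure (\<nu> b) (Sp (snd z) \<inter> Sp (snd y))) * measure (\<nu> b) U"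
  proof (rule finite_measure.Chung_Erdos[OF finite_\<nu> finI Sp_sets _ U])
    fix z assume "z \<in> I"
    then have z: "N \<le> fst z" "snd z \<in> Prs G (fst z)" unfolding I_def by auto
    show "Sp (snd z) \<subseteq> U"
      unfolding U_def using z by (intro subsetI UN_I[of "fst z"] UN_I[of "snd z"]) auto
  qed
  have e1: "(\<Sum>z\<in>I. measure (\<nu> b) (Sp (snd z))) = a n"
    unfolding I_def a_def by (subst sum.Sigma) (auto simp: split_def finite_Prs)
  have e2: "(\<Sum>z\<in>I. \<Sum>y\<in>I. measure (\<nu> b) (Sp (snd z) \<inter> Sp (snd y))) = (\<Sum>i=N..n. \<Sum>j=N..n. Q i j)"
  proof -
    have "(\<Sum>z\<in>I. \<Sum>y\<in>I. measure (\<nu> b) (Sp (snd z) \<inter> Sp (snd y))) =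
        (\<Sum>i=N..n. \<Sum>p\<in>Prs G i. \<Sum>y\<in>I. measure (\<nu> b) (Sp p \<inter> Sp (snd y)))"
      unfolding I_def by (subst (2) sum.Sigma) (auto simp: split_def finite_Prs)
    also have "\<dots> = (\<Sum>i=N..n. \<Sum>p\<in>Prs G i. \<Sum>j=N..n. \<Sum>q\<in>Prs G j. measure (\<nu> b) (Sp p \<inter> Sp q))"
      unfolding I_def by (subst (2) sum.Sigma) (auto simp: split_def finite_Prs)
    also have "\<dots> = (\<Sum>i=N..n. \<Sum>j=N..n. Q i j)"
      unfolding Q_def by (intro sum.cong refl) (rule sum.swap)
    finally show ?thesis .
  qed
  have e3: "(\<Sum>i=N..n. \<Sum>j=N..n. Q i j) \<le> real MM * a n + \<kappa>2 * (W n * W n)"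
  proof -
    have "(\<Sum>i=N..n. \<Sum>j=N..n. Q i j) \<le> (\<Sum>i=N..n. \<Sum>j=N..n.
        (if i = j then real MM * (\<Sum>p\<in>Prs G j. measure (\<nu> b) (Sp p)) else 0) + \<kappa>2 * (wt G i * wt G j))"
      by (intro sum_mono Q_le)
    also have "\<dots> = (\<Sum>i=N..n. \<Sum>j=N..n. if i = j then real MM * (\<Sum>p\<in>Prs G j. measure (\<nu> b) (Sp p)) else 0)
       + (\<Sum>i=N..n. \<Sum>j=N..n. \<kappa>2 * (wt G i * wt G j))" by (simp add: sum.distrib)
    also have "(\<Sum>i=N..n. \<Sum>j=N..n. if i = j then real MM * (\<Sum>p\<in>Prs G j. measure (\<nu> b) (Sp p)) else 0)
       = real MM * a n" by (simp add: a_def sum_distrib_left)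
    also have "(\<Sum>i=N..n. \<Sum>j=N..n. \<kappa>2 * (wt G i * wt G j)) = \<kappa>2 * (W n * W n)"
    proof -
      have "W n * W n = (\<Sum>i=N..n. \<Sum>j=N..n. wt G i * wt G j)" unfolding W_def by (rule sum_product)
      then show ?thesis by (simp only: sum_distrib_left)
    qed
    finally show ?thesis .
  qed
  have main: "(a n)\<^sup>2 \<le> (real MM * a n + \<kappa>2 * (W n * W n)) * measure (\<nu> b) U"
    using CE[unfolded e1 e2] mult_right_mono[OF e3, of "measure (\<nu> b) U"] measure_nonneg[of "\<nu> b" U] by linarith
  have "W n \<le> a n / \<kappa>1" using aW[of n] \<kappa>1_pos by (simp add: field_simps)
  then have "W n * W n \<le> (a n / \<kappa>1) * (a n / \<kappa>1)" using W0 by (intro mult_mono) (auto intro: order_trans)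
  then have "\<kappa>2 * (W n * W n) \<le> \<kappa>2 * ((a n / \<kappa>1) * (a n / \<kappa>1))" using \<kappa>2_nonneg by (rule mult_left_mono)
  also have "\<dots> = \<kappa>2 / \<kappa>1\<^sup>2 * (a n)\<^sup>2" by (simp add: power2_eq_square)
  finally have w: "\<kappa>2 * (W n * W n) \<le> (a n)\<^sup>2 * (\<kappa>2 / \<kappa>1\<^sup>2)" by (simp only: mult.commute)
  have "real MM * a n \<le> (a n)\<^sup>2"
    unfolding power2_eq_square using an by (intro mult_right_mono) auto
  with w have "real MM * a n + \<kappa>2 * (W n * W n) \<le> (a n)\<^sup>2 * (1 + \<kappa>2 / \<kappa>1\<^sup>2)"
    unfolding distrib_left by linarith
  then have "(real MM * a n + \<kappa>2 * (W n * W n)) * measure (\<nu> b) U \<le> (a n)\<^sup>2 * (1 + \<kappa>2 / \<kappa>1\<^sup>2) * measure (\<nu> b) U"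
    by (rule mult_right_mono) simp
  with main have "(a n)\<^sup>2 \<le> (a n)\<^sup>2 * (1 + \<kappa>2 / \<kappa>1\<^sup>2) * measure (\<nu> b) U" by linarith
  then have "(a n)\<^sup>2 * 1 \<le> (a n)\<^sup>2 * ((1 + \<kappa>2 / \<kappa>1\<^sup>2) * measure (\<nu> b) U)" by (simp add: mult.assoc)
  then have "1 \<le> (1 + \<kappa>2 / \<kappa>1\<^sup>2) * measure (\<nu> b) U" using an(1) by (subst (asm) mult_le_cancel_left_pos) auto
  moreover have "0 < 1 + \<kappa>2 / \<kappa>1\<^sup>2" using \<kappa>2_nonneg by (simp add: add_pos_nonneg)
  ultimately show ?thesis by (simp add: \<kappa>_def U_def field_simps)
qed

text \<open>Continuity along the decreasing unions passes from each \<open>N\<close> to infinitely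
  recurring crossings. Moving the entry to time \<open>k * j\<close> costs \<open>k\<close>, and
  fixing the exit time costs \<open>D\<close> more.\<close>

lemma divergence_consts:
  assumes deep: "\<And>j. c1 + D < G j" and div: "\<not> summable (\<lambda>j. exp (- (\<delta> - d) * G j))"
  shows "\<kappa> \<le> measure (\<nu> b) {\<xi> \<in> boundary. \<forall>N. \<exists>j\<ge>N. \<exists>\<alpha>\<in>\<Gamma>. \<exists>h\<in>H.
    dist (\<alpha> b) (ray_to b \<xi> (real (k * j))) \<le> R1 + real k + D \<and>
    dist (\<alpha> (h b)) (ray_to b \<xi> (real (k * j) + G j)) \<le> R1 + real k + D}"
    (is "_ \<le> measure _ {\<xi> \<in> boundary. \<forall>N. \<exists>j\<ge>N. \<exists>\<alpha>\<in>\<Gamma>. \<exists>h\<in>H. ?P \<xi> j \<alpha> h}")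
proof -
  have nsum: "\<not> summable (wt G)"
  proof
    assume s: "summable (wt G)"
    define c where "c = exp (- 3 * D * d) / 2"
    have c: "c > 0" by (simp add: c_def)
    have "c * exp (- (\<delta> - d) * G j) \<le> wt G j" for j
    proof -
      have "0 \<le> G j" using deep[of j] c1_nonneg D_nonneg by linarith
      from card_annulus_lower[OF crit this]
      have "exp (d * (G j - 3 * D)) / 2 * exp (- \<delta> * G j) \<le> wt G j"
        unfolding wt_def Ann_def by (rule mult_right_mono) simp
      then show ?thesis by (simp add: c_def algebra_simps mult_exp_exp)
    qed
    then have "summable (\<lambda>j. c * exp (- (\<delta> - d) * G j))"
      using c by (intro summable_comparison_test[OF _ s]) auto
    then show False using div c by (simp add: summable_cmult_iff)
  qed
  define U where "U N = (\<Union>j\<in>{N..}. \<Union>p\<in>Prs G j. Sp p)" for N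
  have U: "U N \<in> sets (\<nu> b)" for N
    unfolding U_def by (intro sets.countable_UN'' sets.finite_UN finite_Prs Sp_sets) auto
  have dec: "decseq U" unfolding decseq_def U_def by (intro allI impI UN_mono) auto
  have lim: "(\<lambda>N. measure (\<nu> b) (U N)) \<longlonglongrightarrow> measure (\<nu> b) (\<Inter>N. U N)"
    by (rule finite_measure.finite_Lim_measure_decseq[OF finite_\<nu>]) (use U dec in auto)
  have "\<kappa> \<le> measure (\<nu> b) (\<Inter>N. U N)"
    by (rule LIMSEQ_le_const[OF lim]) (use union_lower[OF deep nsum] in \<open>auto simp: U_def\<close>)
  also have "(\<Inter>N. U N) \<subseteq> {\<xi> \<in> boundary. \<forall>N. \<exists>j\<ge>N. \<exists>\<alpha>\<in>\<Gamma>. \<exists>h\<in>H. ?P \<xi> j \<alpha> h}"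
  proof
    fix \<xi> assume \<xi>: "\<xi> \<in> (\<Inter>N. U N)"
    then obtain p where "\<xi> \<in> Sp p" by (auto simp: U_def)
    then have b\<xi>: "\<xi> \<in> boundary" by (simp add: Sp_def shadow_def)
    have "\<exists>j\<ge>N. \<exists>\<alpha>\<in>\<Gamma>. \<exists>h\<in>H. ?P \<xi> j \<alpha> h" for N
    proof -
      have "\<xi> \<in> U N" using \<xi> by blast
      then obtain j p where j: "j \<ge> N" and p: "p \<in> Prs G j" and \<xi>p: "\<xi> \<in> Sp p" unfolding U_def by blast
      note m = Prs_mem[OF p]
      note n = shadow_ray[OF m(1,3) \<xi>p[unfolded Sp_def]]
      define t where "t = real (k * j)"
      have w: "real k * real j = t" "real k * (real j + 1) = t + real k" by (simp_all add: t_def algebra_simps)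
      have m45: "t < len (fst p)" "len (fst p) \<le> t + real k" using m(4,5) unfolding w by auto
      have 1: "dist (ray_to b \<xi> (len (fst p))) (ray_to b \<xi> t) \<le> real k"
        using ray_to_lipschitz[OF b\<xi>, of b "len (fst p)" t] m45 by linarith
      have 2: "dist (ray_to b \<xi> (len (fst p) + len (snd p))) (ray_to b \<xi> (t + G j)) \<le> real k + D"
        using ray_to_lipschitz[OF b\<xi>, of b "len (fst p) + len (snd p)" "t + G j"] m45 m(6) by linarith
      have "?P \<xi> j (fst p) (snd p)"
        using n 1 2 D_nonneg
          dist_triangle[of "fst p b" "ray_to b \<xi> t" "ray_to b \<xi> (len (fst p))"]
          dist_triangle[of "fst p (snd p b)" "ray_to b \<xi> (t + G j)" "ray_to b \<xi> (len (fst p) + len (snd p))"]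
        unfolding t_def[symmetric] by linarith
      then show ?thesis using j m(2,3) by blast
    qed
    then show "\<xi> \<in> {\<xi> \<in> boundary. \<forall>N. \<exists>j\<ge>N. \<exists>\<alpha>\<in>\<Gamma>. \<exists>h\<in>H. ?P \<xi> j \<alpha> h}" using b\<xi> by blast
  qed
  then have "measure (\<nu> b) (\<Inter>N. U N) \<le> measure (\<nu> b) {\<xi> \<in> boundary. \<forall>N. \<exists>j\<ge>N. \<exists>\<alpha>\<in>\<Gamma>. \<exists>h\<in>H. ?P \<xi> j \<alpha> h}"
  proof (rule finite_measure.finite_measure_mono[OF finite_\<nu>])
    have eq: "{\<xi> \<in> boundary. \<forall>N. \<exists>j\<ge>N. \<exists>\<alpha>\<in>\<Gamma>. \<exists>h\<in>H. ?P \<xi> j \<alpha> h} =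
        (\<Inter>N. \<Union>j\<in>{N..}. {\<xi> \<in> boundary. \<exists>\<alpha>\<in>\<Gamma>. \<exists>h\<in>H. ?P \<xi> j \<alpha> h})"
      by (rule limsup_set_eq)
    show "{\<xi> \<in> boundary. \<forall>N. \<exists>j\<ge>N. \<exists>\<alpha>\<in>\<Gamma>. \<exists>h\<in>H. ?P \<xi> j \<alpha> h} \<in> sets (\<nu> b)"
      unfolding sets_\<nu> eq
      by (intro sets.countable_INT' image_subsetI sets.countable_UN' near_pair_sets) auto
  qed
  finally show ?thesis .
qed

end

text \<open>The point is uniformity: \<open>\<kappa>\<close> does not depend on \<open>G\<close>, so
  the same lower bound holds after any constant is added to the run.\<close>

lemma (in khinchin) divergence:
  obtains \<kappa> G0 R :: real and k :: nat where "0 < \<kappa>" "1 \<le> k"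
    "\<forall>G. (\<forall>j. G0 \<le> G j) \<longrightarrow> \<not> summable (\<lambda>j. exp (- (\<delta> - d) * G j)) \<longrightarrow>
      \<kappa> \<le> measure (\<nu> b) {\<xi> \<in> boundary. \<forall>N. \<exists>j\<ge>N. \<exists>\<alpha>\<in>\<Gamma>. \<exists>h\<in>H.
        dist (\<alpha> b) (ray_to b \<xi> (real (k * j))) \<le> R \<and> dist (\<alpha> (h b)) (ray_to b \<xi> (real (k * j) + G j)) \<le> R}"
proof -
  obtain k' cr where k': "0 < k'" "0 < cr"
    "\<forall>t\<ge>k'. cr * exp (\<delta> * t) \<le> real (card {\<alpha>. reduced \<alpha> \<and> t - k' < len \<alpha> \<and> len \<alpha> \<le> t})"
    by (rule reduced_count)
  define k where "k = nat \<lceil>k'\<rceil>"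
  have k: "1 \<le> k" "k' \<le> real k" using k'(1) by (auto simp: k_def) linarith
  have red: "cr * exp (\<delta> * t) \<le> real (card {\<alpha>. reduced \<alpha> \<and> t - real k < len \<alpha> \<and> len \<alpha> \<le> t})" if "real k \<le> t" for t
  proof -
    have "card {\<alpha>. reduced \<alpha> \<and> t - k' < len \<alpha> \<and> len \<alpha> \<le> t} \<le> card {\<alpha>. reduced \<alpha> \<and> t - real k < len \<alpha> \<and> len \<alpha> \<le> t}"
      using k(2) by (intro card_mono finite_subset[OF _ G.finite_ball[of b t]]) (auto simp: reduced_mem)
    moreover have "cr * exp (\<delta> * t) \<le> real (card {\<alpha>. reduced \<alpha> \<and> t - k' < len \<alpha> \<and> len \<alpha> \<le> t})"
      using k'(3) k(2) that by simp
    ultimately show ?thesis by linarith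
  qed
  obtain R cs where R: "R \<ge> 0" "cs > 0" "\<forall>g\<in>\<Gamma>. cs * exp (- \<delta> * dist b (g b)) \<le> measure (\<nu> b) (shadow b R (g b))"
    by (rule shadow_lower)
  obtain c0 where c0: "\<forall>\<beta> h1 h2 k1 k2. \<beta> \<in> \<Gamma> \<longrightarrow> \<beta> \<notin> H \<longrightarrow> h1 \<in> H \<longrightarrow> h2 \<in> H \<longrightarrow> k1 \<in> H \<longrightarrow> k2 \<in> H \<longrightarrow>
    dist (h1 b) (\<beta> (k1 b)) \<le> 2 * (2 * (R + 2 * D + 6 + 2 * exp (R / 2)) + 4 + D) \<longrightarrow>
    dist (h2 b) (\<beta> (k2 b)) \<le> 2 * (2 * (R + 2 * D + 6 + 2 * exp (R / 2)) + 4 + D) \<longrightarrow> dist (h1 b) (h2 b) \<le> c0"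
    by (rule overlap)
  interpret khinchin_consts pt \<Gamma> H b C D \<delta> d K \<nu> k R cr cs c0
  proof unfold_locales
    show "1 \<le> k" "0 \<le> R" "0 < cr" "0 < cs" by (fact k(1) R(1) k'(2) R(2))+
    show "cr * exp (\<delta> * t) \<le> real (card {\<alpha>. reduced \<alpha> \<and> t - real k < len \<alpha> \<and> len \<alpha> \<le> t})"
      if "real k \<le> t" for t using red[OF that] .
    show "cs * exp (- \<delta> * len g) \<le> measure (\<nu> b) (shadow b R (g b))" if "g \<in> \<Gamma>" for g
      using R(3)[rule_format, OF that] .
    show "dist (h1 b) (h2 b) \<le> c0"
      if "\<beta> \<in> \<Gamma>" "\<beta> \<notin> H" "h1 \<in> H" "h2 \<in> H" "k1 \<in> H" "k2 \<in> H"
        "dist (h1 b) (\<beta> (k1 b)) \<le> 2 * (2 * (R + 2 * D + 6 + 2 * exp (R / 2)) + 4 + D)"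
        "dist (h2 b) (\<beta> (k2 b)) \<le> 2 * (2 * (R + 2 * D + 6 + 2 * exp (R / 2)) + 4 + D)" for \<beta> h1 h2 k1 k2
      using c0[rule_format, OF that] .
  qed
  have "\<forall>G. (\<forall>j. c1 + D + 1 \<le> G j) \<longrightarrow> \<not> summable (\<lambda>j. exp (- (\<delta> - d) * G j)) \<longrightarrow>
      \<kappa> \<le> measure (\<nu> b) {\<xi> \<in> boundary. \<forall>N. \<exists>j\<ge>N. \<exists>\<alpha>\<in>\<Gamma>. \<exists>h\<in>H.
        dist (\<alpha> b) (ray_to b \<xi> (real (k * j))) \<le> R1 + real k + D \<and>
        dist (\<alpha> (h b)) (ray_to b \<xi> (real (k * j) + G j)) \<le> R1 + real k + D}"
  proof (intro allI impI)
    fix G :: "nat \<Rightarrow> real"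
    assume deep: "\<forall>j. c1 + D + 1 \<le> G j" and div: "\<not> summable (\<lambda>j. exp (- (\<delta> - d) * G j))"
    have "c1 + D < G j" for j using deep[rule_format, of j] by linarith
    from divergence_consts[OF this div]
    show "\<kappa> \<le> measure (\<nu> b) {\<xi> \<in> boundary. \<forall>N. \<exists>j\<ge>N. \<exists>\<alpha>\<in>\<Gamma>. \<exists>h\<in>H.
        dist (\<alpha> b) (ray_to b \<xi> (real (k * j))) \<le> R1 + real k + D \<and>
        dist (\<alpha> (h b)) (ray_to b \<xi> (real (k * j) + G j)) \<le> R1 + real k + D}" .
  qed
  then show ?thesis by (rule that[OF \<kappa>_pos k(1)])
qed

section \<open>Spiraling lines\<close>

text \<open>The assumption \<open>slow\<close> is the logarithmic form of slow variation:
  \<open>g\<close> is Lipschitz on a large scale.\<close>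

locale khinchin_gauge = khinchin pt \<Gamma> H b C D \<delta> d K \<nu>
  for pt :: "'a::metric_space" and \<Gamma> H b C D \<delta> d K \<nu> +
  fixes g :: "real \<Rightarrow> real" and c :: real
  assumes g_nonneg: "0 \<le> t \<Longrightarrow> 0 \<le> g t"
    and slow: "0 \<le> s \<Longrightarrow> 0 \<le> t \<Longrightarrow> g s \<le> g t + c * (1 + \<bar>s - t\<bar>)"
begin

lemma c_nonneg: "0 \<le> c"
  using slow[of 0 0] by simp

lemma slow': "0 \<le> s \<Longrightarrow> 0 \<le> t \<Longrightarrow> \<bar>s - t\<bar> \<le> a \<Longrightarrow> g s \<le> g t + c * (1 + a)"
  using slow[of s t] mult_left_mono[of "1 + \<bar>s - t\<bar>" "1 + a" c] c_nonneg by linarith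

section \<open>The set of spiraling directions\<close>

definition cross :: "(real \<Rightarrow> 'a) set \<Rightarrow> real \<Rightarrow> real \<Rightarrow> real \<Rightarrow> bool" where
  "cross \<xi> r s t \<longleftrightarrow> (\<exists>\<alpha>\<in>\<Gamma>. \<exists>h\<in>H. dist (\<alpha> b) (ray_to b \<xi> s) \<le> r \<and> dist (\<alpha> (h b)) (ray_to b \<xi> t) \<le> r)"

lemma cross_sets: "{\<xi> \<in> boundary. cross \<xi> r s t} \<in> sets bdry_borel"
  unfolding cross_def by (rule near_pair_sets)

text \<open>Integer times keep the set a countable union. The margin \<open>k\<close> will pay for
  changes of parametrization and for trimming the run at both ends.\<close>

definition deep :: "real \<Rightarrow> nat \<Rightarrow> nat \<Rightarrow> (real \<Rightarrow> 'a) set set" where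
  "deep r k N = {\<xi> \<in> boundary. \<exists>t\<ge>N. \<exists>T. real t + g (real t) + real k \<le> real T \<and> cross \<xi> r (real t) (real T)}"

definition spiral :: "real \<Rightarrow> (real \<Rightarrow> 'a) set set" where
  "spiral r = (\<Inter>k. \<Inter>N. deep r k N)"

text \<open>The action enlarges the radius, so invariance requires the union over all radii.\<close>

definition spirals :: "(real \<Rightarrow> 'a) set set" where
  "spirals = (\<Union>r::nat. spiral (real r))"

lemma deep_sets: "deep r k N \<in> sets bdry_borel"
proof -
  have "deep r k N = (\<Union>t\<in>{N..}. \<Union>T\<in>{T. real t + g (real t) + real k \<le> real T}. {\<xi> \<in> boundary. cross \<xi> r (real t) (real T)})"
    unfolding deep_def by auto
  moreover have "(\<Union>T\<in>{T. real t + g (real t) + real k \<le> real T}. {\<xi> \<in> boundary. cross \<xi> r (real t) (real T)}) \<in> sets bdry_borel"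
    for t :: nat by (rule sets.countable_UN') (auto intro: cross_sets)
  then have "(\<Union>t\<in>{N..}. \<Union>T\<in>{T. real t + g (real t) + real k \<le> real T}. {\<xi> \<in> boundary. cross \<xi> r (real t) (real T)})
    \<in> sets bdry_borel" by (intro sets.countable_UN') auto
  ultimately show ?thesis by simp
qed

lemma spiral_sets: "spiral r \<in> sets bdry_borel"
  unfolding spiral_def by (intro sets.countable_INT' image_subsetI deep_sets) auto

lemma spirals_sets: "spirals \<in> sets bdry_borel"
  unfolding spirals_def by (intro sets.countable_UN') (auto intro: spiral_sets)

lemma spiral_boundary: "\<xi> \<in> spiral r \<Longrightarrow> \<xi> \<in> boundary"
  unfolding spiral_def deep_def by blast

lemma spiralD:
  assumes "\<xi> \<in> spiral r"
  obtains t T :: nat and \<alpha> h where "N \<le> t" "real t + g (real t) + real k \<le> real T" "\<alpha> \<in> \<Gamma>" "h \<in> H"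
    "dist (\<alpha> b) (ray_to b \<xi> (real t)) \<le> r" "dist (\<alpha> (h b)) (ray_to b \<xi> (real T)) \<le> r"
proof -
  have "\<xi> \<in> deep r k N" using assms by (auto simp: spiral_def)
  then show ?thesis using that unfolding deep_def cross_def by blast
qed

text \<open>\<open>divergence\<close> is applied to \<open>g\<close> plus the constant
  \<open>l + \<bar>G0\<bar>\<close>, where \<open>\<bar>G0\<bar>\<close> makes the gauge admissible
  and \<open>l\<close> provides the margin. The bound \<open>\<kappa>\<close> is the same for all
  \<open>l\<close>, hence passes to the intersection.\<close>

lemma spiral_positive:
  assumes div: "\<And>k::nat. 1 \<le> k \<Longrightarrow> \<not> summable (\<lambda>j. exp (- (\<delta> - d) * g (real (k * j))))"
  shows "\<exists>r::nat. 0 < measure (\<nu> b) (spiral (real r))"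
proof -
  obtain \<kappa> G0 R :: real and k :: nat where \<kappa>: "0 < \<kappa>" "1 \<le> k"
    and main: "\<forall>G. (\<forall>j. G0 \<le> G j) \<longrightarrow> \<not> summable (\<lambda>j. exp (- (\<delta> - d) * G j)) \<longrightarrow>
      \<kappa> \<le> measure (\<nu> b) {\<xi> \<in> boundary. \<forall>N. \<exists>j\<ge>N. \<exists>\<alpha>\<in>\<Gamma>. \<exists>h\<in>H.
        dist (\<alpha> b) (ray_to b \<xi> (real (k * j))) \<le> R \<and> dist (\<alpha> (h b)) (ray_to b \<xi> (real (k * j) + G j)) \<le> R}"
    by (rule divergence)
  define r where "r = nat \<lceil>R + 1\<rceil>"
  have r: "R + 1 \<le> real r" by (simp add: r_def) linarith
  define V where "V l = (\<Inter>N. deep (real r) l N)" for l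
  have V_sets: "V l \<in> sets (\<nu> b)" for l
    unfolding V_def sets_\<nu> by (intro sets.countable_INT' image_subsetI deep_sets) auto
  have "\<kappa> \<le> measure (\<nu> b) (V l)" for l
  proof -
    define G where "G j = g (real (k * j)) + (real l + \<bar>G0\<bar>)" for j
    define W where "W = {\<xi> \<in> boundary. \<forall>N. \<exists>j\<ge>N. \<exists>\<alpha>\<in>\<Gamma>. \<exists>h\<in>H.
        dist (\<alpha> b) (ray_to b \<xi> (real (k * j))) \<le> R \<and> dist (\<alpha> (h b)) (ray_to b \<xi> (real (k * j) + G j)) \<le> R}"
    have "G0 \<le> G j" for j using g_nonneg[of "real (k * j)"] by (simp add: G_def)
    moreover have "\<not> summable (\<lambda>j. exp (- (\<delta> - d) * G j))"
    proof
      assume "summable (\<lambda>j. exp (- (\<delta> - d) * G j))"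
      then have "summable (\<lambda>j. exp ((\<delta> - d) * (real l + \<bar>G0\<bar>)) * exp (- (\<delta> - d) * G j))" by (rule summable_mult)
      moreover have "(\<lambda>j. exp ((\<delta> - d) * (real l + \<bar>G0\<bar>)) * exp (- (\<delta> - d) * G j)) = (\<lambda>j. exp (- (\<delta> - d) * g (real (k * j))))"
      proof
        fix j
        have "(\<delta> - d) * (real l + \<bar>G0\<bar>) + - (\<delta> - d) * G j = - (\<delta> - d) * g (real (k * j))" by (simp add: G_def algebra_simps)
        then show "exp ((\<delta> - d) * (real l + \<bar>G0\<bar>)) * exp (- (\<delta> - d) * G j) = exp (- (\<delta> - d) * g (real (k * j)))"
          by (metis exp_add)
      qed
      ultimately have "summable (\<lambda>j. exp (- (\<delta> - d) * g (real (k * j))))" by (simp only:)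
      then show False using div[OF \<kappa>(2)] by contradiction
    qed
    ultimately have "\<kappa> \<le> measure (\<nu> b) W" using main unfolding W_def by blast
    also have "W \<subseteq> V l"
    proof
      fix \<xi> assume \<xi>: "\<xi> \<in> W"
      then have b\<xi>: "\<xi> \<in> boundary" by (simp add: W_def)
      have "\<xi> \<in> deep (real r) l N" for N
      proof -
        obtain j \<alpha> h where j: "j \<ge> N" "\<alpha> \<in> \<Gamma>" "h \<in> H" "dist (\<alpha> b) (ray_to b \<xi> (real (k * j))) \<le> R"
            "dist (\<alpha> (h b)) (ray_to b \<xi> (real (k * j) + G j)) \<le> R" using \<xi> unfolding W_def by blast
        define T where "T = nat \<lceil>real (k * j) + G j\<rceil>"
        have Gj: "0 \<le> G j" using g_nonneg[of "real (k * j)"] by (simp add: G_def)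
        have T: "real (k * j) + G j \<le> real T" "real T \<le> real (k * j) + G j + 1"
          using Gj unfolding T_def by linarith+
        have "dist (ray_to b \<xi> (real (k * j) + G j)) (ray_to b \<xi> (real T)) \<le> 1"
          using ray_to_lipschitz[OF b\<xi>, of b "real (k * j) + G j" "real T"] T by linarith
        then have "dist (\<alpha> (h b)) (ray_to b \<xi> (real T)) \<le> real r"
          using j(5) r dist_triangle[of "\<alpha> (h b)" "ray_to b \<xi> (real T)" "ray_to b \<xi> (real (k * j) + G j)"] by linarith
        then have "cross \<xi> (real r) (real (k * j)) (real T)" unfolding cross_def using j(2,3,4) r by force
        moreover have "N \<le> k * j" using j(1) \<kappa>(2) by (metis le_trans mult_le_mono1 mult_1)
        moreover have "real (k * j) + g (real (k * j)) + real l \<le> real T" using T(1) by (simp add: G_def)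
        ultimately show ?thesis unfolding deep_def using b\<xi> by blast
      qed
      then show "\<xi> \<in> V l" by (simp add: V_def)
    qed
    then have "measure (\<nu> b) W \<le> measure (\<nu> b) (V l)"
      by (rule finite_measure.finite_measure_mono[OF finite_\<nu> _ V_sets])
    finally show ?thesis .
  qed
  moreover have "decseq V"
    unfolding decseq_def
  proof (intro allI impI)
    fix l l' :: nat assume "l \<le> l'"
    then have "real t + g (real t) + real l \<le> real T" if "real t + g (real t) + real l' \<le> real T" for t T :: nat
      using that by linarith
    then have "deep (real r) l' N \<subseteq> deep (real r) l N" for N
      unfolding deep_def by blast
    then show "V l' \<subseteq> V l" unfolding V_def by blast
  qed
  then have "(\<lambda>l. measure (\<nu> b) (V l)) \<longlonglongrightarrow> measure (\<nu> b) (\<Inter>l. V l)"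
    by (intro finite_measure.finite_Lim_measure_decseq[OF finite_\<nu>]) (use V_sets in auto)
  ultimately have "\<kappa> \<le> measure (\<nu> b) (\<Inter>l. V l)" using LIMSEQ_le_const by metis
  moreover have "(\<Inter>l. V l) = spiral (real r)" by (simp add: spiral_def V_def)
  ultimately show ?thesis using \<kappa>(1) by (metis less_le_trans)
qed

text \<open>The image under \<open>\<gamma>\<close> of the ray from \<open>b\<close> converges,
  after a shift \<open>a\<close>, to the ray from \<open>b\<close> to the image point. Crossings are
  carried along; the radius grows by 1 for the convergence and 1 for rounding the times.\<close>

lemma spiral_action:
  assumes \<gamma>: "\<gamma> \<in> \<Gamma>" and \<xi>: "\<xi> \<in> spiral r"
  shows "boundary_action \<gamma> \<xi> \<in> spiral (r + 2)"
proof -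
  have b\<xi>: "\<xi> \<in> boundary" using \<xi> by (rule spiral_boundary)
  define \<eta> where "\<eta> = boundary_action \<gamma> \<xi>"
  have b\<eta>: "\<eta> \<in> boundary" unfolding \<eta>_def by (rule G.action(1)[OF \<gamma> b\<xi>])
  define \<rho> where "\<rho> = ray_to b \<xi>"
  define \<rho>' where "\<rho>' = ray_to b \<eta>"
  have "\<gamma> \<circ> \<rho> \<in> \<eta>" unfolding \<eta>_def \<rho>_def by (rule G.action(2)[OF \<gamma> b\<xi> ray_to(1)[OF b\<xi>]])
  then have "(\<gamma> \<circ> \<rho>, \<rho>') \<in> asymptotic" using iffD1[OF boundary_asymptotic[OF b\<eta>]] ray_to(1)[OF b\<eta>] unfolding \<rho>'_def by blast
  then obtain a where "((\<lambda>s. dist (\<rho>' s) ((\<gamma> \<circ> \<rho>) (s + a))) \<longlongrightarrow> 0) at_top" by (rule asymptotic_shift)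
  then have "\<forall>\<^sub>F s in at_top. dist (\<rho>' s) ((\<gamma> \<circ> \<rho>) (s + a)) < 1" by (rule order_tendstoD) simp
  then obtain s0 where s0: "\<And>s. s \<ge> s0 \<Longrightarrow> dist (\<rho>' s) (\<gamma> (\<rho> (s + a))) < 1" by (auto simp: eventually_at_top_linorder)
  have near: "dist (\<gamma> x) (\<rho>' u) \<le> r + 2" if "dist x (\<rho> v) \<le> r" "\<bar>u + a - v\<bar> \<le> 1" "u \<ge> s0" for x u v
  proof -
    have "dist (\<gamma> (\<rho> v)) (\<gamma> (\<rho> (u + a))) \<le> 1"
      using ray_to_lipschitz[OF b\<xi>, of b v "u + a"] that(2) G.iso[OF \<gamma>] by (simp add: \<rho>_def abs_minus_commute)
    moreover have "dist (\<gamma> x) (\<gamma> (\<rho> v)) \<le> r" using that(1) G.iso[OF \<gamma>] by simp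
    ultimately show ?thesis
      using s0[OF that(3)] dist_triangle[of "\<gamma> x" "\<rho>' u" "\<gamma> (\<rho> v)"] dist_triangle[of "\<gamma> (\<rho> v)" "\<rho>' u" "\<gamma> (\<rho> (u + a))"]
      by (simp add: dist_commute)
  qed
  have "\<eta> \<in> deep (r + 2) k N" for k N
  proof -
    \<comment> \<open>The 2 pays for rounding the two times, the rest for the variation of
      \<open>g\<close> over a time of at most \<open>\<bar>a\<bar> + 1\<close>.\<close>
    define k0 where "k0 = k + nat \<lceil>2 + c * (2 + \<bar>a\<bar>)\<rceil>"
    have k0: "real k0 \<ge> real k + (2 + c * (2 + \<bar>a\<bar>))" unfolding k0_def by linarith
    define N0 where "N0 = N + nat \<lceil>\<bar>a\<bar> + \<bar>s0\<bar> + 2\<rceil>"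
    have N0: "real N0 \<ge> real N + (\<bar>a\<bar> + \<bar>s0\<bar> + 2)" unfolding N0_def by linarith
    obtain t T :: nat and \<alpha> h where t: "N0 \<le> t" and T: "real t + g (real t) + real k0 \<le> real T" and m: "\<alpha> \<in> \<Gamma>" "h \<in> H"
      and n: "dist (\<alpha> b) (ray_to b \<xi> (real t)) \<le> r" "dist (\<alpha> (h b)) (ray_to b \<xi> (real T)) \<le> r"
      by (rule spiralD[OF \<xi>])
    have tN: "real N + (\<bar>a\<bar> + \<bar>s0\<bar> + 2) \<le> real t" using N0 t by linarith
    have tT: "real t + 2 \<le> real T"
      using T k0 g_nonneg[of "real t"] mult_nonneg_nonneg[OF c_nonneg, of "2 + \<bar>a\<bar>"] by linarith
    define t' where "t' = nat \<lceil>real t - a\<rceil>"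
    define T' where "T' = nat \<lfloor>real T - a\<rfloor>"
    have t': "real t - a \<le> real t'" "real t' \<le> real t - a + 1" using tN unfolding t'_def by linarith+
    have T': "real T' \<le> real T - a" "real T - a - 1 \<le> real T'" using tN tT unfolding T'_def by linarith+
    have 1: "dist (\<gamma> (\<alpha> b)) (\<rho>' (real t')) \<le> r + 2"
      by (rule near[OF n(1)[folded \<rho>_def]]) (use t' tN in linarith)+
    have 2: "dist (\<gamma> (\<alpha> (h b))) (\<rho>' (real T')) \<le> r + 2"
      by (rule near[OF n(2)[folded \<rho>_def]]) (use T' tN tT in linarith)+
    have "cross \<eta> (r + 2) (real t') (real T')"
      unfolding cross_def using 1 2 m G.comp_mem[OF \<gamma> m(1)] unfolding \<rho>'_def
      by (intro bexI[of _ "\<gamma> \<circ> \<alpha>"] bexI[of _ h]) auto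
    moreover have "N \<le> t'" using t' tN by linarith
    moreover have "real t' + g (real t') + real k \<le> real T'"
    proof -
      have "g (real t') \<le> g (real t) + c * (1 + (\<bar>a\<bar> + 1))"
        by (rule slow') (use t' in auto)
      moreover have "c * (1 + (\<bar>a\<bar> + 1)) = c * (2 + \<bar>a\<bar>)" by (simp add: algebra_simps)
      ultimately show ?thesis using T T' t' k0 by linarith
    qed
    ultimately show ?thesis unfolding deep_def using b\<eta> by blast
  qed
  then show ?thesis by (simp add: spiral_def \<eta>_def)
qed

lemma spirals_action:
  assumes \<gamma>: "\<gamma> \<in> \<Gamma>" and \<xi>: "\<xi> \<in> boundary"
  shows "boundary_action \<gamma> \<xi> \<in> spirals \<longleftrightarrow> \<xi> \<in> spirals"
proof -
  have *: "boundary_action \<gamma> \<xi> \<in> spirals" if "\<gamma> \<in> \<Gamma>" "\<xi> \<in> spirals" for \<gamma> \<xi>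
  proof -
    obtain r :: nat where "\<xi> \<in> spiral (real r)" using \<open>\<xi> \<in> spirals\<close> by (auto simp: spirals_def)
    from spiral_action[OF \<open>\<gamma> \<in> \<Gamma>\<close> this] have "boundary_action \<gamma> \<xi> \<in> spiral (real (r + 2))" by (simp add: add.commute)
    then show ?thesis unfolding spirals_def by blast
  qed
  show ?thesis using *[OF \<gamma>] *[OF G.inv_mem[OF \<gamma>], of "boundary_action \<gamma> \<xi>"] G.action_inv(1)[OF \<gamma>] by metis
qed

text \<open>The complement of the spiraling directions is invariant; if it were not null, the restricted density
  would have to charge them.\<close>

lemma spirals_full:
  assumes div: "\<And>k::nat. 1 \<le> k \<Longrightarrow> \<not> summable (\<lambda>j. exp (- (\<delta> - d) * g (real (k * j))))"
  shows "measure (\<nu> b) (boundary - spirals) = 0"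
proof (rule ccontr)
  define A where "A = boundary - spirals"
  have "boundary \<in> sets (bdry_borel :: (real \<Rightarrow> 'a) set measure)" using sets.top[of bdry_borel] by simp
  then have A: "A \<in> sets bdry_borel" using spirals_sets by (auto simp: A_def)
  assume "measure (\<nu> b) (boundary - spirals) \<noteq> 0"
  then have "measure (\<nu> b) A \<noteq> 0" by (simp add: A_def)
  moreover have "boundary_action \<gamma> \<xi> \<in> A \<longleftrightarrow> \<xi> \<in> A" if "\<gamma> \<in> \<Gamma>" "\<xi> \<in> boundary" for \<gamma> \<xi>
    using spirals_action[OF that] G.action(1)[OF that] that(2) by (simp add: A_def)
  ultimately have conf': "conformal_density \<Gamma> \<delta> (\<lambda>x. density (\<nu> x) (indicator A))"
    by (intro conformal_density_restrict[OF A])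
  interpret R: khinchin_gauge pt \<Gamma> H b C D \<delta> d K "\<lambda>x. density (\<nu> x) (indicator A)" g c
    by unfold_locales (use conf' dim_pos two_limit_points g_nonneg slow in auto)
  obtain r :: nat where "0 < measure (density (\<nu> b) (indicator A)) (spiral (real r))"
    using R.spiral_positive[OF div] by blast
  then have "0 < measure (\<nu> b) (A \<inter> spiral (real r))" using measure_restrict[OF A spiral_sets] by simp
  moreover have "A \<inter> spiral (real r) = {}" by (auto simp: A_def spirals_def)
  ultimately show False by simp
qed

text \<open>The line is at bounded distance from a translate of the hull at both ends of a run with
  ample margin. Trimming \<open>q\<close> at each end leaves a run inside the
  \<open>\<epsilon>\<close>-neighbourhood, by the exponential bound of
  \<open>quadrilateral\<close>.\<close>

lemma spirals_liouville:
  assumes l: "(l::real \<Rightarrow> 'a) \<in> geodesic_lines" and \<xi>: "end_plus l \<in> spirals" and \<epsilon>: "0 < \<epsilon>"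
    and C: "C = hull_at_infinity (limit_set H)"
  shows "liouville \<epsilon> g \<Gamma> H l"
proof -
  define \<xi> where "\<xi> = end_plus l"
  obtain r :: nat where r: "\<xi> \<in> spiral (real r)" using assms(2) by (auto simp: spirals_def \<xi>_def)
  have b\<xi>: "\<xi> \<in> boundary" by (rule spiral_boundary[OF r])
  have "(l, ray_to b \<xi>) \<in> asymptotic"
    using boundary_asymptotic[OF b\<xi>, of l] line_ends(2)[OF l] ray_to(1)[OF b\<xi>] by (simp add: \<xi>_def)
  then obtain a where "((\<lambda>s. dist (ray_to b \<xi> s) (l (s + a))) \<longlongrightarrow> 0) at_top" by (rule asymptotic_shift)
  then have "\<forall>\<^sub>F s in at_top. dist (ray_to b \<xi> s) (l (s + a)) < 1" by (rule order_tendstoD) simp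
  then obtain s0 where s0: "\<And>s. s \<ge> s0 \<Longrightarrow> dist (ray_to b \<xi> s) (l (s + a)) < 1" by (auto simp: eventually_at_top_linorder)
  define D1 where "D1 = real r + 1"
  \<comment> \<open>Chosen so that \<open>4 * exp (D1 - q) \<le> \<epsilon>\<close>.\<close>
  define q where "q = D1 + \<bar>ln (4 / \<epsilon>)\<bar>"
  have q: "D1 \<le> q" "0 \<le> q" "4 * exp (D1 - q) \<le> \<epsilon>"
  proof -
    have "exp (D1 - q) \<le> exp (- ln (4 / \<epsilon>))" by (simp add: q_def)
    also have "\<dots> = \<epsilon> / 4" using \<epsilon> by (simp add: exp_minus)
    finally show "4 * exp (D1 - q) \<le> \<epsilon>" by simp
  qed (simp_all add: q_def D1_def)
  \<comment> \<open>The margin pays for the two trimmings and for replacing \<open>g\<close> at time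
    \<open>t\<close> by \<open>g\<close> at the later start \<open>\<tau>\<close> on the
    line.\<close>
  define k where "k = nat \<lceil>2 * q + c * (1 + (\<bar>a\<bar> + q))\<rceil>"
  have k: "2 * q + c * (1 + (\<bar>a\<bar> + q)) \<le> real k" unfolding k_def by linarith
  have "\<exists>\<tau> \<gamma>. \<tau> > 0 \<and> real n \<le> \<tau> \<and> \<gamma> \<in> \<Gamma> \<and> (\<forall>u\<in>{\<tau>..\<tau> + g \<tau>}. l u \<in> closed_nbhd \<epsilon> (\<gamma> ` C))" for n :: nat
  proof -
    define N where "N = n + nat \<lceil>\<bar>a\<bar> + \<bar>s0\<bar> + 1\<rceil>"
    have N: "real n + (\<bar>a\<bar> + \<bar>s0\<bar> + 1) \<le> real N" unfolding N_def by linarith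
    obtain t T :: nat and \<alpha> h where t: "N \<le> t" and T: "real t + g (real t) + real k \<le> real T" and m: "\<alpha> \<in> \<Gamma>" "h \<in> H"
      and nr: "dist (\<alpha> b) (ray_to b \<xi> (real t)) \<le> real r" "dist (\<alpha> (h b)) (ray_to b \<xi> (real T)) \<le> real r"
      by (rule spiralD[OF r])
    have tN: "real n + (\<bar>a\<bar> + \<bar>s0\<bar> + 1) \<le> real t" using N t by linarith
    define \<tau> where "\<tau> = real t + a + q"
    have \<tau>: "\<tau> > 0" "real n \<le> \<tau>" using tN q(2) by (auto simp: \<tau>_def)
    have "g \<tau> \<le> g (real t) + c * (1 + (\<bar>a\<bar> + q))"
      by (rule slow') (use \<tau> q(2) in \<open>auto simp: \<tau>_def\<close>)
    then have end_le: "\<tau> + g \<tau> \<le> real T + a - q" using T k by (simp add: \<tau>_def)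
    have g\<tau>: "0 \<le> g \<tau>" using \<tau>(1) g_nonneg by simp
    have p1: "dist (l (real t + a)) (\<alpha> b) \<le> D1"
    proof -
      have "s0 \<le> real t" using tN by linarith
      then show ?thesis using nr(1) s0[of "real t"] dist_triangle[of "l (real t + a)" "\<alpha> b" "ray_to b \<xi> (real t)"]
        by (simp add: D1_def dist_commute)
    qed
    have p2: "dist (l (real T + a)) (\<alpha> (h b)) \<le> D1"
    proof -
      have "s0 \<le> real T" using end_le g\<tau> tN q(2) by (simp add: \<tau>_def)
      then show ?thesis using nr(2) s0[of "real T"] dist_triangle[of "l (real T + a)" "\<alpha> (h b)" "ray_to b \<xi> (real T)"]
        by (simp add: D1_def dist_commute)
    qed
    have "l u \<in> closed_nbhd \<epsilon> (\<alpha> ` C)" if u: "u \<in> {\<tau>..\<tau> + g \<tau>}" for u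
    proof -
      have u': "real t + a + q \<le> u" "u \<le> real T + a - q" using u end_le by (auto simp: \<tau>_def)
      have bu: "between (l (real t + a)) (l u) (l (real T + a))" using u' q(2) by (intro line_between[OF l]) auto
      obtain m' where m': "between (\<alpha> b) m' (\<alpha> (h b))" "dist (l u) m' \<le> 4 * exp (D1 - q)"
        by (rule quadrilateral[OF bu p1 p2 q(1)]) (use u' q(2) in \<open>auto simp: line_dist[OF l]\<close>)
      have "between b (inv_into UNIV \<alpha> m') (h b)"
        using m'(1) G.iso_inv[OF m(1), of m' "h b"] G.iso_inv[OF m(1), of m' b] m(1) by (simp add: between_def dist_commute)
      then have "inv_into UNIV \<alpha> m' \<in> C" using C_between[OF b_mem orbit_mem[OF m(2)]] by blast
      then have in_C: "m' \<in> \<alpha> ` C" using G.inv_right[OF m(1), of m'] by (metis image_eqI)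
      have "infdist (l u) (\<alpha> ` C) \<le> \<epsilon>" using infdist_le[OF in_C, of "l u"] m'(2) q(3) by linarith
      then show ?thesis using in_C by (auto simp: closed_nbhd_def)
    qed
    then show ?thesis using \<tau> m(1) by blast
  qed
  then obtain \<tau> \<gamma> where \<tau>: "\<And>n::nat. \<tau> n > 0" "\<And>n. real n \<le> \<tau> n" "\<And>n. \<gamma> n \<in> \<Gamma>"
      "\<And>n. \<forall>u\<in>{\<tau> n..\<tau> n + g (\<tau> n)}. l u \<in> closed_nbhd \<epsilon> (\<gamma> n ` C)" by metis
  have "filterlim \<tau> at_top sequentially"
    by (rule filterlim_at_top_mono[OF filterlim_real_sequentially]) (use \<tau>(2) in auto)
  then show ?thesis unfolding liouville_def using \<tau> C by blast
qed

subsection \<open>The convergence case\<close>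

definition bad :: "real \<Rightarrow> nat \<Rightarrow> (real \<Rightarrow> 'a) set set" where
  "bad r n = {\<xi> \<in> boundary. cross \<xi> r (real n) (real n + g (real n))}"

definition bads :: "(real \<Rightarrow> 'a) set set" where
  "bads = (\<Union>r::nat. \<Inter>N. \<Union>n\<in>{N..}. bad (real r) n)"

lemma bad_sets: "bad r n \<in> sets bdry_borel"
  unfolding bad_def by (rule cross_sets)

lemma bads_sets: "bads \<in> sets bdry_borel"
  unfolding bads_def by (intro sets.countable_UN' sets.countable_INT' image_subsetI bad_sets) auto

lemma card_wide_annulus:
  assumes r: "0 \<le> r"
  shows "\<exists>M\<ge>0. \<forall>t\<ge>0. real (card {h \<in> H. \<bar>len h - t\<bar> \<le> r}) \<le> M * exp (d * t)"
proof -
  obtain M where M: "\<forall>N\<ge>0. real (card {h \<in> H. N \<le> len h \<and> len h \<le> N + 1}) \<le> M * exp (d * N)"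
    using card_annulus_upper[OF crit] by blast
  have M0: "0 \<le> M"
  proof -
    have "0 \<le> M * exp (d * 0)" using M[rule_format, of 0] of_nat_0_le_iff order_trans by blast
    then show ?thesis by simp
  qed
  define m where "m = nat \<lceil>2 * r\<rceil>"
  have m: "2 * r \<le> real m" unfolding m_def by linarith
  have "real (card {h \<in> H. \<bar>len h - t\<bar> \<le> r}) \<le> (real (Suc m) * M * exp (d * real m)) * exp (d * t)" if t: "0 \<le> t" for t
  proof -
    define s where "s = max 0 (t - r)"
    have s: "0 \<le> s" "s \<le> t" using r t by (auto simp: s_def)
    have fin: "finite {h \<in> H. N \<le> len h \<and> len h \<le> N + 1}" for N
      by (rule finite_subset[OF _ finite_ball[of b "N + 1"]]) auto
    have "{h \<in> H. \<bar>len h - t\<bar> \<le> r} \<subseteq> (\<Union>i\<in>{..m}. {h \<in> H. s + real i \<le> len h \<and> len h \<le> (s + real i) + 1})"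
    proof
      fix h assume h: "h \<in> {h \<in> H. \<bar>len h - t\<bar> \<le> r}"
      then have h': "h \<in> H" "t - r \<le> len h" "len h \<le> t + r" by (auto simp: abs_le_iff)
      define i where "i = nat \<lfloor>len h - s\<rfloor>"
      have sl: "s \<le> len h" using h'(2) by (auto simp: s_def)
      then have i: "s + real i \<le> len h" "len h \<le> (s + real i) + 1" unfolding i_def by linarith+
      have "real i \<le> 2 * r" using i(1) h'(3) by (auto simp: s_def)
      then have "i \<in> {..m}" using m by simp
      then show "h \<in> (\<Union>i\<in>{..m}. {h \<in> H. s + real i \<le> len h \<and> len h \<le> (s + real i) + 1})" using i h'(1) by blast
    qed
    then have "card {h \<in> H. \<bar>len h - t\<bar> \<le> r} \<le> card (\<Union>i\<in>{..m}. {h \<in> H. s + real i \<le> len h \<and> len h \<le> (s + real i) + 1})"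
      using fin by (intro card_mono) auto
    also have "\<dots> \<le> (\<Sum>i\<le>m. card {h \<in> H. s + real i \<le> len h \<and> len h \<le> (s + real i) + 1})"
      by (rule card_UN_le) simp
    finally have "real (card {h \<in> H. \<bar>len h - t\<bar> \<le> r}) \<le> real (\<Sum>i\<le>m. card {h \<in> H. s + real i \<le> len h \<and> len h \<le> (s + real i) + 1})"
      by (simp only: of_nat_le_iff)
    also have "\<dots> = (\<Sum>i\<le>m. real (card {h \<in> H. s + real i \<le> len h \<and> len h \<le> (s + real i) + 1}))" by simp
    also have "\<dots> \<le> (\<Sum>i\<le>m. M * exp (d * (t + real m)))"
    proof (rule sum_mono)
      fix i assume i: "i \<in> {..m}"
      have "real (card {h \<in> H. s + real i \<le> len h \<and> len h \<le> (s + real i) + 1}) \<le> M * exp (d * (s + real i))"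
        using M s(1) by simp
      also have "\<dots> \<le> M * exp (d * (t + real m))"
        using M0 d_nonneg s(2) i by (intro mult_left_mono) (auto intro!: mult_left_mono)
      finally show "real (card {h \<in> H. s + real i \<le> len h \<and> len h \<le> (s + real i) + 1}) \<le> M * exp (d * (t + real m))" .
    qed
    also have "\<dots> = (real (Suc m) * M * exp (d * real m)) * exp (d * t)" by (simp add: algebra_simps exp_add)
    finally show ?thesis .
  qed
  moreover have "0 \<le> real (Suc m) * M * exp (d * real m)" using M0 by simp
  ultimately show ?thesis by blast
qed

text \<open>A union bound: about exp (\<delta> n) entries, exp (d g) exits, and shadows of measure
  about exp (- \<delta> (n + g)). The entries need not be reduced, since counting a crossing
  repeatedly is harmless for an upper bound.\<close>

lemma bad_measure:
  assumes r: "0 \<le> r"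
  shows "\<exists>M. \<forall>n. measure (\<nu> b) (bad r n) \<le> M * exp (- (\<delta> - d) * g (real n))"
proof -
  obtain M where M: "0 \<le> M" "\<forall>t\<ge>0. real (card {h \<in> H. \<bar>len h - t\<bar> \<le> 2 * r}) \<le> M * exp (d * t)"
    using card_wide_annulus[of "2 * r"] r by auto
  define U where "U = exp (\<delta> * (2 * r)) * measure (\<nu> b) boundary"
  have U0: "0 \<le> U" by (simp add: U_def)
  have "measure (\<nu> b) (bad r n) \<le> (K * exp (\<delta> * r) * M * (U * exp (\<delta> * r))) * exp (- (\<delta> - d) * g (real n))" for n
  proof -
    define t where "t = real n + g (real n)"
    have gn: "0 \<le> g (real n)" by (rule g_nonneg) simp
    define P where "P = {z \<in> {\<alpha> \<in> \<Gamma>. len \<alpha> \<le> real n + r} \<times> {h \<in> H. \<bar>len h - g (real n)\<bar> \<le> 2 * r}.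
       t - r \<le> len (fst z \<circ> snd z)}"
    have finH: "finite {h \<in> H. \<bar>len h - g (real n)\<bar> \<le> 2 * r}"
      by (rule finite_subset[OF _ finite_ball[of b "g (real n) + 2 * r"]]) auto
    have finG: "finite {\<alpha> \<in> \<Gamma>. len \<alpha> \<le> real n + r}" by (rule G.finite_ball)
    have finP: "finite P" using finG finH by (simp add: P_def)
    have sub': "bad r n \<subseteq> (\<Union>z\<in>P. shadow b (2 * r) ((fst z \<circ> snd z) b))"
    proof
      fix \<xi> assume "\<xi> \<in> bad r n"
      then obtain \<alpha> h where b\<xi>: "\<xi> \<in> boundary" and m: "\<alpha> \<in> \<Gamma>" "h \<in> H"
        and nr: "dist (\<alpha> b) (ray_to b \<xi> (real n)) \<le> r" "dist (\<alpha> (h b)) (ray_to b \<xi> t) \<le> r"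
        by (auto simp: bad_def cross_def t_def)
      have dn: "dist b (ray_to b \<xi> (real n)) = real n" "dist b (ray_to b \<xi> t) = t"
        "dist (ray_to b \<xi> (real n)) (ray_to b \<xi> t) = g (real n)"
        using gn ray_to_dist0[OF b\<xi>] ray_to_dist[OF b\<xi>, of "real n" t b] by (auto simp: t_def)
      have 1: "len \<alpha> \<le> real n + r" using dist_triangle[of b "\<alpha> b" "ray_to b \<xi> (real n)"] nr(1) dn(1) by (simp add: dist_commute)
      have 2: "\<bar>dist b (\<alpha> (h b)) - t\<bar> \<le> r"
        using abs_dist_diff_le[of "\<alpha> (h b)" b "ray_to b \<xi> t"] nr(2) dn(2) by (simp add: dist_commute)
      have "len h = dist (\<alpha> b) (\<alpha> (h b))" using m(1) by simp
      then have 3: "\<bar>len h - g (real n)\<bar> \<le> 2 * r"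
        using nr dn(3) dist_triangle[of "\<alpha> b" "\<alpha> (h b)" "ray_to b \<xi> (real n)"]
          dist_triangle[of "ray_to b \<xi> (real n)" "\<alpha> (h b)" "ray_to b \<xi> t"]
          dist_triangle[of "ray_to b \<xi> (real n)" "ray_to b \<xi> t" "\<alpha> b"]
          dist_triangle[of "\<alpha> b" "ray_to b \<xi> t" "\<alpha> (h b)"]
          dist_commute[of "\<alpha> (h b)" "ray_to b \<xi> t"] dist_commute[of "\<alpha> b" "ray_to b \<xi> (real n)"]
        unfolding abs_le_iff by linarith
      have "dist (ray_to b \<xi> t) (ray_to b \<xi> (dist b (\<alpha> (h b)))) \<le> r"
        using ray_to_lipschitz[OF b\<xi>, of b t "dist b (\<alpha> (h b))"] 2 by linarith
      then have "dist (\<alpha> (h b)) (ray_to b \<xi> (dist b (\<alpha> (h b)))) \<le> 2 * r"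
        using nr(2) dist_triangle[of "\<alpha> (h b)" "ray_to b \<xi> (dist b (\<alpha> (h b)))" "ray_to b \<xi> t"] by linarith
      then have "\<xi> \<in> shadow b (2 * r) ((\<alpha> \<circ> h) b)" using b\<xi> by (simp add: shadow_def)
      moreover have "(\<alpha>, h) \<in> P" using 1 2 3 m by (auto simp: P_def abs_le_iff)
      ultimately show "\<xi> \<in> (\<Union>z\<in>P. shadow b (2 * r) ((fst z \<circ> snd z) b))" by force
    qed
    have "measure (\<nu> b) (bad r n) \<le> measure (\<nu> b) (\<Union>z\<in>P. shadow b (2 * r) ((fst z \<circ> snd z) b))"
      by (rule finite_measure.finite_measure_mono[OF finite_\<nu> sub']) (auto simp: sets_\<nu> intro!: sets.finite_UN finP shadow_sets)
    also have "\<dots> \<le> (\<Sum>z\<in>P. measure (\<nu> b) (shadow b (2 * r) ((fst z \<circ> snd z) b)))"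
      by (rule finite_measure.finite_measure_subadditive_finite[OF finite_\<nu> finP]) (auto simp: sets_\<nu> intro!: shadow_sets)
    also have "\<dots> \<le> real (card P) * (U * exp (- \<delta> * (t - r)))"
    proof (rule sum_bounded_above)
      fix z assume z: "z \<in> P"
      then have m: "fst z \<circ> snd z \<in> \<Gamma>" "t - r \<le> len (fst z \<circ> snd z)" using sub G.comp_mem by (auto simp: P_def)
      have "measure (\<nu> b) (shadow b (2 * r) ((fst z \<circ> snd z) b)) \<le> U * exp (- \<delta> * len (fst z \<circ> snd z))"
        unfolding U_def by (rule shadow_upper[OF m(1)])
      also have "\<dots> \<le> U * exp (- \<delta> * (t - r))"
      proof -
        have "\<delta> * (t - r) \<le> \<delta> * len (fst z \<circ> snd z)" using m(2) \<delta>_pos by (intro mult_left_mono) auto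
        then show ?thesis by (intro mult_left_mono U0) simp
      qed
      finally show "measure (\<nu> b) (shadow b (2 * r) ((fst z \<circ> snd z) b)) \<le> U * exp (- \<delta> * (t - r))" .
    qed
    also have "\<dots> \<le> ((K * exp (\<delta> * (real n + r))) * (M * exp (d * g (real n)))) * (U * exp (- \<delta> * (t - r)))"
    proof (rule mult_right_mono)
      have "card P \<le> card ({\<alpha> \<in> \<Gamma>. len \<alpha> \<le> real n + r} \<times> {h \<in> H. \<bar>len h - g (real n)\<bar> \<le> 2 * r})"
        using finG finH by (intro card_mono) (auto simp: P_def)
      then have "real (card P) \<le> real (card {\<alpha> \<in> \<Gamma>. len \<alpha> \<le> real n + r}) * real (card {h \<in> H. \<bar>len h - g (real n)\<bar> \<le> 2 * r})"
        by (simp add: card_cartesian_product flip: of_nat_mult)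
      also have "\<dots> \<le> (K * exp (\<delta> * (real n + r))) * (M * exp (d * g (real n)))"
        using r gn M K_pos growth_upper[of "real n + r"] by (intro mult_mono) auto
      finally show "real (card P) \<le> (K * exp (\<delta> * (real n + r))) * (M * exp (d * g (real n)))" .
    qed (use U0 in simp)
    also have "\<dots> = (K * exp (\<delta> * r) * M * (U * exp (\<delta> * r))) * exp (- (\<delta> - d) * g (real n))"
      by (simp add: t_def algebra_simps exp_add exp_diff exp_minus field_simps)
    finally show ?thesis .
  qed
  then show ?thesis by blast
qed

lemma bads_null:
  assumes summ: "summable (\<lambda>n. exp (- (\<delta> - d) * g (real n)))"
  shows "measure (\<nu> b) bads = 0"
proof -
  have "(\<Inter>N. \<Union>n\<in>{N..}. bad (real r) n) \<in> null_sets (\<nu> b)" for r :: nat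
  proof -
    obtain M where M: "\<forall>n. measure (\<nu> b) (bad (real r) n) \<le> M * exp (- (\<delta> - d) * g (real n))"
      using bad_measure[of "real r"] by auto
    have "summable (\<lambda>n. measure (\<nu> b) (bad (real r) n))"
      by (rule summable_comparison_test[OF _ summable_mult[OF summ, of M]]) (use M in auto)
    then have "limsup (bad (real r)) \<in> null_sets (\<nu> b)"
      by (intro borel_cantelli_limsup1) (auto simp: sets_\<nu> bad_sets fin)
    moreover have "limsup (bad (real r)) = (\<Inter>N. \<Union>n\<in>{N..}. bad (real r) n)"
      by (auto simp: limsup_INF_SUP)
    ultimately show ?thesis by simp
  qed
  then have "bads \<in> null_sets (\<nu> b)" unfolding bads_def by (intro null_sets_UN) auto
  then show ?thesis by (simp add: null_sets_def measure_def)
qed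

text \<open>Cocompactness replaces the points of the translated hull at both ends of a run by orbit
  points \<open>\<gamma> n (k1 b)\<close> and \<open>\<gamma> n (k2 b)\<close>; rebasing the run at
  the first one exhibits a crossing.\<close>

lemma liouville_bads:
  assumes l: "(l::real \<Rightarrow> 'a) \<in> geodesic_lines" and li: "liouville \<epsilon> g \<Gamma> H l"
    and C: "C = hull_at_infinity (limit_set H)"
  shows "end_plus l \<in> bads"
proof -
  define \<xi> where "\<xi> = end_plus l"
  have b\<xi>: "\<xi> \<in> boundary" using line_ends(1)[OF l] by (simp add: \<xi>_def)
  obtain \<tau> \<gamma> where \<tau>: "\<And>n::nat. \<tau> n > 0" "filterlim \<tau> at_top sequentially" "\<And>n. \<gamma> n \<in> \<Gamma>"
      "\<And>n t. t \<in> {\<tau> n..\<tau> n + g (\<tau> n)} \<Longrightarrow> l t \<in> closed_nbhd \<epsilon> (\<gamma> n ` C)"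
    using li unfolding liouville_def C by blast
  have "(l, ray_to b \<xi>) \<in> asymptotic"
    using boundary_asymptotic[OF b\<xi>, of l] line_ends(2)[OF l] ray_to(1)[OF b\<xi>] by (simp add: \<xi>_def)
  then obtain a where "((\<lambda>s. dist (ray_to b \<xi> s) (l (s + a))) \<longlongrightarrow> 0) at_top" by (rule asymptotic_shift)
  then have "\<forall>\<^sub>F s in at_top. dist (ray_to b \<xi> s) (l (s + a)) < 1" by (rule order_tendstoD) simp
  then obtain s0 where s0: "\<And>s. s \<ge> s0 \<Longrightarrow> dist (ray_to b \<xi> s) (l (s + a)) < 1" by (auto simp: eventually_at_top_linorder)
  \<comment> \<open>One unit for rounding the starting time to an integer, and the variation of
    \<open>g\<close> over a time of at most \<open>\<bar>a\<bar> + 1\<close>.\<close>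
  define q where "q = 1 + c * (2 + \<bar>a\<bar>)"
  have q: "1 \<le> q" using c_nonneg by (simp add: q_def)
  define r where "r = nat \<lceil>\<bar>\<epsilon>\<bar> + D + 2 + q\<rceil>"
  have r: "\<bar>\<epsilon>\<bar> + D + 2 + q \<le> real r" unfolding r_def by linarith
  have near: "\<exists>k\<in>H. dist (l t) (\<gamma> n (k b)) \<le> \<bar>\<epsilon>\<bar> + 1 + D" if t: "t \<in> {\<tau> n..\<tau> n + g (\<tau> n)}" for n t
  proof -
    have ne: "\<gamma> n ` C \<noteq> {}" and le: "infdist (l t) (\<gamma> n ` C) \<le> \<epsilon>" using \<tau>(4)[OF t] by (auto simp: closed_nbhd_def)
    have "infdist (l t) (\<gamma> n ` C) < \<bar>\<epsilon>\<bar> + 1" using le by linarith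
    then obtain y where y: "y \<in> C" "dist (l t) (\<gamma> n y) < \<bar>\<epsilon>\<bar> + 1"
      using ne unfolding infdist_notempty[OF ne] by (subst (asm) cINF_less_iff) auto
    obtain k where k: "k \<in> H" "dist y (k b) \<le> D" using C_cocompact[OF y(1)] by blast
    have "dist (\<gamma> n y) (\<gamma> n (k b)) \<le> D" using k(2) G.iso[OF \<tau>(3)] by simp
    then have "dist (l t) (\<gamma> n (k b)) \<le> \<bar>\<epsilon>\<bar> + 1 + D"
      using y(2) dist_triangle[of "l t" "\<gamma> n (k b)" "\<gamma> n y"] by linarith
    then show ?thesis using k(1) by blast
  qed
  have "\<xi> \<in> (\<Union>n\<in>{N..}. bad (real r) n)" for N
  proof -
    have "\<forall>\<^sub>F n in sequentially. real N + \<bar>a\<bar> + \<bar>s0\<bar> + 2 \<le> \<tau> n" using \<tau>(2) by (simp add: filterlim_at_top)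
    then obtain n where n: "real N + \<bar>a\<bar> + \<bar>s0\<bar> + 2 \<le> \<tau> n" using eventually_happens'[OF sequentially_bot] by blast
    define i where "i = nat \<lfloor>\<tau> n - a\<rfloor>"
    have i: "real i \<le> \<tau> n - a" "\<tau> n - a \<le> real i + 1" "real N \<le> real i" using n unfolding i_def by linarith+
    have \<tau>0: "0 \<le> \<tau> n" using \<tau>(1)[of n] by simp
    have g\<tau>: "0 \<le> g (\<tau> n)" by (rule g_nonneg[OF \<tau>0])
    obtain k1 where k1: "k1 \<in> H" "dist (l (\<tau> n)) (\<gamma> n (k1 b)) \<le> \<bar>\<epsilon>\<bar> + 1 + D" using near[of "\<tau> n" n] g\<tau> by auto
    obtain k2 where k2: "k2 \<in> H" "dist (l (\<tau> n + g (\<tau> n))) (\<gamma> n (k2 b)) \<le> \<bar>\<epsilon>\<bar> + 1 + D" using near[of "\<tau> n + g (\<tau> n)" n] g\<tau> by auto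
    have gen: "dist (\<gamma> n (k b)) (ray_to b \<xi> v) \<le> real r"
      if "dist (l u) (\<gamma> n (k b)) \<le> \<bar>\<epsilon>\<bar> + 1 + D" "s0 \<le> u - a" "\<bar>u - a - v\<bar> \<le> q" for k u v
    proof -
      have "dist (ray_to b \<xi> (u - a)) (l u) < 1" using s0[OF that(2)] by simp
      moreover have "dist (ray_to b \<xi> (u - a)) (ray_to b \<xi> v) \<le> q" using ray_to_lipschitz[OF b\<xi>, of b "u - a" v] that(3) by linarith
      ultimately show ?thesis
        using that(1) r dist_triangle[of "\<gamma> n (k b)" "ray_to b \<xi> v" "l u"] dist_triangle[of "l u" "ray_to b \<xi> v" "ray_to b \<xi> (u - a)"]
          dist_commute[of "l u" "\<gamma> n (k b)"] dist_commute[of "l u" "ray_to b \<xi> (u - a)"] by linarith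
    qed
    have 1: "dist (\<gamma> n (k1 b)) (ray_to b \<xi> (real i)) \<le> real r"
      by (rule gen[where k = k1 and u = "\<tau> n"]) (use k1(2) n i q in auto)
    have 2: "dist (\<gamma> n (k2 b)) (ray_to b \<xi> (real i + g (real i))) \<le> real r"
    proof (rule gen[where k = k2 and u = "\<tau> n + g (\<tau> n)", OF k2(2)])
      show "s0 \<le> \<tau> n + g (\<tau> n) - a" using n g\<tau> by linarith
      have ab: "\<bar>\<tau> n - real i\<bar> \<le> \<bar>a\<bar> + 1" using i by linarith
      have e: "c * (1 + (\<bar>a\<bar> + 1)) = c * (2 + \<bar>a\<bar>)" by (simp add: algebra_simps)
      have "g (\<tau> n) \<le> g (real i) + c * (2 + \<bar>a\<bar>)" using slow'[OF \<tau>0 _ ab] e by simp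
      moreover have "g (real i) \<le> g (\<tau> n) + c * (2 + \<bar>a\<bar>)" using slow'[OF _ \<tau>0, of "real i" "\<bar>a\<bar> + 1"] ab e by (simp add: abs_minus_commute)
      ultimately show "\<bar>\<tau> n + g (\<tau> n) - a - (real i + g (real i))\<bar> \<le> q" using i by (simp add: q_def abs_le_iff)
    qed
    define \<alpha> where "\<alpha> = \<gamma> n \<circ> k1"
    define h where "h = inv_into UNIV k1 \<circ> k2"
    have m: "\<alpha> \<in> \<Gamma>" "h \<in> H" using G.comp_mem[OF \<tau>(3) sub_mem[OF k1(1)]] comp_mem[OF inv_mem[OF k1(1)] k2(1)] by (auto simp: \<alpha>_def h_def)
    have "\<alpha> b = \<gamma> n (k1 b)" "\<alpha> (h b) = \<gamma> n (k2 b)" using k1(1) by (auto simp: \<alpha>_def h_def)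
    then have "cross \<xi> (real r) (real i) (real i + g (real i))" unfolding cross_def using 1 2 m by (metis (no_types))
    then have "\<xi> \<in> bad (real r) i" using b\<xi> by (simp add: bad_def)
    moreover have "i \<in> {N..}" using i(3) by simp
    ultimately show ?thesis by blast
  qed
  then show ?thesis unfolding bads_def \<xi>_def[symmetric] by blast
qed

end

section \<open>From the boundary to the space of geodesic lines\<close>

text \<open>If the prescribed set function is not a measure, or \<open>X\<close> is not measurable,
  the value is 0 by convention.\<close>

lemma emeasure_measure_of_le: "emeasure (measure_of \<Omega> A \<mu>) X \<le> \<mu> X"
  by (simp add: emeasure_measure_of_conv)

text \<open>Measurability of \<open>\<phi>\<close> is not assumed: the integral of a function
  vanishing almost everywhere is 0 in any case.\<close>

lemma null_density:
  assumes "emeasure M X = 0" "X \<in> sets M"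
  shows "emeasure (density M \<phi>) X = 0"
proof -
  have "AE x in M. \<phi> x * indicator X x = 0"
    using AE_not_in[of X M] assms by (auto simp: null_sets_def indicator_def)
  then have "(\<integral>\<^sup>+x. \<phi> x * indicator X x \<partial>M) = (\<integral>\<^sup>+x. 0 \<partial>M)" by (rule nn_integral_cong_AE)
  then show ?thesis
    using emeasure_measure_of_le[of "space M" "sets M" "\<lambda>A. \<integral>\<^sup>+x. \<phi> x * indicator A x \<partial>M" X]
    by (simp add: density_def)
qed

text \<open>The measurability of the diagonal, of the visual distance and of the inverse Hopf coordinates does not
  matter: \<^const>\<open>measure_of\<close> never exceeds the prescribed set function.\<close>

lemma (in conformal_action) AE_bowen_margulis:
  assumes N: "N \<in> sets bdry_borel" and null: "measure (\<nu> x) N = 0"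
  shows "AE l in bowen_margulis \<delta> \<nu> x. end_plus l \<notin> N"
proof -
  define P where "P = \<nu> x \<Otimes>\<^sub>M (\<nu> x \<Otimes>\<^sub>M (lborel :: real measure))"
  define \<Omega> where "\<Omega> = {(\<xi> :: (real \<Rightarrow> 'a) set, \<eta> :: (real \<Rightarrow> 'a) set, t :: real). \<xi> \<noteq> \<eta>}"
  define R where "R = restrict_space P \<Omega>"
  define Q where "Q = density R (\<lambda>(\<xi>, \<eta>, t). ennreal (1 / visual_dist x \<xi> \<eta> powr (2 * \<delta>)))"
  define B where "B = borel_of (geodesic_lines_topology :: (real \<Rightarrow> 'a) topology)"
  define h where "h = the_inv_into geodesic_lines (hopf_coords x)"
  have BM: "bowen_margulis \<delta> \<nu> x = distr Q B h"
    by (simp add: bowen_margulis_def Q_def R_def P_def \<Omega>_def B_def h_def)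
  have spB: "space B = geodesic_lines" by (simp add: B_def geodesic_lines_topology_def)
  define A where "A = end_plus -` N \<inter> (geodesic_lines :: (real \<Rightarrow> 'a) set)"
  have A: "A \<in> sets B"
    using measurable_sets[OF continuous_map_borel_of[OF continuous_map_end_plus] N] spB by (simp add: A_def B_def)
  \<comment> \<open>The triples with positive endpoint in \<open>N\<close>. It is null although the
    time factor has infinite measure, by the convention that 0 times infinity is 0.\<close>
  define Z where "Z = (boundary :: (real \<Rightarrow> 'a) set set) \<times> N \<times> (UNIV :: real set)"
  interpret \<nu>: finite_measure "\<nu> x" by (rule finite_\<nu>)
  interpret L: pair_sigma_finite "\<nu> x" "lborel :: real measure" by unfold_locales
  have N\<nu>: "N \<in> sets (\<nu> x)" using N by (simp add: sets_\<nu>)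
  have b\<nu>: "boundary \<in> sets (\<nu> x)" using sets.top[of "\<nu> x"] by simp
  have nN: "emeasure (\<nu> x) N = 0" using null by (simp add: \<nu>.emeasure_eq_measure)
  have Z: "Z \<in> sets P" unfolding Z_def P_def by (intro pair_measureI N\<nu> b\<nu>) auto
  have "emeasure P Z = emeasure (\<nu> x) boundary * (emeasure (\<nu> x) N * emeasure lborel (UNIV :: real set))"
  proof -
    have s: "sigma_finite_measure (\<nu> x \<Otimes>\<^sub>M (lborel :: real measure))" by (rule L.P.sigma_finite_measure_axioms)
    have "N \<times> (UNIV :: real set) \<in> sets (\<nu> x \<Otimes>\<^sub>M (lborel :: real measure))" by (intro pair_measureI N\<nu>) auto
    from sigma_finite_measure.emeasure_pair_measure_Times[OF s b\<nu> this] show ?thesis unfolding P_def Z_def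
      using lborel.emeasure_pair_measure_Times[OF N\<nu>, of "UNIV :: real set"] by simp
  qed
  then have "emeasure P Z = 0" using nN by simp
  moreover have "emeasure R (\<Omega> \<inter> Z) \<le> emeasure P (\<Omega> \<inter> Z)"
    unfolding R_def restrict_space_def by (rule emeasure_measure_of_le)
  moreover have "emeasure P (\<Omega> \<inter> Z) \<le> emeasure P Z" by (rule emeasure_mono[OF _ Z]) auto
  ultimately have R0: "emeasure R (\<Omega> \<inter> Z) = 0" by (metis le_zero_eq)
  have ZR: "\<Omega> \<inter> Z \<in> sets R" unfolding R_def sets_restrict_space using Z by blast
  have Q0: "emeasure Q (\<Omega> \<inter> Z) = 0" unfolding Q_def by (rule null_density[OF R0 ZR])
  have "h -` A \<inter> space Q \<subseteq> \<Omega> \<inter> Z"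
  proof
    fix p assume p: "p \<in> h -` A \<inter> space Q"
    then have "p \<in> \<Omega> \<inter> space P" by (simp add: Q_def R_def space_restrict_space)
    moreover obtain \<xi> \<eta> t where e: "p = (\<xi>, \<eta>, t)" by (cases p)
    ultimately have q: "\<xi> \<in> boundary" "\<eta> \<in> boundary" "\<xi> \<noteq> \<eta>"
      by (auto simp: \<Omega>_def P_def space_pair_measure)
    have "end_plus (h p) = \<eta>" unfolding e h_def by (rule end_plus_inv_hopf[OF q])
    moreover have "end_plus (h p) \<in> N" using p by (simp add: A_def)
    ultimately show "p \<in> \<Omega> \<inter> Z" using q by (simp add: e \<Omega>_def Z_def)
  qed
  then have "emeasure Q (h -` A \<inter> space Q) \<le> emeasure Q (\<Omega> \<inter> Z)"
    by (rule emeasure_mono) (use ZR in \<open>simp add: Q_def\<close>)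
  moreover have "emeasure (distr Q B h) A \<le> emeasure Q (h -` A \<inter> space Q)"
    unfolding distr_def by (rule emeasure_measure_of_le)
  ultimately have "emeasure (distr Q B h) A = 0" using Q0 by (metis le_zero_eq)
  then have "A \<in> null_sets (distr Q B h)" using A by (simp add: null_sets_def)
  then show ?thesis unfolding BM by (rule AE_I'[of A]) (auto simp: spB A_def)
qed

context khinchin_gauge
begin

lemma AE_bowen_margulis_line: "AE l in bowen_margulis \<delta> \<nu> x. l \<in> geodesic_lines"
  by (rule AE_I2) (simp add: bowen_margulis_def geodesic_lines_topology_def)

lemma AE_liouville:
  assumes div: "\<And>k::nat. 1 \<le> k \<Longrightarrow> \<not> summable (\<lambda>j. exp (- (\<delta> - d) * g (real (k * j))))"
    and "0 < \<epsilon>" "C = hull_at_infinity (limit_set H)"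
  shows "AE l in bowen_margulis \<delta> \<nu> x. liouville \<epsilon> g \<Gamma> H l"
proof -
  have "boundary \<in> sets (bdry_borel :: (real \<Rightarrow> 'a) set measure)" using sets.top[of bdry_borel] by simp
  then have s: "boundary - spirals \<in> sets bdry_borel" using spirals_sets by auto
  have "AE l in bowen_margulis \<delta> \<nu> x. end_plus l \<notin> boundary - spirals"
    by (rule AE_bowen_margulis[OF s null_sets_base[OF s spirals_full[OF div]]])
  then show ?thesis using AE_bowen_margulis_line
  proof eventually_elim
    fix l :: "real \<Rightarrow> 'a" assume l: "end_plus l \<notin> boundary - spirals" "l \<in> geodesic_lines"
    then have "end_plus l \<in> spirals" using line_ends(1) by blast
    then show "liouville \<epsilon> g \<Gamma> H l" using spirals_liouville[OF l(2)] assms(2,3) by blast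
  qed
qed

lemma AE_not_liouville:
  assumes summ: "summable (\<lambda>n. exp (- (\<delta> - d) * g (real n)))"
    and "C = hull_at_infinity (limit_set H)"
  shows "AE l in bowen_margulis \<delta> \<nu> x. \<not> liouville \<epsilon> g \<Gamma> H l"
proof -
  have "AE l in bowen_margulis \<delta> \<nu> x. end_plus l \<notin> bads"
    by (rule AE_bowen_margulis[OF bads_sets null_sets_base[OF bads_sets bads_null[OF summ]]])
  then show ?thesis using AE_bowen_margulis_line
    by eventually_elim (use liouville_bads assms(2) in blast)
qed

end

section \<open>Slow variation\<close>

text \<open>Taking logarithms, one step of size at most \<open>B\<close> changes \<open>g\<close> by
  at most \<open>ln A\<close>. An interval is subdivided into steps of this size, whose number is
  affine in its length.\<close>

lemma slowly_varying_log:
  assumes "slowly_varying (\<lambda>t. exp (- g t))"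
  shows "\<exists>c\<ge>0. \<forall>s\<ge>0. \<forall>t\<ge>0. g s \<le> g t + c * (1 + \<bar>s - t\<bar>)"
proof -
  obtain B A where BA: "0 < B" "1 \<le> A"
    and sl: "\<forall>x\<ge>0. \<forall>y\<ge>0. \<bar>x - y\<bar> \<le> B \<longrightarrow> exp (- g y) \<le> A * exp (- g x)"
    using assms unfolding slowly_varying_def by blast
  have step: "g x \<le> g y + ln A" if "0 \<le> x" "0 \<le> y" "\<bar>x - y\<bar> \<le> B" for x y
  proof -
    have "exp (- g y) \<le> A * exp (- g x)" using sl that by blast
    also have "\<dots> = exp (ln A + - g x)" using BA(2) by (simp add: exp_diff exp_minus field_simps)
    finally show ?thesis by simp
  qed
  have chain: "g s \<le> g t + real n * ln A" if "0 \<le> s" "0 \<le> t" "\<bar>s - t\<bar> \<le> real n * B" for n s t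
    using that
  proof (induction n arbitrary: s)
    case 0
    then show ?case by simp
  next
    case (Suc n)
    \<comment> \<open>One of \<open>n + 1\<close> equal steps from \<open>s\<close> towards
      \<open>t\<close>.\<close>
    define u where "u = t + (s - t) * (real n / real (Suc n))"
    have q: "real n / real (Suc n) = 1 - 1 / real (Suc n)" by (simp add: field_simps)
    have "u = s * (real n / real (Suc n)) + t * (1 / real (Suc n))" unfolding u_def q by (simp add: algebra_simps diff_divide_distrib)
    then have "0 \<le> u" using Suc.prems by simp
    have "\<bar>u - t\<bar> = \<bar>s - t\<bar> * (real n / real (Suc n))" by (simp add: u_def abs_mult)
    also have "\<dots> \<le> (real (Suc n) * B) * (real n / real (Suc n))" by (intro mult_right_mono Suc.prems) simp
    also have "\<dots> = real n * B" by (simp del: of_nat_Suc)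
    finally have 1: "\<bar>u - t\<bar> \<le> real n * B" .
    have "s - u = (s - t) * (1 / real (Suc n))" unfolding u_def q by (simp add: algebra_simps)
    then have "\<bar>s - u\<bar> = \<bar>s - t\<bar> * (1 / real (Suc n))" by (simp add: abs_mult)
    also have "\<dots> \<le> (real (Suc n) * B) * (1 / real (Suc n))" by (intro mult_right_mono Suc.prems) simp
    finally have 2: "\<bar>s - u\<bar> \<le> B" by simp
    have "g u \<le> g t + real n * ln A" by (rule Suc.IH) (use \<open>0 \<le> u\<close> Suc.prems 1 in auto)
    moreover have "g s \<le> g u + ln A" by (rule step) (use \<open>0 \<le> u\<close> Suc.prems 2 in auto)
    ultimately show ?case by (simp add: algebra_simps)
  qed
  have lnA: "0 \<le> ln A" using BA(2) by simp
  have "g s \<le> g t + ln A * (1 + 1 / B) * (1 + \<bar>s - t\<bar>)" if st: "0 \<le> s" "0 \<le> t" for s t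
  proof -
    define n where "n = nat \<lceil>\<bar>s - t\<bar> / B\<rceil>"
    have q0: "0 \<le> \<bar>s - t\<bar> / B" using BA(1) by simp
    then have n: "\<bar>s - t\<bar> / B \<le> real n" "real n \<le> \<bar>s - t\<bar> / B + 1" unfolding n_def by linarith+
    have "g s \<le> g t + real n * ln A" by (rule chain[OF st]) (use n(1) BA(1) in \<open>simp add: field_simps\<close>)
    also have "real n * ln A \<le> ((1 + 1 / B) * (1 + \<bar>s - t\<bar>)) * ln A"
    proof (rule mult_right_mono[OF _ lnA])
      have "(1 + 1 / B) * (1 + \<bar>s - t\<bar>) = \<bar>s - t\<bar> / B + 1 + (1 / B + \<bar>s - t\<bar>)" using BA(1) by (simp add: field_simps)
      then show "real n \<le> (1 + 1 / B) * (1 + \<bar>s - t\<bar>)" using n(2) divide_pos_pos[OF zero_less_one BA(1)] by linarith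
    qed
    finally show ?thesis by (simp add: mult_ac)
  qed
  moreover have "0 \<le> ln A * (1 + 1 / B)" using lnA BA(1) by simp
  ultimately show ?thesis by blast
qed

lemma nn_integral_lebesgue_steps:
  assumes u: "\<And>j. 0 \<le> u j" and a: "0 < a"
  shows "(\<integral>\<^sup>+t. (\<Sum>j. ennreal (u j) * indicator {x + a * real j..<x + a * real (Suc j)} t) \<partial>lebesgue) = (\<Sum>j. ennreal (a * u j))"
proof -
  have "(\<integral>\<^sup>+t. (\<Sum>j. ennreal (u j) * indicator {x + a * real j..<x + a * real (Suc j)} t) \<partial>lebesgue)
      = (\<Sum>j. \<integral>\<^sup>+t. ennreal (u j) * indicator {x + a * real j..<x + a * real (Suc j)} t \<partial>lebesgue)"
    by (intro nn_integral_suminf borel_measurable_times_ennreal borel_measurable_const borel_measurable_indicator) simp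
  also have "\<dots> = (\<Sum>j. ennreal (a * u j))"
  proof (rule suminf_cong)
    fix j
    have "emeasure lebesgue {x + a * real j..<x + a * real (Suc j)} = ennreal a"
      using a by (simp add: algebra_simps)
    then show "(\<integral>\<^sup>+t. ennreal (u j) * indicator {x + a * real j..<x + a * real (Suc j)} t \<partial>lebesgue) = ennreal (a * u j)"
      using u a by (simp add: nn_integral_cmult_indicator ennreal_mult mult.commute)
  qed
  finally show ?thesis .
qed

text \<open>On each interval of length \<open>k\<close> the function varies by a bounded factor, so
  the sum over the left ends dominates the integral. It is used contrapositively, along the
  progression of windows produced by \<open>divergence\<close>.\<close>

lemma nn_integral_finite_of_summable:
  fixes g :: "real \<Rightarrow> real"
  assumes slow: "\<And>s t. 0 \<le> s \<Longrightarrow> 0 \<le> t \<Longrightarrow> g s \<le> g t + c * (1 + \<bar>s - t\<bar>)" and c: "0 \<le> c"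
    and e: "0 \<le> e" and k: "1 \<le> (k::nat)"
    and summ: "summable (\<lambda>j. exp (- e * g (real (k * j))))"
  shows "(\<integral>\<^sup>+t\<in>{1..}. ennreal (exp (- e * g t)) \<partial>lebesgue) < \<infinity>"
proof -
  define u where "u j = exp (e * c * (1 + real k)) * exp (- e * g (real (k * j)))" for j
  have k0: "0 < real k" using k by simp
  have "ennreal (exp (- e * g t)) * indicator {1..} t
      \<le> (\<Sum>j. ennreal (u j) * indicator {0 + real k * real j..<0 + real k * real (Suc j)} t)" for t
  proof (cases "1 \<le> t")
    case True
    define j where "j = nat \<lfloor>t / real k\<rfloor>"
    have "0 \<le> t / real k" using True by simp
    then have "real j \<le> t / real k" "t / real k < real j + 1" unfolding j_def by linarith+
    then have j: "real k * real j \<le> t" "t < real k * real (Suc j)" using k0 by (simp_all add: field_simps)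
    have "g (real (k * j)) \<le> g t + c * (1 + \<bar>real (k * j) - t\<bar>)" using slow True by simp
    also have "c * (1 + \<bar>real (k * j) - t\<bar>) \<le> c * (1 + real k)" using j c by (intro mult_left_mono) (auto simp: algebra_simps)
    finally have "e * g (real (k * j)) \<le> e * (g t + c * (1 + real k))" using e by (intro mult_left_mono) auto
    then have "exp (- e * g t) \<le> u j" by (simp add: u_def algebra_simps flip: exp_add)
    then have "ennreal (exp (- e * g t)) * indicator {1..} t
        \<le> ennreal (u j) * indicator {0 + real k * real j..<0 + real k * real (Suc j)} t"
      using j True by (simp add: ennreal_leI)
    also have "\<dots> \<le> (\<Sum>j. ennreal (u j) * indicator {0 + real k * real j..<0 + real k * real (Suc j)} t)"
      using sum_le_suminf[of "\<lambda>j. ennreal (u j) * indicator {0 + real k * real j..<0 + real k * real (Suc j)} t" "{j}"]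
      by (simp only: summableI finite.intros sum.insert sum.empty empty_iff not_False_eq_True add_0_right zero_le)
    finally show ?thesis .
  qed simp
  then have "(\<integral>\<^sup>+t\<in>{1..}. ennreal (exp (- e * g t)) \<partial>lebesgue)
      \<le> (\<integral>\<^sup>+t. (\<Sum>j. ennreal (u j) * indicator {0 + real k * real j..<0 + real k * real (Suc j)} t) \<partial>lebesgue)"
    by (rule nn_integral_mono)
  also have "\<dots> = (\<Sum>j. ennreal (real k * u j))" by (rule nn_integral_lebesgue_steps) (use k0 in \<open>auto simp: u_def\<close>)
  also have "\<dots> < \<infinity>"
  proof -
    have "summable (\<lambda>j. real k * u j)" unfolding u_def by (intro summable_mult summ)
    then have "(\<Sum>j. ennreal (real k * u j)) = ennreal (\<Sum>j. real k * u j)" by (intro suminf_ennreal2) (simp add: u_def)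
    then show ?thesis by simp
  qed
  finally show ?thesis .
qed

lemma summable_of_nn_integral_finite:
  fixes g :: "real \<Rightarrow> real"
  assumes slow: "\<And>s t. 0 \<le> s \<Longrightarrow> 0 \<le> t \<Longrightarrow> g s \<le> g t + c * (1 + \<bar>s - t\<bar>)" and c: "0 \<le> c"
    and e: "0 \<le> e" and int: "(\<integral>\<^sup>+t\<in>{1..}. ennreal (exp (- e * g t)) \<partial>lebesgue) < \<infinity>"
  shows "summable (\<lambda>n. exp (- e * g (real n)))"
proof -
  \<comment> \<open>The index is \<open>Suc n\<close> because the unit intervals start at 1, like
    the integral.\<close>
  define u where "u n = exp (- e * c * 2) * exp (- e * g (real (Suc n)))" for n
  define J where "J n = {1 + 1 * real n..<1 + 1 * real (Suc n)}" for n
  have "(\<Sum>n. ennreal (u n) * indicator (J n) t) \<le> ennreal (exp (- e * g t)) * indicator {1..} t" for t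
  proof (cases "1 \<le> t")
    case True
    define n where "n = nat \<lfloor>t - 1\<rfloor>"
    have n: "1 + real n \<le> t" "t < 1 + real (Suc n)" using True unfolding n_def by linarith+
    have "t \<notin> J j" if "j \<noteq> n" for j
    proof
      assume "t \<in> J j"
      then have "1 + real j \<le> t" "t < 1 + real (Suc j)" by (auto simp: J_def)
      then have "j < Suc n" "n < Suc j" using n by linarith+
      then show False using that by simp
    qed
    then have "(\<Sum>j. ennreal (u j) * indicator (J j) t) = (\<Sum>j\<in>{n}. ennreal (u j) * indicator (J j) t)"
      by (intro suminf_finite) auto
    also have "\<dots> \<le> ennreal (u n) * 1" by (cases "t \<in> J n") auto
    also have "\<dots> = ennreal (u n)" by simp
    also have "\<dots> \<le> ennreal (exp (- e * g t))"
    proof (rule ennreal_leI)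
      have "g t \<le> g (real (Suc n)) + c * (1 + \<bar>t - real (Suc n)\<bar>)" using slow True by simp
      also have "c * (1 + \<bar>t - real (Suc n)\<bar>) \<le> c * 2" using n c by (intro mult_left_mono) auto
      finally have "e * g t \<le> e * (g (real (Suc n)) + c * 2)" using e by (intro mult_left_mono) auto
      then show "u n \<le> exp (- e * g t)" by (simp add: u_def algebra_simps flip: exp_add)
    qed
    finally show ?thesis using True by simp
  next
    case False
    then have "t \<notin> J j" for j using of_nat_0_le_iff[of j] by (auto simp: J_def simp del: of_nat_0_le_iff)
    then show ?thesis by simp
  qed
  then have "(\<integral>\<^sup>+t. (\<Sum>n. ennreal (u n) * indicator (J n) t) \<partial>lebesgue) \<le> (\<integral>\<^sup>+t\<in>{1..}. ennreal (exp (- e * g t)) \<partial>lebesgue)"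
    by (rule nn_integral_mono)
  moreover have "(\<integral>\<^sup>+t. (\<Sum>n. ennreal (u n) * indicator (J n) t) \<partial>lebesgue) = (\<Sum>n. ennreal (1 * u n))"
    unfolding J_def by (rule nn_integral_lebesgue_steps) (auto simp: u_def)
  ultimately have "(\<Sum>n. ennreal (u n)) \<noteq> \<infinity>" using int by auto
  then have "summable u" by (intro summable_suminf_not_top) (auto simp: u_def)
  then have "summable (\<lambda>n. exp (e * c * 2) * u n)" by (rule summable_mult)
  moreover have "exp (e * c * 2) * u n = exp (- e * g (real (Suc n)))" for n by (simp add: u_def flip: exp_add)
  ultimately have "summable (\<lambda>n. exp (- e * g (real (Suc n))))" by simp
  then show ?thesis by (subst (asm) summable_Suc_iff)
qed

section \<open>Orbital growth and subgroups\<close>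

text \<open>Orbit points become group elements at the cost of the finite stabilizer of
  \<open>x\<close>, and the base point moves from \<open>x\<close> to \<open>b\<close> at the cost
  of \<open>2 * r\<close> in the radius; a further 1 interpolates between integer radii.\<close>

lemma (in isom_action) group_growth:
  assumes crit: "critical_exponent \<Gamma> = ereal \<delta>"
    and growth: "comparable (\<lambda>n. real (card (isom_orbit \<Gamma> x \<inter> cball x (real n)))) (\<lambda>n. exp (\<delta> * real n))"
  shows "\<exists>K. \<forall>t\<ge>0. real (card {g \<in> \<Gamma>. dist b (g b) \<le> t}) \<le> K * exp (\<delta> * t) \<and>
    exp (\<delta> * t) \<le> K * real (card {g \<in> \<Gamma>. dist b (g b) \<le> t})"
proof -
  have \<delta>: "0 \<le> \<delta>" by (rule critical_exponentD(1)[OF crit])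
  define N where "N n = card (isom_orbit \<Gamma> x \<inter> cball x (real n))" for n
  obtain c where c: "1 \<le> c" "\<And>n. 1 / c * real (N n) \<le> exp (\<delta> * real n)" "\<And>n. exp (\<delta> * real n) \<le> c * real (N n)"
    using growth unfolding comparable_def N_def by blast
  define A where "A t = {g \<in> \<Gamma>. dist x (g x) \<le> t}" for t
  have finA: "finite (A t)" for t unfolding A_def by (rule finite_ball)
  have im: "(\<lambda>g. g x) ` A (real n) = isom_orbit \<Gamma> x \<inter> cball x (real n)" for n by (auto simp: A_def isom_orbit_def)
  define s where "s = card (A 0)"
  have upper: "card (A (real n)) \<le> s * N n" for n
    unfolding N_def
  proof (rule card_le_fibres[OF finA])
    show "(\<lambda>g. g x) ` A (real n) \<subseteq> isom_orbit \<Gamma> x \<inter> cball x (real n)" using im by simp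
    show "finite (isom_orbit \<Gamma> x \<inter> cball x (real n))" using finA im by (metis finite_imageI)
    fix w assume "w \<in> (\<lambda>g. g x) ` A (real n)"
    then obtain a where a: "a \<in> \<Gamma>" "w = a x" by (auto simp: A_def)
    have "card {g \<in> A (real n). g x = w} \<le> card (A 0)"
    proof (rule card_inj_on_le[OF _ _ finA])
      show "inj_on (\<lambda>g. inv_into UNIV a \<circ> g) {g \<in> A (real n). g x = w}"
      proof (rule inj_onI)
        fix g h assume "inv_into UNIV a \<circ> g = inv_into UNIV a \<circ> h"
        then have "a (inv_into UNIV a (g y)) = a (inv_into UNIV a (h y))" for y by (metis comp_apply)
        then show "g = h" using surj_f_inv_f[OF surj[OF a(1)]] by (intro ext) metis
      qed
      show "(\<lambda>g. inv_into UNIV a \<circ> g) ` {g \<in> A (real n). g x = w} \<subseteq> A 0"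
        using comp_mem[OF inv_mem[OF a(1)]] inv_f_f[OF inj[OF a(1)]] a(2) by (auto simp: A_def)
    qed
    then show "card {g \<in> A (real n). g x = w} \<le> s" by (simp add: s_def)
  qed
  have lower: "N n \<le> card (A (real n))" for n
    unfolding N_def im[symmetric] by (rule card_image_le[OF finA])
  define r where "r = dist b x"
  have r: "0 \<le> r" by (simp add: r_def)
  have shift: "\<bar>dist b (g b) - dist x (g x)\<bar> \<le> 2 * r" if g: "g \<in> \<Gamma>" for g
  proof -
    have "dist (g b) (g x) = r" using g by (simp add: r_def)
    then show ?thesis
      using dist_triangle[of b "g b" x] dist_triangle[of x "g b" "g x"] dist_triangle[of x "g x" b] dist_triangle[of b "g x" "g b"]
      by (simp add: r_def dist_commute abs_le_iff)
  qed
  define Bl where "Bl t = {g \<in> \<Gamma>. dist b (g b) \<le> t}" for t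
  have finB: "finite (Bl t)" for t unfolding Bl_def by (rule finite_ball)
  define K where "K = (real s * c + c) * exp (\<delta> * (2 * r + 1))"
  have e1: "1 \<le> exp (\<delta> * (2 * r + 1))" using \<delta> r by simp
  have "real (card (Bl t)) \<le> K * exp (\<delta> * t) \<and> exp (\<delta> * t) \<le> K * real (card (Bl t))" if t: "0 \<le> t" for t
  proof
    define n where "n = nat \<lceil>t + 2 * r\<rceil>"
    have n: "t + 2 * r \<le> real n" "real n \<le> t + (2 * r + 1)" using t r unfolding n_def by linarith+
    have "Bl t \<subseteq> A (real n)"
    proof
      fix g assume "g \<in> Bl t"
      then have g: "g \<in> \<Gamma>" "dist b (g b) \<le> t" by (auto simp: Bl_def)
      then have "dist x (g x) \<le> real n" using shift[OF g(1)] n(1) unfolding abs_le_iff by linarith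
      then show "g \<in> A (real n)" using g(1) by (simp add: A_def)
    qed
    then have "card (Bl t) \<le> s * N n" using card_mono[OF finA] upper order_trans by blast
    then have "real (card (Bl t)) \<le> real s * real (N n)" by (metis of_nat_le_iff of_nat_mult)
    also have "\<dots> \<le> real s * (c * exp (\<delta> * real n))" using c(1) c(2)[of n] by (intro mult_left_mono) (auto simp: field_simps)
    also have "\<dots> \<le> real s * (c * exp (\<delta> * (t + (2 * r + 1))))"
      using c(1) n(2) \<delta> by (intro mult_left_mono) (auto intro: mult_left_mono)
    also have "\<dots> \<le> K * exp (\<delta> * t)" using c(1) by (simp add: K_def algebra_simps exp_add)
    finally show "real (card (Bl t)) \<le> K * exp (\<delta> * t)" .
  next
    have cK: "c * exp (\<delta> * (2 * r + 1)) \<le> K" unfolding K_def using c(1) by (intro mult_right_mono) auto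
    show "exp (\<delta> * t) \<le> K * real (card (Bl t))"
    \<comment> \<open>For small \<open>t\<close> no ball around \<open>x\<close> of nonnegative
      integer radius need fit inside; the identity alone suffices there.\<close>
    proof (cases "t \<le> 2 * r + 1")
      case True
      have "id \<in> Bl t" using id_mem t by (simp add: Bl_def)
      then have "1 \<le> card (Bl t)" using finB[of t] by (metis One_nat_def Suc_leI card_gt_0_iff empty_iff)
      have "exp (\<delta> * t) \<le> exp (\<delta> * (2 * r + 1))" using True \<delta> by (simp add: mult_left_mono)
      also have "\<dots> \<le> c * exp (\<delta> * (2 * r + 1))" using c(1) by simp
      also have "\<dots> \<le> K * 1" using cK by simp
      also have "\<dots> \<le> K * real (card (Bl t))" using \<open>1 \<le> card (Bl t)\<close> c(1) by (intro mult_left_mono) (auto simp: K_def)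
      finally show ?thesis .
    next
      case False
      define n where "n = nat \<lfloor>t - 2 * r\<rfloor>"
      have n: "real n \<le> t - 2 * r" "t \<le> real n + (2 * r + 1)" using False unfolding n_def by linarith+
      have "A (real n) \<subseteq> Bl t"
      proof
        fix g assume "g \<in> A (real n)"
        then have g: "g \<in> \<Gamma>" "dist x (g x) \<le> real n" by (auto simp: A_def)
        then have "dist b (g b) \<le> t" using shift[OF g(1)] n(1) unfolding abs_le_iff by linarith
        then show "g \<in> Bl t" using g(1) by (simp add: Bl_def)
      qed
      then have "N n \<le> card (Bl t)" using card_mono[OF finB] lower order_trans by blast
      have "exp (\<delta> * t) \<le> exp (\<delta> * (real n + (2 * r + 1)))" using n(2) \<delta> by (simp add: mult_left_mono)
      also have "\<dots> = exp (\<delta> * real n) * exp (\<delta> * (2 * r + 1))" by (simp add: distrib_left exp_add)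
      also have "\<dots> \<le> (c * real (N n)) * exp (\<delta> * (2 * r + 1))" by (intro mult_right_mono c(3)) simp
      also have "\<dots> = (c * exp (\<delta> * (2 * r + 1))) * real (N n)" by simp
      also have "\<dots> \<le> K * real (card (Bl t))"
        using cK \<open>N n \<le> card (Bl t)\<close> c(1) by (intro mult_mono) (auto simp: K_def)
      finally show ?thesis .
    qed
  qed
  then show ?thesis unfolding Bl_def by blast
qed

text \<open>Infinite index supplies the element outside \<open>H\<close>, and almost malnormality
  passes from images to preimages because conjugation is injective. The base point is any point of
  the nonempty hull.\<close>

lemma (in isom_action) khinchin_gauge_subgroup:
  assumes sgG: "subgroup \<Gamma> isom_group" and sgH: "subgroup H (isom_group\<lparr>carrier := \<Gamma>\<rparr>)"
    and am: "almost_malnormal (isom_group\<lparr>carrier := \<Gamma>\<rparr>) H" and cc: "convex_cocompact H"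
    and idx: "infinite (rcosets\<^bsub>isom_group\<lparr>carrier := \<Gamma>\<rparr>\<^esub> H)" and crit: "critical_exponent H = ereal d"
    and critG: "critical_exponent \<Gamma> = ereal \<delta>"
    and growth: "comparable (\<lambda>n. real (card (isom_orbit \<Gamma> x \<inter> cball x (real n)))) (\<lambda>n. exp (\<delta> * real n))"
    and conf: "conformal_density \<Gamma> \<delta> \<nu>" and ne: "non_elementary \<Gamma>"
    and g: "\<And>t. 0 \<le> t \<Longrightarrow> 0 \<le> g t" "\<And>s t. 0 \<le> s \<Longrightarrow> 0 \<le> t \<Longrightarrow> g s \<le> g t + c * (1 + \<bar>s - t\<bar>)"
  shows "\<exists>b D K. khinchin_gauge \<Gamma> H b (hull_at_infinity (limit_set H)) D \<delta> d K \<nu> g c"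
proof -
  define GG where "GG = (isom_group\<lparr>carrier := \<Gamma>\<rparr> :: ('a \<Rightarrow> 'a) monoid)"
  have carG: "g \<in> carrier isom_group" if "g \<in> \<Gamma>" for g using subgroup.subset[OF sgG] that by blast
  have sub: "H \<subseteq> \<Gamma>" using subgroup.subset[OF sgH] by simp
  have sgH': "subgroup H isom_group" by (rule group.incl_subgroup[OF group_isom_group sgG sgH])
  have actH: "isom_action H"
  proof unfold_locales
    show "finite {g \<in> H. dist x (g x) \<le> R}" for x R
      by (rule finite_subset[OF _ finite_ball[of x R]]) (use sub in auto)
  qed (use isom_subgroupD[OF sgH'] sub surj iso in auto)
  interpret H: isom_action pt H by (rule actH)
  have "hull_at_infinity (limit_set H) \<noteq> {}" by (rule H.hull_cocompact(1)[OF cc])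
  then obtain b where b: "b \<in> hull_at_infinity (limit_set H)" by blast
  obtain D where D: "\<forall>p\<in>hull_at_infinity (limit_set H). \<exists>h\<in>H. dist p (h b) \<le> D"
    using H.hull_cocompact(2)[OF cc b] by blast
  obtain K where K: "\<forall>t\<ge>0. real (card {g \<in> \<Gamma>. dist b (g b) \<le> t}) \<le> K * exp (\<delta> * t) \<and>
    exp (\<delta> * t) \<le> K * real (card {g \<in> \<Gamma>. dist b (g b) \<le> t})"
    using group_growth[OF critG growth] by blast
  have ls: "limit_set H \<noteq> {}" using cc by (auto simp: convex_cocompact_def)
  have mal: "finite {h \<in> H. w \<circ> h \<circ> inv_into UNIV w \<in> H}" if w: "w \<in> \<Gamma>" "w \<notin> H" for w
  proof -
    have "inv\<^bsub>isom_group\<lparr>carrier := \<Gamma>\<rparr>\<^esub> w = inv_into UNIV w"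
      using group.m_inv_consistent[OF group_isom_group sgG w(1)] inv_isom_group[OF carG[OF w(1)]] by simp
    moreover have "finite ((\<lambda>h. w \<otimes>\<^bsub>isom_group\<lparr>carrier := \<Gamma>\<rparr>\<^esub> h \<otimes>\<^bsub>isom_group\<lparr>carrier := \<Gamma>\<rparr>\<^esub>
        inv\<^bsub>isom_group\<lparr>carrier := \<Gamma>\<rparr>\<^esub> w) ` H \<inter> H)"
      using am w unfolding almost_malnormal_def by simp
    ultimately have "finite ((\<lambda>h. w \<circ> h \<circ> inv_into UNIV w) ` H \<inter> H)" by (simp add: isom_group_def)
    then have "finite ((\<lambda>h. w \<circ> h \<circ> inv_into UNIV w) ` {h \<in> H. w \<circ> h \<circ> inv_into UNIV w \<in> H})"
      by (rule finite_subset[rotated]) auto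
    moreover have "inj_on (\<lambda>h. w \<circ> h \<circ> inv_into UNIV w) {h \<in> H. w \<circ> h \<circ> inv_into UNIV w \<in> H}"
    proof (rule inj_onI)
      fix h k assume eq: "w \<circ> h \<circ> inv_into UNIV w = w \<circ> k \<circ> inv_into UNIV w"
      show "h = k"
      proof
        fix y
        have "w (h (inv_into UNIV w (w y))) = w (k (inv_into UNIV w (w y)))" using eq by (metis comp_apply)
        then show "h y = k y" using inj[OF w(1)] by (simp add: inj_eq)
      qed
    qed
    ultimately show ?thesis by (rule finite_imageD)
  qed
  have "\<exists>a. a \<in> \<Gamma> \<and> a \<notin> H"
  proof (rule ccontr)
    assume "\<not> ?thesis"
    then have eq: "\<Gamma> = H" using sub by blast
    have gr: "group (isom_group\<lparr>carrier := \<Gamma>\<rparr>)" by (rule group.subgroup_imp_group[OF group_isom_group sgG])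
    have "H #>\<^bsub>isom_group\<lparr>carrier := \<Gamma>\<rparr>\<^esub> h = H" if "h \<in> H" for h
      by (rule subgroup.rcos_const[OF sgH gr that])
    then have "rcosets\<^bsub>isom_group\<lparr>carrier := \<Gamma>\<rparr>\<^esub> H \<subseteq> {H}" using eq by (auto simp: RCOSETS_def)
    then show False using idx by (meson finite.emptyI finite_insert finite_subset)
  qed
  note proper_sub = this
  have m: "malnormal_subgroup \<Gamma> H b (hull_at_infinity (limit_set H)) D \<delta> d K"
  proof unfold_locales
    show "m \<in> hull_at_infinity (limit_set H)"
      if "x \<in> hull_at_infinity (limit_set H)" "y \<in> hull_at_infinity (limit_set H)" "between x m y" for x m y
      using that by (rule H.hull_between)
    show "h x \<in> hull_at_infinity (limit_set H)" if "h \<in> H" "x \<in> hull_at_infinity (limit_set H)" for h x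
      using that by (rule H.hull_action)
    show "\<exists>h\<in>H. dist x (h b) \<le> D" if "x \<in> hull_at_infinity (limit_set H)" for x using D that by blast
    show "finite {h \<in> H. w \<circ> h \<circ> inv_into UNIV w \<in> H}" if "w \<in> \<Gamma>" "w \<notin> H" for w using that by (rule mal)
    show "\<exists>h\<in>H. R < dist b (h b)" for R by (rule H.orbit_unbounded[OF ls])
  qed (fact b sub proper_sub crit | use K in blast)+
  then interpret m: malnormal_subgroup pt \<Gamma> H b "hull_at_infinity (limit_set H)" D \<delta> d K .
  have "khinchin_gauge \<Gamma> H b (hull_at_infinity (limit_set H)) D \<delta> d K \<nu> g c"
  proof unfold_locales
    show "\<exists>\<xi>\<in>limit_set \<Gamma>. \<exists>\<eta>\<in>limit_set \<Gamma>. \<xi> \<noteq> \<eta>" using ne unfolding non_elementary_def by blast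
  qed (fact conf m.\<delta>_pos | rule g, assumption+)+
  then show ?thesis by blast
qed

theorem theorem4p9:
  fixes \<Gamma> :: "('a::metric_space \<Rightarrow> 'a) set"
    and \<Gamma>\<^sub>I :: "'i \<Rightarrow> ('a \<Rightarrow> 'a) set" and I :: "'i set"
    and \<delta> :: real and \<delta>\<^sub>I :: "'i \<Rightarrow> real"
    and \<mu> :: "'a \<Rightarrow> (real \<Rightarrow> 'a) set measure" and x\<^sub>0 :: 'a
    and g f :: "real \<Rightarrow> real" and \<epsilon> :: real
  assumes proper: "\<forall>(x::'a) R. compact (cball x R)"
    and geodesic: "geodesic_space (UNIV :: 'a set) dist"
    and CAT: "CAT_minus_one (UNIV :: 'a set) dist"
    and discrete: "discrete_isometry_group \<Gamma>"
    and non_elem: "non_elementary \<Gamma>"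
    and crit: "critical_exponent \<Gamma> = ereal \<delta>"
    and diver: "divergent_type \<Gamma>"
    and dens: "conformal_density \<Gamma> \<delta> \<mu>"
    and growth: "\<exists>x. comparable (\<lambda>n. real (card (isom_orbit \<Gamma> x \<inter> cball x (real n))))
                                (\<lambda>n. exp (\<delta> * real n))"
    and fin: "finite I"
    and subgroups: "\<forall>i\<in>I. subgroup (\<Gamma>\<^sub>I i) (isom_group\<lparr>carrier := \<Gamma>\<rparr>)"
    and malnormal: "\<forall>i\<in>I. almost_malnormal (isom_group\<lparr>carrier := \<Gamma>\<rparr>) (\<Gamma>\<^sub>I i)"
    and cocompact: "\<forall>i\<in>I. convex_cocompact (\<Gamma>\<^sub>I i)"
    and index: "\<forall>i\<in>I. infinite (rcosets\<^bsub>isom_group\<lparr>carrier := \<Gamma>\<rparr>\<^esub> (\<Gamma>\<^sub>I i))"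
    and crit_I: "\<forall>i\<in>I. critical_exponent (\<Gamma>\<^sub>I i) = ereal (\<delta>\<^sub>I i)"
    and g_nonneg: "\<forall>t\<ge>0. g t \<ge> 0"
    and f_def: "f = (\<lambda>t. exp (- g t))"
    and f_slow: "slowly_varying f"
    and eps: "\<epsilon> > 0"
  shows "((\<integral>\<^sup>+t\<in>{1..}. ennreal (f t powr (\<delta> - (INF i\<in>I. \<delta>\<^sub>I i))) \<partial>lebesgue) = \<infinity> \<longrightarrow>
            (AE l in bowen_margulis \<delta> \<mu> x\<^sub>0. \<forall>i\<in>I. liouville \<epsilon> g \<Gamma> (\<Gamma>\<^sub>I i) l)) \<and>
         ((\<integral>\<^sup>+t\<in>{1..}. ennreal (f t powr (\<delta> - (SUP i\<in>I. \<delta>\<^sub>I i))) \<partial>lebesgue) < \<infinity> \<longrightarrow>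
            (AE l in bowen_margulis \<delta> \<mu> x\<^sub>0. \<not> (\<exists>i\<in>I. liouville \<epsilon> g \<Gamma> (\<Gamma>\<^sub>I i) l)))"
proof -
  interpret cat_space x\<^sub>0 using proper geodesic CAT by unfold_locales
  interpret G: isom_action x\<^sub>0 \<Gamma> by (rule isom_action_discrete[OF discrete])
  have sg: "subgroup \<Gamma> isom_group" using discrete by (simp add: discrete_isometry_group_def)
  obtain c where c: "0 \<le> c" "\<forall>s\<ge>0. \<forall>t\<ge>0. g s \<le> g t + c * (1 + \<bar>s - t\<bar>)"
    using slowly_varying_log[OF f_slow[unfolded f_def]] by blast
  obtain y where y: "comparable (\<lambda>n. real (card (isom_orbit \<Gamma> y \<inter> cball y (real n)))) (\<lambda>n. exp (\<delta> * real n))"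
    using growth by blast
  have "\<exists>b D K. khinchin_gauge \<Gamma> (\<Gamma>\<^sub>I i) b (hull_at_infinity (limit_set (\<Gamma>\<^sub>I i))) D \<delta> (\<delta>\<^sub>I i) K \<mu> g c" if "i \<in> I" for i
    by (rule G.khinchin_gauge_subgroup[OF sg _ _ _ _ _ crit y dens non_elem])
      (use that subgroups malnormal cocompact index crit_I g_nonneg c(2) in auto)
  then obtain b D K where kg: "\<And>i. i \<in> I \<Longrightarrow>
      khinchin_gauge \<Gamma> (\<Gamma>\<^sub>I i) (b i) (hull_at_infinity (limit_set (\<Gamma>\<^sub>I i))) (D i) \<delta> (\<delta>\<^sub>I i) (K i) \<mu> g c" by metis
  have less: "\<delta>\<^sub>I i < \<delta>" if "i \<in> I" for i
  proof -
    interpret khinchin_gauge x\<^sub>0 \<Gamma> "\<Gamma>\<^sub>I i" "b i" "hull_at_infinity (limit_set (\<Gamma>\<^sub>I i))" "D i" \<delta> "\<delta>\<^sub>I i" "K i" \<mu> g c by (rule kg[OF that])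
    show ?thesis by (rule exponent_less)
  qed
  define J where "J e = (\<integral>\<^sup>+t\<in>{1..}. ennreal (f t powr e) \<partial>lebesgue)" for e
  have J: "J e = (\<integral>\<^sup>+t\<in>{1..}. ennreal (exp (- e * g t)) \<partial>lebesgue)" for e
  proof -
    have "f t powr e = exp (- e * g t)" for t unfolding f_def exp_powr_real by (simp only: minus_mult_commute mult.commute)
    then show ?thesis by (simp only: J_def)
  qed
  \<comment> \<open>As \<open>g\<close> is nonnegative, larger exponents give smaller integrals.
    Hence the hypothesis at the infimum (resp. supremum) of the exponents controls every member of
    the family.\<close>
  have mono: "J e' \<le> J e" if "e \<le> e'" for e e'
    unfolding J
  proof (rule nn_integral_mono)
    fix t :: real
    show "ennreal (exp (- e' * g t)) * indicator {1..} t \<le> ennreal (exp (- e * g t)) * indicator {1..} t"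
    proof (cases "1 \<le> t")
      case True
      then have "e * g t \<le> e' * g t" using that g_nonneg by (intro mult_right_mono) auto
      then show ?thesis by (intro mult_right_mono ennreal_leI) auto
    qed simp
  qed
  have bounds: "bdd_below (\<delta>\<^sub>I ` I)" "bdd_above (\<delta>\<^sub>I ` I)" using fin by auto
  have slow: "\<And>s t. 0 \<le> s \<Longrightarrow> 0 \<le> t \<Longrightarrow> g s \<le> g t + c * (1 + \<bar>s - t\<bar>)" using c(2) by blast
  have "AE l in bowen_margulis \<delta> \<mu> x\<^sub>0. liouville \<epsilon> g \<Gamma> (\<Gamma>\<^sub>I i) l" if "J (\<delta> - (INF i\<in>I. \<delta>\<^sub>I i)) = \<infinity>" and i: "i \<in> I" for i
  proof -
    interpret khinchin_gauge x\<^sub>0 \<Gamma> "\<Gamma>\<^sub>I i" "b i" "hull_at_infinity (limit_set (\<Gamma>\<^sub>I i))" "D i" \<delta> "\<delta>\<^sub>I i" "K i" \<mu> g c by (rule kg[OF i])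
    have "(INF i\<in>I. \<delta>\<^sub>I i) \<le> \<delta>\<^sub>I i" using i by (rule cINF_lower[OF bounds(1)])
    then have inf: "J (\<delta> - \<delta>\<^sub>I i) = \<infinity>" using mono[of "\<delta> - \<delta>\<^sub>I i" "\<delta> - (INF i\<in>I. \<delta>\<^sub>I i)"] that(1) by (simp add: top_unique)
    \<comment> \<open>Every \<open>k\<close> is covered because the window length comes from the
      counting of reduced elements and is not known here.\<close>
    have "\<not> summable (\<lambda>j. exp (- (\<delta> - \<delta>\<^sub>I i) * g (real (k * j))))" if "1 \<le> k" for k :: nat
      using nn_integral_finite_of_summable[OF slow c(1) _ that, of "\<delta> - \<delta>\<^sub>I i"] less[OF i] inf unfolding J by auto
    then show ?thesis by (rule AE_liouville[OF _ eps refl])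
  qed
  moreover have "AE l in bowen_margulis \<delta> \<mu> x\<^sub>0. \<not> liouville \<epsilon> g \<Gamma> (\<Gamma>\<^sub>I i) l" if "J (\<delta> - (SUP i\<in>I. \<delta>\<^sub>I i)) < \<infinity>" and i: "i \<in> I" for i
  proof -
    interpret khinchin_gauge x\<^sub>0 \<Gamma> "\<Gamma>\<^sub>I i" "b i" "hull_at_infinity (limit_set (\<Gamma>\<^sub>I i))" "D i" \<delta> "\<delta>\<^sub>I i" "K i" \<mu> g c by (rule kg[OF i])
    have "\<delta>\<^sub>I i \<le> (SUP i\<in>I. \<delta>\<^sub>I i)" using i by (rule cSUP_upper[OF _ bounds(2)])
    then have inf: "J (\<delta> - \<delta>\<^sub>I i) < \<infinity>" using mono[of "\<delta> - (SUP i\<in>I. \<delta>\<^sub>I i)" "\<delta> - \<delta>\<^sub>I i"] that(1) by auto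
    have "summable (\<lambda>n. exp (- (\<delta> - \<delta>\<^sub>I i) * g (real n)))"
      using summable_of_nn_integral_finite[OF slow c(1), of "\<delta> - \<delta>\<^sub>I i"] less[OF i] inf unfolding J by auto
    then show ?thesis by (rule AE_not_liouville[OF _ refl])
  qed
  ultimately show ?thesis unfolding J_def[symmetric] using fin by (auto simp: AE_finite_all)
qed

end
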